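(* Let $A_0,\ldots,A_N\in\mathbb{R}^{n\times n}$ and for delays $h_1,\ldots,h_N\ge0$, $\bar h=\max_ih_i$, consider the diffusion with delays $$dx(t)=A_0x(t)\,dt+\sum_{i=1}^NA_ix(t-h_i)\,dW_i(t),\quad t\ge0,\qquad x(s)=\phi(s),\ s\in[-\bar h,0],\qquad(\ast)$$ where $W_1,\ldots,W_N$ are independent Wiener processes and $\phi\in C([-\bar h,0],\mathbb{R}^n)$. The following statements are equivalent: (a) The system $(\ast)$ is mean-square exponentially stable for all $h_i\ge0$, $i=1,\ldots,N$. (b) The system $(\ast)$ with zero delays ($h_i=0$, $i=1,\ldots,N$) is mean-square exponentially stable.
   Context: The stochastic differential equation is understood in the Itô sense on a filtered probability space satisfying the usual conditions. For given delays, the system is mean-square exponentially stable if there exist $\alpha>0$ and $\beta>1$ such that $$\mathbb{E}[\|x(t)\|_2^2]\le\beta e^{-\alpha t}\,\mathbb{E}\Big[\max_{s\in[-\bar h,0]}\|\phi(s)\|_2^2\Big]$$ for all $t\ge0$ and all initial conditions $\phi\in C([-\bar h,0],\mathbb{R}^n)$. *)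

theory Defs
  imports "HOL-Probability.Probability"
begin

text \<open>
  Time is represented by type \<^typ>\<open>real\<close>; a filtration and the Wiener processes matter only at
  times \<open>t \<ge> 0\<close>, and nothing is assumed about their values at negative times.
\<close>

locale usual_filtered_prob_space = prob_space M for M :: "'a measure" +
  fixes F :: "real \<Rightarrow> 'a measure"
  assumes subalg: "\<And>t. 0 \<le> t \<Longrightarrow> subalgebra M (F t)"
    and mono: "\<And>s t. 0 \<le> s \<Longrightarrow> s \<le> t \<Longrightarrow> sets (F s) \<subseteq> sets (F t)"
    and right_continuous: "\<And>t. 0 \<le> t \<Longrightarrow> sets (F t) = (\<Inter>u\<in>{t<..}. sets (F u))"
    and complete: "\<And>A B. B \<in> null_sets M \<Longrightarrow> A \<subseteq> B \<Longrightarrow> A \<in> sets (F 0)"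

text \<open>
  Independent standard Wiener processes \<open>W 1, \<dots>, W N\<close> relative to the filtration \<open>F\<close>: besides the
  mutual independence of the processes, the increments after time \<open>s\<close> of the whole family are
  required to be independent of \<open>F s\<close>, as in the usual notion of an \<open>N\<close>-dimensional
  \<open>F\<close>-Brownian motion.
\<close>

locale independent_wiener_processes = usual_filtered_prob_space M F
  for M :: "'a measure" and F :: "real \<Rightarrow> 'a measure" +
  fixes N :: nat and W :: "nat \<Rightarrow> real \<Rightarrow> 'a \<Rightarrow> real"
  assumes adapted: "\<And>i t. i \<in> {1..N} \<Longrightarrow> 0 \<le> t \<Longrightarrow> W i t \<in> borel_measurable (F t)"
    and start: "\<And>i. i \<in> {1..N} \<Longrightarrow> AE \<omega> in M. W i 0 \<omega> = 0"
    and continuous: "\<And>i. i \<in> {1..N} \<Longrightarrow> AE \<omega> in M. continuous_on {0..} (\<lambda>t. W i t \<omega>)"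
    and gaussian: "\<And>i s t. i \<in> {1..N} \<Longrightarrow> 0 \<le> s \<Longrightarrow> s < t \<Longrightarrow>
      distributed M lborel (\<lambda>\<omega>. W i t \<omega> - W i s \<omega>) (normal_density 0 (sqrt (t - s)))"
    and indep_processes:
      "indep_vars (\<lambda>_. PiM {0..} (\<lambda>_. borel)) (\<lambda>i \<omega>. \<lambda>t\<in>{0..}. W i t \<omega>) {1..N}"
    and indep_increments: "\<And>s t. 0 \<le> s \<Longrightarrow> s < t \<Longrightarrow>
      indep_set (sets (F s))
        (sets (vimage_algebra (space M) (\<lambda>\<omega>. \<lambda>i\<in>{1..N}. W i t \<omega> - W i s \<omega>)
          (PiM {1..N} (\<lambda>_. borel))))"

text \<open>
  A simple integrand is \<open>H s \<omega> = (\<Sum>j<m. indicator {\<tau> j<..\<tau> (j+1)} s *\<^sub>R \<xi> j \<omega>)\<close> with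
  \<open>0 \<le> \<tau> 0 < \<dots> < \<tau> m\<close> and each \<open>\<xi> j\<close> bounded and measurable with respect to \<open>F (\<tau> j)\<close>.
\<close>

definition simple_integrand ::
  "'a measure \<Rightarrow> (real \<Rightarrow> 'a measure) \<Rightarrow> nat \<Rightarrow> (nat \<Rightarrow> real)
    \<Rightarrow> (nat \<Rightarrow> 'a \<Rightarrow> 'b::euclidean_space) \<Rightarrow> bool" where
  "simple_integrand M F m \<tau> \<xi> \<longleftrightarrow>
     0 \<le> \<tau> 0 \<and> (\<forall>j<m. \<tau> j < \<tau> (Suc j)) \<and>
     (\<forall>j<m. \<xi> j \<in> borel_measurable (F (\<tau> j)) \<and> bounded (\<xi> j ` space M))"

definition simple_value ::
  "nat \<Rightarrow> (nat \<Rightarrow> real) \<Rightarrow> (nat \<Rightarrow> 'a \<Rightarrow> 'b::euclidean_space) \<Rightarrow> real \<Rightarrow> 'a \<Rightarrow> 'b" where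
  "simple_value m \<tau> \<xi> s \<omega> = (\<Sum>j<m. indicator {\<tau> j<..\<tau> (Suc j)} s *\<^sub>R \<xi> j \<omega>)"

definition simple_integral ::
  "(real \<Rightarrow> 'a \<Rightarrow> real) \<Rightarrow> nat \<Rightarrow> (nat \<Rightarrow> real) \<Rightarrow> (nat \<Rightarrow> 'a \<Rightarrow> 'b::euclidean_space)
    \<Rightarrow> real \<Rightarrow> 'a \<Rightarrow> 'b" where
  "simple_integral B m \<tau> \<xi> t \<omega> =
     (\<Sum>j<m. (B (min t (\<tau> (Suc j))) \<omega> - B (min t (\<tau> j)) \<omega>) *\<^sub>R \<xi> j \<omega>)"

definition progressively_measurable ::
  "(real \<Rightarrow> 'a measure) \<Rightarrow> (real \<Rightarrow> 'a \<Rightarrow> 'b::euclidean_space) \<Rightarrow> bool" where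
  "progressively_measurable F X \<longleftrightarrow>
     (\<forall>T\<ge>0. (\<lambda>(s, \<omega>). X s \<omega>) \<in> borel_measurable (restrict_space borel {0..T} \<Otimes>\<^sub>M F T))"

text \<open>
  \<open>I\<close> is a version of the It\^o integral process \<open>I t = \<integral>\<^sub>0\<^sup>t X s dB s\<close>. The integrand is progressively
  measurable with almost surely locally square integrable paths (no moments are assumed), and the
  integral is the continuous adapted process whose value at each time is the limit in probability
  of the integrals of simple integrands \<open>H k\<close> with \<open>\<integral>\<^sub>0\<^sup>T \<parallel>H k s - X s\<parallel>\<^sup>2 ds \<rightarrow> 0\<close> in probability for
  all \<open>T\<close>. This determines \<open>I\<close> up to indistinguishability.
\<close>

definition is_ito_integral ::
  "'a measure \<Rightarrow> (real \<Rightarrow> 'a measure) \<Rightarrow> (real \<Rightarrow> 'a \<Rightarrow> real)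
    \<Rightarrow> (real \<Rightarrow> 'a \<Rightarrow> 'b::euclidean_space) \<Rightarrow> (real \<Rightarrow> 'a \<Rightarrow> 'b) \<Rightarrow> bool" where
  "is_ito_integral M F B X I \<longleftrightarrow>
     progressively_measurable F X \<and>
     (\<forall>T\<ge>0. AE \<omega> in M. (\<integral>\<^sup>+s\<in>{0..T}. ennreal ((norm (X s \<omega>))\<^sup>2) \<partial>lborel) < \<infinity>) \<and>
     (\<forall>t\<ge>0. I t \<in> borel_measurable (F t)) \<and>
     (AE \<omega> in M. continuous_on {0..} (\<lambda>t. I t \<omega>)) \<and>
     (\<exists>m \<tau> \<xi>.
        (\<forall>k. simple_integrand M F (m k) (\<tau> k) (\<xi> k)) \<and>
        (\<forall>T\<ge>0. \<forall>\<epsilon>>0.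
          (\<lambda>k. measure M {\<omega> \<in> space M.
             (\<integral>\<^sup>+s\<in>{0..T}. ennreal ((norm (simple_value (m k) (\<tau> k) (\<xi> k) s \<omega> - X s \<omega>))\<^sup>2) \<partial>lborel)
               > ennreal \<epsilon>}) \<longlonglongrightarrow> 0) \<and>
        (\<forall>t\<ge>0. \<forall>\<epsilon>>0.
          (\<lambda>k. measure M {\<omega> \<in> space M.
             norm (simple_integral B (m k) (\<tau> k) (\<xi> k) t \<omega> - I t \<omega>) > \<epsilon>}) \<longlonglongrightarrow> 0))"

definition max_delay :: "nat \<Rightarrow> (nat \<Rightarrow> real) \<Rightarrow> real" where
  "max_delay N h = Max (h ` {1..N})"

text \<open>
  Initial data are random elements of \<open>C([-hb, 0], \<real>\<^sup>n)\<close> known at time \<open>0\<close>. Measurability of every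
  evaluation is Borel measurability as a \<open>C([-hb, 0], \<real>\<^sup>n)\<close>-valued map.
\<close>

definition initial_condition ::
  "'a measure \<Rightarrow> (real \<Rightarrow> 'a measure) \<Rightarrow> real \<Rightarrow> (real \<Rightarrow> 'a \<Rightarrow> real^'n) \<Rightarrow> bool" where
  "initial_condition M F hb \<phi> \<longleftrightarrow>
     (\<forall>s\<in>{-hb..0}. \<phi> s \<in> borel_measurable (F 0)) \<and>
     (\<forall>\<omega>\<in>space M. continuous_on {-hb..0} (\<lambda>s. \<phi> s \<omega>))"

definition sdde_solution ::
  "'a measure \<Rightarrow> (real \<Rightarrow> 'a measure) \<Rightarrow> nat \<Rightarrow> (nat \<Rightarrow> real \<Rightarrow> 'a \<Rightarrow> real)
    \<Rightarrow> (nat \<Rightarrow> real^'n^'n) \<Rightarrow> (nat \<Rightarrow> real) \<Rightarrow> (real \<Rightarrow> 'a \<Rightarrow> real^'n)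
    \<Rightarrow> (real \<Rightarrow> 'a \<Rightarrow> real^'n) \<Rightarrow> bool" where
  "sdde_solution M F N W A h \<phi> x \<longleftrightarrow>
     (\<forall>t\<ge>0. x t \<in> borel_measurable (F t)) \<and>
     (AE \<omega> in M. continuous_on {- max_delay N h..} (\<lambda>t. x t \<omega>)) \<and>
     (AE \<omega> in M. \<forall>s\<in>{- max_delay N h..0}. x s \<omega> = \<phi> s \<omega>) \<and>
     (\<exists>I. (\<forall>i\<in>{1..N}. is_ito_integral M F (W i) (\<lambda>s \<omega>. A i *v x (s - h i) \<omega>) (I i)) \<and>
          (AE \<omega> in M. \<forall>t\<ge>0.
             x t \<omega> = x 0 \<omega> + integral {0..t} (\<lambda>s. A 0 *v x s \<omega>) + (\<Sum>i=1..N. I i t \<omega>)))"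

text \<open>
  Expectations are nonnegative Lebesgue integrals with values in \<open>[0, \<infinity>]\<close>; the estimate is void for
  initial data of infinite second moment. By continuity of \<open>\<phi>\<close> the supremum is a maximum.
\<close>

definition mean_square_exponentially_stable ::
  "'a measure \<Rightarrow> (real \<Rightarrow> 'a measure) \<Rightarrow> nat \<Rightarrow> (nat \<Rightarrow> real \<Rightarrow> 'a \<Rightarrow> real)
    \<Rightarrow> (nat \<Rightarrow> real^'n^'n) \<Rightarrow> (nat \<Rightarrow> real) \<Rightarrow> bool" where
  "mean_square_exponentially_stable M F N W A h \<longleftrightarrow>
     (\<exists>\<alpha>>0. \<exists>\<beta>>1. \<forall>\<phi> x.
        initial_condition M F (max_delay N h) \<phi> \<longrightarrow> sdde_solution M F N W A h \<phi> x \<longrightarrow>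
        (\<forall>t\<ge>0. (\<integral>\<^sup>+\<omega>. ennreal ((norm (x t \<omega>))\<^sup>2) \<partial>M)
           \<le> ennreal (\<beta> * exp (- \<alpha> * t)) *
             (\<integral>\<^sup>+\<omega>. ennreal (SUP s\<in>{- max_delay N h..0}. (norm (\<phi> s \<omega>))\<^sup>2) \<partial>M)))"

end

theory Submission
  imports Defs
begin

text \<open>
  Everything is read off the Euler scheme. Its second moments \<open>E (u \<bullet> X\<^sub>j)\<^sup>2\<close> obey an exact linear
  recursion in which the noise terms only add up, so cross moments between different times never
  occur and a delay merely shifts the index of nonnegative terms.

  If the system without delays is stable, its Euler schemes, started at the unit vectors, contract
  after finitely many steps; here one needs that the dyadic schemes converge to an actual solution,
  locally uniformly almost surely and in mean square. Summing the second moments up to that step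
  gives a positive definite form \<open>q\<close> with
  \<open>2 B(u, A\<^sub>0\<^sup>T u) + (\<Sum>i. q (A\<^sub>i\<^sup>T u)) \<le> - \<parallel>u\<parallel>\<^sup>2 / 2\<close>, where \<open>B\<close> is the polar form of \<open>q\<close>. This
  inequality does not see the delays: by induction over the steps,
  \<open>E (u \<bullet> X\<^sub>j)\<^sup>2 \<le> c exp (- \<alpha> j \<delta>) q(u)\<close> for the Euler scheme of every delayed system with small step
  \<open>\<delta>\<close>. Finally, an arbitrary solution, for which no moments are assumed, is the limit of these
  schemes in mean square on the events where its path stays below a bound, and the bound is
  removed by Fatou's lemma.
\<close>

section \<open>Gronwall inequalities and Wiener increments\<close>

text \<open>What makes delays harmless is where they sit. A delayed state enters only as the
  coefficient of a fresh increment, which has mean zero given the past, so it contributes its own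
  square and nothing else. The drift reads the current state; a delay there would bring in mixed
  moments of two times, which the recursion cannot express.

  The recursion is exact, so without delays it telescopes, and \<open>q\<close> arises from finite
  sums, with no Ito formula and no differential equation for moments. With delays it is only
  estimated from above, and the strict sign in the inequality for \<open>q\<close> is the budget:
  half of it pays for the second order term of a step and for the factor
  \<open>exp (\<alpha> * hb)\<close> by which delayed moments may exceed current ones. This is why
  the decay rate depends on the delays.

  Solutions are constructed only for zero delays and constant initial data, to make the hypothesis
  say something. For the delayed system they are given, and the difficulty is that their integrals
  are limits in probability without moments; hence the truncated distances and the indicators of
  events with bounded paths.\<close>

lemma discrete_gronwall_recursive:
  fixes v :: "nat \<Rightarrow> real"
  assumes "v 0 \<le> 0" and "0 \<le> a" "0 \<le> b"
    and "\<And>j. j < n \<Longrightarrow> v (Suc j) \<le> (1 + a) * v j + b"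
  shows "m \<le> n \<Longrightarrow> v m \<le> real m * b * (1 + a) ^ m"
proof (induction m)
  case 0
  then show ?case using assms by simp
next
  case (Suc m)
  have "v (Suc m) \<le> (1 + a) * v m + b" using Suc assms by auto
  also have "\<dots> \<le> (1 + a) * (real m * b * (1 + a) ^ m) + b * (1 + a) ^ Suc m"
  proof (intro add_mono mult_left_mono Suc)
    have "1 \<le> (1 + a) ^ Suc m" using assms by (intro one_le_power) auto
    then show "b \<le> b * (1 + a) ^ Suc m" using assms by (simp add: mult_le_cancel_left1)
  qed (use Suc assms in auto)
  also have "\<dots> = real (Suc m) * b * (1 + a) ^ Suc m" by (simp add: algebra_simps)
  finally show ?case .
qed

text \<open>Stated in \<open>ennreal\<close> because the errors it is applied to are not known to be
  finite beforehand; the induction only adds and multiplies, so infinite values do no harm.\<close>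

lemma discrete_gronwall_sum:
  fixes a :: "nat \<Rightarrow> ennreal"
  assumes "\<And>m. m \<le> n \<Longrightarrow> a m \<le> b + c * (\<Sum>j<m. a j)"
  shows "m \<le> n \<Longrightarrow> a m \<le> b * (1 + c) ^ m"
proof (induction m rule: less_induct)
  case (less m)
  \<comment> \<open>\<open>b * (1 + c) ^ m\<close> solves the recursion with equality.\<close>
  have sum: "b + c * (\<Sum>j<m. b * (1 + c) ^ j) = b * (1 + c) ^ m"
  proof (induction m)
    case (Suc m)
    have "b + c * (\<Sum>j<Suc m. b * (1 + c) ^ j) = (b + c * (\<Sum>j<m. b * (1 + c) ^ j)) + c * (b * (1 + c) ^ m)"
      by (simp add: distrib_left add.assoc)
    also have "\<dots> = b * (1 + c) ^ Suc m" unfolding Suc by (simp add: distrib_left distrib_right mult_ac)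
    finally show ?case .
  qed simp
  have "a m \<le> b + c * (\<Sum>j<m. a j)" using less assms by simp
  also have "\<dots> \<le> b + c * (\<Sum>j<m. b * (1 + c) ^ j)"
    using less by (intro add_left_mono mult_left_mono sum_mono) auto
  finally show ?case using sum by simp
qed

text \<open>The number of steps times the step size stays below the horizon \<open>T\<close>, so
  growth bounds do not depend on the step size.\<close>

lemma power_le_exp_mult:
  fixes a :: real
  assumes "0 \<le> a" "real j * d \<le> T" "0 \<le> d"
  shows "(1 + a * d) ^ j \<le> exp (a * T)"
proof -
  have "(1 + a * d) ^ j \<le> exp (a * d) ^ j"
    using assms by (intro power_mono) (auto simp: add_nonneg_nonneg)
  also have "\<dots> = exp (a * (real j * d))" by (simp add: exp_of_nat_mult[symmetric] mult_ac)
  also have "\<dots> \<le> exp (a * T)" using assms by (simp add: mult_left_mono)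
  finally show ?thesis .
qed

text \<open>Young's inequality with a free weight. A weight equal to the step size costs a factor
  \<open>1 + s\<close> per step, which a Gronwall argument tolerates; a small weight loses little of
  the first term.\<close>

lemma norm_add_square_le:
  fixes u v :: "'b::real_normed_vector"
  assumes "0 < s"
  shows "(norm (u + v))\<^sup>2 \<le> (1 + s) * (norm u)\<^sup>2 + (1 + 1 / s) * (norm v)\<^sup>2"
proof -
  have "(norm (u + v))\<^sup>2 \<le> (norm u + norm v)\<^sup>2" by (simp add: norm_triangle_ineq power_mono)
  also have "\<dots> = (norm u)\<^sup>2 + (norm v)\<^sup>2 + 2 * (norm u * norm v)" by (simp add: power2_sum)
  also have "2 * (norm u * norm v) \<le> s * (norm u)\<^sup>2 + (norm v)\<^sup>2 / s"
  proof -
    have "0 \<le> (s * norm u - norm v)\<^sup>2 / s" using assms by simp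
    also have "\<dots> = s * (norm u)\<^sup>2 + (norm v)\<^sup>2 / s - 2 * (norm u * norm v)"
      using assms by (simp add: power2_eq_square field_simps)
    finally show ?thesis by simp
  qed
  finally show ?thesis by (simp add: algebra_simps)
qed

lemma norm_add_square_le_double:
  fixes u v :: "'b::real_normed_vector"
  shows "(norm (u + v))\<^sup>2 \<le> 2 * (norm u)\<^sup>2 + 2 * (norm v)\<^sup>2"
  using norm_add_square_le[of 1 u v] by simp

lemma norm_sum_square_le:
  fixes f :: "'i \<Rightarrow> 'b::real_normed_vector"
  shows "(norm (\<Sum>i\<in>I. f i))\<^sup>2 \<le> real (card I) * (\<Sum>i\<in>I. (norm (f i))\<^sup>2)"
proof -
  have "(norm (\<Sum>i\<in>I. f i))\<^sup>2 \<le> (\<Sum>i\<in>I. norm (f i) * 1)\<^sup>2"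
    by (simp add: norm_sum power_mono)
  also have "\<dots> \<le> (\<Sum>i\<in>I. (norm (f i))\<^sup>2) * (\<Sum>i\<in>I. 1\<^sup>2)"
    by (rule Cauchy_Schwarz_ineq_sum)
  finally show ?thesis by (simp add: mult.commute)
qed

lemma norm_square_eq_sum_inner:
  fixes v :: "'b::euclidean_space"
  shows "(norm v)\<^sup>2 = (\<Sum>b\<in>Basis. (b \<bullet> v)\<^sup>2)"
  unfolding power2_norm_eq_inner using euclidean_inner[of v v] by (simp add: power2_eq_square inner_commute)

section \<open>Square integrable random variables known at a given time\<close>

context usual_filtered_prob_space
begin

lemma space_F [simp]: "0 \<le> t \<Longrightarrow> space (F t) = space M"
  using subalg[of t] by (simp add: subalgebra_def)

lemma sets_F: "0 \<le> t \<Longrightarrow> A \<in> sets (F t) \<Longrightarrow> A \<in> sets M"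
  using subalg[of t] by (auto simp: subalgebra_def)

lemma measurable_FM: "0 \<le> t \<Longrightarrow> f \<in> measurable (F t) K \<Longrightarrow> f \<in> measurable M K"
  using measurable_from_subalg[OF subalg] .

lemma measurable_F_mono: "f \<in> measurable (F s) K \<Longrightarrow> 0 \<le> s \<Longrightarrow> s \<le> t \<Longrightarrow> f \<in> measurable (F t) K"
  using mono[of s t] by (auto simp: measurable_def)

text \<open>The class on which the isometry is an exact identity. \<open>0 \<le> t\<close> is
  included because the sigma-algebras at negative times are unconstrained.\<close>

definition L2F :: "real \<Rightarrow> ('a \<Rightarrow> 'b::euclidean_space) \<Rightarrow> bool" where
  "L2F t f \<longleftrightarrow> 0 \<le> t \<and> f \<in> borel_measurable (F t) \<and> integrable M (\<lambda>\<omega>. (norm (f \<omega>))\<^sup>2)"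

lemma L2F_measurable: "L2F t f \<Longrightarrow> f \<in> borel_measurable (F t)"
  by (simp add: L2F_def)

lemma L2F_borel: "L2F t f \<Longrightarrow> f \<in> borel_measurable M"
  by (auto simp: L2F_def intro: measurable_FM)

lemma L2F_integrable: "L2F t f \<Longrightarrow> integrable M (\<lambda>\<omega>. (norm (f \<omega>))\<^sup>2)"
  by (simp add: L2F_def)

lemma L2F_mono: "L2F s f \<Longrightarrow> s \<le> t \<Longrightarrow> L2F t f"
  by (auto simp: L2F_def intro: measurable_F_mono)

lemma L2F_const: "0 \<le> t \<Longrightarrow> L2F t (\<lambda>_. c)"
  by (simp add: L2F_def)

lemma L2F_add:
  assumes "L2F t f" "L2F t g"
  shows "L2F t (\<lambda>\<omega>. f \<omega> + g \<omega>)"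
proof -
  have [measurable]: "f \<in> borel_measurable M" "g \<in> borel_measurable M" using assms L2F_borel by auto
  have "integrable M (\<lambda>\<omega>. (norm (f \<omega> + g \<omega>))\<^sup>2)"
  proof (rule Bochner_Integration.integrable_bound)
    show "integrable M (\<lambda>\<omega>. 2 * (norm (f \<omega>))\<^sup>2 + 2 * (norm (g \<omega>))\<^sup>2)"
      using assms by (simp add: L2F_def)
    show "AE \<omega> in M. norm ((norm (f \<omega> + g \<omega>))\<^sup>2) \<le> norm (2 * (norm (f \<omega>))\<^sup>2 + 2 * (norm (g \<omega>))\<^sup>2)"
      using norm_add_square_le_double by auto
  qed simp
  then show ?thesis using assms by (auto simp: L2F_def)
qed

lemma L2F_bounded:
  assumes "f \<in> borel_measurable (F t)" "0 \<le> t" "\<And>\<omega>. \<omega> \<in> space M \<Longrightarrow> norm (f \<omega>) \<le> C"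
  shows "L2F t f"
proof -
  have [measurable]: "f \<in> borel_measurable M" using assms measurable_FM by auto
  have "integrable M (\<lambda>\<omega>. (norm (f \<omega>))\<^sup>2)"
    by (rule integrable_const_bound[where B="C\<^sup>2"]) (use assms in \<open>auto intro!: power_mono\<close>)
  then show ?thesis using assms by (simp add: L2F_def)
qed

lemma L2F_dominated:
  assumes "f \<in> borel_measurable (F t)" "L2F t g" "\<And>\<omega>. \<omega> \<in> space M \<Longrightarrow> norm (f \<omega>) \<le> C * norm (g \<omega>)"
  shows "L2F t f"
proof -
  have t: "0 \<le> t" using assms by (simp add: L2F_def)
  then have [measurable]: "f \<in> borel_measurable M" using assms measurable_FM by auto
  have "integrable M (\<lambda>\<omega>. (norm (f \<omega>))\<^sup>2)"
  proof (rule Bochner_Integration.integrable_bound)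
    show "integrable M (\<lambda>\<omega>. C\<^sup>2 * (norm (g \<omega>))\<^sup>2)" using assms by (simp add: L2F_def)
    show "AE \<omega> in M. norm ((norm (f \<omega>))\<^sup>2) \<le> norm (C\<^sup>2 * (norm (g \<omega>))\<^sup>2)"
      using assms(3) by (auto simp: power_mult_distrib[symmetric] intro!: power_mono)
  qed simp
  then show ?thesis using assms t by (simp add: L2F_def)
qed

lemma L2F_linear:
  assumes "bounded_linear l" "L2F t f"
  shows "L2F t (\<lambda>\<omega>. l (f \<omega>))"
proof -
  interpret bounded_linear l by fact
  obtain K where K: "\<And>x. norm (l x) \<le> norm x * K" using bounded by auto
  show ?thesis
  proof (rule L2F_dominated[OF _ assms(2)])
    show "(\<lambda>\<omega>. l (f \<omega>)) \<in> borel_measurable (F t)"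
      using borel_measurable_continuous_onI[OF continuous_on[OF continuous_on_id]] L2F_measurable[OF assms(2)]
      by (rule measurable_compose[rotated])
  qed (use K in \<open>auto simp: mult.commute\<close>)
qed

lemma L2F_scaleR: "L2F t f \<Longrightarrow> L2F t (\<lambda>\<omega>. c *\<^sub>R f \<omega>)"
  by (rule L2F_linear[OF bounded_linear_scaleR_right])

lemma L2F_minus: "L2F t f \<Longrightarrow> L2F t (\<lambda>\<omega>. - f \<omega>)"
  using L2F_scaleR[of t f "-1"] by simp

lemma L2F_diff: "L2F t f \<Longrightarrow> L2F t g \<Longrightarrow> L2F t (\<lambda>\<omega>. f \<omega> - g \<omega>)"
  using L2F_add[of t f "\<lambda>\<omega>. - g \<omega>"] L2F_minus[of t g] by simp

lemma L2F_sum: "(\<And>i. i \<in> I \<Longrightarrow> L2F t (f i)) \<Longrightarrow> 0 \<le> t \<Longrightarrow> L2F t (\<lambda>\<omega>. \<Sum>i\<in>I. f i \<omega>)"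
  by (induction I rule: infinite_finite_induct) (auto intro!: L2F_add L2F_const)

lemma L2F_matrix: "L2F t f \<Longrightarrow> L2F t (\<lambda>\<omega>. (A :: real^'n^'m) *v f \<omega>)"
  by (rule L2F_linear[OF matrix_vector_mul_bounded_linear])

lemma L2F_inner: "L2F t f \<Longrightarrow> L2F t (\<lambda>\<omega>. u \<bullet> f \<omega>)"
  by (rule L2F_linear[OF bounded_linear_inner_right])

lemma L2F_indicator:
  assumes "L2F t f" "E \<in> sets (F t)"
  shows "L2F t (\<lambda>\<omega>. indicator E \<omega> *\<^sub>R f \<omega>)"
proof (rule L2F_dominated[OF _ assms(1), where C=1])
  show "(\<lambda>\<omega>. indicator E \<omega> *\<^sub>R f \<omega>) \<in> borel_measurable (F t)"
    using assms L2F_measurable[OF assms(1)] by measurable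
qed (auto simp: indicator_def)

lemma L2F_inner_integrable:
  assumes "L2F t f" "L2F s g"
  shows "integrable M (\<lambda>\<omega>. f \<omega> \<bullet> g \<omega>)"
proof (rule Bochner_Integration.integrable_bound)
  have [measurable]: "f \<in> borel_measurable M" "g \<in> borel_measurable M" using assms L2F_borel by auto
  show "integrable M (\<lambda>\<omega>. (norm (f \<omega>))\<^sup>2 + (norm (g \<omega>))\<^sup>2)" using assms by (simp add: L2F_def)
  show "(\<lambda>\<omega>. f \<omega> \<bullet> g \<omega>) \<in> borel_measurable M" by simp
  have "\<bar>u \<bullet> v\<bar> \<le> (norm u)\<^sup>2 + (norm v)\<^sup>2" for u v :: 'b
  proof -
    have "\<bar>u \<bullet> v\<bar> \<le> norm u * norm v" by (rule Cauchy_Schwarz_ineq2)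
    also have "\<dots> \<le> (norm u)\<^sup>2 + (norm v)\<^sup>2"
    proof -
      have "2 * (norm u * norm v) \<le> (norm u)\<^sup>2 + (norm v)\<^sup>2" using sum_squares_bound[of "norm u" "norm v"] by simp
      moreover have "0 \<le> norm u * norm v" by simp
      ultimately show ?thesis by linarith
    qed
    finally show ?thesis .
  qed
  then show "AE \<omega> in M. norm (f \<omega> \<bullet> g \<omega>) \<le> norm ((norm (f \<omega>))\<^sup>2 + (norm (g \<omega>))\<^sup>2)" by auto
qed

end

section \<open>Moments of Wiener increments weighted by the past\<close>

context independent_wiener_processes
begin

definition dW :: "nat \<Rightarrow> real \<Rightarrow> real \<Rightarrow> 'a \<Rightarrow> real" where
  "dW i s t \<omega> = W i t \<omega> - W i s \<omega>"

lemma dW_measurable: "i \<in> {1..N} \<Longrightarrow> 0 \<le> s \<Longrightarrow> s \<le> t \<Longrightarrow> dW i s t \<in> borel_measurable (F t)"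
  unfolding dW_def using adapted[of i t] measurable_F_mono[OF adapted[of i s], of t] by (intro borel_measurable_diff) auto

lemma dW_borel: "i \<in> {1..N} \<Longrightarrow> 0 \<le> s \<Longrightarrow> s \<le> t \<Longrightarrow> dW i s t \<in> borel_measurable M"
  using measurable_FM[OF _ dW_measurable, of t i s] by auto

lemma dW_moments:
  assumes "i \<in> {1..N}" "0 \<le> s" "s < t"
  shows "integrable M (dW i s t)" "expectation (dW i s t) = 0"
    "integrable M (\<lambda>\<omega>. (dW i s t \<omega>)\<^sup>2)" "expectation (\<lambda>\<omega>. (dW i s t \<omega>)\<^sup>2) = t - s"
proof -
  have D: "distributed M lborel (dW i s t) (normal_density 0 (sqrt (t - s)))"
    using gaussian[OF assms] by (simp add: dW_def[abs_def])
  have pos: "0 < sqrt (t - s)" using assms by simp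
  have 1: "integrable lborel (\<lambda>x. normal_density 0 (sqrt (t - s)) x * x)"
    using integrable_normal_moment[OF pos, of 0 1] by simp
  have 2: "integrable lborel (\<lambda>x. normal_density 0 (sqrt (t - s)) x * x\<^sup>2)"
    using integrable_normal_moment[OF pos, of 0 2] by simp
  show "integrable M (dW i s t)"
    using distributed_integrable[OF D, of "\<lambda>x. x"] 1 by simp
  show e0: "expectation (dW i s t) = 0" using normal_distributed_expectation[OF pos D] .
  show "integrable M (\<lambda>\<omega>. (dW i s t \<omega>)\<^sup>2)"
    using distributed_integrable[OF D, of "\<lambda>x. x\<^sup>2"] 2 by simp
  show "expectation (\<lambda>\<omega>. (dW i s t \<omega>)\<^sup>2) = t - s"
    using normal_distributed_variance[OF pos D] e0 assms by simp
qed

text \<open>Independence of the processes from each other, as opposed to independence of increments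
  from the past, enters here: the mean of a product of two different noises factors into
  zeros.\<close>

lemma dW_cross:
  assumes "i \<in> {1..N}" "l \<in> {1..N}" "i \<noteq> l" "0 \<le> s" "s < t"
  shows "integrable M (\<lambda>\<omega>. dW i s t \<omega> * dW l s t \<omega>)" "expectation (\<lambda>\<omega>. dW i s t \<omega> * dW l s t \<omega>) = 0"
proof -
  \<comment> \<open>An increment is a measurable function of the restricted path, so independence
    passes from paths to increments.\<close>
  have "indep_vars (\<lambda>_. borel) (\<lambda>i. (\<lambda>f. f t - f s) \<circ> (\<lambda>\<omega>. \<lambda>t\<in>{0..}. W i t \<omega>)) {1..N}"
    by (rule indep_vars_compose[OF indep_processes]) (use assms in \<open>auto intro!: borel_measurable_diff measurable_component_singleton\<close>)
  then have "indep_vars (\<lambda>_. borel) (\<lambda>i \<omega>. dW i s t \<omega>) {1..N}"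
    using assms by (simp add: comp_def dW_def)
  then have ind: "indep_vars (\<lambda>_. borel) (\<lambda>i \<omega>. dW i s t \<omega>) {i, l}"
    using assms by (intro indep_vars_subset[where J="{i,l}"]) auto
  have "integrable M (\<lambda>\<omega>. \<Prod>k\<in>{i,l}. dW k s t \<omega>)"
    by (rule indep_vars_integrable[OF _ ind]) (use assms dW_moments in auto)
  then show "integrable M (\<lambda>\<omega>. dW i s t \<omega> * dW l s t \<omega>)" using assms by simp
  have "expectation (\<lambda>\<omega>. \<Prod>k\<in>{i,l}. dW k s t \<omega>) = (\<Prod>k\<in>{i,l}. expectation (dW k s t))"
    by (rule indep_vars_lebesgue_integral[OF _ ind]) (use assms dW_moments in auto)
  then show "expectation (\<lambda>\<omega>. dW i s t \<omega> * dW l s t \<omega>) = 0" using assms dW_moments by simp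
qed

text \<open>The whole vector of increments is independent of the past, hence so is any
  \<open>g\<close> of it. With \<open>g\<close> a coordinate or a product of two coordinates this
  covers first and second moments; independence of each increment alone would not reach the
  products.\<close>

lemma indep_past_increments:
  fixes Z :: "'a \<Rightarrow> real"
  assumes Z: "Z \<in> borel_measurable (F s)" and st: "0 \<le> s" "s < t"
    and g: "g \<in> borel_measurable (PiM {1..N} (\<lambda>_. borel :: real measure))"
  shows "indep_var borel Z borel (\<lambda>\<omega>. g (\<lambda>i\<in>{1..N}. dW i s t \<omega>))"
proof -
  let ?V = "\<lambda>\<omega>. \<lambda>i\<in>{1..N}. dW i s t \<omega>"
  let ?S = "vimage_algebra (space M) ?V (PiM {1..N} (\<lambda>_. borel))"
  have V: "?V \<in> measurable M (PiM {1..N} (\<lambda>_. borel))"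
    using st by (intro measurable_restrict dW_borel) auto
  have Vs: "?V \<in> space M \<rightarrow> space (PiM {1..N} (\<lambda>_. borel))" using measurable_space[OF V] by auto
  have gV: "(\<lambda>\<omega>. g (?V \<omega>)) \<in> borel_measurable M" using measurable_compose[OF V g] .
  have gS: "(\<lambda>\<omega>. g (?V \<omega>)) \<in> borel_measurable ?S"
    using measurable_compose[OF measurable_vimage_algebra1[OF Vs] g] .
  have ind: "indep_set (sets (F s)) (sets ?S)"
    using indep_increments[OF st] by (simp add: dW_def)
  have "indep_set (sigma_sets (space M) {Z -` A \<inter> space M |A. A \<in> sets borel})
     (sigma_sets (space M) {(\<lambda>\<omega>. g (?V \<omega>)) -` A \<inter> space M |A. A \<in> sets borel})"
  proof -
    have 1: "sigma_sets (space M) {Z -` A \<inter> space M |A. A \<in> sets borel} \<subseteq> sets (F s)"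
    proof -
      have "sigma_sets (space (F s)) {Z -` A \<inter> space M |A. A \<in> sets borel} \<subseteq> sets (F s)"
        using measurable_sets[OF Z] st by (intro sets.sigma_sets_subset) auto
      then show ?thesis using st by simp
    qed
    have 2: "sigma_sets (space M) {(\<lambda>\<omega>. g (?V \<omega>)) -` A \<inter> space M |A. A \<in> sets borel} \<subseteq> sets ?S"
    proof -
      have "sigma_sets (space ?S) {(\<lambda>\<omega>. g (?V \<omega>)) -` A \<inter> space M |A. A \<in> sets borel} \<subseteq> sets ?S"
        using measurable_sets[OF gS] by (intro sets.sigma_sets_subset) auto
      then show ?thesis by simp
    qed
    show ?thesis using ind 1 2 unfolding indep_sets2_eq by (meson subsetD subset_trans)
  qed
  then show ?thesis using gV measurable_FM[OF st(1) Z] by (simp add: indep_var_eq)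
qed

lemma expectation_past_times_dW:
  fixes Z :: "'a \<Rightarrow> real"
  assumes Z: "Z \<in> borel_measurable (F s)" "integrable M Z" and st: "0 \<le> s" "s \<le> t" and i: "i \<in> {1..N}"
  shows "integrable M (\<lambda>\<omega>. Z \<omega> * dW i s t \<omega>)" "expectation (\<lambda>\<omega>. Z \<omega> * dW i s t \<omega>) = 0"
proof -
  have "integrable M (\<lambda>\<omega>. Z \<omega> * dW i s t \<omega>) \<and> expectation (\<lambda>\<omega>. Z \<omega> * dW i s t \<omega>) = 0"
  \<comment> \<open>Over a degenerate interval the increment is zero and has no density; the
    Gaussian assumption speaks of \<open>s < t\<close>.\<close>
  proof (cases "s = t")
    case False
    then have st': "s < t" using st by simp
    have "indep_var borel Z borel (dW i s t)"
      using indep_past_increments[OF Z(1) st(1) st', of "\<lambda>f. f i"] i by (simp add: measurable_component_singleton)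
    then show ?thesis
      using indep_var_integrable[of Z "dW i s t"] indep_var_lebesgue_integral[of Z "dW i s t"]
        dW_moments[OF i st(1) st'] Z by simp
  qed (simp add: dW_def)
  then show "integrable M (\<lambda>\<omega>. Z \<omega> * dW i s t \<omega>)" "expectation (\<lambda>\<omega>. Z \<omega> * dW i s t \<omega>) = 0" by auto
qed

lemma expectation_past_times_dW_dW:
  fixes Z :: "'a \<Rightarrow> real"
  assumes Z: "Z \<in> borel_measurable (F s)" "integrable M Z" and st: "0 \<le> s" "s \<le> t"
    and i: "i \<in> {1..N}" and l: "l \<in> {1..N}"
  shows "integrable M (\<lambda>\<omega>. Z \<omega> * (dW i s t \<omega> * dW l s t \<omega>))"
    "expectation (\<lambda>\<omega>. Z \<omega> * (dW i s t \<omega> * dW l s t \<omega>)) = (if i = l then (t - s) * expectation Z else 0)"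
proof -
  have "integrable M (\<lambda>\<omega>. Z \<omega> * (dW i s t \<omega> * dW l s t \<omega>)) \<and>
    expectation (\<lambda>\<omega>. Z \<omega> * (dW i s t \<omega> * dW l s t \<omega>)) = (if i = l then (t - s) * expectation Z else 0)"
  proof (cases "s = t")
    case False
    then have st': "s < t" using st by simp
    have "indep_var borel Z borel (\<lambda>\<omega>. dW i s t \<omega> * dW l s t \<omega>)"
      using indep_past_increments[OF Z(1) st(1) st', of "\<lambda>f. f i * f l"] i l by (simp add: measurable_component_singleton)
    then show ?thesis
      using indep_var_integrable[of Z "\<lambda>\<omega>. dW i s t \<omega> * dW l s t \<omega>"]
        indep_var_lebesgue_integral[of Z "\<lambda>\<omega>. dW i s t \<omega> * dW l s t \<omega>"]
        dW_moments[OF i st(1) st'] dW_cross[OF i l _ st(1) st'] Z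
      by (cases "i = l") (simp_all add: power2_eq_square)
  qed (simp add: dW_def)
  then show "integrable M (\<lambda>\<omega>. Z \<omega> * (dW i s t \<omega> * dW l s t \<omega>))"
    "expectation (\<lambda>\<omega>. Z \<omega> * (dW i s t \<omega> * dW l s t \<omega>)) = (if i = l then (t - s) * expectation Z else 0)" by auto
qed

text \<open>The Ito isometry for one time step. In the expanded square the products of
  \<open>U\<close>-terms with an increment and of two different increments have mean zero, and a
  squared increment contributes its variance \<open>t - s\<close>. The \<open>V i\<close> only have
  to be known at time \<open>s\<close>, so they may stem from any earlier time; this is where delays
  disappear. \<open>J\<close> is a singleton for a single integral and \<open>{1..N}\<close> for an
  Euler step.\<close>

lemma one_step:
  fixes U :: "'a \<Rightarrow> 'b::euclidean_space" and V :: "nat \<Rightarrow> 'a \<Rightarrow> 'b"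
  assumes U: "L2F s U" and V: "\<And>i. i \<in> J \<Longrightarrow> L2F s (V i)" and st: "s \<le> t" and J: "J \<subseteq> {1..N}"
  shows one_step_L2F: "L2F t (\<lambda>\<omega>. U \<omega> + (\<Sum>i\<in>J. dW i s t \<omega> *\<^sub>R V i \<omega>))"
    and one_step_expectation: "expectation (\<lambda>\<omega>. (norm (U \<omega> + (\<Sum>i\<in>J. dW i s t \<omega> *\<^sub>R V i \<omega>)))\<^sup>2)
      = expectation (\<lambda>\<omega>. (norm (U \<omega>))\<^sup>2) + (t - s) * (\<Sum>i\<in>J. expectation (\<lambda>\<omega>. (norm (V i \<omega>))\<^sup>2))"
proof -
  have s: "0 \<le> s" using U by (simp add: L2F_def)
  have finJ: "finite J" using J finite_subset by blast
  let ?c = "\<lambda>i \<omega>. (U \<omega> \<bullet> V i \<omega>) * dW i s t \<omega>"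
  let ?d = "\<lambda>i l \<omega>. (V i \<omega> \<bullet> V l \<omega>) * (dW i s t \<omega> * dW l s t \<omega>)"
  have eq: "(norm (U \<omega> + (\<Sum>i\<in>J. dW i s t \<omega> *\<^sub>R V i \<omega>)))\<^sup>2
      = (norm (U \<omega>))\<^sup>2 + 2 * (\<Sum>i\<in>J. ?c i \<omega>) + (\<Sum>i\<in>J. \<Sum>l\<in>J. ?d i l \<omega>)" for \<omega>
    by (simp add: power2_norm_eq_inner inner_add_left inner_add_right inner_sum_left inner_sum_right
        inner_commute sum_distrib_left mult_ac algebra_simps)
  have c: "integrable M (?c i)" "expectation (?c i) = 0" if "i \<in> J" for i
    using expectation_past_times_dW[of "\<lambda>\<omega>. U \<omega> \<bullet> V i \<omega>" s t i] that J s st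
      L2F_inner_integrable[OF U V[OF that]] L2F_measurable[OF U] L2F_measurable[OF V[OF that]] by auto
  have d: "integrable M (?d i l)" "expectation (?d i l) = (if i = l then (t - s) * expectation (\<lambda>\<omega>. (norm (V i \<omega>))\<^sup>2) else 0)"
    if "i \<in> J" "l \<in> J" for i l
    using expectation_past_times_dW_dW[of "\<lambda>\<omega>. V i \<omega> \<bullet> V l \<omega>" s t i l] that J s st
      L2F_inner_integrable[OF V V, OF that] L2F_measurable[OF V[OF that(1)]] L2F_measurable[OF V[OF that(2)]]
    by (cases "i = l"; auto simp: power2_norm_eq_inner subset_eq)+
  have int: "integrable M (\<lambda>\<omega>. (norm (U \<omega> + (\<Sum>i\<in>J. dW i s t \<omega> *\<^sub>R V i \<omega>)))\<^sup>2)"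
    unfolding eq using c d L2F_integrable[OF U] by (intro Bochner_Integration.integrable_add integrable_mult_right integrable_sum) auto
  have "U \<in> borel_measurable (F t)" using measurable_F_mono[OF L2F_measurable[OF U] s st] .
  moreover have "V i \<in> borel_measurable (F t)" if "i \<in> J" for i
    using measurable_F_mono[OF L2F_measurable[OF V[OF that]] s st] .
  moreover have "dW i s t \<in> borel_measurable (F t)" if "i \<in> J" for i using dW_measurable that J s st by auto
  ultimately have "(\<lambda>\<omega>. U \<omega> + (\<Sum>i\<in>J. dW i s t \<omega> *\<^sub>R V i \<omega>)) \<in> borel_measurable (F t)"
    by (intro borel_measurable_add borel_measurable_sum borel_measurable_scaleR) auto
  with int show "L2F t (\<lambda>\<omega>. U \<omega> + (\<Sum>i\<in>J. dW i s t \<omega> *\<^sub>R V i \<omega>))" using s st by (simp add: L2F_def)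
  have "expectation (\<lambda>\<omega>. (norm (U \<omega> + (\<Sum>i\<in>J. dW i s t \<omega> *\<^sub>R V i \<omega>)))\<^sup>2)
    = expectation (\<lambda>\<omega>. (norm (U \<omega>))\<^sup>2) + 2 * (\<Sum>i\<in>J. expectation (?c i)) + (\<Sum>i\<in>J. \<Sum>l\<in>J. expectation (?d i l))"
    unfolding eq using c(1) d(1) L2F_integrable[OF U] by (simp add: integrable_sum)
  also have "(\<Sum>i\<in>J. expectation (?c i)) = 0" using c by simp
  also have "(\<Sum>i\<in>J. \<Sum>l\<in>J. expectation (?d i l)) = (\<Sum>i\<in>J. \<Sum>l\<in>J. if i = l then (t - s) * expectation (\<lambda>\<omega>. (norm (V i \<omega>))\<^sup>2) else 0)"
    using d by (intro sum.cong refl) auto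
  also have "\<dots> = (t - s) * (\<Sum>i\<in>J. expectation (\<lambda>\<omega>. (norm (V i \<omega>))\<^sup>2))"
    using finJ by (simp add: sum_distrib_left)
  finally show "expectation (\<lambda>\<omega>. (norm (U \<omega> + (\<Sum>i\<in>J. dW i s t \<omega> *\<^sub>R V i \<omega>)))\<^sup>2)
      = expectation (\<lambda>\<omega>. (norm (U \<omega>))\<^sup>2) + (t - s) * (\<Sum>i\<in>J. expectation (\<lambda>\<omega>. (norm (V i \<omega>))\<^sup>2))" by simp
qed

end

section \<open>Integrals of step processes along a grid\<close>

text \<open>Serves to merge the jump times of a simple integrand and the nodes of an Euler grid into
  one increasing grid.\<close>

lemma ex_strict_mono_grid:
  fixes P :: "real set"
  assumes "finite P" "P \<subseteq> {0..t}" "0 \<in> P" "t \<in> P"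
  obtains \<sigma> :: "nat \<Rightarrow> real" and p where "strict_mono_on {..p} \<sigma>" "\<sigma> ` {..p} = P" "\<sigma> 0 = 0" "\<sigma> p = t"
proof
  let ?xs = "sorted_list_of_set P"
  let ?p = "length ?xs - 1"
  have set: "set ?xs = P" using assms by simp
  have ne: "?xs \<noteq> []" using assms by auto
  have le: "{..?p} = {..<length ?xs}" using ne by (cases ?xs) auto
  show mono: "strict_mono_on {..?p} ((!) ?xs)"
  proof (rule strict_mono_onI)
    fix r s assume "r \<in> {..?p}" "s \<in> {..?p}" "r < s"
    then show "?xs ! r < ?xs ! s"
      using sorted_wrt_nth_less[OF strict_sorted_list_of_set[of P], of r s] le by (metis lessThan_iff)
  qed
  show im: "(!) ?xs ` {..?p} = P"
    using set unfolding le by (auto simp: set_conv_nth image_def)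
  have mono': "?xs ! a \<le> ?xs ! b" if "a \<le> b" "b \<le> ?p" for a b
    using strict_mono_onD[OF mono, of a b] that by (cases "a = b") auto
  obtain a where a: "a \<le> ?p" "?xs ! a = 0" using im assms(3) by (metis atMost_iff imageE)
  obtain b where b: "b \<le> ?p" "?xs ! b = t" using im assms(4) by (metis atMost_iff imageE)
  have "?xs ! 0 \<in> P" "?xs ! ?p \<in> P" using im by auto
  then show "?xs ! 0 = 0" "?xs ! ?p = t" using mono'[of 0 a] mono'[of b ?p] a b assms(2) by force+
qed

text \<open>Only jump times up to \<open>t\<close> are required to be grid points: a simple integral
  up to \<open>t\<close> does not see the later ones, so one integrand can be examined at any final
  time.\<close>

locale refining_grid =
  fixes m :: nat and \<tau> :: "nat \<Rightarrow> real" and p :: nat and \<sigma> :: "nat \<Rightarrow> real" and t :: real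
  assumes \<tau>_mono: "\<And>j. j < m \<Longrightarrow> \<tau> j \<le> \<tau> (Suc j)" and \<tau>_nonneg: "0 \<le> \<tau> 0"
    and \<sigma>_mono: "strict_mono_on {..p} \<sigma>" and \<sigma>_first: "\<sigma> 0 = 0" and \<sigma>_last: "\<sigma> p = t"
    and refines: "\<And>j. j \<le> m \<Longrightarrow> \<tau> j \<le> t \<Longrightarrow> \<tau> j \<in> \<sigma> ` {..p}"
begin

lemma \<sigma>_less_iff: "a \<le> p \<Longrightarrow> b \<le> p \<Longrightarrow> \<sigma> a < \<sigma> b \<longleftrightarrow> a < b"
  using strict_mono_on_less[OF \<sigma>_mono] by auto

lemma \<sigma>_le_iff: "a \<le> p \<Longrightarrow> b \<le> p \<Longrightarrow> \<sigma> a \<le> \<sigma> b \<longleftrightarrow> a \<le> b"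
  using strict_mono_on_less_eq[OF \<sigma>_mono] by auto

lemma \<sigma>_nonneg: "l \<le> p \<Longrightarrow> 0 \<le> \<sigma> l"
  using \<sigma>_le_iff[of 0 l] \<sigma>_first by simp

lemma \<sigma>_le_t: "l \<le> p \<Longrightarrow> \<sigma> l \<le> t"
  using \<sigma>_le_iff[of l p] \<sigma>_last by simp

text \<open>No jump time lies in the interior of a cell. For \<open>\<tau> j > t\<close> both sides
  are false.\<close>

lemma \<tau>_less_iff:
  assumes "j \<le> m" "l < p" "\<sigma> l < s" "s \<le> \<sigma> (Suc l)"
  shows "\<tau> j < s \<longleftrightarrow> \<tau> j \<le> \<sigma> l"
proof (cases "\<tau> j \<le> t")
  case True
  then obtain a where a: "a \<le> p" "\<tau> j = \<sigma> a" using refines[OF assms(1)] by auto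
  show ?thesis
  proof
    assume "\<tau> j < s"
    then have "\<sigma> a < \<sigma> (Suc l)" using a assms by simp
    then show "\<tau> j \<le> \<sigma> l" using a assms \<sigma>_less_iff[of a "Suc l"] \<sigma>_le_iff[of a l] by simp
  qed (use assms in auto)
next
  case False
  then show ?thesis using \<sigma>_le_t[of "Suc l"] \<sigma>_le_t[of l] assms by auto
qed

text \<open>The intervals of a simple integrand are open on the left, so it is constant on left-open
  cells and its value there is read off at the right end point.\<close>

lemma simple_value_cell:
  assumes "l < p" "\<sigma> l < s" "s \<le> \<sigma> (Suc l)"
  shows "simple_value m \<tau> \<xi> s \<omega> = simple_value m \<tau> \<xi> (\<sigma> (Suc l)) \<omega>"
proof -
  have "(s \<in> {\<tau> j<..\<tau> (Suc j)}) = (\<sigma> (Suc l) \<in> {\<tau> j<..\<tau> (Suc j)})" if "j < m" for j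
    using \<tau>_less_iff[of j l s] \<tau>_less_iff[of "Suc j" l s] \<tau>_less_iff[of j l "\<sigma> (Suc l)"]
      \<tau>_less_iff[of "Suc j" l "\<sigma> (Suc l)"] that assms by auto
  then show ?thesis unfolding simple_value_def by (intro sum.cong refl) (auto simp: indicator_def)
qed

text \<open>Inside one interval of the integrand the increments over the cells telescope. The
  integrator \<open>B\<close> is arbitrary, so the identity serves Wiener processes and time
  alike.\<close>

lemma simple_integral_eq:
  "simple_integral B m \<tau> \<xi> t \<omega>
    = (\<Sum>l<p. (B (\<sigma> (Suc l)) \<omega> - B (\<sigma> l) \<omega>) *\<^sub>R simple_value m \<tau> \<xi> (\<sigma> (Suc l)) \<omega>)"
proof -
  let ?d = "\<lambda>l. B (\<sigma> (Suc l)) \<omega> - B (\<sigma> l) \<omega>"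
  \<comment> \<open>A jump time beyond \<open>t\<close> is stopped at the last grid point
    \<open>\<sigma> p = t\<close>.\<close>
  have ex: "\<exists>a\<le>p. \<sigma> a = min t (\<tau> j)" if "j \<le> m" for j
  proof (cases "\<tau> j \<le> t")
    case True
    then show ?thesis using refines[OF that True] by auto
  qed (use \<sigma>_last in auto)
  have tel: "(\<Sum>l<p. ?d l * indicator {\<tau> j<..\<tau> (Suc j)} (\<sigma> (Suc l)))
      = B (min t (\<tau> (Suc j))) \<omega> - B (min t (\<tau> j)) \<omega>" if j: "j < m" for j
  proof -
    obtain a where a: "a \<le> p" "\<sigma> a = min t (\<tau> j)" using ex[OF less_imp_le[OF j]] by blast
    obtain b where b: "b \<le> p" "\<sigma> b = min t (\<tau> (Suc j))" using ex[OF Suc_leI[OF j]] by blast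
    have "\<sigma> a \<le> \<sigma> b" unfolding a b using \<tau>_mono[OF j] by simp
    then have ab: "a \<le> b" using \<sigma>_le_iff[OF a(1) b(1)] by blast
    have iff: "\<sigma> (Suc l) \<in> {\<tau> j<..\<tau> (Suc j)} \<longleftrightarrow> l \<in> {a..<b}" if l: "l < p" for l
    proof -
      have "\<tau> j < \<sigma> (Suc l) \<longleftrightarrow> \<sigma> a < \<sigma> (Suc l)" using a \<sigma>_le_t[of "Suc l"] l by auto
      moreover have "\<sigma> (Suc l) \<le> \<tau> (Suc j) \<longleftrightarrow> \<sigma> (Suc l) \<le> \<sigma> b" using b \<sigma>_le_t[of "Suc l"] l by auto
      ultimately show ?thesis using \<sigma>_less_iff[of a "Suc l"] \<sigma>_le_iff[of "Suc l" b] a b l by auto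
    qed
    have "(\<Sum>l<p. ?d l * indicator {\<tau> j<..\<tau> (Suc j)} (\<sigma> (Suc l))) = (\<Sum>l<p. if l \<in> {a..<b} then ?d l else 0)"
      by (intro sum.cong refl) (use iff in \<open>auto simp: indicator_def\<close>)
    also have "\<dots> = (\<Sum>l\<in>{a..<b}. ?d l)"
      using b by (subst sum.inter_restrict[symmetric]) (auto intro!: sum.cong)
    also have "\<dots> = B (\<sigma> b) \<omega> - B (\<sigma> a) \<omega>"
      using sum_Suc_diff'[OF ab, of "\<lambda>l. B (\<sigma> l) \<omega>"] by simp
    finally show ?thesis using a b by simp
  qed
  have "(\<Sum>l<p. ?d l *\<^sub>R simple_value m \<tau> \<xi> (\<sigma> (Suc l)) \<omega>)
      = (\<Sum>l<p. \<Sum>j<m. (?d l * indicator {\<tau> j<..\<tau> (Suc j)} (\<sigma> (Suc l))) *\<^sub>R \<xi> j \<omega>)"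
    by (simp only: simple_value_def scaleR_sum_right scaleR_scaleR)
  also have "\<dots> = (\<Sum>j<m. (\<Sum>l<p. ?d l * indicator {\<tau> j<..\<tau> (Suc j)} (\<sigma> (Suc l))) *\<^sub>R \<xi> j \<omega>)"
    by (subst sum.swap) (simp only: scaleR_sum_left)
  also have "\<dots> = simple_integral B m \<tau> \<xi> t \<omega>"
    unfolding simple_integral_def by (intro sum.cong refl) (simp only: lessThan_iff tel)
  finally show ?thesis by simp
qed

end

context independent_wiener_processes
begin

definition grid_int :: "nat \<Rightarrow> (nat \<Rightarrow> real) \<Rightarrow> (nat \<Rightarrow> 'a \<Rightarrow> 'b::euclidean_space) \<Rightarrow> nat \<Rightarrow> 'a \<Rightarrow> 'b" where
  "grid_int i \<sigma> D p \<omega> = (\<Sum>l<p. dW i (\<sigma> l) (\<sigma> (Suc l)) \<omega> *\<^sub>R D l \<omega>)"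

lemma grid_int_Suc:
  "grid_int i \<sigma> D (Suc q) \<omega> = grid_int i \<sigma> D q \<omega> + dW i (\<sigma> q) (\<sigma> (Suc q)) \<omega> *\<^sub>R D q \<omega>"
  by (simp add: grid_int_def)

text \<open>Induction along the grid: the sum so far is the \<open>U\<close> of
  \<open>one_step\<close>, the next coefficient its only \<open>V\<close>.\<close>

lemma grid_int_isometry:
  assumes i: "i \<in> {1..N}" and D: "\<And>l. l < p \<Longrightarrow> L2F (\<sigma> l) (D l)"
    and \<sigma>: "\<And>l. l < p \<Longrightarrow> \<sigma> l \<le> \<sigma> (Suc l)" "0 \<le> \<sigma> 0"
  shows "q \<le> p \<Longrightarrow> L2F (\<sigma> q) (grid_int i \<sigma> D q) \<and>
    expectation (\<lambda>\<omega>. (norm (grid_int i \<sigma> D q \<omega>))\<^sup>2)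
      = (\<Sum>l<q. (\<sigma> (Suc l) - \<sigma> l) * expectation (\<lambda>\<omega>. (norm (D l \<omega>))\<^sup>2))"
proof (induction q)
  case 0
  then show ?case using \<sigma> by (simp add: grid_int_def[abs_def] L2F_const)
next
  case (Suc q)
  then have IH: "L2F (\<sigma> q) (grid_int i \<sigma> D q)"
    "expectation (\<lambda>\<omega>. (norm (grid_int i \<sigma> D q \<omega>))\<^sup>2)
      = (\<Sum>l<q. (\<sigma> (Suc l) - \<sigma> l) * expectation (\<lambda>\<omega>. (norm (D l \<omega>))\<^sup>2))" by auto
  have q: "q < p" using Suc by simp
  have eq: "grid_int i \<sigma> D (Suc q) = (\<lambda>\<omega>. grid_int i \<sigma> D q \<omega> + (\<Sum>k\<in>{i}. dW k (\<sigma> q) (\<sigma> (Suc q)) \<omega> *\<^sub>R D q \<omega>))"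
    by (auto simp: grid_int_def)
  have J: "{i} \<subseteq> {1..N}" using i by simp
  show ?case
    using one_step[where J="{i}" and V="\<lambda>_. D q", OF IH(1) D[OF q] \<sigma>(1)[OF q] J] IH(2)
    unfolding eq by simp
qed

text \<open>
  Cutting the integrand off once the sum has exceeded \<open>c\<close> leaves a sum that still exceeds \<open>c\<close> at the
  end, so Chebyshev's inequality and the isometry suffice.
\<close>

lemma grid_int_maximal:
  assumes i: "i \<in> {1..N}" and D: "\<And>l. l < p \<Longrightarrow> L2F (\<sigma> l) (D l)"
    and \<sigma>: "\<And>l. l < p \<Longrightarrow> \<sigma> l \<le> \<sigma> (Suc l)" "0 \<le> \<sigma> 0" and c: "0 < c"
  shows "prob {\<omega>\<in>space M. \<exists>q\<le>p. c < norm (grid_int i \<sigma> D q \<omega>)}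
    \<le> (\<Sum>l<p. (\<sigma> (Suc l) - \<sigma> l) * expectation (\<lambda>\<omega>. (norm (D l \<omega>))\<^sup>2)) / c\<^sup>2"
proof -
  let ?S = "grid_int i \<sigma> D"
  define G where "G l = {\<omega>\<in>space M. \<forall>r\<le>l. norm (?S r \<omega>) \<le> c}" for l
  define D' where "D' l \<omega> = indicator (G l) \<omega> *\<^sub>R D l \<omega>" for l \<omega>
  have mono': "\<sigma> a \<le> \<sigma> b" if "a \<le> b" "b \<le> p" for a b
    using that by (induction b) (auto simp: le_Suc_eq intro: order_trans[OF _ \<sigma>(1)])
  have nonneg: "0 \<le> \<sigma> l" if "l \<le> p" for l using mono'[of 0 l] that \<sigma> by auto
  have S: "L2F (\<sigma> q) (?S q)" if "q \<le> p" for q using grid_int_isometry[OF i D \<sigma> that] by blast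
  have Sm: "?S r \<in> borel_measurable (F (\<sigma> l))" if "r \<le> l" "l \<le> p" for r l
    using measurable_F_mono[OF L2F_measurable[OF S[of r]]] that mono' nonneg by auto
  have G: "G l \<in> sets (F (\<sigma> l))" if "l \<le> p" for l
  proof -
    have "G l = (\<Inter>r\<in>{..l}. {\<omega>\<in>space (F (\<sigma> l)). norm (?S r \<omega>) \<le> c})"
      using nonneg[OF that] by (auto simp: G_def)
    also have "\<dots> \<in> sets (F (\<sigma> l))"
      using Sm[OF _ that] by (intro sets.countable_INT) (auto intro!: borel_measurable_le borel_measurable_norm)
    finally show ?thesis .
  qed
  have D': "L2F (\<sigma> l) (D' l)" if "l < p" for l
    unfolding D'_def[abs_def] using L2F_indicator[OF D G] that by auto
  have key: "(if \<exists>r\<le>q. c < norm (?S r \<omega>) then c < norm (grid_int i \<sigma> D' q \<omega>) else grid_int i \<sigma> D' q \<omega> = ?S q \<omega>)"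
    if "\<omega> \<in> space M" for q \<omega>
  proof (induction q)
    case (Suc q)
    show ?case
    proof (cases "\<exists>r\<le>q. c < norm (?S r \<omega>)")
      case True
      then have "\<omega> \<notin> G q" by (auto simp: G_def not_le)
      then have "grid_int i \<sigma> D' (Suc q) \<omega> = grid_int i \<sigma> D' q \<omega>" by (simp add: grid_int_def D'_def)
      moreover have "\<exists>r\<le>Suc q. c < norm (?S r \<omega>)" using True by (auto intro: le_SucI)
      ultimately show ?thesis using Suc True by simp
    next
      case False
      then have "\<omega> \<in> G q" using that by (auto simp: G_def not_less)
      then have eq: "grid_int i \<sigma> D' (Suc q) \<omega> = ?S (Suc q) \<omega>"
        using Suc False unfolding grid_int_Suc by (simp add: D'_def)
      show ?thesis using False by (auto simp: eq le_Suc_eq)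
    qed
  qed (auto simp: grid_int_def)
  have S': "L2F (\<sigma> p) (grid_int i \<sigma> D' p)" and iso:
    "expectation (\<lambda>\<omega>. (norm (grid_int i \<sigma> D' p \<omega>))\<^sup>2) = (\<Sum>l<p. (\<sigma> (Suc l) - \<sigma> l) * expectation (\<lambda>\<omega>. (norm (D' l \<omega>))\<^sup>2))"
    using grid_int_isometry[OF i D' \<sigma> order_refl] by auto
  have [measurable]: "grid_int i \<sigma> D' p \<in> borel_measurable M" using L2F_borel[OF S'] .
  have "prob {\<omega>\<in>space M. \<exists>q\<le>p. c < norm (?S q \<omega>)} \<le> prob {\<omega>\<in>space M. c\<^sup>2 \<le> (norm (grid_int i \<sigma> D' p \<omega>))\<^sup>2}"
  proof (rule finite_measure_mono)
    show "{\<omega>\<in>space M. \<exists>q\<le>p. c < norm (?S q \<omega>)} \<subseteq> {\<omega>\<in>space M. c\<^sup>2 \<le> (norm (grid_int i \<sigma> D' p \<omega>))\<^sup>2}"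
      using key[of _ p] c by (auto intro!: power_mono) (smt (verit))
  qed simp
  also have "\<dots> \<le> expectation (\<lambda>\<omega>. (norm (grid_int i \<sigma> D' p \<omega>))\<^sup>2) / c\<^sup>2"
    using integral_Markov_inequality_measure[of M "\<lambda>\<omega>. (norm (grid_int i \<sigma> D' p \<omega>))\<^sup>2" "{}" "c\<^sup>2"] c L2F_integrable[OF S']
    by simp
  also have "\<dots> \<le> (\<Sum>l<p. (\<sigma> (Suc l) - \<sigma> l) * expectation (\<lambda>\<omega>. (norm (D l \<omega>))\<^sup>2)) / c\<^sup>2"
    unfolding iso
  proof (intro divide_right_mono sum_mono mult_left_mono integral_mono)
    fix l assume "l \<in> {..<p}"
    then have l: "l < p" by simp
    show "integrable M (\<lambda>\<omega>. (norm (D l \<omega>))\<^sup>2)" "integrable M (\<lambda>\<omega>. (norm (D' l \<omega>))\<^sup>2)"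
      using L2F_integrable[OF D[OF l]] L2F_integrable[OF D'[OF l]] by auto
    show "0 \<le> \<sigma> (Suc l) - \<sigma> l" using \<sigma>(1)[OF l] by simp
    show "(norm (D' l \<omega>))\<^sup>2 \<le> (norm (D l \<omega>))\<^sup>2" for \<omega>
      by (simp add: D'_def indicator_def)
  qed simp
  finally show ?thesis .
qed

text \<open>Predictability: a coefficient active on the cell belongs to some \<open>\<tau> j\<close>
  no later than the left end point, so the value attached to the right end point is already known at
  the left one.\<close>

lemma simple_value_L2F:
  assumes "refining_grid m \<tau> p \<sigma> t" and \<xi>: "\<And>j. j < m \<Longrightarrow> L2F (\<tau> j) (\<xi> j)" and l: "l < p"
  shows "L2F (\<sigma> l) (simple_value m \<tau> \<xi> (\<sigma> (Suc l)))"
proof -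
  interpret refining_grid m \<tau> p \<sigma> t by fact
  have "L2F (\<sigma> l) (\<lambda>\<omega>. indicator {\<tau> j<..\<tau> (Suc j)} (\<sigma> (Suc l)) *\<^sub>R \<xi> j \<omega>)" if j: "j < m" for j
  proof (cases "\<tau> j < \<sigma> (Suc l)")
    case True
    then have "\<tau> j \<le> \<sigma> l" using \<tau>_less_iff[of j l "\<sigma> (Suc l)"] \<sigma>_less_iff[of l "Suc l"] j l by auto
    then show ?thesis using L2F_scaleR[OF L2F_mono[OF \<xi>[OF j]]] by blast
  next
    case False
    then show ?thesis using L2F_const[OF \<sigma>_nonneg[of l], of 0] l by (simp add: indicator_def)
  qed
  then show ?thesis unfolding simple_value_def[abs_def] using \<sigma>_nonneg[of l] l by (intro L2F_sum) auto
qed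

lemma simple_integral_eq_grid_int:
  assumes "refining_grid m \<tau> p \<sigma> t"
  shows "simple_integral (W i) m \<tau> \<xi> t \<omega> = grid_int i \<sigma> (\<lambda>l. simple_value m \<tau> \<xi> (\<sigma> (Suc l))) p \<omega>"
  using refining_grid.simple_integral_eq[OF assms, of "W i" \<xi> \<omega>] by (simp add: grid_int_def dW_def)

end

section \<open>The Euler scheme\<close>

lemma matrix_family_bound:
  fixes A :: "nat \<Rightarrow> real^'n^'m"
  obtains K where "0 < K" "\<And>i v. i \<le> N \<Longrightarrow> norm (A i *v v) \<le> K * norm v"
proof -
  have "\<exists>K. \<forall>v. norm (A i *v v) \<le> norm v * K" for i
    using bounded_linear.bounded[OF matrix_vector_mul_bounded_linear] by auto
  then obtain k where k: "\<And>i v. norm (A i *v v) \<le> norm v * k i" by metis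
  show thesis
  proof (rule that)
    show "0 < 1 + (\<Sum>i\<le>N. \<bar>k i\<bar>)" by (simp add: add_pos_nonneg sum_nonneg)
    fix i v assume "i \<le> N"
    then have "\<bar>k i\<bar> \<le> (\<Sum>i\<le>N. \<bar>k i\<bar>)" by (intro member_le_sum) auto
    then have "k i \<le> 1 + (\<Sum>i\<le>N. \<bar>k i\<bar>)" by linarith
    then show "norm (A i *v v) \<le> (1 + (\<Sum>i\<le>N. \<bar>k i\<bar>)) * norm v"
      using k[of i v] by (smt (verit) mult.commute mult_left_mono norm_ge_zero)
  qed
qed

context independent_wiener_processes
begin

text \<open>Delays are counted in whole steps, so a delayed state is again a state of the scheme or
  a value of the initial function at a grid time; nothing has to be interpolated.\<close>

fun euler :: "(nat \<Rightarrow> real^'n^'n) \<Rightarrow> real \<Rightarrow> (nat \<Rightarrow> nat) \<Rightarrow> (real \<Rightarrow> 'a \<Rightarrow> real^'n) \<Rightarrow> nat \<Rightarrow> 'a \<Rightarrow> real^'n" where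
  "euler A \<delta> d \<phi> 0 \<omega> = \<phi> 0 \<omega>"
| "euler A \<delta> d \<phi> (Suc j) \<omega> = euler A \<delta> d \<phi> j \<omega> + \<delta> *\<^sub>R (A 0 *v euler A \<delta> d \<phi> j \<omega>) +
    (\<Sum>i\<in>{1..N}. dW i (real j * \<delta>) (real (Suc j) * \<delta>) \<omega> *\<^sub>R
      (A i *v (if d i \<le> j then euler A \<delta> d \<phi> (j - d i) \<omega> else \<phi> (- (real (d i - j) * \<delta>)) \<omega>)))"

text \<open>The inner term of \<open>euler\<close>, which is spelled out there because it contains
  the recursive call.\<close>

definition euler_delayed :: "(nat \<Rightarrow> real^'n^'n) \<Rightarrow> real \<Rightarrow> (nat \<Rightarrow> nat) \<Rightarrow> (real \<Rightarrow> 'a \<Rightarrow> real^'n) \<Rightarrow> nat \<Rightarrow> nat \<Rightarrow> 'a \<Rightarrow> real^'n" where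
  "euler_delayed A \<delta> d \<phi> i j \<omega> = (if d i \<le> j then euler A \<delta> d \<phi> (j - d i) \<omega> else \<phi> (- (real (d i - j) * \<delta>)) \<omega>)"

lemma euler_Suc:
  "euler A \<delta> d \<phi> (Suc j) \<omega> = (euler A \<delta> d \<phi> j \<omega> + \<delta> *\<^sub>R (A 0 *v euler A \<delta> d \<phi> j \<omega>)) +
    (\<Sum>i\<in>{1..N}. dW i (real j * \<delta>) (real (Suc j) * \<delta>) \<omega> *\<^sub>R (A i *v euler_delayed A \<delta> d \<phi> i j \<omega>))"
  by (simp add: euler_delayed_def)

lemma
  assumes \<phi>: "L2F 0 (\<phi> 0)" "\<And>i k. i \<in> {1..N} \<Longrightarrow> k \<le> d i \<Longrightarrow> L2F 0 (\<phi> (- (real k * \<delta>)))" and \<delta>: "0 \<le> \<delta>"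
  shows euler_L2F: "L2F (real j * \<delta>) (euler A \<delta> d \<phi> j)"
    and euler_delayed_L2F: "i \<in> {1..N} \<Longrightarrow> L2F (real j * \<delta>) (euler_delayed A \<delta> d \<phi> i j)"
proof -
  have del: "L2F (real j * \<delta>) (euler_delayed A \<delta> d \<phi> i j)"
    if "\<And>k. k \<le> j \<Longrightarrow> L2F (real k * \<delta>) (euler A \<delta> d \<phi> k)" "i \<in> {1..N}" for i j
  proof (cases "d i \<le> j")
    case True
    have "L2F (real j * \<delta>) (euler A \<delta> d \<phi> (j - d i))"
      by (rule L2F_mono[OF that(1)]) (use \<delta> in \<open>auto intro!: mult_right_mono\<close>)
    then show ?thesis using True by (simp add: euler_delayed_def[abs_def])
  next
    case False
    have "L2F (real j * \<delta>) (\<phi> (- (real (d i - j) * \<delta>)))"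
      by (rule L2F_mono[OF \<phi>(2)[OF that(2)]]) (use \<delta> in auto)
    then show ?thesis using False by (simp add: euler_delayed_def[abs_def])
  qed
  have main: "L2F (real j * \<delta>) (euler A \<delta> d \<phi> j)" for j
  proof (induction j rule: less_induct)
    case (less j)
    show ?case
    proof (cases j)
      case 0
      then show ?thesis using \<phi> by simp
    next
      case (Suc k)
      have k: "L2F (real k * \<delta>) (euler A \<delta> d \<phi> k)" using less Suc by simp
      show ?thesis unfolding Suc euler_Suc[abs_def]
      proof (rule one_step_L2F)
        show "L2F (real k * \<delta>) (\<lambda>\<omega>. euler A \<delta> d \<phi> k \<omega> + \<delta> *\<^sub>R (A 0 *v euler A \<delta> d \<phi> k \<omega>))"
          using k by (intro L2F_add L2F_scaleR L2F_matrix)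
        show "L2F (real k * \<delta>) (\<lambda>\<omega>. A i *v euler_delayed A \<delta> d \<phi> i k \<omega>)" if "i \<in> {1..N}" for i
          using less Suc that by (intro L2F_matrix del) auto
      qed (use \<delta> in \<open>auto simp: mult_right_mono\<close>)
    qed
  qed
  show "L2F (real j * \<delta>) (euler A \<delta> d \<phi> j)" by (rule main)
  show "L2F (real j * \<delta>) (euler_delayed A \<delta> d \<phi> i j)" if "i \<in> {1..N}" by (rule del[OF main that])
qed

text \<open>Pairing with \<open>u\<close> moves the matrices onto \<open>u\<close>. Identity and
  drift act on the same state and combine into the single vector
  \<open>u + \<delta> *\<^sub>R (u v* A 0)\<close>; the noise terms enter through their squares
  only.\<close>

lemma euler_second_moment:
  assumes \<phi>: "L2F 0 (\<phi> 0)" "\<And>i k. i \<in> {1..N} \<Longrightarrow> k \<le> d i \<Longrightarrow> L2F 0 (\<phi> (- (real k * \<delta>)))" and \<delta>: "0 \<le> \<delta>"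
  shows "expectation (\<lambda>\<omega>. (u \<bullet> euler A \<delta> d \<phi> (Suc j) \<omega>)\<^sup>2) =
    expectation (\<lambda>\<omega>. ((u + \<delta> *\<^sub>R (u v* A 0)) \<bullet> euler A \<delta> d \<phi> j \<omega>)\<^sup>2)
    + \<delta> * (\<Sum>i\<in>{1..N}. expectation (\<lambda>\<omega>. ((u v* A i) \<bullet> euler_delayed A \<delta> d \<phi> i j \<omega>)\<^sup>2))"
proof -
  let ?U = "\<lambda>\<omega>. (u + \<delta> *\<^sub>R (u v* A 0)) \<bullet> euler A \<delta> d \<phi> j \<omega>"
  let ?V = "\<lambda>i \<omega>. (u v* A i) \<bullet> euler_delayed A \<delta> d \<phi> i j \<omega>"
  have eq: "u \<bullet> euler A \<delta> d \<phi> (Suc j) \<omega> = ?U \<omega> + (\<Sum>i\<in>{1..N}. dW i (real j * \<delta>) (real (Suc j) * \<delta>) \<omega> *\<^sub>R ?V i \<omega>)" for \<omega>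
    unfolding euler_Suc by (simp add: inner_add_right inner_add_left inner_sum_right dot_lmul_matrix)
  have step: "real (Suc j) * \<delta> - real j * \<delta> = \<delta>" by (simp add: algebra_simps)
  have "expectation (\<lambda>\<omega>. (norm (?U \<omega> + (\<Sum>i\<in>{1..N}. dW i (real j * \<delta>) (real (Suc j) * \<delta>) \<omega> *\<^sub>R ?V i \<omega>)))\<^sup>2)
     = expectation (\<lambda>\<omega>. (norm (?U \<omega>))\<^sup>2) + (real (Suc j) * \<delta> - real j * \<delta>) * (\<Sum>i\<in>{1..N}. expectation (\<lambda>\<omega>. (norm (?V i \<omega>))\<^sup>2))"
    by (rule one_step_expectation)
      (use \<delta> in \<open>auto intro!: L2F_inner euler_L2F[OF \<phi> \<delta>] euler_delayed_L2F[OF \<phi> \<delta>] mult_right_mono\<close>)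
  then show ?thesis unfolding eq step by simp
qed

text \<open>State \<open>U\<close> and coefficient \<open>V\<close> are kept apart: between two
  nodes of a coarse grid the state moves along the fine grid while the coefficient stays frozen at
  the last coarse node.\<close>

definition estep :: "(nat \<Rightarrow> real^'n^'n) \<Rightarrow> real \<Rightarrow> real \<Rightarrow> ('a \<Rightarrow> real^'n) \<Rightarrow> ('a \<Rightarrow> real^'n) \<Rightarrow> 'a \<Rightarrow> real^'n" where
  "estep A s t U V \<omega> = (U \<omega> + (t - s) *\<^sub>R (A 0 *v V \<omega>)) + (\<Sum>i\<in>{1..N}. dW i s t \<omega> *\<^sub>R (A i *v V \<omega>))"

lemma estep_L2F: "L2F s U \<Longrightarrow> L2F s V \<Longrightarrow> s \<le> t \<Longrightarrow> L2F t (estep A s t U V)"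
  unfolding estep_def[abs_def] by (intro one_step_L2F L2F_add L2F_scaleR L2F_matrix) auto

text \<open>With a frozen coefficient the step is additive in time, so the coarse scheme can be
  observed at fine times without being changed.\<close>

lemma estep_trans: "estep A t r (estep A s t U V) V \<omega> = estep A s r U V \<omega>"
proof -
  have "dW i s r \<omega> = dW i s t \<omega> + dW i t r \<omega>" for i by (simp add: dW_def)
  then show ?thesis by (simp add: estep_def algebra_simps sum.distrib)
qed

lemma estep_diff:
  "estep A s t U V \<omega> - estep A s t U' V' \<omega> = estep A s t (\<lambda>\<omega>. U \<omega> - U' \<omega>) (\<lambda>\<omega>. V \<omega> - V' \<omega>) \<omega>"
  by (simp add: estep_def algebra_simps sum_subtractf matrix_vector_mult_diff_distrib)

lemma estep_refl: "estep A s s U V \<omega> = U \<omega>"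
  by (simp add: estep_def dW_def)

lemma estep_bound:
  assumes U: "L2F s U" and V: "L2F s V" and st: "s \<le> t" "t \<le> s + 1"
    and K: "\<And>i v. i \<le> N \<Longrightarrow> norm (A i *v v) \<le> K * norm v"
  shows "expectation (\<lambda>\<omega>. (norm (estep A s t U V \<omega>))\<^sup>2) \<le> (1 + (t - s)) * expectation (\<lambda>\<omega>. (norm (U \<omega>))\<^sup>2)
     + (t - s) * ((real N + 2) * K\<^sup>2 * expectation (\<lambda>\<omega>. (norm (V \<omega>))\<^sup>2))"
proof (cases "s = t")
  case True
  then show ?thesis by (simp add: estep_refl)
next
  case False
  define h where "h = t - s"
  have h: "0 < h" "h \<le> 1" using False st by (auto simp: h_def)
  let ?u = "expectation (\<lambda>\<omega>. (norm (U \<omega>))\<^sup>2)" and ?v = "expectation (\<lambda>\<omega>. (norm (V \<omega>))\<^sup>2)"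
  have Ai: "(norm (A i *v v))\<^sup>2 \<le> K\<^sup>2 * (norm v)\<^sup>2" if "i \<le> N" for i v
    using K[OF that, of v] by (simp add: power_mult_distrib[symmetric] power_mono)
  have "expectation (\<lambda>\<omega>. (norm (estep A s t U V \<omega>))\<^sup>2)
      = expectation (\<lambda>\<omega>. (norm (U \<omega> + h *\<^sub>R (A 0 *v V \<omega>)))\<^sup>2)
        + h * (\<Sum>i\<in>{1..N}. expectation (\<lambda>\<omega>. (norm (A i *v V \<omega>))\<^sup>2))"
    unfolding estep_def h_def using U V st by (intro one_step_expectation L2F_add L2F_scaleR L2F_matrix) auto
  also have "expectation (\<lambda>\<omega>. (norm (U \<omega> + h *\<^sub>R (A 0 *v V \<omega>)))\<^sup>2)
      \<le> expectation (\<lambda>\<omega>. (1 + h) * (norm (U \<omega>))\<^sup>2 + 2 * h * K\<^sup>2 * (norm (V \<omega>))\<^sup>2)"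
  proof (rule integral_mono)
    show "integrable M (\<lambda>\<omega>. (norm (U \<omega> + h *\<^sub>R (A 0 *v V \<omega>)))\<^sup>2)"
      by (rule L2F_integrable[of s]) (use U V in \<open>intro L2F_add L2F_scaleR L2F_matrix\<close>)
    show "integrable M (\<lambda>\<omega>. (1 + h) * (norm (U \<omega>))\<^sup>2 + 2 * h * K\<^sup>2 * (norm (V \<omega>))\<^sup>2)"
      using L2F_integrable[OF U] L2F_integrable[OF V] by simp
    fix \<omega>
    \<comment> \<open>Young's weight is the step length: the remaining coefficient
      \<open>(1 + 1 / h) * h\<^sup>2\<close> is \<open>h\<^sup>2 + h\<close>, at most
      \<open>2 * h\<close>. These two units and one per noise make up the \<open>N + 2\<close> of
      the statement.\<close>
    have "(norm (U \<omega> + h *\<^sub>R (A 0 *v V \<omega>)))\<^sup>2 \<le> (1 + h) * (norm (U \<omega>))\<^sup>2 + (1 + 1 / h) * (norm (h *\<^sub>R (A 0 *v V \<omega>)))\<^sup>2"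
      using norm_add_square_le h by blast
    also have "(1 + 1 / h) * (norm (h *\<^sub>R (A 0 *v V \<omega>)))\<^sup>2 = (h\<^sup>2 + h) * (norm (A 0 *v V \<omega>))\<^sup>2"
      using h by (simp add: power_mult_distrib power2_eq_square field_simps)
    also have "\<dots> \<le> (2 * h) * (K\<^sup>2 * (norm (V \<omega>))\<^sup>2)"
    proof (rule mult_mono)
      show "h\<^sup>2 + h \<le> 2 * h" using h by (simp add: power2_eq_square mult_left_le_one_le)
    qed (use Ai[of 0] h in auto)
    finally show "(norm (U \<omega> + h *\<^sub>R (A 0 *v V \<omega>)))\<^sup>2 \<le> (1 + h) * (norm (U \<omega>))\<^sup>2 + 2 * h * K\<^sup>2 * (norm (V \<omega>))\<^sup>2"
      by (simp add: mult_ac)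
  qed
  also have "\<dots> = (1 + h) * ?u + 2 * h * K\<^sup>2 * ?v"
    using L2F_integrable[OF U] L2F_integrable[OF V] by simp
  finally have main: "expectation (\<lambda>\<omega>. (norm (estep A s t U V \<omega>))\<^sup>2) \<le> (1 + h) * ?u + 2 * h * K\<^sup>2 * ?v
      + h * (\<Sum>i\<in>{1..N}. expectation (\<lambda>\<omega>. (norm (A i *v V \<omega>))\<^sup>2))" by simp
  have "(\<Sum>i\<in>{1..N}. expectation (\<lambda>\<omega>. (norm (A i *v V \<omega>))\<^sup>2)) \<le> (\<Sum>i\<in>{1..N}. K\<^sup>2 * ?v)"
  proof (rule sum_mono)
    fix i assume i: "i \<in> {1..N}"
    have "expectation (\<lambda>\<omega>. (norm (A i *v V \<omega>))\<^sup>2) \<le> expectation (\<lambda>\<omega>. K\<^sup>2 * (norm (V \<omega>))\<^sup>2)"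
      using L2F_integrable[OF V] L2F_integrable[OF L2F_matrix[OF V]] Ai i by (intro integral_mono) auto
    then show "expectation (\<lambda>\<omega>. (norm (A i *v V \<omega>))\<^sup>2) \<le> K\<^sup>2 * ?v" using L2F_integrable[OF V] by simp
  qed
  then have "h * (\<Sum>i\<in>{1..N}. expectation (\<lambda>\<omega>. (norm (A i *v V \<omega>))\<^sup>2)) \<le> h * (real N * (K\<^sup>2 * ?v))"
    using h by (intro mult_left_mono) auto
  then show ?thesis using main unfolding h_def[symmetric] by (simp add: algebra_simps)
qed

abbreviation euler0 :: "(nat \<Rightarrow> real^'n^'n) \<Rightarrow> real^'n \<Rightarrow> real \<Rightarrow> nat \<Rightarrow> 'a \<Rightarrow> real^'n" where
  "euler0 A v \<delta> \<equiv> euler A \<delta> (\<lambda>_. 0) (\<lambda>_ _. v)"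

lemma euler0_L2F: "0 \<le> \<delta> \<Longrightarrow> L2F (real j * \<delta>) (euler0 A v \<delta> j)"
  by (intro euler_L2F L2F_const) auto

lemma euler0_Suc: "euler0 A v \<delta> (Suc j) = estep A (real j * \<delta>) (real (Suc j) * \<delta>) (euler0 A v \<delta> j) (euler0 A v \<delta> j)"
  by (rule ext) (simp add: estep_def algebra_simps)

lemma euler0_bound:
  assumes K: "\<And>i v. i \<le> N \<Longrightarrow> norm (A i *v v) \<le> K * norm v" and \<delta>: "0 \<le> \<delta>" "\<delta> \<le> 1" and T: "real j * \<delta> \<le> T"
  shows "expectation (\<lambda>\<omega>. (norm (euler0 A v \<delta> j \<omega>))\<^sup>2) \<le> (norm v)\<^sup>2 * exp ((1 + (real N + 2) * K\<^sup>2) * T)"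
proof -
  let ?a = "1 + (real N + 2) * K\<^sup>2"
  have "expectation (\<lambda>\<omega>. (norm (euler0 A v \<delta> j \<omega>))\<^sup>2) \<le> (norm v)\<^sup>2 * (1 + ?a * \<delta>) ^ j"
  proof (induction j)
    case (Suc j)
    let ?e = "expectation (\<lambda>\<omega>. (norm (euler0 A v \<delta> j \<omega>))\<^sup>2)"
    have d: "real (Suc j) * \<delta> - real j * \<delta> = \<delta>" by (simp add: algebra_simps)
    have "expectation (\<lambda>\<omega>. (norm (euler0 A v \<delta> (Suc j) \<omega>))\<^sup>2) \<le> (1 + (real (Suc j) * \<delta> - real j * \<delta>)) * ?e
       + (real (Suc j) * \<delta> - real j * \<delta>) * ((real N + 2) * K\<^sup>2 * ?e)"
      unfolding euler0_Suc by (rule estep_bound[OF euler0_L2F[OF \<delta>(1)] euler0_L2F[OF \<delta>(1)] _ _ K]) (use \<delta> in \<open>auto simp: algebra_simps\<close>)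
    also have "\<dots> = (1 + ?a * \<delta>) * ?e" unfolding d by (simp add: algebra_simps)
    also have "\<dots> \<le> (1 + ?a * \<delta>) * ((norm v)\<^sup>2 * (1 + ?a * \<delta>) ^ j)"
      using Suc \<delta> by (intro mult_left_mono) auto
    finally show ?case by (simp add: mult_ac)
  qed (simp add: prob_space)
  also have "\<dots> \<le> (norm v)\<^sup>2 * exp (?a * T)"
    using power_le_exp_mult[of ?a j \<delta> T] \<delta> T by (intro mult_left_mono) auto
  finally show ?thesis .
qed

text \<open>The two schemes are compared through \<open>Z\<close>, the coarse scheme observed at the
  fine times. \<open>X - Z\<close> starts at zero and is driven by \<open>X - Y\<close>;
  \<open>Z - Y\<close> is at most one partial coarse step and hence of order
  \<open>r * \<delta>\<close> in second moment; the recursive Gronwall inequality closes the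
  circle.\<close>

lemma euler0_refine:
  fixes A :: "nat \<Rightarrow> real^'n^'n"
  assumes K: "\<And>i v. i \<le> N \<Longrightarrow> norm (A i *v v) \<le> K * norm v"
  obtains C where "0 < C" "\<And>\<delta> r j. 0 < \<delta> \<Longrightarrow> 0 < r \<Longrightarrow> real r * \<delta> \<le> 1 \<Longrightarrow> real j * \<delta> \<le> T \<Longrightarrow>
    expectation (\<lambda>\<omega>. (norm (euler0 A v \<delta> j \<omega> - euler0 A v (real r * \<delta>) (j div r) \<omega>))\<^sup>2) \<le> C * (real r * \<delta>)"
proof -
  define c where "c = (real N + 2) * K\<^sup>2"
  define B where "B = (norm v)\<^sup>2 * exp ((1 + c) * T)"
  \<comment> \<open>The middle summand bounds \<open>X - Z\<close>, the last one
    \<open>Z - Y\<close>.\<close>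
  define C where "C = 1 + 2 * (T * (2 * c * (c * B)) * exp ((1 + 2 * c) * T)) + 2 * (c * B)"
  have c0: "0 \<le> c" by (simp add: c_def)
  have B0: "0 \<le> B" by (simp add: B_def)
  \<comment> \<open>\<open>T\<close> has no sign assumption and \<open>C\<close> may be negative for
    \<open>T < 0\<close>, hence \<open>\<bar>C\<bar> + 1\<close>.\<close>
  have "expectation (\<lambda>\<omega>. (norm (euler0 A v \<delta> j \<omega> - euler0 A v (real r * \<delta>) (j div r) \<omega>))\<^sup>2) \<le> (\<bar>C\<bar> + 1) * (real r * \<delta>)"
    if \<delta>: "0 < \<delta>" and r: "0 < r" and rd: "real r * \<delta> \<le> 1" and T: "real j * \<delta> \<le> T" for \<delta> r j
  proof -
    let ?D = "real r * \<delta>"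
    let ?X = "euler0 A v \<delta>" and ?Y = "\<lambda>j. euler0 A v ?D (j div r)"
    have \<delta>1: "\<delta> \<le> 1"
    proof -
      have "1 * \<delta> \<le> real r * \<delta>" using r \<delta> by (intro mult_right_mono) auto
      then show ?thesis using rd by simp
    qed
    define Z where "Z j = estep A (real (j div r) * ?D) (real j * \<delta>) (?Y j) (?Y j)" for j
    have qle: "real (j div r) * ?D \<le> real j * \<delta>" for j
    proof -
      have "real (j div r * r) \<le> real j" by (subst of_nat_le_iff) simp
      then have "real (j div r) * real r * \<delta> \<le> real j * \<delta>" using \<delta> by (intro mult_right_mono) auto
      then show ?thesis by (simp add: mult_ac)
    qed
    have qge: "real j * \<delta> \<le> real (j div r) * ?D + ?D" for j
    proof -
      have "j \<le> (j div r + 1) * r" using dividend_less_times_div[OF r, of j] by (simp add: algebra_simps)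
      then have "real j \<le> (real (j div r) + 1) * real r" by (metis of_nat_1 of_nat_add of_nat_le_iff of_nat_mult)
      then have "real j * \<delta> \<le> (real (j div r) + 1) * real r * \<delta>" using \<delta> by (intro mult_right_mono) auto
      then show ?thesis by (simp add: algebra_simps)
    qed
    have Y: "L2F (real (j div r) * ?D) (?Y j)" for j using \<delta> by (intro euler0_L2F) auto
    then have Y': "L2F (real j * \<delta>) (?Y j)" for j using L2F_mono qle by blast
    have X: "L2F (real j * \<delta>) (?X j)" for j using \<delta> by (intro euler0_L2F) auto
    have Z: "L2F (real j * \<delta>) (Z j)" for j unfolding Z_def using Y qle by (intro estep_L2F) auto
    \<comment> \<open>Either the fine step stays in the current coarse cell and
      \<open>estep_trans\<close> applies, or it ends exactly at the next coarse node, where the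
      completed step is the new coarse state and \<open>Z\<close> restarts from it.\<close>
    have ZSuc: "Z (Suc j) = estep A (real j * \<delta>) (real (Suc j) * \<delta>) (Z j) (?Y j)" for j
    proof (cases "Suc j div r = j div r")
      case True
      show ?thesis unfolding Z_def True by (rule ext) (rule estep_trans[symmetric])
    next
      case False
      have m: "Suc j mod r = 0" and q: "Suc j div r = Suc (j div r)"
        using False div_Suc[of j r] by (auto split: if_splits)
      have "Suc j = Suc (j div r) * r" using div_mult_mod_eq[of "Suc j" r] m q by simp
      then have "real (Suc j) = real (Suc (j div r)) * real r" by (metis of_nat_mult)
      then have t: "real (Suc j) * \<delta> = real (Suc (j div r)) * ?D" by simp
      have "Z (Suc j) = ?Y (Suc j)" unfolding Z_def t q by (rule ext) (rule estep_refl)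
      also have "\<dots> = estep A (real (j div r) * ?D) (real (Suc j) * \<delta>) (?Y j) (?Y j)"
        unfolding q t by (rule euler0_Suc)
      also have "\<dots> = estep A (real j * \<delta>) (real (Suc j) * \<delta>) (Z j) (?Y j)"
        unfolding Z_def by (rule ext) (rule estep_trans[symmetric])
      finally show ?thesis .
    qed
    have Yb: "expectation (\<lambda>\<omega>. (norm (?Y j \<omega>))\<^sup>2) \<le> B" if "real j * \<delta> \<le> T" for j
      unfolding B_def c_def by (rule euler0_bound[OF K _ rd order_trans[OF qle that]]) (use \<delta> in auto)
    have ZY: "expectation (\<lambda>\<omega>. (norm (Z j \<omega> - ?Y j \<omega>))\<^sup>2) \<le> ?D * (c * B)" if "real j * \<delta> \<le> T" for j
    proof -
      have t1: "real j * \<delta> \<le> real (j div r) * ?D + 1" using qge[of j] rd by linarith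
      have nn: "0 \<le> real (j div r) * ?D" using \<delta> by simp
      \<comment> \<open>The common state cancels, so the difference is a partial step out of
        zero.\<close>
      have eq: "Z j \<omega> - ?Y j \<omega> = estep A (real (j div r) * ?D) (real j * \<delta>) (\<lambda>_. 0) (?Y j) \<omega>" for \<omega>
        by (simp add: Z_def estep_def)
      have "expectation (\<lambda>\<omega>. (norm (Z j \<omega> - ?Y j \<omega>))\<^sup>2)
          \<le> (1 + (real j * \<delta> - real (j div r) * ?D)) * expectation (\<lambda>\<omega>. (norm (0 :: real^'n))\<^sup>2)
          + (real j * \<delta> - real (j div r) * ?D) * ((real N + 2) * K\<^sup>2 * expectation (\<lambda>\<omega>. (norm (?Y j \<omega>))\<^sup>2))"
        unfolding eq by (rule estep_bound[OF L2F_const[OF nn] Y qle t1 K])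
      also have "\<dots> = (real j * \<delta> - real (j div r) * ?D) * (c * expectation (\<lambda>\<omega>. (norm (?Y j \<omega>))\<^sup>2))"
        by (simp add: c_def)
      also have "\<dots> \<le> ?D * (c * B)"
        using qge[of j] Yb[OF that] \<delta> c0 by (intro mult_mono) auto
      finally show ?thesis .
    qed
    define e where "e j = expectation (\<lambda>\<omega>. (norm (?X j \<omega> - Z j \<omega>))\<^sup>2)" for j
    have dXY: "expectation (\<lambda>\<omega>. (norm (?X j \<omega> - ?Y j \<omega>))\<^sup>2) \<le> 2 * e j + 2 * (?D * (c * B))" if "real j * \<delta> \<le> T" for j
    proof -
      have "expectation (\<lambda>\<omega>. (norm (?X j \<omega> - ?Y j \<omega>))\<^sup>2)
          \<le> expectation (\<lambda>\<omega>. 2 * (norm (?X j \<omega> - Z j \<omega>))\<^sup>2 + 2 * (norm (Z j \<omega> - ?Y j \<omega>))\<^sup>2)"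
      proof (rule integral_mono)
        show "integrable M (\<lambda>\<omega>. (norm (?X j \<omega> - ?Y j \<omega>))\<^sup>2)" using L2F_integrable[OF L2F_diff[OF X Y']] .
        show "integrable M (\<lambda>\<omega>. 2 * (norm (?X j \<omega> - Z j \<omega>))\<^sup>2 + 2 * (norm (Z j \<omega> - ?Y j \<omega>))\<^sup>2)"
          using L2F_integrable[OF L2F_diff[OF X Z]] L2F_integrable[OF L2F_diff[OF Z Y']] by simp
        show "(norm (?X j \<omega> - ?Y j \<omega>))\<^sup>2 \<le> 2 * (norm (?X j \<omega> - Z j \<omega>))\<^sup>2 + 2 * (norm (Z j \<omega> - ?Y j \<omega>))\<^sup>2" for \<omega>
          using norm_add_square_le_double[of "?X j \<omega> - Z j \<omega>" "Z j \<omega> - ?Y j \<omega>"] by simp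
      qed
      also have "\<dots> = 2 * e j + 2 * expectation (\<lambda>\<omega>. (norm (Z j \<omega> - ?Y j \<omega>))\<^sup>2)"
        using L2F_integrable[OF L2F_diff[OF X Z]] L2F_integrable[OF L2F_diff[OF Z Y']] by (simp add: e_def)
      finally show ?thesis using ZY[OF that] by simp
    qed
    have rec: "e (Suc k) \<le> (1 + (1 + 2 * c) * \<delta>) * e k + \<delta> * (2 * c * (?D * (c * B)))" if "k < j" for k
    proof -
      have kT: "real k * \<delta> \<le> T"
      proof -
        have "real k * \<delta> \<le> real j * \<delta>" using that \<delta> by (intro mult_right_mono) auto
        then show ?thesis using T by simp
      qed
      have d: "real (Suc k) * \<delta> - real k * \<delta> = \<delta>" by (simp add: algebra_simps)
      have "e (Suc k) = expectation (\<lambda>\<omega>. (norm (estep A (real k * \<delta>) (real (Suc k) * \<delta>) (\<lambda>\<omega>. ?X k \<omega> - Z k \<omega>) (\<lambda>\<omega>. ?X k \<omega> - ?Y k \<omega>) \<omega>))\<^sup>2)"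
        unfolding e_def euler0_Suc ZSuc estep_diff ..
      also have "\<dots> \<le> (1 + (real (Suc k) * \<delta> - real k * \<delta>)) * expectation (\<lambda>\<omega>. (norm (?X k \<omega> - Z k \<omega>))\<^sup>2)
          + (real (Suc k) * \<delta> - real k * \<delta>) * ((real N + 2) * K\<^sup>2 * expectation (\<lambda>\<omega>. (norm (?X k \<omega> - ?Y k \<omega>))\<^sup>2))"
        by (rule estep_bound[OF L2F_diff[OF X Z] L2F_diff[OF X Y'] _ _ K]) (use \<delta> \<delta>1 in \<open>auto simp: algebra_simps\<close>)
      also have "\<dots> = (1 + \<delta>) * e k + \<delta> * (c * expectation (\<lambda>\<omega>. (norm (?X k \<omega> - ?Y k \<omega>))\<^sup>2))"
        unfolding d by (simp add: e_def c_def)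
      also have "\<dots> \<le> (1 + \<delta>) * e k + \<delta> * (c * (2 * e k + 2 * (?D * (c * B))))"
        using dXY[OF kT] \<delta> c0 by (intro add_left_mono mult_left_mono) auto
      finally show ?thesis by (simp add: algebra_simps)
    qed
    have "e 0 = 0" by (simp add: e_def Z_def estep_refl)
    then have "e j \<le> real j * (\<delta> * (2 * c * (?D * (c * B)))) * (1 + (1 + 2 * c) * \<delta>) ^ j"
      using \<delta> c0 B0 by (intro discrete_gronwall_recursive[where n=j] rec) auto
    also have "\<dots> = (real j * \<delta>) * (2 * c * (c * B) * ?D) * (1 + (1 + 2 * c) * \<delta>) ^ j" by (simp add: mult_ac)
    also have "\<dots> \<le> T * (2 * c * (c * B) * ?D) * exp ((1 + 2 * c) * T)"
      using T \<delta> c0 B0 power_le_exp_mult[of "1 + 2 * c" j \<delta> T] order_trans[OF _ T, of 0]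
      by (intro mult_mono) auto
    finally have ej: "e j \<le> T * (2 * c * (c * B)) * exp ((1 + 2 * c) * T) * ?D" by (simp add: mult_ac)
    have "expectation (\<lambda>\<omega>. (norm (?X j \<omega> - ?Y j \<omega>))\<^sup>2) \<le> 2 * e j + 2 * (?D * (c * B))" by (rule dXY[OF T])
    also have "\<dots> \<le> C * ?D"
    proof -
      have "C * ?D = ?D + 2 * (T * (2 * c * (c * B)) * exp ((1 + 2 * c) * T) * ?D) + 2 * (?D * (c * B))"
        by (simp add: C_def algebra_simps)
      moreover have "0 \<le> ?D" using \<delta> by simp
      ultimately show ?thesis using ej by linarith
    qed
    also have "\<dots> \<le> (\<bar>C\<bar> + 1) * ?D" using \<delta> by (intro mult_right_mono) auto
    finally show ?thesis .
  qed
  then show thesis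
    by (intro that[of "\<bar>C\<bar> + 1"]) auto
qed

end

section \<open>Measurability and convergence of simple integrals\<close>

text \<open>Tonelli measurability in the form that fits progressive measurability, where the time
  factor is the restricted interval \<open>{0..T}\<close>.\<close>

lemma borel_measurable_set_nn_integral_snd:
  fixes f :: "real \<Rightarrow> 'a \<Rightarrow> ennreal"
  assumes "(\<lambda>(s, \<omega>). f s \<omega>) \<in> borel_measurable (restrict_space borel {0..T} \<Otimes>\<^sub>M M)"
  shows "(\<lambda>\<omega>. \<integral>\<^sup>+s\<in>{0..T}. f s \<omega> \<partial>lborel) \<in> borel_measurable M"
proof -
  let ?R = "restrict_space lborel {0..T}"
  interpret sigma_finite_measure ?R
    by (rule sigma_finite_measure_restrict_space) (auto intro: lborel.sigma_finite_measure_axioms)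
  have "sets ?R = sets (restrict_space borel {0..T})" by (rule sets_restrict_space_cong) simp
  then have "sets (?R \<Otimes>\<^sub>M M) = sets (restrict_space borel {0..T} \<Otimes>\<^sub>M M)" by (rule sets_pair_measure_cong) simp
  then have "(\<lambda>(s, \<omega>). f s \<omega>) \<in> borel_measurable (?R \<Otimes>\<^sub>M M)"
    using assms measurable_cong_sets[OF _ refl] by blast
  from measurable_pair_swap[OF this] have "(\<lambda>(\<omega>, s). f s \<omega>) \<in> borel_measurable (M \<Otimes>\<^sub>M ?R)"
    by (simp add: case_prod_beta')
  then have "(\<lambda>\<omega>. \<integral>\<^sup>+s. f s \<omega> \<partial>?R) \<in> borel_measurable M"
    by (intro borel_measurable_nn_integral) simp
  then show ?thesis by (simp add: nn_integral_restrict_space)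
qed

text \<open>Every \<open>t\<close> is the limit of its dyadic floors, which stay in the interval.
  Only levels from \<open>lmin\<close> on are assumed, because two Euler integrals share a grid
  formula only on levels at least as fine as both.\<close>

lemma continuous_on_bound_dyadic:
  fixes f :: "real \<Rightarrow> 'b::real_normed_vector"
  assumes cont: "continuous_on {0..real K} f"
    and bound: "\<And>l q. lmin \<le> l \<Longrightarrow> q \<le> K * 2 ^ l \<Longrightarrow> norm (f (real q / 2 ^ l)) \<le> c"
    and t: "t \<in> {0..real K}"
  shows "norm (f t) \<le> c"
proof -
  define g where "g l = real (nat \<lfloor>t * 2 ^ l\<rfloor>) / 2 ^ l" for l :: nat
  have g: "t - (1/2) ^ l \<le> g l" "g l \<le> t" "0 \<le> g l" for l
  proof -
    have nn: "0 \<le> t * 2 ^ l" using t by simp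
    then have e: "real (nat \<lfloor>t * 2 ^ l\<rfloor>) = of_int \<lfloor>t * 2 ^ l\<rfloor>" by simp
    have "t * 2 ^ l - 1 \<le> of_int \<lfloor>t * 2 ^ l\<rfloor>" "of_int \<lfloor>t * 2 ^ l\<rfloor> \<le> t * 2 ^ l" by linarith+
    then have "(t * 2 ^ l - 1) / 2 ^ l \<le> g l" "g l \<le> (t * 2 ^ l) / 2 ^ l"
      unfolding g_def e by (intro divide_right_mono; simp)+
    then show "t - (1/2) ^ l \<le> g l" "g l \<le> t" by (simp_all add: diff_divide_distrib power_divide)
    show "0 \<le> g l" by (simp add: g_def)
  qed
  have "g \<longlonglongrightarrow> t"
  proof (rule tendsto_sandwich[of "\<lambda>l. t - (1/2) ^ l" _ _ "\<lambda>_. t"])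
    have "(\<lambda>l. t - (1/2) ^ l) \<longlonglongrightarrow> t - 0" by (intro tendsto_diff tendsto_const LIMSEQ_power_zero) auto
    then show "(\<lambda>l. t - (1/2) ^ l) \<longlonglongrightarrow> t" by simp
  qed (use g in auto)
  then have "(\<lambda>l. f (g l)) \<longlonglongrightarrow> f t"
    by (rule continuous_on_tendsto_compose[OF cont]) (use g(3) t in \<open>auto intro!: always_eventually order_trans[OF g(2)]\<close>)
  then have lim: "(\<lambda>l. norm (f (g l))) \<longlonglongrightarrow> norm (f t)" by (rule tendsto_norm)
  have "norm (f (g l)) \<le> c" if "lmin \<le> l" for l
    unfolding g_def
  proof (rule bound[OF that])
    have "t * 2 ^ l \<le> real (K * 2 ^ l)" using t by simp
    then have "\<lfloor>t * 2 ^ l\<rfloor> \<le> int (K * 2 ^ l)" by (metis floor_mono floor_of_nat)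
    then show "nat \<lfloor>t * 2 ^ l\<rfloor> \<le> K * 2 ^ l" by (simp only: nat_le_iff)
  qed
  then show ?thesis by (intro LIMSEQ_le_const2[OF lim]) auto
qed

lemma simple_value_linear:
  assumes "linear L"
  shows "simple_value m \<tau> (\<lambda>j \<omega>. L (\<xi> j \<omega>)) s \<omega> = L (simple_value m \<tau> \<xi> s \<omega>)"
  by (simp only: simple_value_def linear_sum[OF assms] linear_cmul[OF assms])

lemma simple_integral_continuous:
  assumes "continuous_on {0..} (\<lambda>t. B t \<omega>)" and "\<And>j. j \<le> m \<Longrightarrow> 0 \<le> \<tau> j"
  shows "continuous_on {0..} (\<lambda>t. simple_integral B m \<tau> \<xi> t \<omega>)"
proof -
  have c: "continuous_on {0..} (\<lambda>t. B (min t (\<tau> j)) \<omega>)" if "j \<le> m" for j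
    by (rule continuous_on_compose2[OF assms(1)]) (use assms(2)[OF that] in \<open>auto intro!: continuous_intros\<close>)
  show ?thesis unfolding simple_integral_def
    by (intro continuous_intros c) auto
qed

lemma simple_value_eq_single:
  assumes "\<And>j. j < m \<Longrightarrow> \<tau> j \<le> \<tau> (Suc j)" and q: "q < m" "\<tau> q < s" "s \<le> \<tau> (Suc q)"
  shows "simple_value m \<tau> \<xi> s \<omega> = \<xi> q \<omega>"
proof -
  have mono: "\<tau> a \<le> \<tau> b" if "a \<le> b" "b \<le> m" for a b
    using that by (induction b) (auto simp: le_Suc_eq intro: order_trans[OF _ assms(1)])
  have "indicator {\<tau> j<..\<tau> (Suc j)} s *\<^sub>R \<xi> j \<omega> = (if j = q then \<xi> q \<omega> else 0)" if "j < m" for j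
  proof (cases j q rule: linorder_cases)
    case less
    then have "\<tau> (Suc j) < s" using mono[of "Suc j" q] q by auto
    then show ?thesis using less by (auto simp: indicator_def)
  next
    case greater
    then have "s \<le> \<tau> j" using mono[of "Suc q" j] q that by auto
    then show ?thesis using greater by (auto simp: indicator_def)
  qed (use q in \<open>auto simp: indicator_def\<close>)
  then have "simple_value m \<tau> \<xi> s \<omega> = (\<Sum>j<m. if j = q then \<xi> q \<omega> else 0)"
    unfolding simple_value_def by (intro sum.cong refl) auto
  then show ?thesis using q by simp
qed

text \<open>Lets drift integrals be treated as simple integrals against time itself. A left-open
  interval differs from a closed one in a single point.\<close>

lemma simple_value_has_integral:
  assumes "\<And>j. j < m \<Longrightarrow> \<tau> j \<le> \<tau> (Suc j)" "0 \<le> \<tau> 0" "0 \<le> t"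
  shows "((\<lambda>s. simple_value m \<tau> \<xi> s \<omega>) has_integral simple_integral (\<lambda>t _. t) m \<tau> \<xi> t \<omega>) {0..t}"
proof -
  have mono: "\<tau> a \<le> \<tau> b" if "a \<le> b" "b \<le> m" for a b
    using that by (induction b) (auto simp: le_Suc_eq intro: order_trans[OF _ assms(1)])
  have one: "((\<lambda>s. indicator {\<tau> j<..\<tau> (Suc j)} s *\<^sub>R \<xi> j \<omega>) has_integral
      (min t (\<tau> (Suc j)) - min t (\<tau> j)) *\<^sub>R \<xi> j \<omega>) {0..t}" if j: "j < m" for j
  proof -
    let ?a = "min t (\<tau> j)" and ?b = "min t (\<tau> (Suc j))"
    have ab: "?a \<le> ?b" using assms(1)[OF j] by auto
    have a0: "0 \<le> \<tau> j" using mono[of 0 j] j assms(2) by auto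
    have "((\<lambda>s. \<xi> j \<omega>) has_integral (?b - ?a) *\<^sub>R \<xi> j \<omega>) {?a..?b}"
      using has_integral_const_real[of "\<xi> j \<omega>" ?a ?b] ab by simp
    then have "((\<lambda>s. if s \<in> {?a..?b} then \<xi> j \<omega> else 0) has_integral (?b - ?a) *\<^sub>R \<xi> j \<omega>) {0..t}"
      by (subst has_integral_restrict) (use a0 assms(3) in auto)
    then show ?thesis
      by (rule has_integral_spike_finite[rotated 2, where S="{?a}"])
        (use assms(1)[OF j] in \<open>auto simp: indicator_def\<close>)
  qed
  show ?thesis unfolding simple_value_def simple_integral_def
    by (rule has_integral_sum) (use one in auto)
qed

section \<open>Progressive measurability of step processes\<close>

context usual_filtered_prob_space
begin

lemma steps_nonneg:
  assumes "\<And>j. j < m \<Longrightarrow> \<tau> j \<le> \<tau> (Suc j)" "0 \<le> \<tau> 0" "j \<le> m"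
  shows "0 \<le> (\<tau> j :: real)"
  using assms(3) by (induction j) (auto simp: assms(2) Suc_le_eq intro: order_trans[OF _ assms(1)])

lemma simple_value_progressive:
  assumes \<tau>: "\<And>j. j < m \<Longrightarrow> \<tau> j \<le> \<tau> (Suc j)" "0 \<le> \<tau> 0"
    and \<xi>: "\<And>j. j < m \<Longrightarrow> \<xi> j \<in> borel_measurable (F (\<tau> j))"
  shows "progressively_measurable F (simple_value m \<tau> \<xi>)"
  unfolding progressively_measurable_def
proof (intro allI impI)
  fix T :: real assume T: "0 \<le> T"
  have "(\<lambda>x. indicator {\<tau> j<..\<tau> (Suc j)} (fst x) *\<^sub>R \<xi> j (snd x)) \<in> borel_measurable (restrict_space borel {0..T} \<Otimes>\<^sub>M F T)"
    if j: "j < m" for j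
  \<comment> \<open>If the interval begins after \<open>T\<close>, the coefficient may be unknown at
    time \<open>T\<close>, but its indicator vanishes on \<open>{0..T}\<close>.\<close>
  proof (cases "\<tau> j \<le> T")
    case True
    have [measurable]: "\<xi> j \<in> borel_measurable (F T)"
      using measurable_F_mono[OF \<xi>[OF j] steps_nonneg[OF \<tau>, of m j] True] j by auto
    have [measurable]: "(indicator {\<tau> j<..\<tau> (Suc j)} :: real \<Rightarrow> real) \<in> borel_measurable (restrict_space borel {0..T})"
      by (rule measurable_restrict_space1) simp
    show ?thesis by measurable
  next
    case False
    have "(\<lambda>_. 0) \<in> borel_measurable (restrict_space borel {0..T} \<Otimes>\<^sub>M F T)" by simp
    then show ?thesis
      by (rule measurable_cong[THEN iffD1, rotated])
        (use False in \<open>auto simp: space_pair_measure indicator_def\<close>)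
  qed
  then have "(\<lambda>x. \<Sum>j<m. indicator {\<tau> j<..\<tau> (Suc j)} (fst x) *\<^sub>R \<xi> j (snd x)) \<in> borel_measurable (restrict_space borel {0..T} \<Otimes>\<^sub>M F T)"
    by (intro borel_measurable_sum) auto
  then show "(\<lambda>(s, \<omega>). simple_value m \<tau> \<xi> s \<omega>) \<in> borel_measurable (restrict_space borel {0..T} \<Otimes>\<^sub>M F T)"
    by (simp add: simple_value_def[abs_def] case_prod_beta' )
qed

lemma progressive_M:
  assumes "progressively_measurable F X" "0 \<le> T"
  shows "(\<lambda>(s, \<omega>). X s \<omega>) \<in> borel_measurable (restrict_space borel {0..T} \<Otimes>\<^sub>M M)"
proof -
  let ?R = "restrict_space borel {0..T}"
  have "(\<lambda>x. x) \<in> measurable M (F T)"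
    using measurable_from_subalg[OF subalg[OF assms(2)] measurable_ident_sets[OF refl]] .
  then have "(\<lambda>x. snd x) \<in> measurable (?R \<Otimes>\<^sub>M M) (F T)" by (rule measurable_compose[OF measurable_snd])
  from measurable_Pair[OF measurable_fst this]
  have id: "(\<lambda>x. (fst x, snd x)) \<in> measurable (?R \<Otimes>\<^sub>M M) (?R \<Otimes>\<^sub>M F T)" .
  have "(\<lambda>(s, \<omega>). X s \<omega>) \<in> borel_measurable (?R \<Otimes>\<^sub>M F T)"
    using assms by (simp add: progressively_measurable_def)
  from measurable_compose[OF id this] show ?thesis by simp
qed

lemma progressive_adapted:
  assumes "progressively_measurable F X" "0 \<le> t"
  shows "X t \<in> borel_measurable (F t)"
proof -
  have "(\<lambda>\<omega>. (t, \<omega>)) \<in> measurable (F t) (restrict_space borel {0..t} \<Otimes>\<^sub>M F t)"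
    by (intro measurable_Pair measurable_const measurable_ident_sets) (use assms in \<open>auto simp: space_restrict_space\<close>)
  moreover have "(\<lambda>(s, \<omega>). X s \<omega>) \<in> borel_measurable (restrict_space borel {0..t} \<Otimes>\<^sub>M F t)"
    using assms by (simp add: progressively_measurable_def)
  ultimately have "(\<lambda>\<omega>. (\<lambda>(s, \<omega>). X s \<omega>) (t, \<omega>)) \<in> borel_measurable (F t)"
    by (rule measurable_compose)
  then show ?thesis by simp
qed

lemma borel_measurable_square_integral:
  fixes X Y :: "real \<Rightarrow> 'a \<Rightarrow> 'b::euclidean_space"
  assumes "progressively_measurable F X" "progressively_measurable F Y" "0 \<le> T"
  shows "(\<lambda>\<omega>. \<integral>\<^sup>+s\<in>{0..T}. ennreal ((norm (X s \<omega> - Y s \<omega>))\<^sup>2) \<partial>lborel) \<in> borel_measurable M"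
proof (rule borel_measurable_set_nn_integral_snd)
  note progressive_M[OF assms(1,3), unfolded case_prod_beta', measurable]
    and progressive_M[OF assms(2,3), unfolded case_prod_beta', measurable]
  show "(\<lambda>(s, \<omega>). ennreal ((norm (X s \<omega> - Y s \<omega>))\<^sup>2)) \<in> borel_measurable (restrict_space borel {0..T} \<Otimes>\<^sub>M M)"
    unfolding case_prod_beta' by measurable
qed

lemma simple_integral_adapted:
  assumes \<tau>: "\<And>j. j < m \<Longrightarrow> \<tau> j \<le> \<tau> (Suc j)" "0 \<le> \<tau> 0"
    and \<xi>: "\<And>j. j < m \<Longrightarrow> \<xi> j \<in> borel_measurable (F (\<tau> j))"
    and B: "\<And>s. 0 \<le> s \<Longrightarrow> B s \<in> borel_measurable (F s)" and t: "0 \<le> t"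
  shows "simple_integral B m \<tau> \<xi> t \<in> borel_measurable (F t)"
proof -
  have "(\<lambda>\<omega>. (B (min t (\<tau> (Suc j))) \<omega> - B (min t (\<tau> j)) \<omega>) *\<^sub>R \<xi> j \<omega>) \<in> borel_measurable (F t)" if j: "j < m" for j
  \<comment> \<open>For \<open>\<tau> j > t\<close> both stopped times equal \<open>t\<close>, and
    the coefficient, possibly unknown at time \<open>t\<close>, is multiplied by zero.\<close>
  proof (cases "\<tau> j \<le> t")
    case True
    have [measurable]: "\<xi> j \<in> borel_measurable (F t)"
      using measurable_F_mono[OF \<xi>[OF j] steps_nonneg[OF \<tau>, of m j] True] j by auto
    have [measurable]: "B (min t (\<tau> r)) \<in> borel_measurable (F t)" if "r \<le> m" for r
      using measurable_F_mono[OF B, of "min t (\<tau> r)" t] t steps_nonneg[OF \<tau>, of m r] that by auto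
    have [measurable]: "B (min t (\<tau> (Suc j))) \<in> borel_measurable (F t)" "B (min t (\<tau> j)) \<in> borel_measurable (F t)"
      using j by (auto intro: \<open>\<And>r. r \<le> m \<Longrightarrow> B (min t (\<tau> r)) \<in> borel_measurable (F t)\<close>)
    show ?thesis by measurable
  next
    case False
    then show ?thesis using \<tau>(1)[OF j] by (simp add: min_def)
  qed
  then show ?thesis unfolding simple_integral_def[abs_def] by (intro borel_measurable_sum) auto
qed

end

section \<open>Convergence in probability and almost sure convergence\<close>

context prob_space
begin

text \<open>Dominated convergence for the indicators. It turns pathwise limits into the limits in
  probability that the definition of the integral demands.\<close>

lemma prob_tendsto_zero_of_AE_eventually:
  assumes E: "\<And>k. E k \<in> events" and ev: "AE \<omega> in M. eventually (\<lambda>k. \<omega> \<notin> E k) sequentially"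
  shows "(\<lambda>k. prob (E k)) \<longlonglongrightarrow> 0"
proof -
  have "(\<lambda>k. expectation (indicator (E k) :: 'a \<Rightarrow> real)) \<longlonglongrightarrow> expectation (\<lambda>_. 0)"
  proof (rule integral_dominated_convergence[where w="\<lambda>_. 1"])
    show "AE \<omega> in M. (\<lambda>k. indicator (E k) \<omega>) \<longlonglongrightarrow> (0::real)"
      using ev
    proof eventually_elim
      case (elim \<omega>)
      then have "eventually (\<lambda>k. indicator (E k) \<omega> = (0::real)) sequentially"
        by eventually_elim (simp add: indicator_def)
      then show ?case by (rule tendsto_eventually)
    qed
  qed (use E in \<open>auto simp: indicator_def\<close>)
  then show ?thesis using E by simp
qed

text \<open>The classical subsequence argument of Riesz. Values are in \<open>ennreal\<close>
  because the squared distances of integrands to which it is applied may be infinite.\<close>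

lemma AE_subsequence_of_prob_tendsto_zero:
  fixes f :: "nat \<Rightarrow> 'a \<Rightarrow> ennreal"
  assumes f[measurable]: "\<And>k. f k \<in> borel_measurable M"
    and lim: "\<And>\<epsilon>. 0 < \<epsilon> \<Longrightarrow> (\<lambda>k. prob {\<omega>\<in>space M. ennreal \<epsilon> < f k \<omega>}) \<longlonglongrightarrow> 0"
  obtains r :: "nat \<Rightarrow> nat" where "strict_mono r" "AE \<omega> in M. (\<lambda>k. f (r k) \<omega>) \<longlonglongrightarrow> 0"
proof -
  have "\<exists>k>n. prob {\<omega>\<in>space M. ennreal ((1/2) ^ n) < f k \<omega>} < (1/2) ^ n" for n
  proof -
    have "eventually (\<lambda>k. prob {\<omega>\<in>space M. ennreal ((1/2) ^ n) < f k \<omega>} < (1/2) ^ n) sequentially"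
      using order_tendstoD(2)[OF lim[of "(1/2) ^ n"], of "(1/2) ^ n"] by simp
    from eventually_happens[OF eventually_conj[OF this eventually_gt_at_top[of n]]] show ?thesis by auto
  qed
  \<comment> \<open>The threshold for the next index is set by the current one; since
    \<open>r n \<ge> n\<close>, both the thresholds and the probabilities are dominated by
    \<open>(1/2) ^ n\<close>.\<close>
  then have "\<exists>r. \<forall>n. True \<and> (r (Suc n) > r n \<and> prob {\<omega>\<in>space M. ennreal ((1/2) ^ r n) < f (r (Suc n)) \<omega>} < (1/2) ^ r n)"
    by (intro dependent_nat_choice) auto
  then obtain r where r: "\<And>n. r n < r (Suc n)"
    "\<And>n. prob {\<omega>\<in>space M. ennreal ((1/2) ^ r n) < f (r (Suc n)) \<omega>} < (1/2) ^ r n" by auto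
  have sm: "strict_mono r" using r by (simp add: strict_mono_Suc_iff)
  have rn: "n \<le> r n" for n using sm by (rule strict_mono_imp_increasing)
  have le: "(1/2 :: real) ^ r n \<le> (1/2) ^ n" for n using rn by (intro power_decreasing) auto
  have "AE \<omega> in M. eventually (\<lambda>n. \<omega> \<in> space M - {\<omega>\<in>space M. ennreal ((1/2) ^ r n) < f (r (Suc n)) \<omega>}) sequentially"
  proof (rule borel_cantelli_AE1)
    show "summable (\<lambda>n. prob {\<omega>\<in>space M. ennreal ((1/2) ^ r n) < f (r (Suc n)) \<omega>})"
      by (rule summable_comparison_test'[where g="\<lambda>n. (1/2) ^ n" and N=0])
        (auto intro!: summable_geometric order_trans[OF less_imp_le[OF r(2)] le])
  qed (auto simp: less_top[symmetric])
  then have "AE \<omega> in M. (\<lambda>n. f (r (Suc n)) \<omega>) \<longlonglongrightarrow> 0"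
  proof eventually_elim
    case (elim \<omega>)
    then have ev: "eventually (\<lambda>n. f (r (Suc n)) \<omega> \<le> ennreal ((1/2) ^ n)) sequentially"
      by eventually_elim (auto simp: not_less intro: order_trans[OF _ ennreal_leI[OF le]])
    have "(\<lambda>n. ennreal ((1/2) ^ n)) \<longlonglongrightarrow> ennreal 0" by (intro tendsto_ennrealI LIMSEQ_power_zero) auto
    then show ?case
      by (intro tendsto_sandwich[OF _ ev tendsto_const]) auto
  qed
  then show thesis using sm by (intro that[of "\<lambda>n. r (Suc n)"]) (auto simp: strict_mono_Suc_iff)
qed

end

section \<open>Dyadic Euler schemes for the system without delays\<close>

text \<open>Index \<open>q\<close> of the cell \<open>(q / 2 ^ k, (q + 1) / 2 ^ k]\<close> that
  contains \<open>s\<close>. Ceiling minus one, rather than floor, matches the left-open intervals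
  of \<open>simple_value\<close>.\<close>

definition dyadic_cell :: "nat \<Rightarrow> real \<Rightarrow> nat" where
  "dyadic_cell k s = nat (\<lceil>s * 2 ^ k\<rceil> - 1)"

lemma dyadic_cell:
  assumes "0 < s"
  shows "real (dyadic_cell k s) / 2 ^ k < s" "s \<le> real (Suc (dyadic_cell k s)) / 2 ^ k"
proof -
  have "0 < \<lceil>s * 2 ^ k\<rceil>" using assms by simp
  then have e: "real (dyadic_cell k s) = of_int \<lceil>s * 2 ^ k\<rceil> - 1" by (simp add: dyadic_cell_def)
  have "of_int \<lceil>s * 2 ^ k\<rceil> - 1 < s * 2 ^ k" "s * 2 ^ k \<le> of_int \<lceil>s * 2 ^ k\<rceil>" by linarith+
  then show "real (dyadic_cell k s) / 2 ^ k < s" "s \<le> real (Suc (dyadic_cell k s)) / 2 ^ k"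
    using e by (simp_all add: field_simps)
qed

lemma dyadic_cell_unique:
  assumes "real q / 2 ^ k < s" "s \<le> real (Suc q) / 2 ^ k"
  shows "dyadic_cell k s = q"
proof -
  have "real q < s * 2 ^ k" "s * 2 ^ k \<le> real q + 1" using assms by (simp_all add: field_simps)
  then have "\<lceil>s * 2 ^ k\<rceil> = int q + 1" by (intro ceiling_unique) auto
  then show ?thesis by (simp add: dyadic_cell_def)
qed

text \<open>Dyadic cells are nested, and the index arithmetic is that of
  \<open>euler0_refine\<close> with \<open>r = 2 ^ (l - k)\<close>.\<close>

lemma dyadic_cell_div:
  assumes s: "0 < s" and kl: "k \<le> l"
  shows "dyadic_cell l s div 2 ^ (l - k) = dyadic_cell k s"
proof -
  let ?r = "2 ^ (l - k) :: nat" and ?c = "dyadic_cell l s"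
  let ?q = "?c div ?r"
  have r: "0 < ?r" by simp
  have pow: "(2::real) ^ l = 2 ^ k * real ?r" using kl by (simp add: power_add[symmetric])
  have "?q * ?r \<le> ?c" by simp
  then have "real ?q * real ?r \<le> real ?c" by (metis of_nat_le_iff of_nat_mult)
  then have "real ?q / 2 ^ k \<le> real ?c / 2 ^ l" unfolding pow using r by (simp add: field_simps)
  then have 1: "real ?q / 2 ^ k < s" using dyadic_cell(1)[OF s, of l] by simp
  have "Suc ?c \<le> Suc ?q * ?r" using dividend_less_times_div[OF r, of ?c] by (simp add: algebra_simps)
  then have "real (Suc ?c) \<le> real (Suc ?q) * real ?r" by (metis of_nat_le_iff of_nat_mult)
  then have "real (Suc ?c) / real ?r \<le> real (Suc ?q)" using r by (simp add: pos_divide_le_eq)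
  then have "real (Suc ?c) / real ?r / 2 ^ k \<le> real (Suc ?q) / 2 ^ k" by (rule divide_right_mono) simp
  then have "real (Suc ?c) / 2 ^ l \<le> real (Suc ?q) / 2 ^ k" unfolding pow by (simp add: mult.commute)
  then have 2: "s \<le> real (Suc ?q) / 2 ^ k" using dyadic_cell(2)[OF s, of l] by simp
  show ?thesis using dyadic_cell_unique[OF 1 2] by simp
qed

lemma dyadic_refining_grid:
  assumes "k \<le> l"
  shows "refining_grid m (\<lambda>j. real j / 2 ^ k) q (\<lambda>r. real r / 2 ^ l) (real q / 2 ^ l)"
proof
  show "strict_mono_on {..q} (\<lambda>r. real r / 2 ^ l)" by (intro strict_mono_onI) (simp add: divide_strict_right_mono)
  fix j assume j: "real j / 2 ^ k \<le> real q / 2 ^ l"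
  have e: "real j / 2 ^ k = real (j * 2 ^ (l - k)) / 2 ^ l"
  proof -
    have "(2::real) ^ l = 2 ^ k * 2 ^ (l - k)" using assms by (simp add: power_add[symmetric])
    then show ?thesis by simp
  qed
  have "real (j * 2 ^ (l - k)) \<le> real q" using j unfolding e by (simp add: divide_le_cancel)
  then have "j * 2 ^ (l - k) \<le> q" by (simp only: of_nat_le_iff)
  then show "real j / 2 ^ k \<in> (\<lambda>r. real r / 2 ^ l) ` {..q}" unfolding e by blast
qed (auto simp: divide_right_mono)

context independent_wiener_processes
begin

text \<open>Putting time in slot 0 of the family of integrators lets the drift be treated like a noise term.\<close>

definition drift_or_noise :: "nat \<Rightarrow> real \<Rightarrow> 'a \<Rightarrow> real" where
  "drift_or_noise i t \<omega> = (if i = 0 then t else W i t \<omega>)"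

abbreviation dyadic_euler :: "(nat \<Rightarrow> real^'n^'n) \<Rightarrow> real^'n \<Rightarrow> nat \<Rightarrow> nat \<Rightarrow> 'a \<Rightarrow> real^'n" where
  "dyadic_euler A v k \<equiv> euler0 A v (1 / 2 ^ k)"

text \<open>The horizon \<open>k\<close> grows with the level, so a single sequence serves all
  compact time intervals. Time 0 belongs to no left-open cell and receives the initial value by
  hand.\<close>

definition euler_path :: "(nat \<Rightarrow> real^'n^'n) \<Rightarrow> real^'n \<Rightarrow> nat \<Rightarrow> real \<Rightarrow> 'a \<Rightarrow> real^'n" where
  "euler_path A v k s \<omega> = (if s \<le> 0 then v else simple_value (k * 2 ^ k) (\<lambda>j. real j / 2 ^ k) (dyadic_euler A v k) s \<omega>)"

definition euler_integral :: "(nat \<Rightarrow> real^'n^'n) \<Rightarrow> real^'n \<Rightarrow> nat \<Rightarrow> nat \<Rightarrow> real \<Rightarrow> 'a \<Rightarrow> real^'n" where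
  "euler_integral A v i k = simple_integral (drift_or_noise i) (k * 2 ^ k) (\<lambda>j. real j / 2 ^ k)
     (\<lambda>j \<omega>. A i *v dyadic_euler A v k j \<omega>)"

lemma dyadic_euler_L2F: "L2F (real j / 2 ^ k) (dyadic_euler A v k j)"
  using euler0_L2F[of "1 / 2 ^ k" j A v] by simp

lemma euler_path_eq:
  assumes "0 < s" "s \<le> real k"
  shows "euler_path A v k s \<omega> = dyadic_euler A v k (dyadic_cell k s) \<omega>"
proof -
  have "real (dyadic_cell k s) / 2 ^ k < real k" using dyadic_cell(1)[OF assms(1)] assms(2) by (rule less_le_trans)
  then have "real (dyadic_cell k s) < real (k * 2 ^ k)" by (simp add: field_simps)
  then have "dyadic_cell k s < k * 2 ^ k" by (simp only: of_nat_less_iff)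
  then have "simple_value (k * 2 ^ k) (\<lambda>j. real j / 2 ^ k) (dyadic_euler A v k) s \<omega> = dyadic_euler A v k (dyadic_cell k s) \<omega>"
    by (intro simple_value_eq_single) (use dyadic_cell[OF assms(1)] in \<open>auto simp: divide_right_mono\<close>)
  then show ?thesis using assms by (simp add: euler_path_def)
qed

text \<open>\<open>euler0_refine\<close> with \<open>\<delta> = 1 / 2 ^ l\<close> and
  \<open>r = 2 ^ (l - k)\<close>. The bound depends on the coarser level only, which later allows
  \<open>l\<close> to tend to infinity; \<open>K \<le> k\<close> ensures that both paths reach up to
  time \<open>s\<close>.\<close>

lemma euler_path_cauchy:
  fixes A :: "nat \<Rightarrow> real^'n^'n" and K :: nat
  obtains C where "0 < C" "\<And>k l s. K \<le> k \<Longrightarrow> k \<le> l \<Longrightarrow> 0 < s \<Longrightarrow> s \<le> real K \<Longrightarrow>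
    expectation (\<lambda>\<omega>. (norm (euler_path A v l s \<omega> - euler_path A v k s \<omega>))\<^sup>2) \<le> C / 2 ^ k"
proof -
  obtain KA where KA: "0 < KA" "\<And>i v. i \<le> N \<Longrightarrow> norm (A i *v v) \<le> KA * norm v"
    by (rule matrix_family_bound[of N A]) (rule that; blast)
  obtain C where C: "0 < C" "\<And>\<delta> r j. 0 < \<delta> \<Longrightarrow> 0 < r \<Longrightarrow> real r * \<delta> \<le> 1 \<Longrightarrow> real j * \<delta> \<le> real K \<Longrightarrow>
    expectation (\<lambda>\<omega>. (norm (euler0 A v \<delta> j \<omega> - euler0 A v (real r * \<delta>) (j div r) \<omega>))\<^sup>2) \<le> C * (real r * \<delta>)"
    by (rule euler0_refine[where A=A and v=v and T="real K" and K=KA]) (use KA(2) that in blast)+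
  show thesis
  proof (rule that[OF C(1)])
    fix k l :: nat and s :: real assume kl: "K \<le> k" "k \<le> l" and s: "0 < s" "s \<le> real K"
    let ?r = "2 ^ (l - k) :: nat"
    have "(2::real) ^ l = 2 ^ k * 2 ^ (l - k)" using kl by (simp add: power_add[symmetric])
    then have rd: "real ?r * (1 / 2 ^ l) = 1 / 2 ^ k" by simp
    have "real (dyadic_cell l s) * (1 / 2 ^ l) \<le> real K" using dyadic_cell(1)[OF s(1), of l] s by simp
    then have "expectation (\<lambda>\<omega>. (norm (dyadic_euler A v l (dyadic_cell l s) \<omega>
        - euler0 A v (real ?r * (1 / 2 ^ l)) (dyadic_cell l s div ?r) \<omega>))\<^sup>2) \<le> C * (real ?r * (1 / 2 ^ l))"
      by (intro C(2)) (auto simp: rd simp del: of_nat_power)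
    moreover have "euler_path A v l s \<omega> = dyadic_euler A v l (dyadic_cell l s) \<omega>"
      "euler_path A v k s \<omega> = dyadic_euler A v k (dyadic_cell k s) \<omega>" for \<omega>
      using kl s by (auto intro!: euler_path_eq)
    ultimately show "expectation (\<lambda>\<omega>. (norm (euler_path A v l s \<omega> - euler_path A v k s \<omega>))\<^sup>2) \<le> C / 2 ^ k"
      unfolding rd dyadic_cell_div[OF s(1) kl(2)] by simp
  qed
qed

lemma euler_integral_grid:
  assumes "k \<le> l"
  shows "euler_integral A v i k (real q / 2 ^ l) \<omega> = (\<Sum>r<q. (drift_or_noise i (real (Suc r) / 2 ^ l) \<omega>
    - drift_or_noise i (real r / 2 ^ l) \<omega>) *\<^sub>R (A i *v euler_path A v k (real (Suc r) / 2 ^ l) \<omega>))"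
proof -
  have "0 < real (Suc r) / 2 ^ l" for r by simp
  then have "simple_value (k * 2 ^ k) (\<lambda>j. real j / 2 ^ k) (\<lambda>j \<omega>. A i *v dyadic_euler A v k j \<omega>) (real (Suc r) / 2 ^ l) \<omega>
      = A i *v euler_path A v k (real (Suc r) / 2 ^ l) \<omega>" for r
    unfolding euler_path_def simple_value_linear[OF matrix_vector_mul_linear] by (simp only: not_le[symmetric] if_False)
  then show ?thesis
    unfolding euler_integral_def refining_grid.simple_integral_eq[OF dyadic_refining_grid[OF assms]] by simp
qed

lemma euler_path_L2F:
  assumes "k \<le> l"
  shows "L2F (real r / 2 ^ l) (euler_path A v k (real (Suc r) / 2 ^ l))"
proof -
  have "0 < real (Suc r) / 2 ^ l" by simp
  then have "euler_path A v k (real (Suc r) / 2 ^ l)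
      = simple_value (k * 2 ^ k) (\<lambda>j. real j / 2 ^ k) (dyadic_euler A v k) (real (Suc r) / 2 ^ l)"
    unfolding euler_path_def[abs_def] by (simp only: not_le[symmetric] if_False)
  then show ?thesis
    using simple_value_L2F[OF dyadic_refining_grid[OF assms, of "k * 2 ^ k" "Suc r"] dyadic_euler_L2F lessI] by simp
qed

lemma euler_integral_measurable:
  assumes "i \<le> N" "0 \<le> t"
  shows "euler_integral A v i k t \<in> borel_measurable (F t)"
  unfolding euler_integral_def
proof (rule simple_integral_adapted[OF _ _ _ _ assms(2)])
  show "(\<lambda>\<omega>. A i *v dyadic_euler A v k j \<omega>) \<in> borel_measurable (F (real j / 2 ^ k))" for j
    using L2F_measurable[OF L2F_matrix[OF dyadic_euler_L2F]] .
  show "drift_or_noise i s \<in> borel_measurable (F s)" if "0 \<le> s" for s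
    using that assms adapted[of i s] by (cases "i = 0") (auto simp: drift_or_noise_def[abs_def])
qed (auto simp: divide_right_mono)

text \<open>Successive levels are compared at all dyadic times at once. On one fine grid the noise
  part follows from the maximal inequality and the drift part from Cauchy-Schwarz and Markov, with a
  bound that does not depend on the grid. Refining the grid enlarges the event, so the bound
  survives the union over all grids.\<close>

lemma euler_integral_increment_prob:
  fixes A :: "nat \<Rightarrow> real^'n^'n" and K :: nat
  assumes i: "i \<le> N"
  obtains L where "0 < L" "\<And>k c. K \<le> k \<Longrightarrow> 0 < c \<Longrightarrow>
    prob {\<omega>\<in>space M. \<exists>l\<ge>Suc k. \<exists>q\<le>K * 2 ^ l. c < norm (euler_integral A v i (Suc k) (real q / 2 ^ l) \<omega>
      - euler_integral A v i k (real q / 2 ^ l) \<omega>)} \<le> L / (2 ^ k * c\<^sup>2)"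
proof -
  obtain KA where KA: "0 < KA" "\<And>i v. i \<le> N \<Longrightarrow> norm (A i *v v) \<le> KA * norm v"
    by (rule matrix_family_bound[of N A]) (rule that; blast)
  obtain C where C: "0 < C" "\<And>k l s. K \<le> k \<Longrightarrow> k \<le> l \<Longrightarrow> 0 < s \<Longrightarrow> s \<le> real K \<Longrightarrow>
    expectation (\<lambda>\<omega>. (norm (euler_path A v l s \<omega> - euler_path A v k s \<omega>))\<^sup>2) \<le> C / 2 ^ k"
    by (rule euler_path_cauchy[of K A v]) (rule that; blast)
  \<comment> \<open>\<open>K\<^sup>2\<close> comes from the drift, \<open>K\<close> from the noise,
    and 1 keeps \<open>L\<close> positive for \<open>K = 0\<close>.\<close>
  define L where "L = ((real K)\<^sup>2 + real K + 1) * (KA\<^sup>2 * C)"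
  have L0: "0 < L" unfolding L_def using KA C by (intro mult_pos_pos) (auto simp: add_nonneg_pos)
  show thesis
  proof (rule that[OF L0])
    fix k :: nat and c :: real assume k: "K \<le> k" and c: "0 < c"
    let ?\<Delta> = "\<lambda>l q \<omega>. euler_integral A v i (Suc k) (real q / 2 ^ l) \<omega> - euler_integral A v i k (real q / 2 ^ l) \<omega>"
    define E where "E l = {\<omega>\<in>space M. \<exists>q\<le>K * 2 ^ l. c < norm (?\<Delta> l q \<omega>)}" for l
    have [measurable]: "euler_integral A v i k' (real q / 2 ^ l) \<in> borel_measurable M" for k' q l
      by (rule measurable_FM[OF _ euler_integral_measurable[OF i]]) auto
    have E_meas[measurable]: "E l \<in> events" for l unfolding E_def by measurable
    have bound: "prob (E l) \<le> L / (2 ^ k * c\<^sup>2)" if l: "Suc k \<le> l" for l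
    proof -
      let ?\<sigma> = "\<lambda>r. real r / 2 ^ l" and ?p = "K * 2 ^ l"
      define D where "D r \<omega> = A i *v (euler_path A v (Suc k) (?\<sigma> (Suc r)) \<omega> - euler_path A v k (?\<sigma> (Suc r)) \<omega>)" for r \<omega>
      have \<Delta>: "?\<Delta> l q \<omega> = (\<Sum>r<q. (drift_or_noise i (?\<sigma> (Suc r)) \<omega> - drift_or_noise i (?\<sigma> r) \<omega>) *\<^sub>R D r \<omega>)" for q \<omega>
        using l unfolding euler_integral_grid[OF l] euler_integral_grid[OF Suc_leD[OF l]] D_def
        by (simp add: matrix_vector_mult_diff_distrib scaleR_diff_right sum_subtractf)
      have path: "L2F (?\<sigma> r) (\<lambda>\<omega>. euler_path A v (Suc k) (?\<sigma> (Suc r)) \<omega> - euler_path A v k (?\<sigma> (Suc r)) \<omega>)" for r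
        using l by (intro L2F_diff euler_path_L2F) auto
      then have D: "L2F (?\<sigma> r) (D r)" for r unfolding D_def[abs_def] by (rule L2F_matrix)
      have DE: "expectation (\<lambda>\<omega>. (norm (D r \<omega>))\<^sup>2) \<le> KA\<^sup>2 * C / 2 ^ k" if r: "r < ?p" for r
      proof -
        have "Suc r \<le> ?p" using r by simp
        then have "real (Suc r) \<le> real K * 2 ^ l" by (metis of_nat_le_iff of_nat_mult of_nat_numeral of_nat_power)
        then have sK: "?\<sigma> (Suc r) \<le> real K" by (simp add: field_simps)
        have "expectation (\<lambda>\<omega>. (norm (D r \<omega>))\<^sup>2)
            \<le> expectation (\<lambda>\<omega>. KA\<^sup>2 * (norm (euler_path A v (Suc k) (?\<sigma> (Suc r)) \<omega> - euler_path A v k (?\<sigma> (Suc r)) \<omega>))\<^sup>2)"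
        proof (rule integral_mono)
          show "integrable M (\<lambda>\<omega>. (norm (D r \<omega>))\<^sup>2)" using L2F_integrable[OF D] .
          show "integrable M (\<lambda>\<omega>. KA\<^sup>2 * (norm (euler_path A v (Suc k) (?\<sigma> (Suc r)) \<omega> - euler_path A v k (?\<sigma> (Suc r)) \<omega>))\<^sup>2)"
            using L2F_integrable[OF path] by simp
          show "(norm (D r \<omega>))\<^sup>2 \<le> KA\<^sup>2 * (norm (euler_path A v (Suc k) (?\<sigma> (Suc r)) \<omega> - euler_path A v k (?\<sigma> (Suc r)) \<omega>))\<^sup>2" for \<omega>
            unfolding D_def power_mult_distrib[symmetric] using KA(2)[OF i] by (intro power_mono) auto
        qed
        also have "\<dots> \<le> KA\<^sup>2 * (C / 2 ^ k)"
        proof -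
          have "expectation (\<lambda>\<omega>. (norm (euler_path A v (Suc k) (?\<sigma> (Suc r)) \<omega> - euler_path A v k (?\<sigma> (Suc r)) \<omega>))\<^sup>2) \<le> C / 2 ^ k"
            by (rule C(2)[OF k le_SucI[OF order_refl] _ sK]) simp
          from mult_left_mono[OF this, of "KA\<^sup>2"] show ?thesis by (simp only: integral_mult_right_zero zero_le_power2)
        qed
        finally show ?thesis by simp
      qed
      have sumD: "(\<Sum>r<?p. expectation (\<lambda>\<omega>. (norm (D r \<omega>))\<^sup>2)) \<le> real ?p * (KA\<^sup>2 * C / 2 ^ k)"
        using sum_mono[of "{..<?p}" "\<lambda>r. expectation (\<lambda>\<omega>. (norm (D r \<omega>))\<^sup>2)" "\<lambda>_. KA\<^sup>2 * C / 2 ^ k"] DE by simp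
      have step: "?\<sigma> (Suc r) - ?\<sigma> r = 1 / 2 ^ l" for r by (simp add: diff_divide_distrib[symmetric])
      have main: "prob (E l) \<le> ((real K)\<^sup>2 + real K) * (KA\<^sup>2 * C / 2 ^ k) / c\<^sup>2"
      proof (cases "i = 0")
        case False
        have iN: "i \<in> {1..N}" using False i by simp
        have "?\<Delta> l q \<omega> = grid_int i ?\<sigma> D q \<omega>" for q \<omega>
          unfolding \<Delta> grid_int_def dW_def drift_or_noise_def using False by simp
        then have "prob (E l) \<le> (\<Sum>r<?p. (?\<sigma> (Suc r) - ?\<sigma> r) * expectation (\<lambda>\<omega>. (norm (D r \<omega>))\<^sup>2)) / c\<^sup>2"
          unfolding E_def using grid_int_maximal[OF iN, of ?p ?\<sigma> D c] D c by (simp add: divide_right_mono)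
        also have "(\<Sum>r<?p. (?\<sigma> (Suc r) - ?\<sigma> r) * expectation (\<lambda>\<omega>. (norm (D r \<omega>))\<^sup>2))
            = (1 / 2 ^ l) * (\<Sum>r<?p. expectation (\<lambda>\<omega>. (norm (D r \<omega>))\<^sup>2))"
          unfolding step by (simp add: sum_divide_distrib)
        also have "(1 / 2 ^ l) * (\<Sum>r<?p. expectation (\<lambda>\<omega>. (norm (D r \<omega>))\<^sup>2)) / c\<^sup>2
            \<le> (1 / 2 ^ l) * (real ?p * (KA\<^sup>2 * C / 2 ^ k)) / c\<^sup>2"
          by (intro divide_right_mono mult_left_mono sumD) auto
        also have "\<dots> = real K * (KA\<^sup>2 * C / 2 ^ k) / c\<^sup>2" by simp
        also have "\<dots> \<le> ((real K)\<^sup>2 + real K) * (KA\<^sup>2 * C / 2 ^ k) / c\<^sup>2"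
          using C by (intro divide_right_mono mult_right_mono) auto
        finally show ?thesis .
      next
        case True
        \<comment> \<open>By Cauchy-Schwarz the square of a sum of \<open>K * 2 ^ l\<close> terms
          with weight \<open>1 / 2 ^ l\<close> is at most \<open>K * 2 ^ l\<close> times the sum of
          their squares; this is \<open>Q\<close>.\<close>
        define Q where "Q \<omega> = real K * (1 / 2 ^ l) * (\<Sum>r<?p. (norm (D r \<omega>))\<^sup>2)" for \<omega>
        have Qint: "integrable M Q" unfolding Q_def using L2F_integrable[OF D] by (intro integrable_mult_right integrable_sum) auto
        have "E l \<subseteq> {\<omega>\<in>space M. c\<^sup>2 \<le> Q \<omega>}"
        proof (safe)
          fix \<omega> assume "\<omega> \<in> E l"
          then obtain q where q: "q \<le> ?p" "c < norm (?\<Delta> l q \<omega>)" and "\<omega> \<in> space M" by (auto simp: E_def)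
          have "norm (?\<Delta> l q \<omega>) \<le> (\<Sum>r<q. norm ((1 / 2 ^ l) *\<^sub>R D r \<omega>))"
            unfolding \<Delta> using True step by (simp add: drift_or_noise_def sum_norm_le)
          also have "\<dots> \<le> (\<Sum>r<?p. norm ((1 / 2 ^ l) *\<^sub>R D r \<omega>))"
            using q by (intro sum_mono2) auto
          finally have "c \<le> (\<Sum>r<?p. norm ((1 / 2 ^ l) *\<^sub>R D r \<omega>))" using q by simp
          then have "c\<^sup>2 \<le> (\<Sum>r<?p. norm ((1 / 2 ^ l) *\<^sub>R D r \<omega>))\<^sup>2" using c by (intro power_mono) auto
          also have "\<dots> \<le> real (card {..<?p}) * (\<Sum>r<?p. (norm (norm ((1 / 2 ^ l) *\<^sub>R D r \<omega>)))\<^sup>2)"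
            using norm_sum_square_le[of "\<lambda>r. norm ((1 / 2 ^ l) *\<^sub>R D r \<omega>)" "{..<?p}"] by (simp only: real_norm_def power2_abs)
          also have "\<dots> = Q \<omega>"
            by (simp add: Q_def power_mult_distrib power_divide sum_divide_distrib[symmetric] sum_distrib_left[symmetric] power2_eq_square)
          finally show "c\<^sup>2 \<le> Q \<omega>" .
        qed (auto simp: E_def)
        then have "prob (E l) \<le> prob {\<omega>\<in>space M. c\<^sup>2 \<le> Q \<omega>}"
          using Qint by (intro finite_measure_mono) auto
        also have "\<dots> \<le> expectation Q / c\<^sup>2"
        proof -
          have "0 \<le> Q \<omega>" for \<omega> unfolding Q_def by (intro mult_nonneg_nonneg sum_nonneg) auto
          then show ?thesis using integral_Markov_inequality_measure[of M Q "{}" "c\<^sup>2"] c Qint by simp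
        qed
        also have "expectation Q = real K * (1 / 2 ^ l) * (\<Sum>r<?p. expectation (\<lambda>\<omega>. (norm (D r \<omega>))\<^sup>2))"
          unfolding Q_def using L2F_integrable[OF D] by (simp add: integrable_sum)
        also have "real K * (1 / 2 ^ l) * (\<Sum>r<?p. expectation (\<lambda>\<omega>. (norm (D r \<omega>))\<^sup>2)) / c\<^sup>2
            \<le> real K * (1 / 2 ^ l) * (real ?p * (KA\<^sup>2 * C / 2 ^ k)) / c\<^sup>2"
          by (intro divide_right_mono mult_left_mono sumD) auto
        also have "\<dots> = (real K)\<^sup>2 * (KA\<^sup>2 * C / 2 ^ k) / c\<^sup>2" by (simp add: power2_eq_square)
        also have "\<dots> \<le> ((real K)\<^sup>2 + real K) * (KA\<^sup>2 * C / 2 ^ k) / c\<^sup>2"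
          using C by (intro divide_right_mono mult_right_mono) auto
        finally show ?thesis .
      qed
      also have "\<dots> \<le> ((real K)\<^sup>2 + real K + 1) * (KA\<^sup>2 * C / 2 ^ k) / c\<^sup>2"
        using C by (intro divide_right_mono mult_right_mono) auto
      also have "\<dots> = L / (2 ^ k * c\<^sup>2)" by (simp add: L_def)
      finally show ?thesis .
    qed
    \<comment> \<open>Node \<open>q\<close> of one level is node \<open>2 * q\<close> of the
      next.\<close>
    have inc: "incseq (\<lambda>n. E (Suc k + n))"
    proof (rule incseq_SucI)
      fix n
      show "E (Suc k + n) \<subseteq> E (Suc k + Suc n)"
      proof
        fix \<omega> assume "\<omega> \<in> E (Suc k + n)"
        then obtain q where q: "q \<le> K * 2 ^ (Suc k + n)" "c < norm (?\<Delta> (Suc k + n) q \<omega>)" "\<omega> \<in> space M" by (auto simp: E_def)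
        have "real (2 * q) / 2 ^ (Suc k + Suc n) = real q / 2 ^ (Suc k + n)" by simp
        then have "c < norm (?\<Delta> (Suc k + Suc n) (2 * q) \<omega>)" using q(2) by presburger
        moreover have "2 * q \<le> K * 2 ^ (Suc k + Suc n)" using q(1) by simp
        ultimately show "\<omega> \<in> E (Suc k + Suc n)" using q(3) unfolding E_def by blast
      qed
    qed
    have "(\<lambda>n. prob (E (Suc k + n))) \<longlonglongrightarrow> prob (\<Union>n. E (Suc k + n))"
      by (rule finite_Lim_measure_incseq[OF _ inc]) auto
    then have "prob (\<Union>n. E (Suc k + n)) \<le> L / (2 ^ k * c\<^sup>2)"
      by (rule LIMSEQ_le_const2) (auto intro!: bound)
    moreover have "{\<omega>\<in>space M. \<exists>l\<ge>Suc k. \<exists>q\<le>K * 2 ^ l. c < norm (?\<Delta> l q \<omega>)} = (\<Union>n. E (Suc k + n))"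
    proof (intro set_eqI iffI)
      fix \<omega> assume "\<omega> \<in> {\<omega>\<in>space M. \<exists>l\<ge>Suc k. \<exists>q\<le>K * 2 ^ l. c < norm (?\<Delta> l q \<omega>)}"
      then obtain l where l: "Suc k \<le> l" "\<omega> \<in> E l" by (auto simp: E_def)
      then show "\<omega> \<in> (\<Union>n. E (Suc k + n))" by (metis UN_I UNIV_I le_Suc_ex)
    next
      fix \<omega> assume "\<omega> \<in> (\<Union>n. E (Suc k + n))"
      then obtain n where "\<omega> \<in> E (Suc k + n)" by blast
      moreover have "Suc k \<le> Suc k + n" by simp
      ultimately show "\<omega> \<in> {\<omega>\<in>space M. \<exists>l\<ge>Suc k. \<exists>q\<le>K * 2 ^ l. c < norm (?\<Delta> l q \<omega>)}"
        unfolding E_def by blast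
    qed
    ultimately show "prob {\<omega>\<in>space M. \<exists>l\<ge>Suc k. \<exists>q\<le>K * 2 ^ l. c < norm (?\<Delta> l q \<omega>)} \<le> L / (2 ^ k * c\<^sup>2)"
      by simp
  qed
qed

lemma euler_integral_continuous:
  assumes "i \<le> N"
  shows "AE \<omega> in M. \<forall>k. continuous_on {0..} (\<lambda>t. euler_integral A v i k t \<omega>)"
proof -
  have "AE \<omega> in M. continuous_on {0..} (\<lambda>t. drift_or_noise i t \<omega>)"
    using continuous[of i] assms by (cases "i = 0") (auto simp: drift_or_noise_def intro!: continuous_intros)
  then show ?thesis
    by eventually_elim (auto simp: euler_integral_def intro!: simple_integral_continuous)
qed

text \<open>The ratio 4/5 lies between \<open>1 / sqrt 2\<close> and 1: the thresholds are summable,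
  and so are the probabilities, since \<open>2 * (4/5)\<^sup>2 = 32/25 > 1\<close>. Borel-Cantelli
  then applies on each horizon \<open>K\<close>, and continuity passes from dyadic to all
  times.\<close>

lemma euler_integral_AE_increments:
  fixes A :: "nat \<Rightarrow> real^'n^'n"
  assumes i: "i \<le> N"
  shows "AE \<omega> in M. \<forall>K::nat. \<exists>k0. \<forall>k\<ge>k0. \<forall>t\<in>{0..real K}.
    norm (euler_integral A v i (Suc k) t \<omega> - euler_integral A v i k t \<omega>) \<le> (4/5) ^ k"
  unfolding AE_all_countable
proof
  fix K :: nat
  obtain L where L: "0 < L" "\<And>k c. K \<le> k \<Longrightarrow> 0 < c \<Longrightarrow>
    prob {\<omega>\<in>space M. \<exists>l\<ge>Suc k. \<exists>q\<le>K * 2 ^ l. c < norm (euler_integral A v i (Suc k) (real q / 2 ^ l) \<omega>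
      - euler_integral A v i k (real q / 2 ^ l) \<omega>)} \<le> L / (2 ^ k * c\<^sup>2)"
    by (rule euler_integral_increment_prob[OF i, of K A v]) (rule that; blast)
  define E where "E k = {\<omega>\<in>space M. \<exists>l\<ge>Suc k. \<exists>q\<le>K * 2 ^ l. (4/5) ^ k < norm (euler_integral A v i (Suc k) (real q / 2 ^ l) \<omega>
      - euler_integral A v i k (real q / 2 ^ l) \<omega>)}" for k
  have [measurable]: "euler_integral A v i k' (real q / 2 ^ l) \<in> borel_measurable M" for k' q l
    by (rule measurable_FM[OF _ euler_integral_measurable[OF i]]) auto
  have E: "E k \<in> events" for k unfolding E_def by measurable
  \<comment> \<open>The probability bound is available from level \<open>K\<close> on, hence the
    shift.\<close>
  have pE: "prob (E (n + K)) \<le> L * (25/32) ^ n" for n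
  proof -
    have "prob (E (n + K)) \<le> L / (2 ^ (n + K) * ((4/5) ^ (n + K))\<^sup>2)" unfolding E_def by (rule L(2)) auto
    also have "(2::real) ^ (n + K) * ((4/5) ^ (n + K))\<^sup>2 = (32/25) ^ (n + K)"
      by (simp add: power2_eq_square power_mult_distrib[symmetric])
    also have "L / (32/25) ^ (n + K) \<le> L / (32/25) ^ n"
      using L by (intro divide_left_mono power_increasing mult_pos_pos) auto
    also have "\<dots> = L * (25/32) ^ n" by (simp add: power_divide)
    finally show ?thesis .
  qed
  have "AE \<omega> in M. eventually (\<lambda>n. \<omega> \<in> space M - E (n + K)) sequentially"
  proof (rule borel_cantelli_AE1)
    show "summable (\<lambda>n. prob (E (n + K)))"
      by (rule summable_comparison_test'[where g="\<lambda>n. L * (25/32) ^ n" and N=0])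
        (use pE in \<open>auto intro!: summable_mult summable_geometric\<close>)
  qed (use E in \<open>auto simp: less_top[symmetric]\<close>)
  then show "AE \<omega> in M. \<exists>k0. \<forall>k\<ge>k0. \<forall>t\<in>{0..real K}.
      norm (euler_integral A v i (Suc k) t \<omega> - euler_integral A v i k t \<omega>) \<le> (4/5) ^ k"
    using euler_integral_continuous[OF i, of A v]
  proof eventually_elim
    case (elim \<omega>)
    then obtain n0 where n0: "\<And>n. n0 \<le> n \<Longrightarrow> \<omega> \<in> space M - E (n + K)"
      unfolding eventually_sequentially by blast
    show ?case
    proof (intro exI allI impI ballI)
      fix k t assume k: "n0 + K \<le> k" and t: "t \<in> {0..real K}"
      then have nE: "\<omega> \<in> space M - E k" using n0[of "k - K"] by simp
      show "norm (euler_integral A v i (Suc k) t \<omega> - euler_integral A v i k t \<omega>) \<le> (4/5) ^ k"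
      proof (rule continuous_on_bound_dyadic[OF _ _ t, where lmin="Suc k"])
        show "continuous_on {0..real K} (\<lambda>t. euler_integral A v i (Suc k) t \<omega> - euler_integral A v i k t \<omega>)"
          using elim(2) by (intro continuous_on_diff) (auto intro: continuous_on_subset)
        fix l q assume "Suc k \<le> l" "q \<le> K * 2 ^ l"
        then show "norm (euler_integral A v i (Suc k) (real q / 2 ^ l) \<omega> - euler_integral A v i k (real q / 2 ^ l) \<omega>) \<le> (4/5) ^ k"
          using nE unfolding E_def by (auto simp: not_less)
      qed
    qed
  qed
qed

end

section \<open>A solution of the system without delays\<close>

text \<open>Telescoping reduces this to the Weierstrass test. Naming the limit by \<open>lim\<close>
  makes it the same function for all sets \<open>S\<close>.\<close>

lemma uniform_limit_of_geometric_increments: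
  fixes g :: "nat \<Rightarrow> real \<Rightarrow> 'b::banach"
  assumes "\<And>k t. kmin \<le> k \<Longrightarrow> t \<in> S \<Longrightarrow> norm (g (Suc k) t - g k t) \<le> (4/5) ^ k"
  shows "uniform_limit S g (\<lambda>t. lim (\<lambda>k. g k t)) sequentially"
proof -
  have "uniformly_convergent_on S (\<lambda>n t. \<Sum>i<n. g (Suc i) t - g i t)"
    by (rule Weierstrass_m_test'_ev[where M="\<lambda>k. (4/5) ^ k"])
      (use assms in \<open>auto simp: eventually_sequentially intro!: summable_geometric\<close>)
  then obtain l where "uniform_limit S (\<lambda>n t. \<Sum>i<n. g (Suc i) t - g i t) l sequentially"
    by (auto simp: uniformly_convergent_on_def)
  then have "uniform_limit S (\<lambda>n t. (\<Sum>i<n. g (Suc i) t - g i t) + g 0 t) (\<lambda>t. l t + g 0 t) sequentially"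
    by (intro uniform_limit_intros)
  then have "uniformly_convergent_on S g"
    using sum_lessThan_telescope[of "\<lambda>i. g i t" for t] by (auto simp: uniformly_convergent_on_def)
  then show ?thesis by (simp add: uniformly_convergent_uniform_limit_iff)
qed

lemma uniform_limit_finite_sum:
  fixes f :: "'i \<Rightarrow> 'k \<Rightarrow> 'a \<Rightarrow> 'b::real_normed_vector"
  assumes "finite I" "\<And>i. i \<in> I \<Longrightarrow> uniform_limit S (f i) (g i) F"
  shows "uniform_limit S (\<lambda>k t. \<Sum>i\<in>I. f i k t) (\<lambda>t. \<Sum>i\<in>I. g i t) F"
  using assms by (induction I) (auto intro!: uniform_limit_intros)

context independent_wiener_processes
begin

text \<open>Through this identity at the nodes of the scheme, uniform convergence of the integrals
  carries over to the scheme. The index set includes 0, so the drift is one of the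
  integrals.\<close>

lemma dyadic_euler_eq_integrals:
  assumes "q \<le> k * 2 ^ k"
  shows "dyadic_euler A v k q \<omega> = v + (\<Sum>i\<le>N. euler_integral A v i k (real q / 2 ^ k) \<omega>)"
  using assms
proof (induction q)
  case 0
  then show ?case using euler_integral_grid[OF order_refl, of A v _ k 0] by simp
next
  case (Suc q)
  have "real (Suc q) \<le> real (k * 2 ^ k)" using Suc.prems by (simp only: of_nat_le_iff)
  then have "real (Suc q) / 2 ^ k \<le> real k" by (simp add: field_simps)
  moreover have cell: "dyadic_cell k (real (Suc q) / 2 ^ k) = q"
    by (rule dyadic_cell_unique) (auto simp: divide_strict_right_mono)
  ultimately have path: "euler_path A v k (real (Suc q) / 2 ^ k) \<omega> = dyadic_euler A v k q \<omega>"
    using euler_path_eq[of "real (Suc q) / 2 ^ k" k A v \<omega>] unfolding cell by (simp del: of_nat_Suc)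
  have inc: "euler_integral A v i k (real (Suc q) / 2 ^ k) \<omega> = euler_integral A v i k (real q / 2 ^ k) \<omega> +
      (drift_or_noise i (real (Suc q) / 2 ^ k) \<omega> - drift_or_noise i (real q / 2 ^ k) \<omega>) *\<^sub>R (A i *v dyadic_euler A v k q \<omega>)" for i
    unfolding euler_integral_grid[OF order_refl] sum.lessThan_Suc path ..
  have N: "{..N} = insert 0 {1..N}" by auto
  have "(\<Sum>i\<le>N. (drift_or_noise i (real (Suc q) / 2 ^ k) \<omega> - drift_or_noise i (real q / 2 ^ k) \<omega>) *\<^sub>R (A i *v dyadic_euler A v k q \<omega>))
      = (1 / 2 ^ k) *\<^sub>R (A 0 *v dyadic_euler A v k q \<omega>) +
        (\<Sum>i\<in>{1..N}. dW i (real q / 2 ^ k) (real (Suc q) / 2 ^ k) \<omega> *\<^sub>R (A i *v dyadic_euler A v k q \<omega>))"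
    unfolding N by (subst sum.insert) (auto simp: drift_or_noise_def dW_def diff_divide_distrib[symmetric] intro!: sum.cong)
  then show ?case unfolding inc using Suc by (simp add: sum.distrib)
qed

text \<open>\<open>lim\<close> is taken at every outcome, also where the sequence diverges: a
  pointwise \<open>lim\<close> of progressively measurable processes is progressively measurable
  without removing a null set.\<close>

definition euler_limit :: "(nat \<Rightarrow> real^'n^'n) \<Rightarrow> real^'n \<Rightarrow> real \<Rightarrow> 'a \<Rightarrow> real^'n" where
  "euler_limit A v s \<omega> = lim (\<lambda>k. euler_path A v k s \<omega>)"

definition integral_limit :: "(nat \<Rightarrow> real^'n^'n) \<Rightarrow> real^'n \<Rightarrow> nat \<Rightarrow> real \<Rightarrow> 'a \<Rightarrow> real^'n" where
  "integral_limit A v i t \<omega> = lim (\<lambda>k. euler_integral A v i k t \<omega>)"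

text \<open>The integrals converge by their summable increments. The step path at \<open>t\<close>
  equals the continuous sum \<open>xk\<close> at the node before \<open>t\<close>, and uniform
  continuity of the limit \<open>xx\<close> absorbs that shift of time. Uniform convergence of the
  paths in turn identifies the limit of the drift integrals.\<close>

lemma AE_uniform_limits:
  fixes A :: "nat \<Rightarrow> real^'n^'n"
  shows "AE \<omega> in M.
    (\<forall>i\<le>N. continuous_on {0..} (\<lambda>t. integral_limit A v i t \<omega>) \<and>
      (\<forall>K::nat. uniform_limit {0..real K} (\<lambda>k t. euler_integral A v i k t \<omega>) (\<lambda>t. integral_limit A v i t \<omega>) sequentially)) \<and>
    continuous_on {0..} (\<lambda>t. euler_limit A v t \<omega>) \<and>
    (\<forall>K::nat. uniform_limit {0..real K} (\<lambda>k t. euler_path A v k t \<omega>) (\<lambda>t. euler_limit A v t \<omega>) sequentially) \<and>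
    (\<forall>t\<ge>0. euler_limit A v t \<omega> = v + (\<Sum>i\<le>N. integral_limit A v i t \<omega>)) \<and>
    (\<forall>t\<ge>0. integral_limit A v 0 t \<omega> = integral {0..t} (\<lambda>s. A 0 *v euler_limit A v s \<omega>))"
proof -
  have "AE \<omega> in M. \<forall>i\<in>{..N}. \<forall>K::nat. \<exists>kmin. \<forall>k\<ge>kmin. \<forall>t\<in>{0..real K}.
      norm (euler_integral A v i (Suc k) t \<omega> - euler_integral A v i k t \<omega>) \<le> (4/5) ^ k"
    by (rule AE_finite_allI) (auto intro: euler_integral_AE_increments)
  moreover have "AE \<omega> in M. \<forall>i\<in>{..N}. \<forall>k. continuous_on {0..} (\<lambda>t. euler_integral A v i k t \<omega>)"
    by (rule AE_finite_allI) (auto intro: euler_integral_continuous)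
  ultimately show ?thesis
  proof eventually_elim
    case (elim \<omega>)
    have UI: "uniform_limit {0..real K} (\<lambda>k t. euler_integral A v i k t \<omega>) (\<lambda>t. integral_limit A v i t \<omega>) sequentially"
      if i: "i \<le> N" for i K
    proof -
      obtain kmin where "\<forall>k\<ge>kmin. \<forall>t\<in>{0..real K}.
          norm (euler_integral A v i (Suc k) t \<omega> - euler_integral A v i k t \<omega>) \<le> (4/5) ^ k"
        using elim(1) i by blast
      then show ?thesis unfolding integral_limit_def
        by (intro uniform_limit_of_geometric_increments[where kmin=kmin]) auto
    qed
    have all_K: "continuous_on {0..} f" if "\<And>K::nat. continuous_on {0..real K} f" for f :: "real \<Rightarrow> real^'n"
    proof (rule continuous_on_eq_continuous_within[THEN iffD2], rule ballI)
      fix t :: real assume t: "t \<in> {0..}"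
      obtain K :: nat where K: "t < real K" using reals_Archimedean2 by blast
      have "continuous (at t within {0..real K}) f"
        using that[of K] t K by (simp add: continuous_on_eq_continuous_within)
      moreover have "at t within {0..real K} = at t within {0..}"
        by (rule at_within_nhd[of t "{..<real K}"]) (use K in auto)
      ultimately show "continuous (at t within {0..}) f" by simp
    qed
    have CI: "continuous_on {0..} (\<lambda>t. integral_limit A v i t \<omega>)" if i: "i \<le> N" for i
    proof (rule all_K)
      fix K :: nat
      show "continuous_on {0..real K} (\<lambda>t. integral_limit A v i t \<omega>)"
        by (rule uniform_limit_theorem[OF _ UI[OF i]])
          (use elim(2) i in \<open>auto intro!: always_eventually intro: continuous_on_subset[where s="{0..}"]\<close>)
    qed
    define xx where "xx t = v + (\<Sum>i\<le>N. integral_limit A v i t \<omega>)" for t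
    define xk where "xk k t = v + (\<Sum>i\<le>N. euler_integral A v i k t \<omega>)" for k t
    have Cx: "continuous_on {0..} xx" unfolding xx_def by (intro continuous_intros CI) auto
    have Ux: "uniform_limit {0..real K} xk xx sequentially" for K
      unfolding xk_def[abs_def] xx_def[abs_def] by (intro uniform_limit_add uniform_limit_const uniform_limit_finite_sum UI) auto
    have Up: "uniform_limit {0..real K} (\<lambda>k t. euler_path A v k t \<omega>) xx sequentially" for K :: nat
    proof (rule uniform_limitI)
      fix e :: real assume e: "0 < e"
      have "uniformly_continuous_on {0..real K} xx"
        by (intro compact_uniformly_continuous continuous_on_subset[OF Cx]) auto
      then obtain d where d: "0 < d" "\<And>s t. s \<in> {0..real K} \<Longrightarrow> t \<in> {0..real K} \<Longrightarrow> dist t s < d \<Longrightarrow> dist (xx t) (xx s) < e / 2"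
        unfolding uniformly_continuous_on_def using e by (meson half_gt_zero)
      have "eventually (\<lambda>k. \<forall>t\<in>{0..real K}. dist (xk k t) (xx t) < e / 2) sequentially"
        using uniform_limitD[OF Ux, of "e / 2" K] e by simp
      moreover have "eventually (\<lambda>k. (1/2::real) ^ k < d) sequentially"
        using order_tendstoD(2)[OF LIMSEQ_power_zero[of "1/2 :: real"] d(1)] by simp
      moreover have "eventually (\<lambda>k. K \<le> k) sequentially" by (rule eventually_ge_at_top)
      ultimately show "eventually (\<lambda>k. \<forall>t\<in>{0..real K}. dist (euler_path A v k t \<omega>) (xx t) < e) sequentially"
      proof eventually_elim
        case (elim k)
        show ?case
        proof
          fix t assume t: "t \<in> {0..real K}"
          \<comment> \<open>The node whose value the step path takes at \<open>t\<close>; at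
            \<open>t = 0\<close> the path has its initial value.\<close>
          define c where "c = (if t = 0 then 0 else real (dyadic_cell k t) / 2 ^ k)"
          have c: "c \<in> {0..real K} \<and> dist c t < d \<and> euler_path A v k t \<omega> = xk k c"
          proof (cases "t = 0")
            case True
            then show ?thesis using t d euler_integral_grid[OF order_refl, of A v _ k 0]
              by (simp add: c_def xk_def euler_path_def)
          next
            case False
            then have t0: "0 < t" using t by simp
            have tk: "t \<le> real k" using t elim by simp
            have c1: "c = real (dyadic_cell k t) / 2 ^ k" using False by (simp add: c_def)
            have ct: "c < t" "t \<le> c + (1/2) ^ k" using dyadic_cell[OF t0, of k] unfolding c1
              by (simp_all add: add_divide_distrib power_divide add.commute)
            have "real (dyadic_cell k t) \<le> t * 2 ^ k" using ct(1) unfolding c1 by (simp add: field_simps)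
            also have "\<dots> \<le> real k * 2 ^ k" by (rule mult_right_mono[OF tk]) simp
            finally have "real (dyadic_cell k t) \<le> real k * 2 ^ k" .
            then have "dyadic_cell k t \<le> k * 2 ^ k" by (metis of_nat_le_iff of_nat_mult of_nat_numeral of_nat_power)
            then have "euler_path A v k t \<omega> = xk k c"
              unfolding c1 xk_def euler_path_eq[OF t0 tk] by (rule dyadic_euler_eq_integrals)
            moreover have "0 \<le> c" unfolding c1 by simp
            ultimately show ?thesis using ct t elim(2) by (auto simp: dist_real_def)
          qed
          have "dist (xk k c) (xx c) < e / 2" using elim(1) c by blast
          moreover have "dist (xx c) (xx t) < e / 2" using d(2) t c by blast
          ultimately show "dist (euler_path A v k t \<omega>) (xx t) < e"
            using c dist_triangle[of "xk k c" "xx t" "xx c"] by simp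
        qed
      qed
    qed
    have x_eq: "euler_limit A v t \<omega> = xx t" if t: "0 \<le> t" for t
    proof -
      obtain K :: nat where "t \<le> real K" using real_arch_simple by blast
      then have "(\<lambda>k. euler_path A v k t \<omega>) \<longlonglongrightarrow> xx t"
        using tendsto_uniform_limitI[OF Up, of t K] t by simp
      then show ?thesis unfolding euler_limit_def by (rule limI)
    qed
    have drift: "integral_limit A v 0 t \<omega> = integral {0..t} (\<lambda>s. A 0 *v euler_limit A v s \<omega>)" if t: "0 \<le> t" for t
    proof -
      obtain K :: nat where K: "t \<le> real K" using real_arch_simple by blast
      obtain KA where KA: "0 < KA" "\<And>i v. i \<le> N \<Longrightarrow> norm (A i *v v) \<le> KA * norm v"
        by (rule matrix_family_bound[of N A]) (rule that; blast)
      have hi: "((\<lambda>s. A 0 *v euler_path A v k s \<omega>) has_integral euler_integral A v 0 k t \<omega>) {0..t}" for k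
      proof -
        have "drift_or_noise 0 = (\<lambda>t _. t)" by (intro ext) (simp add: drift_or_noise_def)
        then have "((\<lambda>s. simple_value (k * 2 ^ k) (\<lambda>j. real j / 2 ^ k) (\<lambda>j \<omega>. A 0 *v dyadic_euler A v k j \<omega>) s \<omega>)
            has_integral euler_integral A v 0 k t \<omega>) {0..t}"
          unfolding euler_integral_def using t by (auto intro!: simple_value_has_integral simp: divide_right_mono)
        then show ?thesis
          by (rule has_integral_spike_finite[rotated 2, where S="{0}"])
            (auto simp: euler_path_def simple_value_linear[OF matrix_vector_mul_linear])
      qed
      have "continuous_on {0..t} (\<lambda>s. A 0 *v euler_limit A v s \<omega>)"
      proof -
        have "continuous_on {0..t} (\<lambda>s. A 0 *v xx s)"
          by (rule continuous_on_compose2[OF matrix_vector_mult_linear_continuous_on continuous_on_subset[OF Cx]]) auto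
        then show ?thesis by (rule continuous_on_eq) (auto simp: x_eq)
      qed
      then have hx: "((\<lambda>s. A 0 *v euler_limit A v s \<omega>) has_integral integral {0..t} (\<lambda>s. A 0 *v euler_limit A v s \<omega>)) {0..t}"
        using integrable_continuous_real integrable_integral by blast
      have "(\<lambda>k. euler_integral A v 0 k t \<omega>) \<longlonglongrightarrow> integral {0..t} (\<lambda>s. A 0 *v euler_limit A v s \<omega>)"
      proof (rule LIMSEQ_I)
        fix e :: real assume e: "0 < e"
        \<comment> \<open>\<open>t + 1\<close> instead of \<open>t\<close> avoids a division by zero
          at \<open>t = 0\<close>.\<close>
        define e' where "e' = e / (2 * KA * (t + 1))"
        have e': "0 < e'" using e KA t by (simp add: e'_def)
        obtain k0 where k0: "\<And>k s. k0 \<le> k \<Longrightarrow> s \<in> {0..real K} \<Longrightarrow> dist (euler_path A v k s \<omega>) (xx s) < e'"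
          using uniform_limitD[OF Up e', of K] unfolding eventually_sequentially by blast
        show "\<exists>k0. \<forall>k\<ge>k0. norm (euler_integral A v 0 k t \<omega> - integral {0..t} (\<lambda>s. A 0 *v euler_limit A v s \<omega>)) < e"
        proof (intro exI allI impI)
          fix k assume k: "k0 \<le> k"
          have "norm (euler_integral A v 0 k t \<omega> - integral {0..t} (\<lambda>s. A 0 *v euler_limit A v s \<omega>)) \<le> (KA * e') * measure lborel {0..t}"
          proof (rule has_integral_bound_real[OF _ _ has_integral_diff[OF hi hx], of _ "{}"])
            fix s assume s: "s \<in> {0..t} - {}"
              have "norm (A 0 *v euler_path A v k s \<omega> - A 0 *v euler_limit A v s \<omega>) \<le> KA * norm (euler_path A v k s \<omega> - xx s)"
                using KA(2)[of 0 "euler_path A v k s \<omega> - xx s"] s by (simp add: matrix_vector_mult_diff_distrib x_eq)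
              also have "\<dots> \<le> KA * e'" using k0[OF k, of s] s K KA by (intro mult_left_mono) (auto simp: dist_norm)
              finally show "norm (A 0 *v euler_path A v k s \<omega> - A 0 *v euler_limit A v s \<omega>) \<le> KA * e'" .
          qed (use KA e' in auto)
          also have "KA * e' = e / (2 * (t + 1))" using KA by (simp add: e'_def)
          also have "e / (2 * (t + 1)) * measure lborel {0..t} = (e / 2) * (t / (t + 1))" using t by simp
          also have "\<dots> \<le> (e / 2) * 1" using t e by (intro mult_left_mono) auto
          also have "\<dots> < e" using e by simp
          finally show "norm (euler_integral A v 0 k t \<omega> - integral {0..t} (\<lambda>s. A 0 *v euler_limit A v s \<omega>)) < e" .
        qed
      qed
      then show ?thesis unfolding integral_limit_def by (rule limI)
    qed
    have "continuous_on {0..} (\<lambda>t. euler_limit A v t \<omega>)"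
      using Cx by (rule continuous_on_eq) (auto simp: x_eq)
    moreover have "uniform_limit {0..real K} (\<lambda>k t. euler_path A v k t \<omega>) (\<lambda>t. euler_limit A v t \<omega>) sequentially" for K :: nat
      using uniform_limit_cong'[of "{0..real K}" "\<lambda>k t. euler_path A v k t \<omega>" "\<lambda>k t. euler_path A v k t \<omega>" "\<lambda>t. euler_limit A v t \<omega>" xx sequentially] Up x_eq
      by auto
    ultimately show ?case using UI CI drift x_eq unfolding xx_def by blast
  qed
qed

lemma euler_path_progressive: "progressively_measurable F (euler_path A v k)"
  unfolding progressively_measurable_def
proof (intro allI impI)
  fix T :: real assume "0 \<le> T"
  have "progressively_measurable F (simple_value (k * 2 ^ k) (\<lambda>j. real j / 2 ^ k) (dyadic_euler A v k))"
    by (rule simple_value_progressive) (auto simp: divide_right_mono intro: L2F_measurable[OF dyadic_euler_L2F])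
  then have [measurable]: "(\<lambda>x. simple_value (k * 2 ^ k) (\<lambda>j. real j / 2 ^ k) (dyadic_euler A v k) (fst x) (snd x))
      \<in> borel_measurable (restrict_space borel {0..T} \<Otimes>\<^sub>M F T)"
    using \<open>0 \<le> T\<close> by (simp add: progressively_measurable_def case_prod_beta')
  have [measurable]: "(\<lambda>s. s) \<in> borel_measurable (restrict_space borel {0..T} :: real measure)"
    by (rule measurable_restrict_space1) simp
  show "(\<lambda>(s, \<omega>). euler_path A v k s \<omega>) \<in> borel_measurable (restrict_space borel {0..T} \<Otimes>\<^sub>M F T)"
    unfolding euler_path_def case_prod_beta' by measurable
qed

lemma euler_limit_progressive: "progressively_measurable F (euler_limit A v)"
  unfolding progressively_measurable_def
proof (intro allI impI)
  fix T :: real assume "0 \<le> T"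
  then have [measurable]: "(\<lambda>x. euler_path A v k (fst x) (snd x)) \<in> borel_measurable (restrict_space borel {0..T} \<Otimes>\<^sub>M F T)" for k
    using euler_path_progressive[of A v k] by (simp add: progressively_measurable_def case_prod_beta')
  show "(\<lambda>(s, \<omega>). euler_limit A v s \<omega>) \<in> borel_measurable (restrict_space borel {0..T} \<Otimes>\<^sub>M F T)"
    unfolding euler_limit_def case_prod_beta' by measurable
qed

lemma progressively_measurable_matrix:
  assumes "progressively_measurable F X"
  shows "progressively_measurable F (\<lambda>s \<omega>. (B :: real^'n^'m) *v X s \<omega>)"
  unfolding progressively_measurable_def case_prod_beta'
proof (intro allI impI)
  fix T :: real assume "0 \<le> T"
  then have "(\<lambda>x. X (fst x) (snd x)) \<in> borel_measurable (restrict_space borel {0..T} \<Otimes>\<^sub>M F T)"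
    using assms by (simp add: progressively_measurable_def case_prod_beta')
  then show "(\<lambda>x. B *v X (fst x) (snd x)) \<in> borel_measurable (restrict_space borel {0..T} \<Otimes>\<^sub>M F T)"
    by (rule measurable_compose) (intro borel_measurable_continuous_onI matrix_vector_mult_linear_continuous_on)
qed

end

text \<open>Time 0 is exempt because a simple integrand vanishes there while the process it
  approximates need not.\<close>

lemma set_nn_integral_le_const:
  assumes "\<And>s. s \<in> {0..T} - {0} \<Longrightarrow> f s \<le> ennreal c" "0 \<le> T" "0 \<le> c"
  shows "(\<integral>\<^sup>+s\<in>{0..T}. f s \<partial>lborel) \<le> ennreal (c * T)"
proof -
  have "(\<integral>\<^sup>+s\<in>{0..T}. f s \<partial>lborel) \<le> (\<integral>\<^sup>+s. ennreal c * indicator {0..T} s \<partial>lborel)"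
  proof (rule nn_integral_mono_AE)
    show "AE s in lborel. f s * indicator {0..T} s \<le> ennreal c * indicator {0..T} s"
      using AE_lborel_singleton[of "0::real"]
      by eventually_elim (use assms(1) in \<open>auto simp: indicator_def\<close>)
  qed
  also have "\<dots> = ennreal c * ennreal T"
    using assms by (subst nn_integral_cmult_indicator) auto
  finally show ?thesis using assms by (simp add: ennreal_mult)
qed

section \<open>The limit of the dyadic schemes as a solution, and contraction of the schemes\<close>

context independent_wiener_processes
begin

text \<open>Both limits demanded by \<open>is_ito_integral\<close> are proved almost surely, where
  they follow from the uniform convergence of paths and integrals, and then weakened to limits in
  probability. The obstacle is that the Euler coefficients are unbounded.\<close>

lemma integral_limit_is_ito:
  fixes A :: "nat \<Rightarrow> real^'n^'n"
  assumes i: "i \<in> {1..N}"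
  shows "is_ito_integral M F (W i) (\<lambda>s \<omega>. A i *v euler_limit A v s \<omega>) (integral_limit A v i)"
proof -
  have iN: "i \<le> N" using i by simp
  let ?X = "\<lambda>s \<omega>. A i *v euler_limit A v s \<omega>"
  let ?m = "\<lambda>k::nat. k * 2 ^ k" and ?\<tau> = "\<lambda>k j. real j / 2 ^ k"
  let ?\<xi> = "\<lambda>k j \<omega>. A i *v dyadic_euler A v k j \<omega>"
  obtain KA where KA: "0 < KA" "\<And>i v. i \<le> N \<Longrightarrow> norm (A i *v v) \<le> KA * norm v"
    by (rule matrix_family_bound[of N A]) (rule that; blast)
  have \<xi>: "L2F (?\<tau> k j) (?\<xi> k j)" for k j by (intro L2F_matrix dyadic_euler_L2F)
  have prog: "progressively_measurable F ?X" by (intro progressively_measurable_matrix euler_limit_progressive)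
  \<comment> \<open>Finitely many finite random variables have a common bound up to small
    probability.\<close>
  have R_ex: "\<exists>R::nat. prob {\<omega>\<in>space M. \<exists>j<?m k. real R < norm (?\<xi> k j \<omega>)} < (1/2) ^ k" for k
  proof -
    have [measurable]: "?\<xi> k j \<in> borel_measurable M" for j using L2F_borel[OF \<xi>] .
    have "(\<lambda>R. prob {\<omega>\<in>space M. \<exists>j<?m k. real R < norm (?\<xi> k j \<omega>)}) \<longlonglongrightarrow> 0"
    proof (rule prob_tendsto_zero_of_AE_eventually)
      show "{\<omega>\<in>space M. \<exists>j<?m k. real R < norm (?\<xi> k j \<omega>)} \<in> events" for R by measurable
      show "AE \<omega> in M. eventually (\<lambda>R. \<omega> \<notin> {\<omega>\<in>space M. \<exists>j<?m k. real R < norm (?\<xi> k j \<omega>)}) sequentially"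
      proof (rule AE_I2)
        fix \<omega>
        obtain R0 :: nat where R0: "(\<Sum>j<?m k. norm (?\<xi> k j \<omega>)) \<le> real R0" using real_arch_simple by blast
        have "norm (?\<xi> k j \<omega>) \<le> real R" if "R0 \<le> R" "j < ?m k" for R j
          using member_le_sum[of j "{..<?m k}" "\<lambda>j. norm (?\<xi> k j \<omega>)"] that R0 by simp
        then show "eventually (\<lambda>R. \<omega> \<notin> {\<omega>\<in>space M. \<exists>j<?m k. real R < norm (?\<xi> k j \<omega>)}) sequentially"
          unfolding eventually_sequentially
        proof (intro exI[of _ R0] allI impI notI)
          fix R assume le: "\<And>R j. R0 \<le> R \<Longrightarrow> j < ?m k \<Longrightarrow> norm (?\<xi> k j \<omega>) \<le> real R" and R: "R0 \<le> R"
            and "\<omega> \<in> {\<omega>\<in>space M. \<exists>j<?m k. real R < norm (?\<xi> k j \<omega>)}"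
          then obtain j where j: "j < ?m k" "real R < norm (?\<xi> k j \<omega>)" by blast
          show False using le[OF R j(1)] j(2) by linarith
        qed
      qed
    qed
    from order_tendstoD(2)[OF this, of "(1/2) ^ k"]
    have "eventually (\<lambda>R. prob {\<omega>\<in>space M. \<exists>j<?m k. real R < norm (?\<xi> k j \<omega>)} < (1/2) ^ k) sequentially" by simp
    from eventually_happens[OF this] show ?thesis by simp
  qed
  then obtain R :: "nat \<Rightarrow> nat" where R: "\<And>k. prob {\<omega>\<in>space M. \<exists>j<?m k. real (R k) < norm (?\<xi> k j \<omega>)} < (1/2) ^ k"
    using choice[of "\<lambda>k R. prob {\<omega>\<in>space M. \<exists>j<?m k. real R < norm (?\<xi> k j \<omega>)} < (1/2) ^ k"] by blast
  \<comment> \<open>Simple integrands have to be bounded; the truncation is inactive outside an event of probability \<open>2\<^sup>-\<^sup>k\<close>.\<close>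
  define \<zeta> where "\<zeta> k j \<omega> = indicator {\<omega>\<in>space M. norm (?\<xi> k j \<omega>) \<le> real (R k)} \<omega> *\<^sub>R ?\<xi> k j \<omega>" for k j \<omega>
  have \<zeta>_meas: "\<zeta> k j \<in> borel_measurable (F (?\<tau> k j))" for k j
  proof -
    have [measurable]: "?\<xi> k j \<in> borel_measurable (F (?\<tau> k j))" using L2F_measurable[OF \<xi>] .
    have "{\<omega>\<in>space (F (?\<tau> k j)). norm (?\<xi> k j \<omega>) \<le> real (R k)} \<in> sets (F (?\<tau> k j))" by measurable
    then have [measurable]: "{\<omega>\<in>space M. norm (?\<xi> k j \<omega>) \<le> real (R k)} \<in> sets (F (?\<tau> k j))" by simp
    show ?thesis unfolding \<zeta>_def[abs_def] by measurable
  qed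
  have simple: "simple_integrand M F (?m k) (?\<tau> k) (\<zeta> k)" for k
  proof -
    have "norm (\<zeta> k j \<omega>) \<le> real (R k)" for j \<omega> by (simp add: \<zeta>_def indicator_def)
    then have "bounded (\<zeta> k j ` space M)" for j by (intro boundedI[where B="real (R k)"]) auto
    then show ?thesis using \<zeta>_meas by (auto simp: simple_integrand_def divide_strict_right_mono)
  qed
  have noclip: "AE \<omega> in M. eventually (\<lambda>k. \<forall>j<?m k. \<zeta> k j \<omega> = ?\<xi> k j \<omega>) sequentially"
  proof -
    have [measurable]: "?\<xi> k j \<in> borel_measurable M" for k j using L2F_borel[OF \<xi>] .
    have "AE \<omega> in M. eventually (\<lambda>k. \<omega> \<in> space M - {\<omega>\<in>space M. \<exists>j<?m k. real (R k) < norm (?\<xi> k j \<omega>)}) sequentially"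
    proof (rule borel_cantelli_AE1)
      show "summable (\<lambda>k. prob {\<omega>\<in>space M. \<exists>j<?m k. real (R k) < norm (?\<xi> k j \<omega>)})"
        by (rule summable_comparison_test'[where g="\<lambda>n. (1/2) ^ n" and N=0])
          (auto intro!: summable_geometric less_imp_le[OF R])
    qed (auto simp: less_top[symmetric])
    then show ?thesis
    proof eventually_elim
      case (elim \<omega>)
      then show ?case
      proof eventually_elim
        case (elim k)
        have "norm (?\<xi> k j \<omega>) \<le> real (R k)" if "j < ?m k" for j
          using elim that not_less by blast
        then show ?case using elim by (simp add: \<zeta>_def)
      qed
    qed
  qed
  have conv: "AE \<omega> in M. (\<lambda>k. simple_integral (W i) (?m k) (?\<tau> k) (\<zeta> k) t \<omega>) \<longlonglongrightarrow> integral_limit A v i t \<omega>" if t: "0 \<le> t" for t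
    using noclip AE_uniform_limits[of A v]
  proof eventually_elim
    case (elim \<omega>)
    obtain K :: nat where "t \<le> real K" using real_arch_simple by blast
    then have lim: "(\<lambda>k. euler_integral A v i k t \<omega>) \<longlonglongrightarrow> integral_limit A v i t \<omega>"
    proof -
      have "uniform_limit {0..real K} (\<lambda>k t. euler_integral A v i k t \<omega>) (\<lambda>t. integral_limit A v i t \<omega>) sequentially"
        using elim(2) iN by blast
      from tendsto_uniform_limitI[OF this, of t] show ?thesis using t \<open>t \<le> real K\<close> by simp
    qed
    have "eventually (\<lambda>k. euler_integral A v i k t \<omega> = simple_integral (W i) (?m k) (?\<tau> k) (\<zeta> k) t \<omega>) sequentially"
      using elim(1)
    proof eventually_elim
      case (elim k)
      then show ?case using i by (auto simp: euler_integral_def simple_integral_def drift_or_noise_def intro!: sum.cong)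
    qed
    then show ?case using lim by (rule Lim_transform_eventually[rotated])
  qed
  have convX: "AE \<omega> in M. \<forall>e>0. eventually (\<lambda>k. (\<integral>\<^sup>+s\<in>{0..T}.
      ennreal ((norm (simple_value (?m k) (?\<tau> k) (\<zeta> k) s \<omega> - ?X s \<omega>))\<^sup>2) \<partial>lborel) \<le> ennreal e) sequentially"
    if T: "0 \<le> T" for T
    using noclip AE_uniform_limits[of A v]
  proof eventually_elim
    case (elim \<omega>)
    show ?case
    proof (intro allI impI)
      fix e :: real assume e: "0 < e"
      obtain K :: nat where K: "T \<le> real K" using real_arch_simple by blast
      \<comment> \<open>Chosen so that \<open>(KA * d)\<^sup>2 * T\<close> equals
        \<open>e * (T / (T + 1))\<close>, which is at most \<open>e\<close> and makes sense for
        \<open>T = 0\<close> too.\<close>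
      define d where "d = sqrt (e / (T + 1)) / KA"
      have d: "0 < d" using e T KA by (simp add: d_def)
      have "eventually (\<lambda>k. \<forall>t\<in>{0..real K}. dist (euler_path A v k t \<omega>) (euler_limit A v t \<omega>) < d) sequentially"
      proof -
        have "uniform_limit {0..real K} (\<lambda>k t. euler_path A v k t \<omega>) (\<lambda>t. euler_limit A v t \<omega>) sequentially"
          using elim(2) by blast
        from uniform_limitD[OF this d] show ?thesis .
      qed
      then show "eventually (\<lambda>k. (\<integral>\<^sup>+s\<in>{0..T}.
          ennreal ((norm (simple_value (?m k) (?\<tau> k) (\<zeta> k) s \<omega> - ?X s \<omega>))\<^sup>2) \<partial>lborel) \<le> ennreal e) sequentially"
        using elim(1)
      proof eventually_elim
        case (elim k)
        have "(\<integral>\<^sup>+s\<in>{0..T}. ennreal ((norm (simple_value (?m k) (?\<tau> k) (\<zeta> k) s \<omega> - ?X s \<omega>))\<^sup>2) \<partial>lborel)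
            \<le> ennreal ((KA * d)\<^sup>2 * T)"
        proof (rule set_nn_integral_le_const)
          fix s assume s: "s \<in> {0..T} - {0}"
          have "simple_value (?m k) (?\<tau> k) (\<zeta> k) s \<omega> = simple_value (?m k) (?\<tau> k) (?\<xi> k) s \<omega>"
            unfolding simple_value_def using elim(2) by (intro sum.cong) auto
          also have "\<dots> = A i *v euler_path A v k s \<omega>"
            using s by (simp add: simple_value_linear[OF matrix_vector_mul_linear] euler_path_def)
          finally have "norm (simple_value (?m k) (?\<tau> k) (\<zeta> k) s \<omega> - ?X s \<omega>) \<le> KA * norm (euler_path A v k s \<omega> - euler_limit A v s \<omega>)"
            using KA(2)[OF iN] by (simp add: matrix_vector_mult_diff_distrib[symmetric])
          also have "\<dots> \<le> KA * d"
            using elim(1) s K KA by (intro mult_left_mono) (auto simp: dist_norm intro: less_imp_le)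
          finally show "ennreal ((norm (simple_value (?m k) (?\<tau> k) (\<zeta> k) s \<omega> - ?X s \<omega>))\<^sup>2) \<le> ennreal ((KA * d)\<^sup>2)"
            by (intro ennreal_leI power_mono) auto
        qed (use T in auto)
        also have "(KA * d)\<^sup>2 * T = e * (T / (T + 1))" using KA e T by (simp add: d_def)
        also have "ennreal \<dots> \<le> ennreal (e * 1)" using e T by (intro ennreal_leI mult_left_mono) auto
        finally show ?case by simp
      qed
    qed
  qed
  have sq: "AE \<omega> in M. (\<integral>\<^sup>+s\<in>{0..T}. ennreal ((norm (?X s \<omega>))\<^sup>2) \<partial>lborel) < \<infinity>" if T: "0 \<le> T" for T
    using AE_uniform_limits[of A v]
  proof eventually_elim
    case (elim \<omega>)
    have "continuous_on {0..T} (\<lambda>s. ?X s \<omega>)"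
      by (rule continuous_on_compose2[OF matrix_vector_mult_linear_continuous_on continuous_on_subset[of "{0..}"]])
        (use elim in auto)
    then have "bounded ((\<lambda>s. ?X s \<omega>) ` {0..T})" by (intro compact_imp_bounded compact_continuous_image) auto
    then obtain B where B: "\<And>s. s \<in> {0..T} \<Longrightarrow> norm (?X s \<omega>) \<le> B"
      unfolding bounded_iff by blast
    have "(\<integral>\<^sup>+s\<in>{0..T}. ennreal ((norm (?X s \<omega>))\<^sup>2) \<partial>lborel) \<le> ennreal (B\<^sup>2 * T)"
      by (rule set_nn_integral_le_const) (use B T in \<open>auto intro!: ennreal_leI power_mono\<close>)
    then show ?case by (rule le_less_trans) simp
  qed
  have ad: "integral_limit A v i t \<in> borel_measurable (F t)" if "0 \<le> t" for t
    unfolding integral_limit_def[abs_def] using euler_integral_measurable[OF iN that] by measurable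
  have ct: "AE \<omega> in M. continuous_on {0..} (\<lambda>t. integral_limit A v i t \<omega>)"
    using AE_uniform_limits[of A v] by eventually_elim (use iN in auto)
  have p1: "(\<lambda>k. prob {\<omega>\<in>space M. (\<integral>\<^sup>+s\<in>{0..T}. ennreal ((norm (simple_value (?m k) (?\<tau> k) (\<zeta> k) s \<omega> - ?X s \<omega>))\<^sup>2) \<partial>lborel)
      > ennreal e}) \<longlonglongrightarrow> 0" if T: "0 \<le> T" and e: "0 < e" for T e
  proof (rule prob_tendsto_zero_of_AE_eventually)
    fix k
    have "progressively_measurable F (simple_value (?m k) (?\<tau> k) (\<zeta> k))"
      by (rule simple_value_progressive) (auto simp: divide_right_mono \<zeta>_meas)
    from borel_measurable_square_integral[OF this prog T]
    show "{\<omega>\<in>space M. (\<integral>\<^sup>+s\<in>{0..T}. ennreal ((norm (simple_value (?m k) (?\<tau> k) (\<zeta> k) s \<omega> - ?X s \<omega>))\<^sup>2) \<partial>lborel)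
      > ennreal e} \<in> events" by measurable
  next
    show "AE \<omega> in M. eventually (\<lambda>k. \<omega> \<notin> {\<omega>\<in>space M. (\<integral>\<^sup>+s\<in>{0..T}. ennreal ((norm (simple_value (?m k) (?\<tau> k) (\<zeta> k) s \<omega> - ?X s \<omega>))\<^sup>2) \<partial>lborel)
      > ennreal e}) sequentially"
      using convX[OF T] by eventually_elim (use e in \<open>auto elim!: eventually_mono simp: not_less\<close>)
  qed
  have p2: "(\<lambda>k. prob {\<omega>\<in>space M. norm (simple_integral (W i) (?m k) (?\<tau> k) (\<zeta> k) t \<omega> - integral_limit A v i t \<omega>) > e}) \<longlonglongrightarrow> 0"
    if t: "0 \<le> t" and e: "0 < e" for t e
  proof (rule prob_tendsto_zero_of_AE_eventually)
    fix k
    have [measurable]: "simple_integral (W i) (?m k) (?\<tau> k) (\<zeta> k) t \<in> borel_measurable M"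
      by (rule measurable_FM[OF t simple_integral_adapted]) (use t in \<open>auto simp: divide_right_mono \<zeta>_meas adapted[OF i]\<close>)
    have [measurable]: "integral_limit A v i t \<in> borel_measurable M"
      unfolding integral_limit_def[abs_def] using measurable_FM[OF t euler_integral_measurable[OF iN t]] by measurable
    show "{\<omega>\<in>space M. norm (simple_integral (W i) (?m k) (?\<tau> k) (\<zeta> k) t \<omega> - integral_limit A v i t \<omega>) > e} \<in> events"
      by measurable
  next
    show "AE \<omega> in M. eventually (\<lambda>k. \<omega> \<notin> {\<omega>\<in>space M. norm (simple_integral (W i) (?m k) (?\<tau> k) (\<zeta> k) t \<omega> - integral_limit A v i t \<omega>) > e}) sequentially"
      using conv[OF t]
    proof eventually_elim
      case (elim \<omega>)
      from tendstoD[OF this e] show ?case by eventually_elim (auto simp: dist_norm)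
    qed
  qed
  show ?thesis
    unfolding is_ito_integral_def
    by (intro conjI allI impI exI[of _ ?m] exI[of _ ?\<tau>] exI[of _ \<zeta>] prog sq ad ct simple p1 p2)
qed

lemma max_delay_zero: "1 \<le> N \<Longrightarrow> max_delay N (\<lambda>_. 0) = 0"
  by (simp add: max_delay_def)

lemma euler_limit_solution:
  fixes A :: "nat \<Rightarrow> real^'n^'n"
  assumes N: "1 \<le> N"
  shows "sdde_solution M F N W A (\<lambda>_. 0) (\<lambda>_ _. v) (euler_limit A v)"
  unfolding sdde_solution_def max_delay_zero[OF N]
proof (intro conjI exI[of _ "integral_limit A v"])
  show "\<forall>t\<ge>0. euler_limit A v t \<in> borel_measurable (F t)"
    using progressive_adapted[OF euler_limit_progressive] by auto
  show "AE \<omega> in M. continuous_on {- 0..} (\<lambda>t. euler_limit A v t \<omega>)"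
    using AE_uniform_limits[of A v] by eventually_elim simp
  have x0: "euler_limit A v 0 \<omega> = v" for \<omega> by (simp add: euler_limit_def euler_path_def)
  then show "AE \<omega> in M. \<forall>s\<in>{- 0..0}. euler_limit A v s \<omega> = v" by simp
  show "\<forall>i\<in>{1..N}. is_ito_integral M F (W i) (\<lambda>s \<omega>. A i *v euler_limit A v (s - 0) \<omega>) (integral_limit A v i)"
    unfolding diff_zero by (intro ballI integral_limit_is_ito)
  have "{..N} = insert 0 {1..N}" by auto
  then have split: "(\<Sum>i\<le>N. integral_limit A v i t \<omega>) = integral_limit A v 0 t \<omega> + (\<Sum>i=1..N. integral_limit A v i t \<omega>)" for t \<omega>
    by simp
  show "AE \<omega> in M. \<forall>t\<ge>0. euler_limit A v t \<omega> = euler_limit A v 0 \<omega> + integral {0..t} (\<lambda>s. A 0 *v euler_limit A v s \<omega>)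
      + (\<Sum>i=1..N. integral_limit A v i t \<omega>)"
    using AE_uniform_limits[of A v] by eventually_elim (auto simp: x0 split add.assoc)
qed

text \<open>Fatou as the finer level in \<open>euler_path_cauchy\<close> tends to infinity. The
  nonnegative integral is used since the limit is not known to be square integrable.\<close>

lemma euler_limit_distance:
  fixes A :: "nat \<Rightarrow> real^'n^'n" and K :: nat
  assumes K: "0 < K"
  obtains C where "0 < C" "\<And>k. K \<le> k \<Longrightarrow>
    (\<integral>\<^sup>+\<omega>. ennreal ((norm (euler_limit A v (real K) \<omega> - dyadic_euler A v k (dyadic_cell k (real K)) \<omega>))\<^sup>2) \<partial>M) \<le> ennreal (C / 2 ^ k)"
proof -
  obtain C where C: "0 < C" "\<And>k l s. K \<le> k \<Longrightarrow> k \<le> l \<Longrightarrow> 0 < s \<Longrightarrow> s \<le> real K \<Longrightarrow>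
    expectation (\<lambda>\<omega>. (norm (euler_path A v l s \<omega> - euler_path A v k s \<omega>))\<^sup>2) \<le> C / 2 ^ k"
    by (rule euler_path_cauchy[of K A v]) (rule that; blast)
  show thesis
  proof (rule that[OF C(1)])
    fix k assume k: "K \<le> k"
    let ?s = "real K"
    have s: "0 < ?s" using K by simp
    have path: "euler_path A v l ?s = dyadic_euler A v l (dyadic_cell l ?s)" if "K \<le> l" for l
      using euler_path_eq[OF s, of l] that by auto
    have L2: "L2F ?s (euler_path A v l ?s)" if "K \<le> l" for l
      unfolding path[OF that] using L2F_mono[OF dyadic_euler_L2F less_imp_le[OF dyadic_cell(1)[OF s]]] .
    have [measurable]: "euler_path A v l ?s \<in> borel_measurable M" for l
      by (rule measurable_FM[OF _ progressive_adapted[OF euler_path_progressive]]) (use s in auto)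
    have "AE \<omega> in M. ennreal ((norm (euler_limit A v ?s \<omega> - euler_path A v k ?s \<omega>))\<^sup>2)
        = liminf (\<lambda>l. ennreal ((norm (euler_path A v (l + k) ?s \<omega> - euler_path A v k ?s \<omega>))\<^sup>2))"
      using AE_uniform_limits[of A v]
    proof eventually_elim
      case (elim \<omega>)
      then have "uniform_limit {0..real K} (\<lambda>k t. euler_path A v k t \<omega>) (\<lambda>t. euler_limit A v t \<omega>) sequentially"
        by blast
      from tendsto_uniform_limitI[OF this, of ?s]
      have "(\<lambda>l. euler_path A v l ?s \<omega>) \<longlonglongrightarrow> euler_limit A v ?s \<omega>" by simp
      then have "(\<lambda>l. ennreal ((norm (euler_path A v (l + k) ?s \<omega> - euler_path A v k ?s \<omega>))\<^sup>2))
          \<longlonglongrightarrow> ennreal ((norm (euler_limit A v ?s \<omega> - euler_path A v k ?s \<omega>))\<^sup>2)"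
        by (intro tendsto_intros LIMSEQ_ignore_initial_segment)
      from lim_imp_Liminf[OF sequentially_bot this] show ?case by (rule sym)
    qed
    then have "(\<integral>\<^sup>+\<omega>. ennreal ((norm (euler_limit A v ?s \<omega> - euler_path A v k ?s \<omega>))\<^sup>2) \<partial>M)
        = (\<integral>\<^sup>+\<omega>. liminf (\<lambda>l. ennreal ((norm (euler_path A v (l + k) ?s \<omega> - euler_path A v k ?s \<omega>))\<^sup>2)) \<partial>M)"
      by (rule nn_integral_cong_AE)
    also have "\<dots> \<le> liminf (\<lambda>l. \<integral>\<^sup>+\<omega>. ennreal ((norm (euler_path A v (l + k) ?s \<omega> - euler_path A v k ?s \<omega>))\<^sup>2) \<partial>M)"
      by (rule nn_integral_liminf) measurable
    also have "\<dots> \<le> liminf (\<lambda>l::nat. ennreal (C / 2 ^ k))"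
    proof (rule Liminf_mono, rule always_eventually, rule allI)
      fix l
      have "(\<integral>\<^sup>+\<omega>. ennreal ((norm (euler_path A v (l + k) ?s \<omega> - euler_path A v k ?s \<omega>))\<^sup>2) \<partial>M)
          = ennreal (expectation (\<lambda>\<omega>. (norm (euler_path A v (l + k) ?s \<omega> - euler_path A v k ?s \<omega>))\<^sup>2))"
        using k by (intro nn_integral_eq_integral L2F_integrable[OF L2F_diff[OF L2 L2]]) auto
      also have "\<dots> \<le> ennreal (C / 2 ^ k)" using C(2)[OF k _ s, of "l + k"] by (intro ennreal_leI) simp
      finally show "(\<integral>\<^sup>+\<omega>. ennreal ((norm (euler_path A v (l + k) ?s \<omega> - euler_path A v k ?s \<omega>))\<^sup>2) \<partial>M) \<le> ennreal (C / 2 ^ k)" .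
    qed
    also have "\<dots> = ennreal (C / 2 ^ k)" by (rule Liminf_const) simp
    finally show "(\<integral>\<^sup>+\<omega>. ennreal ((norm (euler_limit A v ?s \<omega> - dyadic_euler A v k (dyadic_cell k ?s) \<omega>))\<^sup>2) \<partial>M) \<le> ennreal (C / 2 ^ k)"
      unfolding path[OF k] .
  qed
qed

text \<open>The hypothesis supplies a time \<open>K\<close> at which the solutions started at the
  unit vectors are small, and convergence at this fixed time supplies the level \<open>k\<close>.
  With second moments of solution and distance at most \<open>1 / (8 * d)\<close>, \<open>d\<close>
  the dimension, the scheme has at most \<open>1 / (2 * d)\<close>, and the sum over the unit
  vectors is one half.\<close>

lemma euler_contraction_of_stability:
  fixes A :: "nat \<Rightarrow> real^'n^'n"
  assumes N: "1 \<le> N" and stable: "mean_square_exponentially_stable M F N W A (\<lambda>_. 0)"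
  obtains \<delta> n where "0 < \<delta>"
    "\<And>u. (\<Sum>b\<in>Basis. expectation (\<lambda>\<omega>. (u \<bullet> euler0 A b \<delta> n \<omega>)\<^sup>2)) \<le> (norm u)\<^sup>2 / 2"
proof -
  obtain \<alpha> \<beta> where \<alpha>: "0 < \<alpha>" and \<beta>: "1 < \<beta>" and st: "\<And>\<phi> x t. initial_condition M F 0 \<phi> \<Longrightarrow> sdde_solution M F N W A (\<lambda>_. 0) \<phi> x \<Longrightarrow> 0 \<le> t \<Longrightarrow>
      (\<integral>\<^sup>+\<omega>. ennreal ((norm (x t \<omega>))\<^sup>2) \<partial>M) \<le> ennreal (\<beta> * exp (- \<alpha> * t)) * (\<integral>\<^sup>+\<omega>. ennreal (SUP s\<in>{- 0..0}. (norm (\<phi> s \<omega>))\<^sup>2) \<partial>M)"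
    using stable unfolding mean_square_exponentially_stable_def max_delay_zero[OF N] by blast
  let ?d = "real DIM(real^'n)"
  have d: "0 < ?d" by simp
  have "((\<lambda>K. \<beta> * exp (- \<alpha> * real K)) \<longlongrightarrow> \<beta> * 0) sequentially"
  proof (intro tendsto_mult tendsto_const)
    have "(\<lambda>K. exp (- \<alpha>) ^ K) \<longlonglongrightarrow> 0" using \<alpha> by (intro LIMSEQ_power_zero) simp
    then show "(\<lambda>K. exp (- \<alpha> * real K)) \<longlonglongrightarrow> 0" by (simp add: exp_of_nat_mult[symmetric] mult.commute)
  qed
  then have "eventually (\<lambda>K. \<beta> * exp (- \<alpha> * real K) < 1 / (8 * ?d)) sequentially"
    using order_tendstoD(2)[of _ "\<beta> * 0" _ "1 / (8 * ?d)"] d by simp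
  then have "eventually (\<lambda>K. 0 < K \<and> \<beta> * exp (- \<alpha> * real K) < 1 / (8 * ?d)) sequentially"
    using eventually_gt_at_top[of "0::nat"] by eventually_elim simp
  then obtain K where K: "0 < K" "\<beta> * exp (- \<alpha> * real K) < 1 / (8 * ?d)"
    by (auto simp: eventually_sequentially)
  have xK: "(\<integral>\<^sup>+\<omega>. ennreal ((norm (euler_limit A b (real K) \<omega>))\<^sup>2) \<partial>M) \<le> ennreal (1 / (8 * ?d))" if b: "b \<in> Basis" for b :: "real^'n"
  proof -
    have "initial_condition M F 0 (\<lambda>_ _. b)" by (simp add: initial_condition_def)
    then have "(\<integral>\<^sup>+\<omega>. ennreal ((norm (euler_limit A b (real K) \<omega>))\<^sup>2) \<partial>M)
        \<le> ennreal (\<beta> * exp (- \<alpha> * real K)) * (\<integral>\<^sup>+\<omega>. ennreal (SUP s\<in>{- 0..0::real}. (norm b)\<^sup>2) \<partial>M)"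
      by (rule st[OF _ euler_limit_solution[OF N]]) simp
    also have "\<dots> = ennreal (\<beta> * exp (- \<alpha> * real K))" using b by (simp add: emeasure_space_1)
    also have "\<dots> \<le> ennreal (1 / (8 * ?d))" using K by (intro ennreal_leI) simp
    finally show ?thesis .
  qed
  have "eventually (\<lambda>k. \<forall>b\<in>Basis. expectation (\<lambda>\<omega>. (norm (dyadic_euler A b k (dyadic_cell k (real K)) \<omega>))\<^sup>2) \<le> 1 / (2 * ?d)) sequentially"
  proof (rule eventually_ball_finite)
    show "\<forall>b\<in>Basis. eventually (\<lambda>k. expectation (\<lambda>\<omega>. (norm (dyadic_euler A b k (dyadic_cell k (real K)) \<omega>))\<^sup>2) \<le> 1 / (2 * ?d)) sequentially"
    proof
      fix b :: "real^'n" assume b: "b \<in> Basis"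
      obtain C where C: "0 < C" "\<And>k. K \<le> k \<Longrightarrow>
        (\<integral>\<^sup>+\<omega>. ennreal ((norm (euler_limit A b (real K) \<omega> - dyadic_euler A b k (dyadic_cell k (real K)) \<omega>))\<^sup>2) \<partial>M) \<le> ennreal (C / 2 ^ k)"
        by (rule euler_limit_distance[OF K(1), of A b]) (rule that; blast)
      have "(\<lambda>k. C * (1/2) ^ k) \<longlonglongrightarrow> C * 0" by (intro tendsto_mult tendsto_const LIMSEQ_power_zero) simp
      then have "eventually (\<lambda>k. C * (1/2) ^ k < 1 / (8 * ?d)) sequentially"
        using order_tendstoD(2)[of _ "C * 0" _ "1 / (8 * ?d)"] d by simp
      then show "eventually (\<lambda>k. expectation (\<lambda>\<omega>. (norm (dyadic_euler A b k (dyadic_cell k (real K)) \<omega>))\<^sup>2) \<le> 1 / (2 * ?d)) sequentially"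
        using eventually_ge_at_top[of K]
      proof eventually_elim
        case (elim k)
        let ?X = "euler_limit A b (real K)" and ?Y = "dyadic_euler A b k (dyadic_cell k (real K))"
        have [measurable]: "?X \<in> borel_measurable M"
          by (rule measurable_FM[OF _ progressive_adapted[OF euler_limit_progressive]]) auto
        have [measurable]: "?Y \<in> borel_measurable M" using L2F_borel[OF dyadic_euler_L2F] .
        have "ennreal (expectation (\<lambda>\<omega>. (norm (?Y \<omega>))\<^sup>2)) = (\<integral>\<^sup>+\<omega>. ennreal ((norm (?Y \<omega>))\<^sup>2) \<partial>M)"
          by (rule nn_integral_eq_integral[symmetric]) (auto intro: L2F_integrable[OF dyadic_euler_L2F])
        also have "\<dots> \<le> (\<integral>\<^sup>+\<omega>. 2 * ennreal ((norm (?X \<omega>))\<^sup>2) + 2 * ennreal ((norm (?X \<omega> - ?Y \<omega>))\<^sup>2) \<partial>M)"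
        proof (rule nn_integral_mono)
          fix \<omega>
          have "(norm (?Y \<omega>))\<^sup>2 \<le> 2 * (norm (?X \<omega>))\<^sup>2 + 2 * (norm (?X \<omega> - ?Y \<omega>))\<^sup>2"
            using norm_add_square_le_double[of "?X \<omega>" "?Y \<omega> - ?X \<omega>"] by (simp add: norm_minus_commute)
          then have "ennreal ((norm (?Y \<omega>))\<^sup>2) \<le> ennreal (2 * (norm (?X \<omega>))\<^sup>2 + 2 * (norm (?X \<omega> - ?Y \<omega>))\<^sup>2)"
            by (rule ennreal_leI)
          then show "ennreal ((norm (?Y \<omega>))\<^sup>2) \<le> 2 * ennreal ((norm (?X \<omega>))\<^sup>2) + 2 * ennreal ((norm (?X \<omega> - ?Y \<omega>))\<^sup>2)"
            by (simp add: ennreal_plus ennreal_mult)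
        qed
        also have "\<dots> = 2 * (\<integral>\<^sup>+\<omega>. ennreal ((norm (?X \<omega>))\<^sup>2) \<partial>M) + 2 * (\<integral>\<^sup>+\<omega>. ennreal ((norm (?X \<omega> - ?Y \<omega>))\<^sup>2) \<partial>M)"
          by (simp add: nn_integral_add nn_integral_cmult)
        also have "\<dots> \<le> 2 * ennreal (1 / (8 * ?d)) + 2 * ennreal (1 / (8 * ?d))"
        proof (intro add_mono mult_left_mono)
          show "(\<integral>\<^sup>+\<omega>. ennreal ((norm (?X \<omega>))\<^sup>2) \<partial>M) \<le> ennreal (1 / (8 * ?d))" by (rule xK[OF b])
          have "C / 2 ^ k \<le> 1 / (8 * ?d)" using elim(1) by (simp add: power_divide)
          then show "(\<integral>\<^sup>+\<omega>. ennreal ((norm (?X \<omega> - ?Y \<omega>))\<^sup>2) \<partial>M) \<le> ennreal (1 / (8 * ?d))"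
            using C(2)[OF elim(2)] by (meson ennreal_leI order_trans)
        qed auto
        also have "\<dots> = ennreal (2 * (1 / (8 * ?d)) + 2 * (1 / (8 * ?d)))"
        proof -
          have two: "2 * ennreal x = ennreal (2 * x)" if "0 \<le> x" for x using that by (simp add: ennreal_mult)
          have nn: "0 \<le> 1 / (8 * ?d)" using d by simp
          show ?thesis unfolding two[OF nn] by (rule ennreal_plus[symmetric]) auto
        qed
        also have "2 * (1 / (8 * ?d)) + 2 * (1 / (8 * ?d)) = 1 / (2 * ?d)" using d by (simp add: field_simps)
        finally show ?case using d by (simp add: ennreal_le_iff)
      qed
    qed
  qed simp
  then obtain k where k: "\<And>b. b \<in> Basis \<Longrightarrow> expectation (\<lambda>\<omega>. (norm (dyadic_euler A b k (dyadic_cell k (real K)) \<omega>))\<^sup>2) \<le> 1 / (2 * ?d)"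
    by (auto simp: eventually_sequentially)
  show thesis
  proof (rule that)
    show "0 < (1 / 2 ^ k :: real)" by simp
    fix u :: "real^'n"
    \<comment> \<open>This is \<open>K * 2 ^ k - 1\<close>: cells are open on the left, so at time
      \<open>K\<close> the path still shows the node before it.\<close>
    let ?n = "dyadic_cell k (real K)"
    have "(\<Sum>b\<in>Basis. expectation (\<lambda>\<omega>. (u \<bullet> dyadic_euler A b k ?n \<omega>)\<^sup>2)) \<le> (\<Sum>b\<in>(Basis :: (real^'n) set). (norm u)\<^sup>2 * (1 / (2 * ?d)))"
    proof (rule sum_mono)
      fix b :: "real^'n" assume b: "b \<in> Basis"
      have "expectation (\<lambda>\<omega>. (u \<bullet> dyadic_euler A b k ?n \<omega>)\<^sup>2) \<le> expectation (\<lambda>\<omega>. (norm u)\<^sup>2 * (norm (dyadic_euler A b k ?n \<omega>))\<^sup>2)"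
      proof (rule integral_mono)
        show "integrable M (\<lambda>\<omega>. (u \<bullet> dyadic_euler A b k ?n \<omega>)\<^sup>2)"
          using L2F_integrable[OF L2F_inner[OF dyadic_euler_L2F]] by simp
        show "integrable M (\<lambda>\<omega>. (norm u)\<^sup>2 * (norm (dyadic_euler A b k ?n \<omega>))\<^sup>2)"
          by (intro integrable_mult_right L2F_integrable[OF dyadic_euler_L2F])
        show "(u \<bullet> dyadic_euler A b k ?n \<omega>)\<^sup>2 \<le> (norm u)\<^sup>2 * (norm (dyadic_euler A b k ?n \<omega>))\<^sup>2" for \<omega>
          using power_mono[OF Cauchy_Schwarz_ineq2[of u "dyadic_euler A b k ?n \<omega>"], of 2] by (simp add: power_mult_distrib)
      qed
      also have "\<dots> = (norm u)\<^sup>2 * expectation (\<lambda>\<omega>. (norm (dyadic_euler A b k ?n \<omega>))\<^sup>2)" by simp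
      also have "\<dots> \<le> (norm u)\<^sup>2 * (1 / (2 * ?d))" by (intro mult_left_mono k[OF b]) simp
      finally show "expectation (\<lambda>\<omega>. (u \<bullet> dyadic_euler A b k ?n \<omega>)\<^sup>2) \<le> (norm u)\<^sup>2 * (1 / (2 * ?d))" .
    qed
    also have "\<dots> = (norm u)\<^sup>2 / 2" using d by (simp del: DIM_cart)
    finally show "(\<Sum>b\<in>Basis. expectation (\<lambda>\<omega>. (u \<bullet> euler0 A b (1 / 2 ^ k) ?n \<omega>)\<^sup>2)) \<le> (norm u)\<^sup>2 / 2" .
  qed
qed

end

section \<open>Distance of an Ito integral from an Euler sum\<close>

text \<open>The test at \<open>l\<close> already counts \<open>a l\<close>, so the kept terms cannot
  overshoot \<open>c\<close>. The induction has to carry along that the kept sum is at most the full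
  one.\<close>

lemma sum_stopped_le:
  fixes a :: "nat \<Rightarrow> real"
  assumes a: "\<And>l. l < p \<Longrightarrow> 0 \<le> a l" and c: "0 \<le> c"
  shows "(\<Sum>l<p. if (\<Sum>r\<le>l. a r) \<le> c then a l else 0) \<le> c"
proof -
  have "q \<le> p \<Longrightarrow> (\<Sum>l<q. if (\<Sum>r\<le>l. a r) \<le> c then a l else 0) \<le> c
      \<and> (\<Sum>l<q. if (\<Sum>r\<le>l. a r) \<le> c then a l else 0) \<le> (\<Sum>l<q. a l)" for q
  proof (induction q)
    case (Suc q)
    then show ?case using a[of q] by (auto simp: lessThan_Suc_atMost[symmetric])
  qed (use c in auto)
  then show ?thesis by blast
qed

text \<open>The left-open cells miss only time 0, a null set.\<close>

lemma (in refining_grid) nn_integral_cells: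
  fixes f :: "real \<Rightarrow> ennreal"
  assumes f: "\<And>l s. l < p \<Longrightarrow> \<sigma> l < s \<Longrightarrow> s \<le> \<sigma> (Suc l) \<Longrightarrow> f s = f (\<sigma> (Suc l))"
  shows "(\<integral>\<^sup>+s\<in>{0..t}. f s \<partial>lborel) = (\<Sum>l<p. ennreal (\<sigma> (Suc l) - \<sigma> l) * f (\<sigma> (Suc l)))"
proof -
  have pt: "q \<le> p \<Longrightarrow> f s * indicator {0..\<sigma> q} s = (\<Sum>l<q. f (\<sigma> (Suc l)) * indicator {\<sigma> l<..\<sigma> (Suc l)} s)" if "s \<noteq> 0" for s q
  proof (induction q)
    case 0
    then show ?case using that \<sigma>_first by (auto simp: indicator_def)
  next
    case (Suc q)
    have "\<sigma> q \<le> \<sigma> (Suc q)" "0 \<le> \<sigma> q" using \<sigma>_le_iff[of q "Suc q"] \<sigma>_nonneg[of q] Suc.prems by auto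
    then have "f s * indicator {0..\<sigma> (Suc q)} s = f s * indicator {0..\<sigma> q} s + f (\<sigma> (Suc q)) * indicator {\<sigma> q<..\<sigma> (Suc q)} s"
      using f[of q s] Suc.prems by (auto simp: indicator_def)
    then show ?case using Suc by simp
  qed
  have "(\<integral>\<^sup>+s\<in>{0..t}. f s \<partial>lborel) = (\<integral>\<^sup>+s. (\<Sum>l<p. f (\<sigma> (Suc l)) * indicator {\<sigma> l<..\<sigma> (Suc l)} s) \<partial>lborel)"
  proof (rule nn_integral_cong_AE)
    show "AE s in lborel. f s * indicator {0..t} s = (\<Sum>l<p. f (\<sigma> (Suc l)) * indicator {\<sigma> l<..\<sigma> (Suc l)} s)"
      using AE_lborel_singleton[of "0::real"] by eventually_elim (use pt[of _ p] \<sigma>_last in simp)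
  qed
  also have "\<dots> = (\<Sum>l<p. \<integral>\<^sup>+s. f (\<sigma> (Suc l)) * indicator {\<sigma> l<..\<sigma> (Suc l)} s \<partial>lborel)"
    by (rule nn_integral_sum) simp
  also have "\<dots> = (\<Sum>l<p. ennreal (\<sigma> (Suc l) - \<sigma> l) * f (\<sigma> (Suc l)))"
  proof (rule sum.cong[OF refl])
    fix l assume "l \<in> {..<p}"
    then have "\<sigma> l \<le> \<sigma> (Suc l)" using \<sigma>_le_iff[of l "Suc l"] by auto
    then show "(\<integral>\<^sup>+s. f (\<sigma> (Suc l)) * indicator {\<sigma> l<..\<sigma> (Suc l)} s \<partial>lborel) = ennreal (\<sigma> (Suc l) - \<sigma> l) * f (\<sigma> (Suc l))"
      by (subst nn_integral_cmult_indicator) (auto simp: mult.commute)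
  qed
  finally show ?thesis .
qed

lemma ennreal_norm_add_square_le:
  fixes u v :: "'b::real_normed_vector"
  shows "ennreal ((norm (u + v))\<^sup>2) \<le> 2 * ennreal ((norm u)\<^sup>2) + 2 * ennreal ((norm v)\<^sup>2)"
proof -
  have "ennreal ((norm (u + v))\<^sup>2) \<le> ennreal (2 * (norm u)\<^sup>2 + 2 * (norm v)\<^sup>2)"
    by (intro ennreal_leI norm_add_square_le_double)
  then show ?thesis by (simp add: ennreal_plus ennreal_mult)
qed

context independent_wiener_processes
begin

text \<open>
  The integrand is stopped when the accumulated \<open>\<integral>\<parallel>H\<parallel>\<^sup>2\<close> exceeds \<open>C\<close>. This changes nothing on the event in
  question, and it bounds the first term by a constant, which is what makes it survive a limit in
  probability.
\<close>

lemma simple_euler_error: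
  fixes y z :: "nat \<Rightarrow> 'a \<Rightarrow> 'b::euclidean_space"
  assumes i: "i \<in> {1..N}" and H: "simple_integrand M F m \<tau> \<xi>"
    and \<delta>: "0 < \<delta>" and t: "t = real n * \<delta>"
    and y: "\<And>j. j < n \<Longrightarrow> L2F (real j * \<delta>) (y j)"
    and G: "\<And>j. j \<le> n \<Longrightarrow> G j \<in> sets (F (real j * \<delta>))" "\<And>j k. j \<le> k \<Longrightarrow> k \<le> n \<Longrightarrow> G k \<subseteq> G j"
    and z: "\<And>j. j < n \<Longrightarrow> z j \<in> borel_measurable (F (real j * \<delta>))"
    and zR: "\<And>j \<omega>. j < n \<Longrightarrow> \<omega> \<in> G j \<Longrightarrow> norm (z j \<omega>) \<le> R"
    and C: "0 \<le> C"
  shows "(\<integral>\<^sup>+\<omega>. ennreal ((norm (simple_integral (W i) m \<tau> \<xi> t \<omega> - (\<Sum>j<n. dW i (real j * \<delta>) (real (Suc j) * \<delta>) \<omega> *\<^sub>R y j \<omega>)))\<^sup>2)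
      * indicator {\<omega>\<in>G n. (\<integral>\<^sup>+s\<in>{0..t}. ennreal ((norm (simple_value m \<tau> \<xi> s \<omega>))\<^sup>2) \<partial>lborel) \<le> ennreal C} \<omega> \<partial>M)
    \<le> 2 * (\<integral>\<^sup>+\<omega>. min (ennreal (2 * C + 2 * R\<^sup>2 * t))
          (\<integral>\<^sup>+s\<in>{0..t}. ennreal ((norm (simple_value m \<tau> \<xi> s \<omega> - simple_value n (\<lambda>j. real j * \<delta>) z s \<omega>))\<^sup>2) \<partial>lborel) \<partial>M)
      + 2 * (\<Sum>j<n. ennreal \<delta> * (\<integral>\<^sup>+\<omega>. ennreal ((norm (z j \<omega> - y j \<omega>))\<^sup>2) * indicator (G j) \<omega> \<partial>M))"
proof -
  let ?grid = "\<lambda>j. real j * \<delta>"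
  have t0: "0 \<le> t" using t \<delta> by simp
  have \<tau>: "\<And>j. j < m \<Longrightarrow> \<tau> j \<le> \<tau> (Suc j)" "0 \<le> \<tau> 0" using H by (auto simp: simple_integrand_def intro: less_imp_le)
  have \<xi>: "L2F (\<tau> j) (\<xi> j)" if j: "j < m" for j
  proof -
    obtain B where "\<forall>\<omega>\<in>space M. norm (\<xi> j \<omega>) \<le> B" using H j by (auto simp: simple_integrand_def bounded_iff)
    then show ?thesis
      using H j steps_nonneg[OF \<tau>, of m j] by (intro L2F_bounded[where C=B]) (auto simp: simple_integrand_def)
  qed
  \<comment> \<open>Common refinement of the jump times of the integrand and the Euler
    nodes.\<close>
  let ?P = "{0, t} \<union> {s\<in>\<tau> ` {..m}. s \<le> t} \<union> ?grid ` {..n}"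
  have P: "finite ?P" "0 \<in> ?P" "t \<in> ?P" by auto
  have P_sub: "?P \<subseteq> {0..t}"
    using t0 steps_nonneg[OF \<tau>] \<delta> t by (auto intro!: mult_right_mono)
  obtain \<sigma> :: "nat \<Rightarrow> real" and p where \<sigma>: "strict_mono_on {..p} \<sigma>" "\<sigma> ` {..p} = ?P" "\<sigma> 0 = 0" "\<sigma> p = t"
    by (rule ex_strict_mono_grid[OF P(1) P_sub P(2,3)]) (rule that; assumption)
  have gridH: "refining_grid m \<tau> p \<sigma> t"
    by unfold_locales (use \<tau> \<sigma> in auto)
  have gridn: "refining_grid n ?grid p \<sigma> t"
    by unfold_locales (use \<delta> \<sigma> in \<open>auto intro: mult_right_mono\<close>)
  have gridnn: "refining_grid n ?grid n ?grid t"
    by unfold_locales (use \<delta> t in \<open>auto intro!: mult_right_mono strict_mono_onI\<close>)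
  interpret H: refining_grid m \<tau> p \<sigma> t by (rule gridH)
  interpret U: refining_grid n ?grid p \<sigma> t by (rule gridn)
  have \<sigma>_step: "\<sigma> l \<le> \<sigma> (Suc l)" "\<sigma> l < \<sigma> (Suc l)" if "l < p" for l
    using that H.\<sigma>_le_iff[of l "Suc l"] H.\<sigma>_less_iff[of l "Suc l"] by auto
  have "\<exists>j<n. ?grid j < \<sigma> (Suc l) \<and> \<sigma> (Suc l) \<le> ?grid (Suc j)" if l: "l < p" for l
  proof -
    have s: "0 < \<sigma> (Suc l)" "\<sigma> (Suc l) \<le> t"
      using l H.\<sigma>_less_iff[of 0 "Suc l"] H.\<sigma>_le_t[of "Suc l"] \<sigma>(3) by auto
    define j where "j = (LEAST j. \<sigma> (Suc l) \<le> ?grid (Suc j))"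
    have ex: "\<sigma> (Suc l) \<le> ?grid (Suc (n - 1))"
    proof -
      have "0 < n" using s t \<delta> by (cases n) auto
      then show ?thesis using s t by simp
    qed
    have 1: "\<sigma> (Suc l) \<le> ?grid (Suc j)" unfolding j_def by (rule LeastI[of _ "n - 1"]) (rule ex)
    have "j \<le> n - 1" unfolding j_def by (rule Least_le) (rule ex)
    moreover have "0 < n" using s t \<delta> by (cases n) auto
    ultimately have jn: "j < n" by simp
    have "?grid j < \<sigma> (Suc l)"
    proof (cases j)
      case (Suc j')
      then have "\<not> \<sigma> (Suc l) \<le> ?grid (Suc j')" unfolding j_def by (intro not_less_Least) simp
      then show ?thesis using Suc by simp
    qed (use s in auto)
    then show ?thesis using 1 jn by blast
  qed
  \<comment> \<open>\<open>c l\<close> is the Euler step that contains the cell \<open>l\<close> of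
    the refined grid.\<close>
  then obtain c where c: "\<And>l. l < p \<Longrightarrow> c l < n" "\<And>l. l < p \<Longrightarrow> ?grid (c l) < \<sigma> (Suc l)" "\<And>l. l < p \<Longrightarrow> \<sigma> (Suc l) \<le> ?grid (Suc (c l))"
    by metis
  have c\<sigma>: "?grid (c l) \<le> \<sigma> l" if l: "l < p" for l
    using U.\<tau>_less_iff[of "c l" l "\<sigma> (Suc l)"] c[OF l] l \<sigma>_step[OF l] by simp
  have at_cell: "simple_value n ?grid w (\<sigma> (Suc l)) \<omega> = w (c l) \<omega>" if l: "l < p" for w :: "nat \<Rightarrow> 'a \<Rightarrow> 'b" and l \<omega>
    by (rule simple_value_eq_single) (use c[OF l] \<delta> in \<open>auto intro: mult_right_mono\<close>)
  let ?H = "\<lambda>l. simple_value m \<tau> \<xi> (\<sigma> (Suc l))"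
  define a where "a l \<omega> = (\<sigma> (Suc l) - \<sigma> l) * (norm (?H l \<omega>))\<^sup>2" for l \<omega>
  have a0: "0 \<le> a l \<omega>" if "l < p" for l \<omega> using \<sigma>_step[OF that] by (simp add: a_def)
  \<comment> \<open>The energy up to and including cell \<open>l\<close> is known at the left end
    point of that cell, so this way of stopping is adapted.\<close>
  define Th where "Th l = {\<omega>\<in>space M. (\<Sum>r\<le>l. a r \<omega>) \<le> C}" for l
  have HL2: "L2F (\<sigma> l) (?H l)" if "l < p" for l using simple_value_L2F[OF gridH \<xi> that] .
  have \<sigma>_mono: "\<sigma> r \<le> \<sigma> l" if "r \<le> l" "l \<le> p" for r l using that H.\<sigma>_le_iff[of r l] by simp
  have Th: "Th l \<in> sets (F (\<sigma> l))" if l: "l < p" for l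
  proof -
    have "a r \<in> borel_measurable (F (\<sigma> l))" if r: "r \<le> l" for r
      unfolding a_def[abs_def]
      using measurable_F_mono[OF L2F_measurable[OF HL2[of r]] _ \<sigma>_mono[of r l]] H.\<sigma>_nonneg[of r] r l by simp
    then have "(\<lambda>\<omega>. \<Sum>r\<le>l. a r \<omega>) \<in> borel_measurable (F (\<sigma> l))" by (intro borel_measurable_sum) auto
    then have "{\<omega>\<in>space (F (\<sigma> l)). (\<Sum>r\<le>l. a r \<omega>) \<le> C} \<in> sets (F (\<sigma> l))" by measurable
    then show ?thesis using H.\<sigma>_nonneg[of l] l by (simp add: Th_def)
  qed
  define E where "E l = G (c l) \<inter> Th l" for l
  have E: "E l \<in> sets (F (\<sigma> l))" if l: "l < p" for l
  proof -
    have "G (c l) \<in> sets (F (?grid (c l)))" using G(1)[of "c l"] c(1)[OF l] by simp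
    then have "G (c l) \<in> sets (F (\<sigma> l))" using mono[of "?grid (c l)" "\<sigma> l"] c\<sigma>[OF l] \<delta> by auto
    then show ?thesis using Th[OF l] by (auto simp: E_def)
  qed
  define D where "D l \<omega> = indicator (E l) \<omega> *\<^sub>R (?H l \<omega> - y (c l) \<omega>)" for l \<omega>
  have D: "L2F (\<sigma> l) (D l)" if l: "l < p" for l
    unfolding D_def[abs_def]
    by (intro L2F_indicator L2F_diff HL2[OF l] L2F_mono[OF y[OF c(1)[OF l]] c\<sigma>[OF l]] E[OF l])
  let ?B = "\<lambda>\<omega>. \<integral>\<^sup>+s\<in>{0..t}. ennreal ((norm (simple_value m \<tau> \<xi> s \<omega>))\<^sup>2) \<partial>lborel"
  let ?S = "\<lambda>\<omega>. \<Sum>j<n. dW i (?grid j) (?grid (Suc j)) \<omega> *\<^sub>R y j \<omega>"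
  have S_eq: "?S \<omega> = grid_int i \<sigma> (\<lambda>l. y (c l)) p \<omega>" for \<omega>
  proof -
    have "?S \<omega> = simple_integral (W i) n ?grid y t \<omega>"
    proof -
      have "min t (?grid j) = ?grid j" if "j \<le> n" for j using that t \<delta> by (simp add: min_absorb2)
      then show ?thesis unfolding simple_integral_def dW_def by (intro sum.cong refl) (simp del: of_nat_Suc)
    qed
    also have "\<dots> = grid_int i \<sigma> (\<lambda>l. y (c l)) p \<omega>"
      unfolding simple_integral_eq_grid_int[OF gridn] unfolding grid_int_def by (intro sum.cong refl) (simp add: at_cell)
    finally show ?thesis .
  qed
  have B_eq: "?B \<omega> = ennreal (\<Sum>l<p. a l \<omega>)" for \<omega>
  proof -
    have "?B \<omega> = (\<Sum>l<p. ennreal (\<sigma> (Suc l) - \<sigma> l) * ennreal ((norm (?H l \<omega>))\<^sup>2))"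
      by (rule H.nn_integral_cells) (subst H.simple_value_cell, assumption+, rule refl)
    also have "\<dots> = (\<Sum>l<p. ennreal (a l \<omega>))"
      by (intro sum.cong refl) (use \<sigma>_step in \<open>auto simp: a_def ennreal_mult\<close>)
    also have "\<dots> = ennreal (\<Sum>l<p. a l \<omega>)" using a0 by (intro sum_ennreal) auto
    finally show ?thesis .
  qed
  have G_space: "G j \<subseteq> space M" if "j \<le> n" for j
    using sets.sets_into_space[OF G(1)[OF that]] \<delta> by simp
  have main_eq: "simple_integral (W i) m \<tau> \<xi> t \<omega> - ?S \<omega> = grid_int i \<sigma> D p \<omega>" if \<omega>: "\<omega> \<in> G n" "?B \<omega> \<le> ennreal C" for \<omega>
  proof -
    have "\<omega> \<in> E l" if l: "l < p" for l
    proof -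
      have "(\<Sum>r\<le>l. a r \<omega>) \<le> (\<Sum>r<p. a r \<omega>)" using l a0 by (intro sum_mono2) auto
      also have "\<dots> \<le> C" using \<omega>(2) C unfolding B_eq by (simp add: ennreal_le_iff)
      finally have "\<omega> \<in> Th l" using \<omega>(1) G_space[of n] by (auto simp: Th_def)
      then show ?thesis using \<omega>(1) G(2)[of "c l" n] c(1)[OF l] by (auto simp: E_def)
    qed
    then have "grid_int i \<sigma> D p \<omega> = grid_int i \<sigma> ?H p \<omega> - grid_int i \<sigma> (\<lambda>l. y (c l)) p \<omega>"
      unfolding grid_int_def sum_subtractf[symmetric] by (intro sum.cong refl) (simp add: D_def scaleR_diff_right)
    then show ?thesis unfolding S_eq simple_integral_eq_grid_int[OF gridH] by simp
  qed
  have iso: "L2F (\<sigma> p) (grid_int i \<sigma> D p)"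
    "expectation (\<lambda>\<omega>. (norm (grid_int i \<sigma> D p \<omega>))\<^sup>2) = (\<Sum>l<p. (\<sigma> (Suc l) - \<sigma> l) * expectation (\<lambda>\<omega>. (norm (D l \<omega>))\<^sup>2))"
    using grid_int_isometry[where \<sigma>=\<sigma> and D=D and p=p and q=p, OF i D \<sigma>_step(1)] \<sigma>(3) by auto
  have [measurable]: "D l \<in> borel_measurable M" if "l < p" for l using L2F_borel[OF D[OF that]] .
  let ?Hz = "\<lambda>\<omega>. \<integral>\<^sup>+s\<in>{0..t}. ennreal ((norm (simple_value m \<tau> \<xi> s \<omega> - simple_value n ?grid z s \<omega>))\<^sup>2) \<partial>lborel"
  let ?K = "ennreal (2 * C + 2 * R\<^sup>2 * t)"
  have Hz_eq: "?Hz \<omega> = (\<Sum>l<p. ennreal ((\<sigma> (Suc l) - \<sigma> l) * (norm (?H l \<omega> - z (c l) \<omega>))\<^sup>2))" for \<omega>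
  proof -
    have "?Hz \<omega> = (\<Sum>l<p. ennreal (\<sigma> (Suc l) - \<sigma> l) * ennreal ((norm (?H l \<omega> - simple_value n ?grid z (\<sigma> (Suc l)) \<omega>))\<^sup>2))"
      by (rule H.nn_integral_cells) (subst H.simple_value_cell, assumption+, subst U.simple_value_cell, assumption+, rule refl)
    also have "\<dots> = (\<Sum>l<p. ennreal ((\<sigma> (Suc l) - \<sigma> l) * (norm (?H l \<omega> - z (c l) \<omega>))\<^sup>2))"
      by (intro sum.cong refl) (use \<sigma>_step at_cell in \<open>auto simp: ennreal_mult\<close>)
    finally show ?thesis .
  qed
  \<comment> \<open>The bound by the constant is where stopping pays: the kept energy of the
    integrand is at most \<open>C\<close>, and \<open>z j\<close> is bounded by \<open>R\<close> on
    \<open>G j\<close>.\<close>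
  have first: "(\<Sum>l<p. ennreal ((\<sigma> (Suc l) - \<sigma> l) * (norm (?H l \<omega> - z (c l) \<omega>))\<^sup>2) * indicator (E l) \<omega>) \<le> min ?K (?Hz \<omega>)" for \<omega>
  proof (rule min.boundedI)
    show "(\<Sum>l<p. ennreal ((\<sigma> (Suc l) - \<sigma> l) * (norm (?H l \<omega> - z (c l) \<omega>))\<^sup>2) * indicator (E l) \<omega>) \<le> ?Hz \<omega>"
      unfolding Hz_eq by (intro sum_mono) (auto simp: indicator_def)
    have "(\<Sum>l<p. ennreal ((\<sigma> (Suc l) - \<sigma> l) * (norm (?H l \<omega> - z (c l) \<omega>))\<^sup>2) * indicator (E l) \<omega>)
        \<le> (\<Sum>l<p. ennreal (2 * (if (\<Sum>r\<le>l. a r \<omega>) \<le> C then a l \<omega> else 0) + 2 * R\<^sup>2 * (\<sigma> (Suc l) - \<sigma> l)))"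
    proof (rule sum_mono)
      fix l assume "l \<in> {..<p}"
      then have l: "l < p" by simp
      show "ennreal ((\<sigma> (Suc l) - \<sigma> l) * (norm (?H l \<omega> - z (c l) \<omega>))\<^sup>2) * indicator (E l) \<omega>
          \<le> ennreal (2 * (if (\<Sum>r\<le>l. a r \<omega>) \<le> C then a l \<omega> else 0) + 2 * R\<^sup>2 * (\<sigma> (Suc l) - \<sigma> l))"
      proof (cases "\<omega> \<in> E l")
        case True
        then have "norm (z (c l) \<omega>) \<le> R" "(\<Sum>r\<le>l. a r \<omega>) \<le> C" using zR[OF c(1)[OF l]] by (auto simp: E_def Th_def)
        then have "(norm (z (c l) \<omega>))\<^sup>2 \<le> R\<^sup>2" by (intro power_mono) auto
        then have "(norm (?H l \<omega> - z (c l) \<omega>))\<^sup>2 \<le> 2 * (norm (?H l \<omega>))\<^sup>2 + 2 * R\<^sup>2"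
          using norm_add_square_le_double[of "?H l \<omega>" "- z (c l) \<omega>"] by simp
        from mult_left_mono[OF this, of "\<sigma> (Suc l) - \<sigma> l"]
        have "(\<sigma> (Suc l) - \<sigma> l) * (norm (?H l \<omega> - z (c l) \<omega>))\<^sup>2 \<le> 2 * a l \<omega> + 2 * R\<^sup>2 * (\<sigma> (Suc l) - \<sigma> l)"
          using \<sigma>_step[OF l] by (simp add: a_def algebra_simps)
        then show ?thesis using True \<open>(\<Sum>r\<le>l. a r \<omega>) \<le> C\<close> by (auto intro!: ennreal_leI)
      qed simp
    qed
    also have "\<dots> = ennreal (\<Sum>l<p. 2 * (if (\<Sum>r\<le>l. a r \<omega>) \<le> C then a l \<omega> else 0) + 2 * R\<^sup>2 * (\<sigma> (Suc l) - \<sigma> l))"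
      using a0 \<sigma>_step by (intro sum_ennreal) auto
    also have "\<dots> \<le> ?K"
    proof (rule ennreal_leI)
      have "(\<Sum>l<p. \<sigma> (Suc l) - \<sigma> l) = t" using sum_lessThan_telescope[of \<sigma> p] \<sigma> by simp
      then have "(\<Sum>l<p. 2 * R\<^sup>2 * (\<sigma> (Suc l) - \<sigma> l)) = 2 * R\<^sup>2 * t" unfolding sum_distrib_left[symmetric] by simp
      moreover have "(\<Sum>l<p. 2 * (if (\<Sum>r\<le>l. a r \<omega>) \<le> C then a l \<omega> else 0)) \<le> 2 * C"
        unfolding sum_distrib_left[symmetric] using sum_stopped_le[of p "\<lambda>l. a l \<omega>" C] a0 C by simp
      ultimately show "(\<Sum>l<p. 2 * (if (\<Sum>r\<le>l. a r \<omega>) \<le> C then a l \<omega> else 0) + 2 * R\<^sup>2 * (\<sigma> (Suc l) - \<sigma> l)) \<le> 2 * C + 2 * R\<^sup>2 * t"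
        unfolding sum.distrib by simp
    qed
    finally show "(\<Sum>l<p. ennreal ((\<sigma> (Suc l) - \<sigma> l) * (norm (?H l \<omega> - z (c l) \<omega>))\<^sup>2) * indicator (E l) \<omega>) \<le> ?K" .
  qed
  define w where "w j \<omega> = indicator (G j) \<omega> *\<^sub>R (z j \<omega> - y j \<omega>)" for j \<omega>
  \<comment> \<open>Both sums are the time integral of the same step process, taken once along the
    refined grid and once along the Euler grid.\<close>
  have second: "(\<Sum>l<p. ennreal ((\<sigma> (Suc l) - \<sigma> l) * (norm (w (c l) \<omega>))\<^sup>2)) = (\<Sum>j<n. ennreal \<delta> * ennreal ((norm (w j \<omega>))\<^sup>2))" for \<omega>
  proof -
    have "(\<Sum>l<p. ennreal ((\<sigma> (Suc l) - \<sigma> l) * (norm (w (c l) \<omega>))\<^sup>2))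
        = (\<Sum>l<p. ennreal (\<sigma> (Suc l) - \<sigma> l) * ennreal ((norm (simple_value n ?grid w (\<sigma> (Suc l)) \<omega>))\<^sup>2))"
      by (intro sum.cong refl) (use \<sigma>_step at_cell in \<open>auto simp: ennreal_mult\<close>)
    also have "\<dots> = (\<integral>\<^sup>+s\<in>{0..t}. ennreal ((norm (simple_value n ?grid w s \<omega>))\<^sup>2) \<partial>lborel)"
      by (rule U.nn_integral_cells[symmetric]) (subst U.simple_value_cell, assumption+, rule refl)
    also have "\<dots> = (\<Sum>j<n. ennreal (?grid (Suc j) - ?grid j) * ennreal ((norm (simple_value n ?grid w (?grid (Suc j)) \<omega>))\<^sup>2))"
      by (rule refining_grid.nn_integral_cells[OF gridnn]) (subst refining_grid.simple_value_cell[OF gridnn], assumption+, rule refl)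
    also have "\<dots> = (\<Sum>j<n. ennreal \<delta> * ennreal ((norm (w j \<omega>))\<^sup>2))"
    proof (intro sum.cong refl)
      fix j assume "j \<in> {..<n}"
      then have "simple_value n ?grid w (?grid (Suc j)) \<omega> = w j \<omega>"
        by (intro simple_value_eq_single) (use \<delta> in \<open>auto intro: mult_right_mono\<close>)
      moreover have "?grid (Suc j) - ?grid j = \<delta>" by (simp add: algebra_simps)
      ultimately show "ennreal (?grid (Suc j) - ?grid j) * ennreal ((norm (simple_value n ?grid w (?grid (Suc j)) \<omega>))\<^sup>2)
          = ennreal \<delta> * ennreal ((norm (w j \<omega>))\<^sup>2)" by (simp only:)
    qed
    finally show ?thesis .
  qed
  have D_le: "ennreal ((\<sigma> (Suc l) - \<sigma> l) * (norm (D l \<omega>))\<^sup>2)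
      \<le> 2 * (ennreal ((\<sigma> (Suc l) - \<sigma> l) * (norm (?H l \<omega> - z (c l) \<omega>))\<^sup>2) * indicator (E l) \<omega>)
        + 2 * ennreal ((\<sigma> (Suc l) - \<sigma> l) * (norm (w (c l) \<omega>))\<^sup>2)" if l: "l < p" for l \<omega>
  proof (cases "\<omega> \<in> E l")
    case True
    then have "w (c l) \<omega> = z (c l) \<omega> - y (c l) \<omega>" "D l \<omega> = (?H l \<omega> - z (c l) \<omega>) + (z (c l) \<omega> - y (c l) \<omega>)"
      by (auto simp: w_def D_def E_def)
    then have "(norm (D l \<omega>))\<^sup>2 \<le> 2 * (norm (?H l \<omega> - z (c l) \<omega>))\<^sup>2 + 2 * (norm (w (c l) \<omega>))\<^sup>2"
      using norm_add_square_le_double by metis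
    from mult_left_mono[OF this, of "\<sigma> (Suc l) - \<sigma> l"] \<sigma>_step[OF l]
    have "ennreal ((\<sigma> (Suc l) - \<sigma> l) * (norm (D l \<omega>))\<^sup>2)
        \<le> ennreal (2 * ((\<sigma> (Suc l) - \<sigma> l) * (norm (?H l \<omega> - z (c l) \<omega>))\<^sup>2) + 2 * ((\<sigma> (Suc l) - \<sigma> l) * (norm (w (c l) \<omega>))\<^sup>2))"
      by (intro ennreal_leI) (simp add: algebra_simps)
    also have "\<dots> = 2 * ennreal ((\<sigma> (Suc l) - \<sigma> l) * (norm (?H l \<omega> - z (c l) \<omega>))\<^sup>2)
        + 2 * ennreal ((\<sigma> (Suc l) - \<sigma> l) * (norm (w (c l) \<omega>))\<^sup>2)"
      using \<sigma>_step[OF l] by (simp add: ennreal_plus ennreal_mult)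
    finally show ?thesis using True by simp
  qed (simp add: D_def)
  have zm: "z j \<in> borel_measurable M" if "j < n" for j
    by (rule measurable_FM[OF _ z[OF that]]) (use \<delta> in auto)
  have ym: "y j \<in> borel_measurable M" if "j < n" for j using L2F_borel[OF y[OF that]] .
  have Gm: "G j \<in> sets M" if "j \<le> n" for j by (rule sets_F[OF _ G(1)[OF that]]) (use \<delta> in auto)
  have Hzm: "?Hz \<in> borel_measurable M"
    by (rule borel_measurable_square_integral[OF simple_value_progressive simple_value_progressive t0])
      (use \<tau> L2F_measurable[OF \<xi>] z \<delta> in \<open>auto intro: mult_right_mono\<close>)
  have wm: "w j \<in> borel_measurable M" if "j < n" for j
  proof -
    have [measurable]: "z j \<in> borel_measurable M" "y j \<in> borel_measurable M" "G j \<in> sets M" using zm ym Gm that by auto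
    show ?thesis unfolding w_def[abs_def] by measurable
  qed
  have "(\<integral>\<^sup>+\<omega>. ennreal ((norm (simple_integral (W i) m \<tau> \<xi> t \<omega> - ?S \<omega>))\<^sup>2)
      * indicator {\<omega>\<in>G n. ?B \<omega> \<le> ennreal C} \<omega> \<partial>M) \<le> (\<integral>\<^sup>+\<omega>. ennreal ((norm (grid_int i \<sigma> D p \<omega>))\<^sup>2) \<partial>M)"
  proof (rule nn_integral_mono)
    fix \<omega>
    show "ennreal ((norm (simple_integral (W i) m \<tau> \<xi> t \<omega> - ?S \<omega>))\<^sup>2) * indicator {\<omega>\<in>G n. ?B \<omega> \<le> ennreal C} \<omega>
        \<le> ennreal ((norm (grid_int i \<sigma> D p \<omega>))\<^sup>2)"
    proof (cases "\<omega> \<in> {\<omega>\<in>G n. ?B \<omega> \<le> ennreal C}")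
      case True
      then have "simple_integral (W i) m \<tau> \<xi> t \<omega> - ?S \<omega> = grid_int i \<sigma> D p \<omega>" by (intro main_eq) auto
      then show ?thesis using True by simp
    qed simp
  qed
  also have "\<dots> = ennreal (expectation (\<lambda>\<omega>. (norm (grid_int i \<sigma> D p \<omega>))\<^sup>2))"
    by (rule nn_integral_eq_integral[OF L2F_integrable[OF iso(1)]]) simp
  also have "\<dots> = ennreal (expectation (\<lambda>\<omega>. \<Sum>l<p. (\<sigma> (Suc l) - \<sigma> l) * (norm (D l \<omega>))\<^sup>2))"
    unfolding iso(2) using L2F_integrable[OF D] by (subst Bochner_Integration.integral_sum) auto
  also have "\<dots> = (\<integral>\<^sup>+\<omega>. ennreal (\<Sum>l<p. (\<sigma> (Suc l) - \<sigma> l) * (norm (D l \<omega>))\<^sup>2) \<partial>M)"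
    using L2F_integrable[OF D] \<sigma>_step
    by (intro nn_integral_eq_integral[symmetric] integrable_sum integrable_mult_right AE_I2 sum_nonneg) auto
  also have "\<dots> \<le> (\<integral>\<^sup>+\<omega>. 2 * min ?K (?Hz \<omega>) + 2 * (\<Sum>j<n. ennreal \<delta> * ennreal ((norm (w j \<omega>))\<^sup>2)) \<partial>M)"
  proof (rule nn_integral_mono)
    fix \<omega>
    have "ennreal (\<Sum>l<p. (\<sigma> (Suc l) - \<sigma> l) * (norm (D l \<omega>))\<^sup>2) = (\<Sum>l<p. ennreal ((\<sigma> (Suc l) - \<sigma> l) * (norm (D l \<omega>))\<^sup>2))"
      using \<sigma>_step by (intro sum_ennreal[symmetric]) auto
    also have "\<dots> \<le> (\<Sum>l<p. 2 * (ennreal ((\<sigma> (Suc l) - \<sigma> l) * (norm (?H l \<omega> - z (c l) \<omega>))\<^sup>2) * indicator (E l) \<omega>)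
        + 2 * ennreal ((\<sigma> (Suc l) - \<sigma> l) * (norm (w (c l) \<omega>))\<^sup>2))"
      by (rule sum_mono) (use D_le in auto)
    also have "\<dots> = 2 * (\<Sum>l<p. ennreal ((\<sigma> (Suc l) - \<sigma> l) * (norm (?H l \<omega> - z (c l) \<omega>))\<^sup>2) * indicator (E l) \<omega>)
        + 2 * (\<Sum>l<p. ennreal ((\<sigma> (Suc l) - \<sigma> l) * (norm (w (c l) \<omega>))\<^sup>2))"
      by (simp only: sum.distrib sum_distrib_left)
    also have "\<dots> \<le> 2 * min ?K (?Hz \<omega>) + 2 * (\<Sum>j<n. ennreal \<delta> * ennreal ((norm (w j \<omega>))\<^sup>2))"
      unfolding second by (intro add_mono mult_left_mono first) auto
    finally show "ennreal (\<Sum>l<p. (\<sigma> (Suc l) - \<sigma> l) * (norm (D l \<omega>))\<^sup>2)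
        \<le> 2 * min ?K (?Hz \<omega>) + 2 * (\<Sum>j<n. ennreal \<delta> * ennreal ((norm (w j \<omega>))\<^sup>2))" .
  qed
  also have "\<dots> = 2 * (\<integral>\<^sup>+\<omega>. min ?K (?Hz \<omega>) \<partial>M) + 2 * (\<integral>\<^sup>+\<omega>. (\<Sum>j<n. ennreal \<delta> * ennreal ((norm (w j \<omega>))\<^sup>2)) \<partial>M)"
    using Hzm wm by (subst nn_integral_add) (auto intro!: borel_measurable_sum simp: nn_integral_cmult)
  also have "(\<integral>\<^sup>+\<omega>. (\<Sum>j<n. ennreal \<delta> * ennreal ((norm (w j \<omega>))\<^sup>2)) \<partial>M)
      = (\<Sum>j<n. ennreal \<delta> * (\<integral>\<^sup>+\<omega>. ennreal ((norm (z j \<omega> - y j \<omega>))\<^sup>2) * indicator (G j) \<omega> \<partial>M))"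
  proof -
    have "(\<integral>\<^sup>+\<omega>. (\<Sum>j<n. ennreal \<delta> * ennreal ((norm (w j \<omega>))\<^sup>2)) \<partial>M) = (\<Sum>j<n. ennreal \<delta> * (\<integral>\<^sup>+\<omega>. ennreal ((norm (w j \<omega>))\<^sup>2) \<partial>M))"
      using wm by (subst nn_integral_sum) (auto intro!: sum.cong simp: nn_integral_cmult)
    also have "\<dots> = (\<Sum>j<n. ennreal \<delta> * (\<integral>\<^sup>+\<omega>. ennreal ((norm (z j \<omega> - y j \<omega>))\<^sup>2) * indicator (G j) \<omega> \<partial>M))"
      by (intro sum.cong arg_cong2[where f="(*)"] refl nn_integral_cong) (auto simp: w_def indicator_def)
    finally show ?thesis .
  qed
  finally show ?thesis .
qed

end

text \<open>The triangle inequality for squared distances survives truncation at \<open>K\<close>.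
  Truncated distances are needed because convergence in probability says nothing about untruncated
  means.\<close>

lemma min_double_sum_le:
  fixes K x y :: ennreal
  shows "min K (2 * x + 2 * y) \<le> 2 * min K x + 2 * min K y"
proof (cases "K \<le> x \<or> K \<le> y")
  case True
  have "K \<le> 2 * K + z" for z :: ennreal
  proof -
    have "1 * K \<le> 2 * K" by (rule mult_right_mono) auto
    then show ?thesis by (simp add: add_increasing2)
  qed
  then have "K \<le> 2 * min K x + 2 * min K y"
    using True by (auto simp: min_def add.commute[of _ "2 * K"])
  then show ?thesis by (rule min.coboundedI1)
next
  case False
  then have "min K x = x" "min K y = y" by (auto simp: min_def)
  then show ?thesis by simp
qed

context usual_filtered_prob_space
begin

lemma progressive_section:
  assumes "progressively_measurable F X" "0 \<le> T" "\<omega> \<in> space M"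
  shows "(\<lambda>s. X s \<omega>) \<in> borel_measurable (restrict_space borel {0..T})"
proof -
  have "(\<lambda>s. (s, \<omega>)) \<in> measurable (restrict_space borel {0..T}) (restrict_space borel {0..T} \<Otimes>\<^sub>M M)"
    by (intro measurable_Pair measurable_const measurable_ident_sets) (use assms in auto)
  from measurable_compose[OF this progressive_M[OF assms(1,2)]] show ?thesis by simp
qed

text \<open>The weight is left free for two purposes: \<open>c = 1\<close> is good enough for
  distances, while a small \<open>c\<close> keeps the energy of an approximating integrand just
  above that of the limit.\<close>

lemma square_integral_triangle:
  fixes X Y Z :: "real \<Rightarrow> 'a \<Rightarrow> 'b::euclidean_space"
  assumes prog: "progressively_measurable F X" "progressively_measurable F Y" "progressively_measurable F Z"
    and T: "0 \<le> T" and \<omega>: "\<omega> \<in> space M" and c: "0 < c"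
  shows "(\<integral>\<^sup>+s\<in>{0..T}. ennreal ((norm (X s \<omega> - Z s \<omega>))\<^sup>2) \<partial>lborel)
    \<le> ennreal (1 + c) * (\<integral>\<^sup>+s\<in>{0..T}. ennreal ((norm (X s \<omega> - Y s \<omega>))\<^sup>2) \<partial>lborel)
      + ennreal (1 + 1 / c) * (\<integral>\<^sup>+s\<in>{0..T}. ennreal ((norm (Y s \<omega> - Z s \<omega>))\<^sup>2) \<partial>lborel)"
proof -
  have meas: "(\<lambda>s. ennreal ((norm (P s \<omega> - Q s \<omega>))\<^sup>2) * indicator {0..T} s) \<in> borel_measurable lborel"
    if "progressively_measurable F P" "progressively_measurable F Q" for P Q :: "real \<Rightarrow> 'a \<Rightarrow> 'b"
  proof -
    have [measurable]: "(\<lambda>s. P s \<omega>) \<in> borel_measurable (restrict_space borel {0..T})"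
      "(\<lambda>s. Q s \<omega>) \<in> borel_measurable (restrict_space borel {0..T})"
      using that progressive_section[OF _ T \<omega>] by auto
    have "(\<lambda>s. ennreal ((norm (P s \<omega> - Q s \<omega>))\<^sup>2)) \<in> borel_measurable (restrict_space borel {0..T})" by measurable
    then have "(\<lambda>s. ennreal ((norm (P s \<omega> - Q s \<omega>))\<^sup>2) * indicator {0..T} s) \<in> borel_measurable borel"
      by (subst (asm) borel_measurable_restrict_space_iff_ennreal) auto
    then show ?thesis by simp
  qed
  have "(\<integral>\<^sup>+s\<in>{0..T}. ennreal ((norm (X s \<omega> - Z s \<omega>))\<^sup>2) \<partial>lborel)
      \<le> (\<integral>\<^sup>+s. ennreal (1 + c) * (ennreal ((norm (X s \<omega> - Y s \<omega>))\<^sup>2) * indicator {0..T} s)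
        + ennreal (1 + 1 / c) * (ennreal ((norm (Y s \<omega> - Z s \<omega>))\<^sup>2) * indicator {0..T} s) \<partial>lborel)"
  proof (rule nn_integral_mono)
    fix s
    have "(norm (X s \<omega> - Z s \<omega>))\<^sup>2 \<le> (1 + c) * (norm (X s \<omega> - Y s \<omega>))\<^sup>2 + (1 + 1 / c) * (norm (Y s \<omega> - Z s \<omega>))\<^sup>2"
      using norm_add_square_le[OF c, of "X s \<omega> - Y s \<omega>" "Y s \<omega> - Z s \<omega>"] by simp
    then have "ennreal ((norm (X s \<omega> - Z s \<omega>))\<^sup>2)
        \<le> ennreal ((1 + c) * (norm (X s \<omega> - Y s \<omega>))\<^sup>2 + (1 + 1 / c) * (norm (Y s \<omega> - Z s \<omega>))\<^sup>2)" by (rule ennreal_leI)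
    also have "\<dots> = ennreal (1 + c) * ennreal ((norm (X s \<omega> - Y s \<omega>))\<^sup>2) + ennreal (1 + 1 / c) * ennreal ((norm (Y s \<omega> - Z s \<omega>))\<^sup>2)"
      using c by (subst ennreal_plus) (auto simp: ennreal_mult)
    finally show "ennreal ((norm (X s \<omega> - Z s \<omega>))\<^sup>2) * indicator {0..T} s
      \<le> ennreal (1 + c) * (ennreal ((norm (X s \<omega> - Y s \<omega>))\<^sup>2) * indicator {0..T} s)
        + ennreal (1 + 1 / c) * (ennreal ((norm (Y s \<omega> - Z s \<omega>))\<^sup>2) * indicator {0..T} s)"
      by (auto simp: indicator_def)
  qed
  also have "\<dots> = ennreal (1 + c) * (\<integral>\<^sup>+s\<in>{0..T}. ennreal ((norm (X s \<omega> - Y s \<omega>))\<^sup>2) \<partial>lborel)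
      + ennreal (1 + 1 / c) * (\<integral>\<^sup>+s\<in>{0..T}. ennreal ((norm (Y s \<omega> - Z s \<omega>))\<^sup>2) \<partial>lborel)"
    unfolding nn_integral_add[OF borel_measurable_times_ennreal[OF borel_measurable_const meas[OF prog(1,2)]]
        borel_measurable_times_ennreal[OF borel_measurable_const meas[OF prog(2,3)]]]
      nn_integral_cmult[OF meas[OF prog(1,2)]] nn_integral_cmult[OF meas[OF prog(2,3)]] ..
  finally show ?thesis .
qed

lemma progressively_measurable_const: "progressively_measurable F (\<lambda>_ _. c)"
  by (simp add: progressively_measurable_def)

end

context independent_wiener_processes
begin

text \<open>\<open>simple_euler_error\<close> is applied to the approximating simple integrands.
  Along a subsequence their distance to \<open>X\<close> and the error of their integrals both tend
  to 0 almost surely; Fatou treats the left side, dominated convergence the truncated distance on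
  the right. The energy bound is relaxed to \<open>C + 1\<close> so that the approximating
  integrands eventually satisfy it.\<close>

lemma ito_euler_error:
  fixes X J :: "real \<Rightarrow> 'a \<Rightarrow> 'b::euclidean_space" and y z :: "nat \<Rightarrow> 'a \<Rightarrow> 'b"
  assumes i: "i \<in> {1..N}" and ito: "is_ito_integral M F (W i) X J"
    and \<delta>: "0 < \<delta>" and t: "t = real n * \<delta>"
    and y: "\<And>j. j < n \<Longrightarrow> L2F (real j * \<delta>) (y j)"
    and G: "\<And>j. j \<le> n \<Longrightarrow> G j \<in> sets (F (real j * \<delta>))" "\<And>j k. j \<le> k \<Longrightarrow> k \<le> n \<Longrightarrow> G k \<subseteq> G j"
    and z: "\<And>j. j < n \<Longrightarrow> z j \<in> borel_measurable (F (real j * \<delta>))"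
    and zR: "\<And>j \<omega>. j < n \<Longrightarrow> \<omega> \<in> G j \<Longrightarrow> norm (z j \<omega>) \<le> R"
    and C: "0 \<le> C"
    and XC: "AE \<omega> in M. \<omega> \<in> G n \<longrightarrow> (\<integral>\<^sup>+s\<in>{0..t}. ennreal ((norm (X s \<omega>))\<^sup>2) \<partial>lborel) \<le> ennreal C"
  shows "(\<integral>\<^sup>+\<omega>. ennreal ((norm (J t \<omega> - (\<Sum>j<n. dW i (real j * \<delta>) (real (Suc j) * \<delta>) \<omega> *\<^sub>R y j \<omega>)))\<^sup>2)
      * indicator (G n) \<omega> \<partial>M)
    \<le> 4 * (\<integral>\<^sup>+\<omega>. min (ennreal (2 * (C + 1) + 2 * R\<^sup>2 * t))
          (\<integral>\<^sup>+s\<in>{0..t}. ennreal ((norm (X s \<omega> - simple_value n (\<lambda>j. real j * \<delta>) z s \<omega>))\<^sup>2) \<partial>lborel) \<partial>M)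
      + 2 * (\<Sum>j<n. ennreal \<delta> * (\<integral>\<^sup>+\<omega>. ennreal ((norm (z j \<omega> - y j \<omega>))\<^sup>2) * indicator (G j) \<omega> \<partial>M))"
    (is "_ \<le> 4 * (\<integral>\<^sup>+\<omega>. min ?K (?d \<omega>) \<partial>M) + ?E2")
proof -
  have t0: "0 \<le> t" using t \<delta> by simp
  obtain m \<tau> \<xi> where H: "\<And>k::nat. simple_integrand M F (m k) (\<tau> k) (\<xi> k)"
    and lim_sq: "\<And>\<epsilon>. 0 < \<epsilon> \<Longrightarrow> (\<lambda>k. prob {\<omega> \<in> space M.
      (\<integral>\<^sup>+s\<in>{0..t}. ennreal ((norm (simple_value (m k) (\<tau> k) (\<xi> k) s \<omega> - X s \<omega>))\<^sup>2) \<partial>lborel) > ennreal \<epsilon>}) \<longlonglongrightarrow> 0"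
    and lim_int: "\<And>\<epsilon>. 0 < \<epsilon> \<Longrightarrow> (\<lambda>k. prob {\<omega> \<in> space M. norm (simple_integral (W i) (m k) (\<tau> k) (\<xi> k) t \<omega> - J t \<omega>) > \<epsilon>}) \<longlonglongrightarrow> 0"
    and X_prog: "progressively_measurable F X" and J_meas: "J t \<in> borel_measurable (F t)"
    using ito t0 unfolding is_ito_integral_def by blast
  define Hv where "Hv k = simple_value (m k) (\<tau> k) (\<xi> k)" for k
  define S where "S k = simple_integral (W i) (m k) (\<tau> k) (\<xi> k) t" for k
  define sy where "sy \<omega> = (\<Sum>j<n. dW i (real j * \<delta>) (real (Suc j) * \<delta>) \<omega> *\<^sub>R y j \<omega>)" for \<omega>
  define zv where "zv = simple_value n (\<lambda>j. real j * \<delta>) z"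
  have \<tau>: "\<And>j. j < m k \<Longrightarrow> \<tau> k j \<le> \<tau> k (Suc j)" "0 \<le> \<tau> k 0"
    and \<xi>: "\<And>j. j < m k \<Longrightarrow> \<xi> k j \<in> borel_measurable (F (\<tau> k j))" for k
    using H[of k] by (auto simp: simple_integrand_def intro: less_imp_le)
  have Hv_prog: "progressively_measurable F (Hv k)" for k
    unfolding Hv_def by (rule simple_value_progressive[OF \<tau> \<xi>])
  have zv_prog: "progressively_measurable F zv"
    unfolding zv_def by (rule simple_value_progressive) (use \<delta> z in \<open>auto intro: mult_right_mono\<close>)
  have [measurable]: "S k \<in> borel_measurable M" for k
    unfolding S_def using adapted[OF i] by (intro measurable_FM[OF t0 simple_integral_adapted[OF \<tau> \<xi> _ t0]]) auto
  have [measurable]: "J t \<in> borel_measurable M" using measurable_FM[OF t0 J_meas] .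
  have [measurable]: "sy \<in> borel_measurable M"
  proof -
    have "dW i (real j * \<delta>) (real (Suc j) * \<delta>) \<in> borel_measurable M" for j
      by (rule dW_borel[OF i]) (use \<delta> in \<open>auto intro: mult_right_mono\<close>)
    then show ?thesis unfolding sy_def[abs_def]
      by (intro borel_measurable_sum borel_measurable_scaleR) (auto intro: L2F_borel[OF y])
  qed
  have [measurable]: "G n \<in> sets M" by (rule sets_F[OF _ G(1)]) (use \<delta> in auto)
  define a where "a k \<omega> = (\<integral>\<^sup>+s\<in>{0..t}. ennreal ((norm (Hv k s \<omega> - X s \<omega>))\<^sup>2) \<partial>lborel)" for k \<omega>
  have am[measurable]: "a k \<in> borel_measurable M" for k
    unfolding a_def[abs_def] by (rule borel_measurable_square_integral[OF Hv_prog X_prog t0])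
  obtain r1 :: "nat \<Rightarrow> nat" where r1: "strict_mono r1" "AE \<omega> in M. (\<lambda>k. a (r1 k) \<omega>) \<longlonglongrightarrow> 0"
  proof (rule AE_subsequence_of_prob_tendsto_zero[OF am])
    show "(\<lambda>k. prob {\<omega>\<in>space M. ennreal \<epsilon> < a k \<omega>}) \<longlonglongrightarrow> 0" if "0 < \<epsilon>" for \<epsilon>
      using lim_sq[OF that] by (simp add: a_def Hv_def)
  qed
  \<comment> \<open>A second extraction, along the first subsequence, so that both limits hold
    almost surely together.\<close>
  define b where "b k \<omega> = ennreal (norm (S (r1 k) \<omega> - J t \<omega>))" for k \<omega>
  have bm[measurable]: "b k \<in> borel_measurable M" for k unfolding b_def[abs_def] by measurable
  obtain r2 :: "nat \<Rightarrow> nat" where r2: "strict_mono r2" "AE \<omega> in M. (\<lambda>k. b (r2 k) \<omega>) \<longlonglongrightarrow> 0"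
  proof (rule AE_subsequence_of_prob_tendsto_zero[OF bm])
    show "(\<lambda>k. prob {\<omega>\<in>space M. ennreal \<epsilon> < b k \<omega>}) \<longlonglongrightarrow> 0" if "0 < \<epsilon>" for \<epsilon>
      using LIMSEQ_subseq_LIMSEQ[OF lim_int[OF that] r1(1)] that by (simp add: b_def S_def comp_def ennreal_less_iff)
  qed
  define r where "r k = r1 (r2 k)" for k
  have a_lim: "AE \<omega> in M. (\<lambda>k. a (r k) \<omega>) \<longlonglongrightarrow> 0"
    using r1(2) by eventually_elim (use LIMSEQ_subseq_LIMSEQ[OF _ r2(1)] in \<open>auto simp: r_def comp_def\<close>)
  have S_lim: "AE \<omega> in M. (\<lambda>k. S (r k) \<omega>) \<longlonglongrightarrow> J t \<omega>"
    using r2(2)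
  proof eventually_elim
    case (elim \<omega>)
    then have "(\<lambda>k. norm (S (r k) \<omega> - J t \<omega>)) \<longlonglongrightarrow> 0"
      unfolding b_def r_def by (subst (asm) ennreal_0[symmetric], subst (asm) tendsto_ennreal_iff) auto
    then show ?case by (simp add: tendsto_norm_zero_iff LIM_zero_iff)
  qed
  define B where "B k \<omega> = (\<integral>\<^sup>+s\<in>{0..t}. ennreal ((norm (Hv k s \<omega>))\<^sup>2) \<partial>lborel)" for k \<omega>
  have Bm[measurable]: "B k \<in> borel_measurable M" for k
    using borel_measurable_square_integral[OF Hv_prog progressively_measurable_const[of 0] t0, of k] by (simp add: B_def[abs_def])
  define L where "L k \<omega> = ennreal ((norm (S k \<omega> - sy \<omega>))\<^sup>2) * indicator {\<omega>\<in>G n. B k \<omega> \<le> ennreal (C + 1)} \<omega>" for k \<omega>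
  have [measurable]: "{\<omega>\<in>G n. B k \<omega> \<le> ennreal (C + 1)} \<in> sets M" for k
  proof -
    have "{\<omega>\<in>G n. B k \<omega> \<le> ennreal (C + 1)} = G n \<inter> {\<omega>\<in>space M. B k \<omega> \<le> ennreal (C + 1)}"
      using sets.sets_into_space[OF \<open>G n \<in> sets M\<close>] by auto
    then show ?thesis by simp
  qed
  have Lm[measurable]: "L k \<in> borel_measurable M" for k unfolding L_def[abs_def] by measurable
  have d_meas[measurable]: "(\<lambda>\<omega>. ?d \<omega>) \<in> borel_measurable M"
    using borel_measurable_square_integral[OF X_prog zv_prog t0] by (simp add: zv_def)
  have L_le: "(\<integral>\<^sup>+\<omega>. L k \<omega> \<partial>M) \<le> 4 * (\<integral>\<^sup>+\<omega>. min ?K (?d \<omega>) \<partial>M) + 4 * (\<integral>\<^sup>+\<omega>. min ?K (a k \<omega>) \<partial>M) + ?E2" for k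
  proof -
    have "(\<integral>\<^sup>+\<omega>. L k \<omega> \<partial>M) \<le> 2 * (\<integral>\<^sup>+\<omega>. min ?K (\<integral>\<^sup>+s\<in>{0..t}. ennreal ((norm (Hv k s \<omega> - zv s \<omega>))\<^sup>2) \<partial>lborel) \<partial>M) + ?E2"
      using simple_euler_error[OF i H[of k] \<delta> t y G z zR, of "C + 1"] C
      unfolding L_def B_def S_def Hv_def sy_def zv_def by simp
    also have "(\<integral>\<^sup>+\<omega>. min ?K (\<integral>\<^sup>+s\<in>{0..t}. ennreal ((norm (Hv k s \<omega> - zv s \<omega>))\<^sup>2) \<partial>lborel) \<partial>M)
        \<le> (\<integral>\<^sup>+\<omega>. 2 * min ?K (?d \<omega>) + 2 * min ?K (a k \<omega>) \<partial>M)"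
    proof (rule nn_integral_mono)
      fix \<omega> assume \<omega>: "\<omega> \<in> space M"
      have "(\<integral>\<^sup>+s\<in>{0..t}. ennreal ((norm (Hv k s \<omega> - zv s \<omega>))\<^sup>2) \<partial>lborel) \<le> 2 * ?d \<omega> + 2 * a k \<omega>"
        using square_integral_triangle[OF Hv_prog[of k] X_prog zv_prog t0 \<omega>, of 1] by (simp add: a_def zv_def add.commute)
      then have "min ?K (\<integral>\<^sup>+s\<in>{0..t}. ennreal ((norm (Hv k s \<omega> - zv s \<omega>))\<^sup>2) \<partial>lborel) \<le> min ?K (2 * ?d \<omega> + 2 * a k \<omega>)"
        by (intro min.mono order_refl)
      also have "\<dots> \<le> 2 * min ?K (?d \<omega>) + 2 * min ?K (a k \<omega>)" by (rule min_double_sum_le)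
      finally show "min ?K (\<integral>\<^sup>+s\<in>{0..t}. ennreal ((norm (Hv k s \<omega> - zv s \<omega>))\<^sup>2) \<partial>lborel) \<le> 2 * min ?K (?d \<omega>) + 2 * min ?K (a k \<omega>)" .
    qed
    also have "\<dots> = 2 * (\<integral>\<^sup>+\<omega>. min ?K (?d \<omega>) \<partial>M) + 2 * (\<integral>\<^sup>+\<omega>. min ?K (a k \<omega>) \<partial>M)"
      by (subst nn_integral_add) (auto simp: nn_integral_cmult)
    finally show ?thesis by (simp add: distrib_left mult.assoc[symmetric] add_right_mono mult_left_mono)
  qed
  have a_int: "(\<lambda>k. \<integral>\<^sup>+\<omega>. min ?K (a (r k) \<omega>) \<partial>M) \<longlonglongrightarrow> 0"
  proof -
    have "(\<lambda>k. \<integral>\<^sup>+\<omega>. min ?K (a (r k) \<omega>) \<partial>M) \<longlonglongrightarrow> (\<integral>\<^sup>+\<omega>. 0 \<partial>M)"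
    proof (rule nn_integral_dominated_convergence[where w="\<lambda>_. ?K"])
      show "AE \<omega> in M. (\<lambda>k. min ?K (a (r k) \<omega>)) \<longlonglongrightarrow> 0"
        using a_lim
      proof eventually_elim
        case (elim \<omega>)
        have "(\<lambda>k. min ?K (a (r k) \<omega>)) \<longlonglongrightarrow> min ?K 0" by (intro tendsto_min tendsto_const elim)
        then show ?case by (simp only: min_absorb2[OF zero_le])
      qed
    qed (auto simp: emeasure_space_1 less_top[symmetric] ennreal_mult_eq_top_iff)
    then show ?thesis by simp
  qed
  have "(\<integral>\<^sup>+\<omega>. ennreal ((norm (J t \<omega> - sy \<omega>))\<^sup>2) * indicator (G n) \<omega> \<partial>M) \<le> (\<integral>\<^sup>+\<omega>. liminf (\<lambda>k. L (r k) \<omega>) \<partial>M)"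
  proof (rule nn_integral_mono_AE)
    show "AE \<omega> in M. ennreal ((norm (J t \<omega> - sy \<omega>))\<^sup>2) * indicator (G n) \<omega> \<le> liminf (\<lambda>k. L (r k) \<omega>)"
      using a_lim S_lim XC AE_space
    proof eventually_elim
      case (elim \<omega>)
      show ?case
      proof (cases "\<omega> \<in> G n")
        case True
        \<comment> \<open>With this weight \<open>(1 + c) * C \<le> C + 1/2\<close>; the other half
          of the unit is left for the distance of the integrands.\<close>
        define c where "c = 1 / (2 * (C + 1))"
        have c: "0 < c" "c * C \<le> 1 / 2" using C by (auto simp: c_def field_simps)
        have pos: "ennreal (1 + 1 / c) * 0 < ennreal (1 / 2)"
          unfolding mult_zero_right by (subst ennreal_less_zero_iff) simp
        have "(\<lambda>k. ennreal (1 + 1 / c) * a (r k) \<omega>) \<longlonglongrightarrow> ennreal (1 + 1 / c) * 0"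
          by (intro ennreal_tendsto_cmult elim) simp
        then have "eventually (\<lambda>k. ennreal (1 + 1 / c) * a (r k) \<omega> < ennreal (1 / 2)) sequentially"
          by (rule order_tendstoD(2)[OF _ pos])
        then have "eventually (\<lambda>k. B (r k) \<omega> \<le> ennreal (C + 1)) sequentially"
        proof eventually_elim
          case (elim k)
          have "B (r k) \<omega> \<le> ennreal (1 + c) * (\<integral>\<^sup>+s\<in>{0..t}. ennreal ((norm (X s \<omega>))\<^sup>2) \<partial>lborel) + ennreal (1 + 1 / c) * a (r k) \<omega>"
            using square_integral_triangle[OF progressively_measurable_const[of 0] X_prog Hv_prog[of "r k"] t0 \<open>\<omega> \<in> space M\<close> c(1)]
            by (simp add: B_def a_def norm_minus_commute)
          also have "\<dots> \<le> ennreal (1 + c) * ennreal C + ennreal (1 / 2)"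
          proof (intro add_mono mult_left_mono less_imp_le[OF elim])
            show "(\<integral>\<^sup>+s\<in>{0..t}. ennreal ((norm (X s \<omega>))\<^sup>2) \<partial>lborel) \<le> ennreal C" 
              using \<open>\<omega> \<in> G n \<longrightarrow> _\<close> True by blast
          qed simp
          also have "\<dots> = ennreal ((1 + c) * C + 1 / 2)" using c C by (subst ennreal_plus) (auto simp: ennreal_mult)
          also have "\<dots> \<le> ennreal (C + 1)" using c by (intro ennreal_leI) (simp add: algebra_simps)
          finally show ?case .
        qed
        then have ev: "eventually (\<lambda>k. ennreal ((norm (S (r k) \<omega> - sy \<omega>))\<^sup>2) = L (r k) \<omega>) sequentially"
          by eventually_elim (use True in \<open>simp add: L_def\<close>)
        have "(\<lambda>k. ennreal ((norm (S (r k) \<omega> - sy \<omega>))\<^sup>2)) \<longlonglongrightarrow> ennreal ((norm (J t \<omega> - sy \<omega>))\<^sup>2)"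
          using elim(2) by (intro tendsto_intros)
        then have "(\<lambda>k. L (r k) \<omega>) \<longlonglongrightarrow> ennreal ((norm (J t \<omega> - sy \<omega>))\<^sup>2)"
          using ev by (rule Lim_transform_eventually)
        from lim_imp_Liminf[OF sequentially_bot this] True show ?thesis by simp
      qed simp
    qed
  qed
  also have "\<dots> \<le> liminf (\<lambda>k. \<integral>\<^sup>+\<omega>. L (r k) \<omega> \<partial>M)" by (rule nn_integral_liminf) simp
  also have "\<dots> \<le> liminf (\<lambda>k. 4 * (\<integral>\<^sup>+\<omega>. min ?K (?d \<omega>) \<partial>M) + 4 * (\<integral>\<^sup>+\<omega>. min ?K (a (r k) \<omega>) \<partial>M) + ?E2)"
    by (intro Liminf_mono always_eventually allI L_le)
  also have "\<dots> = 4 * (\<integral>\<^sup>+\<omega>. min ?K (?d \<omega>) \<partial>M) + 4 * 0 + ?E2"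
  proof (rule lim_imp_Liminf[OF sequentially_bot])
    show "(\<lambda>k. 4 * (\<integral>\<^sup>+\<omega>. min ?K (?d \<omega>) \<partial>M) + 4 * (\<integral>\<^sup>+\<omega>. min ?K (a (r k) \<omega>) \<partial>M) + ?E2)
        \<longlonglongrightarrow> 4 * (\<integral>\<^sup>+\<omega>. min ?K (?d \<omega>) \<partial>M) + 4 * 0 + ?E2"
      by (intro tendsto_add tendsto_const ennreal_tendsto_cmult a_int) simp
  qed
  finally show ?thesis by (simp add: sy_def)
qed

end

section \<open>Euler schemes and arbitrary solutions of the delayed system\<close>

text \<open>In a nondegenerate interval the rationals are dense; a single point has to be rational
  itself, which covers zero delays at time 0.\<close>

lemma norm_le_of_countable_dense:
  fixes f :: "real \<Rightarrow> 'b::real_normed_vector"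
  assumes cont: "continuous_on {a..b} f" and le: "a < b \<or> a \<in> \<rat>"
    and bound: "\<And>q. q \<in> \<rat> \<Longrightarrow> q \<in> {a..b} \<Longrightarrow> norm (f q) \<le> c" and r: "r \<in> {a..b}"
  shows "norm (f r) \<le> c"
proof (cases "a < b")
  case False
  then have "r = a" "a \<in> \<rat>" using r le by auto
  then show ?thesis using bound[of r] r by simp
next
  case True
  show ?thesis
  proof (rule ccontr)
    assume "\<not> norm (f r) \<le> c"
    then have pos: "0 < norm (f r) - c" by simp
    obtain d where d: "0 < d" "\<And>s. s \<in> {a..b} \<Longrightarrow> dist s r < d \<Longrightarrow> dist (f s) (f r) < norm (f r) - c"
      using cont r pos unfolding continuous_on_iff by meson
    have "max a (r - d) < min b (r + d)" using True r d(1) by auto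
    then obtain q where q: "q \<in> \<rat>" "max a (r - d) < q" "q < min b (r + d)" using Rats_dense_in_real by blast
    then have q': "q \<in> {a..b}" "dist q r < d" by (auto simp: dist_real_def)
    have "norm (f r) \<le> norm (f q) + dist (f q) (f r)"
      using norm_triangle_sub[of "f r" "f q"] by (simp add: dist_norm norm_minus_commute)
    then show False using bound[OF q(1) q'(1)] d(2)[OF q'] by simp
  qed
qed

text \<open>The shifted sum uses an initial stretch of the original terms, each of them
  once.\<close>

lemma sum_shifted_le:
  fixes f :: "nat \<Rightarrow> ennreal"
  shows "(\<Sum>j<m. if d \<le> j then f (j - d) else 0) \<le> (\<Sum>j<m. f j)"
proof -
  have "(\<Sum>j<m. if d \<le> j then f (j - d) else 0) = (\<Sum>j\<in>{d..<m}. f (j - d))"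
    by (rule sum.mono_neutral_cong_right) auto
  also have "\<dots> = (\<Sum>j\<in>(\<lambda>j. j - d) ` {d..<m}. f j)"
    by (rule sum.reindex_cong[symmetric, where l="\<lambda>j. j - d"]) (auto simp: inj_on_def)
  also have "\<dots> \<le> (\<Sum>j<m. f j)" by (rule sum_mono2) auto
  finally show ?thesis .
qed

text \<open>A given solution with its stochastic integrals \<open>J\<close>, a final time
  \<open>t\<close> and a bound \<open>R\<close> at which its path will be cut off. Fixing
  \<open>t\<close> first makes it the last node of every grid.\<close>

locale sdde_solution_path = independent_wiener_processes M F N W
  for M :: "'a measure" and F :: "real \<Rightarrow> 'a measure" and N :: nat and W :: "nat \<Rightarrow> real \<Rightarrow> 'a \<Rightarrow> real" +
  fixes A :: "nat \<Rightarrow> real^'n^'n" and h :: "nat \<Rightarrow> real" and \<phi> x :: "real \<Rightarrow> 'a \<Rightarrow> real^'n"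
    and J :: "nat \<Rightarrow> real \<Rightarrow> 'a \<Rightarrow> real^'n" and t KA R :: real
  assumes N_pos: "1 \<le> N" and h_nonneg: "\<And>i. i \<in> {1..N} \<Longrightarrow> 0 \<le> h i"
    and \<phi>_L2: "\<And>s. s \<in> {- max_delay N h..0} \<Longrightarrow> L2F 0 (\<phi> s)"
    and x_adapted: "\<And>s. 0 \<le> s \<Longrightarrow> x s \<in> borel_measurable (F s)"
    and x_continuous: "AE \<omega> in M. continuous_on {- max_delay N h..} (\<lambda>s. x s \<omega>)"
    and x_initial: "AE \<omega> in M. \<forall>s\<in>{- max_delay N h..0}. x s \<omega> = \<phi> s \<omega>"
    and J_ito: "\<And>i. i \<in> {1..N} \<Longrightarrow> is_ito_integral M F (W i) (\<lambda>s \<omega>. A i *v x (s - h i) \<omega>) (J i)"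
    and x_equation: "AE \<omega> in M. \<forall>s\<ge>0. x s \<omega> = x 0 \<omega> + integral {0..s} (\<lambda>s. A 0 *v x s \<omega>) + (\<Sum>i=1..N. J i s \<omega>)"
    and t_pos: "0 < t" and KA_pos: "0 < KA" and KA: "\<And>i v. i \<le> N \<Longrightarrow> norm (A i *v v) \<le> KA * norm v" and R_nonneg: "0 \<le> R"
begin

abbreviation "hb \<equiv> max_delay N h"

definition step :: "nat \<Rightarrow> real" where "step n = t / real n"

text \<open>Rounded down, so that the scheme reads the initial function only inside
  \<open>[- hb, 0]\<close>.\<close>

definition lag :: "nat \<Rightarrow> nat \<Rightarrow> nat" where "lag n i = nat \<lfloor>h i / step n\<rfloor>"

text \<open>At negative times the solution agrees with \<open>\<phi>\<close> only almost surely and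
  carries no measurability of its own; taking \<open>\<phi>\<close> there makes the path measurable
  at every time.\<close>

definition path :: "real \<Rightarrow> 'a \<Rightarrow> real^'n" where "path s \<omega> = (if s < 0 then \<phi> s \<omega> else x s \<omega>)"

definition times :: "real set" where "times = \<rat> \<union> (*) t ` \<rat>"

text \<open>The multiples of \<open>t\<close> make all grid points of all Euler schemes members of \<open>times\<close>.\<close>

definition below :: "real \<Rightarrow> 'a set" where
  "below s = {\<omega>\<in>space M. \<forall>q\<in>times \<inter> {- hb..s}. norm (path q \<omega>) \<le> R}"

definition lagged :: "nat \<Rightarrow> nat \<Rightarrow> nat \<Rightarrow> 'a \<Rightarrow> real^'n" where
  "lagged n i j \<omega> = (if lag n i \<le> j then x (real (j - lag n i) * step n) \<omega> else \<phi> (- (real (lag n i - j) * step n)) \<omega>)"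

abbreviation eul :: "nat \<Rightarrow> nat \<Rightarrow> 'a \<Rightarrow> real^'n" where "eul n \<equiv> euler A (step n) (lag n) \<phi>"

definition err :: "nat \<Rightarrow> nat \<Rightarrow> 'a \<Rightarrow> real^'n" where
  "err n j \<omega> = x (real j * step n) \<omega> - eul n j \<omega>"

definition errint :: "nat \<Rightarrow> nat \<Rightarrow> ennreal" where
  "errint n j = (\<integral>\<^sup>+\<omega>. ennreal ((norm (err n j \<omega>))\<^sup>2) * indicator (below (real j * step n)) \<omega> \<partial>M)"

text \<open>The cost of freezing the delayed coefficient on the grid. The cap is that of
  \<open>ito_euler_error\<close> for \<open>C = (KA * R)\<^sup>2 * t\<close> and coefficients
  bounded by \<open>KA * R\<close>.\<close>

definition \<rho> :: "nat \<Rightarrow> nat \<Rightarrow> ennreal" where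
  "\<rho> n i = (\<integral>\<^sup>+\<omega>. min (ennreal (2 * ((KA * R)\<^sup>2 * t + 1) + 2 * (KA * R)\<^sup>2 * t))
     (\<integral>\<^sup>+s\<in>{0..t}. ennreal ((norm (A i *v x (s - h i) \<omega>
        - simple_value n (\<lambda>j. real j * step n) (\<lambda>j \<omega>. A i *v lagged n i j \<omega>) s \<omega>))\<^sup>2) \<partial>lborel) \<partial>M)"

lemma delay_le_hb: "i \<in> {1..N} \<Longrightarrow> h i \<le> hb"
  unfolding max_delay_def by (intro Max_ge) auto

lemma hb_nonneg: "0 \<le> hb"
  using h_nonneg[of 1] delay_le_hb[of 1] N_pos by auto

lemma step_pos: "0 < n \<Longrightarrow> 0 < step n"
  using t_pos by (simp add: step_def)

lemma step_last: "0 < n \<Longrightarrow> real n * step n = t"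
  by (simp add: step_def)

lemma grid_le_t: "0 < n \<Longrightarrow> m \<le> n \<Longrightarrow> real m * step n \<le> t"
  using step_last[of n] step_pos[of n] mult_right_mono[of "real m" "real n" "step n"] by simp

lemma lag_le: "i \<in> {1..N} \<Longrightarrow> 0 < n \<Longrightarrow> real (lag n i) * step n \<le> h i"
proof -
  assume i: "i \<in> {1..N}" and n: "0 < n"
  have "0 \<le> h i / step n" using h_nonneg[OF i] step_pos[OF n] by simp
  then have "real (lag n i) \<le> h i / step n" by (simp add: lag_def)
  then show ?thesis using step_pos[OF n] by (simp add: pos_le_divide_eq)
qed

lemma lag_ge: "i \<in> {1..N} \<Longrightarrow> 0 < n \<Longrightarrow> h i \<le> (real (lag n i) + 1) * step n"
proof -
  assume i: "i \<in> {1..N}" and n: "0 < n"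
  have "0 \<le> h i / step n" using h_nonneg[OF i] step_pos[OF n] by simp
  then have "real (lag n i) = of_int \<lfloor>h i / step n\<rfloor>" by (simp add: lag_def)
  moreover have "h i / step n \<le> of_int \<lfloor>h i / step n\<rfloor> + 1" by linarith
  ultimately have "h i / step n \<le> real (lag n i) + 1" by simp
  then show ?thesis using step_pos[OF n] by (simp add: pos_divide_le_eq)
qed

lemma past_history:
  assumes "i \<in> {1..N}" "0 < n" "k \<le> lag n i"
  shows "- (real k * step n) \<in> {- hb..0}"
proof -
  have "real k * step n \<le> real (lag n i) * step n"
    using assms step_pos[of n] by (intro mult_right_mono) auto
  then have "real k * step n \<le> hb" using lag_le[OF assms(1,2)] delay_le_hb[OF assms(1)] by linarith
  then show ?thesis using step_pos[OF assms(2)] by auto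
qed

lemma eul_L2:
  assumes "0 < n"
  shows "L2F (real j * step n) (eul n j)"
    and "i \<in> {1..N} \<Longrightarrow> L2F (real j * step n) (euler_delayed A (step n) (lag n) \<phi> i j)"
proof -
  have 0: "L2F 0 (\<phi> 0)" using \<phi>_L2[of 0] hb_nonneg by simp
  have 1: "L2F 0 (\<phi> (- (real k * step n)))" if "i \<in> {1..N}" "k \<le> lag n i" for i k
    using \<phi>_L2[OF past_history[OF that(1) assms that(2)]] .
  have 2: "0 \<le> step n" using step_pos[OF assms] by simp
  show "L2F (real j * step n) (eul n j)" by (rule euler_L2F[OF 0 1 2])
  show "L2F (real j * step n) (euler_delayed A (step n) (lag n) \<phi> i j)" if "i \<in> {1..N}"
    by (rule euler_delayed_L2F[OF 0 1 2 that])
qed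

lemma path_measurable:
  assumes "0 \<le> s" "q \<in> {- hb..s}"
  shows "path q \<in> borel_measurable (F s)"
proof (cases "q < 0")
  case True
  then show ?thesis using measurable_F_mono[OF L2F_measurable[OF \<phi>_L2[of q]], of s] assms by (simp add: path_def[abs_def])
next
  case False
  then show ?thesis using measurable_F_mono[OF x_adapted[of q], of s] assms by (simp add: path_def[abs_def])
qed

lemma lagged_eq_path: "0 < n \<Longrightarrow> lagged n i j = path ((real j - real (lag n i)) * step n)"
proof
  fix \<omega> assume n: "0 < n"
  have "(real j - real (lag n i)) * step n = - (real (lag n i - j) * step n)" if "j < lag n i"
    using that by (simp add: of_nat_diff algebra_simps)
  then show "lagged n i j \<omega> = path ((real j - real (lag n i)) * step n) \<omega>"
    using step_pos[OF n] by (auto simp: lagged_def path_def of_nat_diff mult_less_0_iff not_le)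
qed

lemma lagged_time:
  assumes "i \<in> {1..N}" "0 < n"
  shows "(real j - real (lag n i)) * step n \<in> times \<inter> {- hb..real j * step n}"
proof -
  have "(real j - real (lag n i)) * step n = t * ((real j - real (lag n i)) / real n)" by (simp add: step_def)
  moreover have "t * ((real j - real (lag n i)) / real n) \<in> (*) t ` \<rat>" by (intro imageI) simp
  ultimately have "(real j - real (lag n i)) * step n \<in> times" unfolding times_def by simp
  moreover have "0 \<le> real j * step n" "0 \<le> real (lag n i) * step n" using step_pos[OF assms(2)] by auto
  ultimately show ?thesis
    using lag_le[OF assms] delay_le_hb[OF assms(1)] by (auto simp: left_diff_distrib)
qed

lemma below_sets: "0 \<le> s \<Longrightarrow> below s \<in> sets (F s)"
proof -
  assume s: "0 \<le> s"
  have c: "countable (times \<inter> {- hb..s})" unfolding times_def by (intro countable_Int1) (auto simp: countable_rat)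
  have "{\<omega>\<in>space (F s). norm (path q \<omega>) \<le> R} \<in> sets (F s)" if "q \<in> times \<inter> {- hb..s}" for q
  proof -
    have [measurable]: "path q \<in> borel_measurable (F s)" using that by (intro path_measurable[OF s]) simp
    show ?thesis by measurable
  qed
  moreover have ne: "0 \<in> times \<inter> {- hb..s}" using s hb_nonneg by (simp add: times_def)
  ultimately have "(\<Inter>q\<in>times \<inter> {- hb..s}. {\<omega>\<in>space (F s). norm (path q \<omega>) \<le> R}) \<in> sets (F s)"
    by (intro sets.countable_INT'[OF c]) auto
  moreover have "below s = (\<Inter>q\<in>times \<inter> {- hb..s}. {\<omega>\<in>space (F s). norm (path q \<omega>) \<le> R})"
    using s ne by (auto simp: below_def)
  ultimately show "below s \<in> sets (F s)" by simp
qed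

lemma below_events: "0 \<le> s \<Longrightarrow> below s \<in> events"
  using below_sets sets_F by blast

lemma below_antimono: "r \<le> s \<Longrightarrow> below s \<subseteq> below r"
  by (auto simp: below_def)

text \<open>\<open>below\<close> tests only countably many times in order to be an event; continuity
  of the path extends the bound to all times.\<close>

lemma below_AE: "AE \<omega> in M. \<forall>s\<ge>0. \<omega> \<in> below s \<longrightarrow> (\<forall>r\<in>{- hb..s}. norm (x r \<omega>) \<le> R)"
  using x_continuous x_initial
proof eventually_elim
  case (elim \<omega>)
  show ?case
  proof (intro allI impI ballI)
    fix s r assume s: "0 \<le> s" and \<omega>: "\<omega> \<in> below s" and r: "r \<in> {- hb..s}"
    show "norm (x r \<omega>) \<le> R"
    proof (rule norm_le_of_countable_dense[OF _ _ _ r])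
      show "continuous_on {- hb..s} (\<lambda>r. x r \<omega>)" using elim(1) by (rule continuous_on_subset) auto
      show "- hb < s \<or> - hb \<in> \<rat>" using s hb_nonneg by (cases "hb = 0") auto
      fix q assume q: "q \<in> \<rat>" "q \<in> {- hb..s}"
      then have "norm (path q \<omega>) \<le> R" using \<omega> by (auto simp: below_def times_def)
      then show "norm (x q \<omega>) \<le> R" using elim(2) q by (auto simp: path_def split: if_splits)
    qed
  qed
qed

lemma x_borel: "0 \<le> s \<Longrightarrow> x s \<in> borel_measurable M"
  using measurable_FM[OF _ x_adapted] by blast

lemma err_borel: "0 < n \<Longrightarrow> err n j \<in> borel_measurable M"
  unfolding err_def[abs_def] using x_borel[of "real j * step n"] L2F_borel[OF eul_L2(1)] step_pos[of n]
  by (intro borel_measurable_diff) auto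

text \<open>Before the lag has elapsed, \<open>lagged\<close> and the scheme both read
  \<open>\<phi>\<close> and their difference is zero. Afterwards it is the error
  \<open>lag n i\<close> steps earlier. The events \<open>below\<close> decrease in time, so the
  indicator may be replaced by the one of the earlier node, and the shifted errors are again terms
  of the full sum.\<close>

lemma ito_term_error:
  assumes i: "i \<in> {1..N}" and n: "0 < n" and m: "m \<le> n"
  shows "(\<integral>\<^sup>+\<omega>. ennreal ((norm (J i (real m * step n) \<omega> - (\<Sum>j<m. dW i (real j * step n) (real (Suc j) * step n) \<omega>
      *\<^sub>R (A i *v euler_delayed A (step n) (lag n) \<phi> i j \<omega>))))\<^sup>2) * indicator (below (real m * step n)) \<omega> \<partial>M)
    \<le> 4 * \<rho> n i + ennreal (2 * KA\<^sup>2 * step n) * (\<Sum>j<m. errint n j)"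
proof -
  have iN: "i \<le> N" using i by simp
  have s0: "0 < step n" using step_pos[OF n] .
  have mt: "real m * step n \<le> t" by (rule grid_le_t[OF n m])
  let ?z = "\<lambda>j \<omega>. A i *v lagged n i j \<omega>" and ?y = "\<lambda>j \<omega>. A i *v euler_delayed A (step n) (lag n) \<phi> i j \<omega>"
  let ?C = "(KA * R)\<^sup>2 * t" and ?tm = "real m * step n"
  have "(\<integral>\<^sup>+\<omega>. ennreal ((norm (J i ?tm \<omega> - (\<Sum>j<m. dW i (real j * step n) (real (Suc j) * step n) \<omega> *\<^sub>R ?y j \<omega>)))\<^sup>2)
      * indicator (below ?tm) \<omega> \<partial>M)
    \<le> 4 * (\<integral>\<^sup>+\<omega>. min (ennreal (2 * (?C + 1) + 2 * (KA * R)\<^sup>2 * ?tm))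
          (\<integral>\<^sup>+s\<in>{0..?tm}. ennreal ((norm (A i *v x (s - h i) \<omega> - simple_value m (\<lambda>j. real j * step n) ?z s \<omega>))\<^sup>2) \<partial>lborel) \<partial>M)
      + 2 * (\<Sum>j<m. ennreal (step n) * (\<integral>\<^sup>+\<omega>. ennreal ((norm (?z j \<omega> - ?y j \<omega>))\<^sup>2) * indicator (below (real j * step n)) \<omega> \<partial>M))"
  proof (rule ito_euler_error[OF i J_ito[OF i] s0 refl, where G="\<lambda>j. below (real j * step n)"])
    show "L2F (real j * step n) (?y j)" for j by (intro L2F_matrix eul_L2(2)[OF n i])
    show "below (real j * step n) \<in> sets (F (real j * step n))" for j using s0 by (intro below_sets) simp
    show "below (real k * step n) \<subseteq> below (real j * step n)" if "j \<le> k" for j k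
      using that s0 by (intro below_antimono mult_right_mono) auto
    show "?z j \<in> borel_measurable (F (real j * step n))" for j
    proof -
      have "lagged n i j \<in> borel_measurable (F (real j * step n))"
        unfolding lagged_eq_path[OF n] using lagged_time[OF i n, of j] s0 by (intro path_measurable) auto
      then show ?thesis
        by (rule measurable_compose) (intro borel_measurable_continuous_onI matrix_vector_mult_linear_continuous_on)
    qed
    show "norm (?z j \<omega>) \<le> KA * R" if "\<omega> \<in> below (real j * step n)" for j \<omega>
    proof -
      have "norm (lagged n i j \<omega>) \<le> R" using that lagged_time[OF i n, of j] unfolding lagged_eq_path[OF n] by (auto simp: below_def)
      then show ?thesis using KA[OF iN, of "lagged n i j \<omega>"] KA_pos by (auto intro: order_trans mult_left_mono)
    qed
    show "0 \<le> ?C" using t_pos by simp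
    show "AE \<omega> in M. \<omega> \<in> below ?tm \<longrightarrow> (\<integral>\<^sup>+s\<in>{0..?tm}. ennreal ((norm (A i *v x (s - h i) \<omega>))\<^sup>2) \<partial>lborel) \<le> ennreal ?C"
      using below_AE
    proof eventually_elim
      case (elim \<omega>)
      show ?case
      proof
        assume \<omega>: "\<omega> \<in> below ?tm"
        have "(\<integral>\<^sup>+s\<in>{0..?tm}. ennreal ((norm (A i *v x (s - h i) \<omega>))\<^sup>2) \<partial>lborel) \<le> ennreal ((KA * R)\<^sup>2 * ?tm)"
        proof (rule set_nn_integral_le_const)
          fix s assume s: "s \<in> {0..?tm} - {0}"
          then have "s - h i \<in> {- hb..?tm}" using delay_le_hb[OF i] h_nonneg[OF i] by auto
          moreover have "0 \<le> ?tm" using s0 by simp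
          ultimately have "norm (x (s - h i) \<omega>) \<le> R" using elim \<omega> by blast
          then have "norm (A i *v x (s - h i) \<omega>) \<le> KA * R"
            using KA[OF iN, of "x (s - h i) \<omega>"] KA_pos by (auto intro: order_trans mult_left_mono)
          then show "ennreal ((norm (A i *v x (s - h i) \<omega>))\<^sup>2) \<le> ennreal ((KA * R)\<^sup>2)" by (intro ennreal_leI power_mono) auto
        qed (use s0 in auto)
        also have "\<dots> \<le> ennreal ?C" using mt by (intro ennreal_leI mult_left_mono) auto
        finally show "(\<integral>\<^sup>+s\<in>{0..?tm}. ennreal ((norm (A i *v x (s - h i) \<omega>))\<^sup>2) \<partial>lborel) \<le> ennreal ?C" .
      qed
    qed
  qed
  also have "\<dots> \<le> 4 * \<rho> n i + 2 * (\<Sum>j<m. ennreal (step n) * (if lag n i \<le> j then ennreal (KA\<^sup>2) * errint n (j - lag n i) else 0))"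
  proof (intro add_mono mult_left_mono sum_mono)
    show "(\<integral>\<^sup>+\<omega>. min (ennreal (2 * (?C + 1) + 2 * (KA * R)\<^sup>2 * ?tm))
          (\<integral>\<^sup>+s\<in>{0..?tm}. ennreal ((norm (A i *v x (s - h i) \<omega> - simple_value m (\<lambda>j. real j * step n) ?z s \<omega>))\<^sup>2) \<partial>lborel) \<partial>M)
        \<le> \<rho> n i"
      unfolding \<rho>_def
    proof (intro nn_integral_mono min.mono ennreal_leI add_left_mono mult_left_mono mt)
      fix \<omega> s
      show "ennreal ((norm (A i *v x (s - h i) \<omega> - simple_value m (\<lambda>j. real j * step n) ?z s \<omega>))\<^sup>2) * indicator {0..?tm} s
          \<le> ennreal ((norm (A i *v x (s - h i) \<omega> - simple_value n (\<lambda>j. real j * step n) ?z s \<omega>))\<^sup>2) * indicator {0..t} s"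
      proof (cases "s \<in> {0..?tm}")
        case True
        \<comment> \<open>Steps after node \<open>m\<close> do not act before it, so the distance up
          to \<open>m\<close> is at most the one up to \<open>t\<close>; this makes the bound
          uniform in \<open>m\<close>.\<close>
        have "simple_value n (\<lambda>j. real j * step n) ?z s \<omega> = simple_value m (\<lambda>j. real j * step n) ?z s \<omega>"
          unfolding simple_value_def
        proof (rule sum.mono_neutral_right)
          show "\<forall>j\<in>{..<n} - {..<m}. indicator {real j * step n<..real (Suc j) * step n} s *\<^sub>R ?z j \<omega> = 0"
          proof
            fix j assume "j \<in> {..<n} - {..<m}"
            then have "real m * step n \<le> real j * step n" using s0 by (intro mult_right_mono) auto
            then show "indicator {real j * step n<..real (Suc j) * step n} s *\<^sub>R ?z j \<omega> = 0" using True by (auto simp: indicator_def)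
          qed
        qed (use m in auto)
        then show ?thesis using True mt by (auto simp: indicator_def)
      qed simp
    qed auto
    fix j assume "j \<in> {..<m}"
    show "(\<integral>\<^sup>+\<omega>. ennreal ((norm (?z j \<omega> - ?y j \<omega>))\<^sup>2) * indicator (below (real j * step n)) \<omega> \<partial>M)
        \<le> (if lag n i \<le> j then ennreal (KA\<^sup>2) * errint n (j - lag n i) else 0)"
    proof (cases "lag n i \<le> j")
      case True
      have e: "?z j \<omega> - ?y j \<omega> = A i *v err n (j - lag n i) \<omega>" for \<omega>
        using True by (simp add: lagged_def euler_delayed_def err_def matrix_vector_mult_diff_distrib)
      have bm: "below (real j * step n) \<subseteq> below (real (j - lag n i) * step n)"
        using s0 by (intro below_antimono mult_right_mono) auto
      have [measurable]: "err n (j - lag n i) \<in> borel_measurable M" "below (real (j - lag n i) * step n) \<in> events"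
        using err_borel[OF n] s0 by (auto intro!: below_events)
      have "(\<integral>\<^sup>+\<omega>. ennreal ((norm (?z j \<omega> - ?y j \<omega>))\<^sup>2) * indicator (below (real j * step n)) \<omega> \<partial>M)
          \<le> (\<integral>\<^sup>+\<omega>. ennreal (KA\<^sup>2) * (ennreal ((norm (err n (j - lag n i) \<omega>))\<^sup>2) * indicator (below (real (j - lag n i) * step n)) \<omega>) \<partial>M)"
      proof (rule nn_integral_mono)
        fix \<omega>
        have "(norm (A i *v err n (j - lag n i) \<omega>))\<^sup>2 \<le> KA\<^sup>2 * (norm (err n (j - lag n i) \<omega>))\<^sup>2"
          unfolding power_mult_distrib[symmetric] using KA[OF iN] by (intro power_mono) auto
        then have "ennreal ((norm (A i *v err n (j - lag n i) \<omega>))\<^sup>2) \<le> ennreal (KA\<^sup>2) * ennreal ((norm (err n (j - lag n i) \<omega>))\<^sup>2)"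
          by (simp add: ennreal_mult[symmetric] ennreal_leI)
        then show "ennreal ((norm (?z j \<omega> - ?y j \<omega>))\<^sup>2) * indicator (below (real j * step n)) \<omega>
            \<le> ennreal (KA\<^sup>2) * (ennreal ((norm (err n (j - lag n i) \<omega>))\<^sup>2) * indicator (below (real (j - lag n i) * step n)) \<omega>)"
          unfolding e using bm by (auto simp: indicator_def)
      qed
      also have "\<dots> = ennreal (KA\<^sup>2) * errint n (j - lag n i)"
        unfolding errint_def by (rule nn_integral_cmult) measurable
      finally show ?thesis using True by simp
    next
      case False
      then have "?z j \<omega> - ?y j \<omega> = 0" for \<omega> by (simp add: lagged_def euler_delayed_def)
      then show ?thesis using False by simp
    qed
  qed auto
  also have "2 * (\<Sum>j<m. ennreal (step n) * (if lag n i \<le> j then ennreal (KA\<^sup>2) * errint n (j - lag n i) else 0))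
      = ennreal (2 * KA\<^sup>2 * step n) * (\<Sum>j<m. if lag n i \<le> j then errint n (j - lag n i) else 0)"
  proof -
    have "ennreal (2 * KA\<^sup>2 * step n) = 2 * (ennreal (step n) * ennreal (KA\<^sup>2))"
      using s0 by (simp add: ennreal_mult mult_ac)
    moreover have "(\<Sum>j<m. ennreal (step n) * (if lag n i \<le> j then ennreal (KA\<^sup>2) * errint n (j - lag n i) else 0))
        = (\<Sum>j<m. (ennreal (step n) * ennreal (KA\<^sup>2)) * (if lag n i \<le> j then errint n (j - lag n i) else 0))"
      by (intro sum.cong refl) (simp add: mult.assoc)
    ultimately show ?thesis by (simp only: sum_distrib_left mult.assoc)
  qed
  also have "4 * \<rho> n i + ennreal (2 * KA\<^sup>2 * step n) * (\<Sum>j<m. if lag n i \<le> j then errint n (j - lag n i) else 0)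
      \<le> 4 * \<rho> n i + ennreal (2 * KA\<^sup>2 * step n) * (\<Sum>j<m. errint n j)"
    by (intro add_left_mono mult_left_mono sum_shifted_le) auto
  finally show ?thesis .
qed

end

lemma uniform_cell_exists:
  assumes "0 < \<delta>" "0 < s" "s \<le> real m * \<delta>"
  obtains j where "j < m" "real j * \<delta> < s" "s \<le> real (Suc j) * \<delta>"
proof
  let ?c = "\<lceil>s / \<delta>\<rceil>"
  have c: "0 < ?c" using assms by simp
  have "s / \<delta> \<le> real m" using assms by (simp add: pos_divide_le_eq)
  then have "?c \<le> int m" by (simp add: ceiling_le_iff)
  then show "nat (?c - 1) < m" using c by linarith
  have e: "real (nat (?c - 1)) = of_int ?c - 1" using c by simp
  have "of_int ?c - 1 < s / \<delta>" by linarith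
  then show "real (nat (?c - 1)) * \<delta> < s" unfolding e using assms(1) by (simp only: pos_less_divide_eq)
  have "s \<le> of_int ?c * \<delta>" using le_of_int_ceiling[of "s / \<delta>"] assms(1) by (simp only: pos_divide_le_eq)
  then show "s \<le> real (Suc (nat (?c - 1))) * \<delta>" using e by simp
qed

section \<open>The remainders of drift and noise tend to zero\<close>

context sdde_solution_path
begin

text \<open>Almost surely the drift integral minus its Riemann sum. Expressed through the equation,
  without the integral, it is visibly a random variable.\<close>

definition drift_rem :: "nat \<Rightarrow> nat \<Rightarrow> 'a \<Rightarrow> real^'n" where
  "drift_rem n m \<omega> = x (real m * step n) \<omega> - x 0 \<omega> - (\<Sum>i=1..N. J i (real m * step n) \<omega>)
    - (\<Sum>j<m. step n *\<^sub>R (A 0 *v x (real j * step n) \<omega>))"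

text \<open>The supremum stands inside the integral to give a single bound for all nodes.\<close>

definition drift_err :: "nat \<Rightarrow> ennreal" where
  "drift_err n = (\<integral>\<^sup>+\<omega>. (SUP m\<in>{..n}. ennreal ((norm (drift_rem n m \<omega>))\<^sup>2) * indicator (below (real m * step n)) \<omega>) \<partial>M)"

lemma J_borel: "i \<in> {1..N} \<Longrightarrow> 0 \<le> s \<Longrightarrow> J i s \<in> borel_measurable M"
  using J_ito[of i] measurable_FM[of s "J i s"] by (auto simp: is_ito_integral_def)

lemma drift_rem_borel: "0 < n \<Longrightarrow> drift_rem n m \<in> borel_measurable M"
proof -
  assume n: "0 < n"
  have nn: "0 \<le> real j * step n" for j using step_pos[OF n] by simp
  have "(\<lambda>\<omega>. A 0 *v x (real j * step n) \<omega>) \<in> borel_measurable M" for j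
    using x_borel[OF nn[of j]]
    by (rule measurable_compose) (intro borel_measurable_continuous_onI matrix_vector_mult_linear_continuous_on)
  then show "drift_rem n m \<in> borel_measurable M"
    unfolding drift_rem_def[abs_def] using x_borel[OF nn[of m]] x_borel[of 0] J_borel[OF _ nn[of m]]
    by (intro borel_measurable_diff borel_measurable_sum borel_measurable_scaleR borel_measurable_const) auto
qed

lemma step_tendsto: "(\<lambda>n. step (Suc n)) \<longlonglongrightarrow> 0"
proof -
  have "(\<lambda>n. t * inverse (real (Suc n))) \<longlonglongrightarrow> t * 0"
    by (intro tendsto_mult tendsto_const LIMSEQ_inverse_real_of_nat)
  then show ?thesis by (simp add: step_def divide_inverse)
qed

lemma oscillation_AE:
  "AE \<omega> in M. \<forall>e>0. eventually (\<lambda>n. \<forall>r\<in>{- hb..t}. \<forall>s\<in>{- hb..t}. \<bar>r - s\<bar> \<le> step (Suc n) \<longrightarrow>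
    norm (x r \<omega> - x s \<omega>) \<le> e) sequentially"
  using x_continuous
proof eventually_elim
  case (elim \<omega>)
  show ?case
  proof (intro allI impI)
    fix e :: real assume e: "0 < e"
    have "continuous_on {- hb..t} (\<lambda>s. x s \<omega>)" using elim by (rule continuous_on_subset) auto
    then have "uniformly_continuous_on {- hb..t} (\<lambda>s. x s \<omega>)" by (rule compact_uniformly_continuous) simp
    then obtain d where d: "0 < d" "\<And>r s. s \<in> {- hb..t} \<Longrightarrow> r \<in> {- hb..t} \<Longrightarrow> dist r s < d \<Longrightarrow> dist (x r \<omega>) (x s \<omega>) < e"
      using e unfolding uniformly_continuous_on_def by meson
    from order_tendstoD(2)[OF step_tendsto d(1)]
    show "eventually (\<lambda>n. \<forall>r\<in>{- hb..t}. \<forall>s\<in>{- hb..t}. \<bar>r - s\<bar> \<le> step (Suc n) \<longrightarrow> norm (x r \<omega> - x s \<omega>) \<le> e) sequentially"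
    proof eventually_elim
      case (elim n)
      show ?case
      proof (intro ballI impI)
        fix r s assume rs: "r \<in> {- hb..t}" "s \<in> {- hb..t}" "\<bar>r - s\<bar> \<le> step (Suc n)"
        then have "dist r s < d" using elim by (simp add: dist_real_def)
        from d(2)[OF rs(2,1) this] show "norm (x r \<omega> - x s \<omega>) \<le> e" by (simp add: dist_norm)
      qed
    qed
  qed
qed

text \<open>A pathwise bound with free oscillation \<open>e\<close>: \<open>e = 2 * R\<close> yields
  the dominating constant for dominated convergence, small \<open>e\<close> the convergence
  itself.\<close>

lemma drift_rem_bound:
  "AE \<omega> in M. \<forall>n m e. 0 < n \<longrightarrow> m \<le> n \<longrightarrow> 0 \<le> e \<longrightarrow>
     (\<forall>j<m. \<forall>s. real j * step n < s \<longrightarrow> s \<le> real (Suc j) * step n \<longrightarrow> norm (x s \<omega> - x (real j * step n) \<omega>) \<le> e) \<longrightarrow>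
     norm (drift_rem n m \<omega>) \<le> KA * e * t"
  using x_continuous x_equation
proof eventually_elim
  case (elim \<omega>)
  show ?case
  proof (intro allI impI)
    fix n m e assume n: "0 < n" and m: "m \<le> n" and e: "0 \<le> (e::real)"
      and osc: "\<forall>j<m. \<forall>s. real j * step n < s \<longrightarrow> s \<le> real (Suc j) * step n \<longrightarrow> norm (x s \<omega> - x (real j * step n) \<omega>) \<le> e"
    let ?tm = "real m * step n"
    have s0: "0 < step n" using step_pos[OF n] .
    have tm0: "0 \<le> ?tm" using s0 by simp
    have "continuous_on {0..?tm} (\<lambda>s. A 0 *v x s \<omega>)"
      by (rule continuous_on_compose2[OF matrix_vector_mult_linear_continuous_on continuous_on_subset[OF elim(1)]])
        (use hb_nonneg in auto)
    then have hx: "((\<lambda>s. A 0 *v x s \<omega>) has_integral integral {0..?tm} (\<lambda>s. A 0 *v x s \<omega>)) {0..?tm}"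
      using integrable_continuous_real integrable_integral by blast
    let ?\<xi> = "\<lambda>j \<omega>. A 0 *v x (real j * step n) \<omega>"
    have hs: "((\<lambda>s. simple_value m (\<lambda>j. real j * step n) ?\<xi> s \<omega>) has_integral
        simple_integral (\<lambda>t _. t) m (\<lambda>j. real j * step n) ?\<xi> ?tm \<omega>) {0..?tm}"
      by (rule simple_value_has_integral) (use s0 in \<open>auto intro: mult_right_mono\<close>)
    have si: "simple_integral (\<lambda>t _. t) m (\<lambda>j. real j * step n) ?\<xi> ?tm \<omega> = (\<Sum>j<m. step n *\<^sub>R (A 0 *v x (real j * step n) \<omega>))"
      unfolding simple_integral_def
    proof (rule sum.cong[OF refl])
      fix j assume "j \<in> {..<m}"
      then have "min ?tm (real (Suc j) * step n) = real (Suc j) * step n" "min ?tm (real j * step n) = real j * step n"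
        using s0 by (auto intro!: min_absorb2 mult_right_mono)
      moreover have "real (Suc j) * step n - real j * step n = step n" by (simp add: algebra_simps)
      ultimately show "(min ?tm (real (Suc j) * step n) - min ?tm (real j * step n)) *\<^sub>R (A 0 *v x (real j * step n) \<omega>)
          = step n *\<^sub>R (A 0 *v x (real j * step n) \<omega>)" by (simp only:)
    qed
    have eq: "drift_rem n m \<omega> = integral {0..?tm} (\<lambda>s. A 0 *v x s \<omega>) - simple_integral (\<lambda>t _. t) m (\<lambda>j. real j * step n) ?\<xi> ?tm \<omega>"
      unfolding drift_rem_def si using elim(2)[rule_format, OF tm0] by simp
    have "norm (drift_rem n m \<omega>) \<le> (KA * e) * measure lborel {0..?tm}"
      unfolding eq
    proof (rule has_integral_bound_real[OF _ _ has_integral_diff[OF hx hs], of _ "{0}"])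
      fix s assume s: "s \<in> {0..?tm} - {0}"
      then obtain j where j: "j < m" "real j * step n < s" "s \<le> real (Suc j) * step n"
        using uniform_cell_exists[OF s0, of s m] by auto
      have v: "simple_value m (\<lambda>j. real j * step n) ?\<xi> s \<omega> = A 0 *v x (real j * step n) \<omega>"
        by (rule simple_value_eq_single[OF _ j]) (use s0 in \<open>auto intro: mult_right_mono\<close>)
      have "norm (A 0 *v x s \<omega> - A 0 *v x (real j * step n) \<omega>) \<le> KA * norm (x s \<omega> - x (real j * step n) \<omega>)"
        using KA[of 0] by (simp add: matrix_vector_mult_diff_distrib[symmetric])
      also have "\<dots> \<le> KA * e" using osc j KA_pos by (intro mult_left_mono) auto
      finally show "norm (A 0 *v x s \<omega> - simple_value m (\<lambda>j. real j * step n) ?\<xi> s \<omega>) \<le> KA * e" unfolding v .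
    qed (use KA_pos e in auto)
    also have "\<dots> = (KA * e) * ?tm" using tm0 by simp
    also have "\<dots> \<le> (KA * e) * t" using grid_le_t[OF n m] KA_pos e by (intro mult_left_mono) auto
    finally show "norm (drift_rem n m \<omega>) \<le> KA * e * t" .
  qed
qed

lemma drift_err_tendsto: "(\<lambda>n. drift_err (Suc n)) \<longlonglongrightarrow> 0"
proof -
  let ?q = "\<lambda>n \<omega>. SUP m\<in>{..Suc n}. ennreal ((norm (drift_rem (Suc n) m \<omega>))\<^sup>2) * indicator (below (real m * step (Suc n))) \<omega>"
  have "(\<lambda>n. \<integral>\<^sup>+\<omega>. ?q n \<omega> \<partial>M) \<longlonglongrightarrow> (\<integral>\<^sup>+\<omega>. 0 \<partial>M)"
  proof (rule nn_integral_dominated_convergence[where w="\<lambda>_. ennreal ((KA * (2 * R) * t)\<^sup>2)"])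
    show "?q n \<in> borel_measurable M" for n
    proof (rule borel_measurable_SUP)
      fix m assume "m \<in> {..Suc n}"
      have [measurable]: "drift_rem (Suc n) m \<in> borel_measurable M" by (rule drift_rem_borel) simp
      have [measurable]: "below (real m * step (Suc n)) \<in> events" using step_pos[of "Suc n"] by (intro below_events) auto
      show "(\<lambda>\<omega>. ennreal ((norm (drift_rem (Suc n) m \<omega>))\<^sup>2) * indicator (below (real m * step (Suc n))) \<omega>) \<in> borel_measurable M"
        by measurable
    qed simp
    show "AE \<omega> in M. ?q n \<omega> \<le> ennreal ((KA * (2 * R) * t)\<^sup>2)" for n
      using drift_rem_bound below_AE
    proof eventually_elim
      case (elim \<omega>)
      show ?case
      proof (rule SUP_least)
        fix m assume m: "m \<in> {..Suc n}"
        show "ennreal ((norm (drift_rem (Suc n) m \<omega>))\<^sup>2) * indicator (below (real m * step (Suc n))) \<omega> \<le> ennreal ((KA * (2 * R) * t)\<^sup>2)"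
        proof (cases "\<omega> \<in> below (real m * step (Suc n))")
          case True
          have s0: "0 < step (Suc n)" by (rule step_pos) simp
          have tm0: "0 \<le> real m * step (Suc n)" using s0 by simp
          have b: "norm (x r \<omega>) \<le> R" if "0 \<le> r" "r \<le> real m * step (Suc n)" for r
          proof -
            have "r \<in> {- hb..real m * step (Suc n)}" using that hb_nonneg by simp
            then show ?thesis using elim(2) True tm0 by blast
          qed
          have "norm (drift_rem (Suc n) m \<omega>) \<le> KA * (2 * R) * t"
          proof (rule elim(1)[rule_format])
            fix j s assume j: "j < m" "real j * step (Suc n) < s" "s \<le> real (Suc j) * step (Suc n)"
            have "real (Suc j) * step (Suc n) \<le> real m * step (Suc n)" "real j * step (Suc n) \<le> real m * step (Suc n)" "0 \<le> real j * step (Suc n)"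
              using j s0 by (auto intro!: mult_right_mono)
            then have "norm (x s \<omega>) \<le> R" "norm (x (real j * step (Suc n)) \<omega>) \<le> R" using j by (auto intro!: b)
            then show "norm (x s \<omega> - x (real j * step (Suc n)) \<omega>) \<le> 2 * R"
              using norm_triangle_ineq4[of "x s \<omega>" "x (real j * step (Suc n)) \<omega>"] by simp
          qed (use m R_nonneg in auto)
          then show ?thesis using True by (auto intro!: ennreal_leI power_mono)
        qed simp
      qed
    qed
    show "(\<integral>\<^sup>+\<omega>. ennreal ((KA * (2 * R) * t)\<^sup>2) \<partial>M) < \<infinity>" by (simp add: emeasure_space_1)
    show "AE \<omega> in M. (\<lambda>n. ?q n \<omega>) \<longlonglongrightarrow> 0"
      using drift_rem_bound oscillation_AE
    proof eventually_elim
      case (elim \<omega>)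
      show ?case
      proof (rule order_tendstoI)
        fix a :: ennreal assume "0 < a"
        then obtain c :: real where c: "0 < c" "ennreal c < a"
          by (metis ennreal_less_zero_iff ennreal_cases dense le_less_trans less_top not_gr_zero order_less_le top_greatest zero_le ennreal_0 leD)
        \<comment> \<open>Makes \<open>KA * e * t\<close> equal to \<open>sqrt c\<close>.\<close>
        define e where "e = sqrt c / (KA * t)"
        have e: "0 < e" using c KA_pos t_pos by (simp add: e_def)
        have "eventually (\<lambda>n. \<forall>r\<in>{- hb..t}. \<forall>s\<in>{- hb..t}. \<bar>r - s\<bar> \<le> step (Suc n) \<longrightarrow> norm (x r \<omega> - x s \<omega>) \<le> e) sequentially"
          using elim(2) e by blast
        then show "eventually (\<lambda>n. ?q n \<omega> < a) sequentially"
        proof eventually_elim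
          case (elim n)
          have "?q n \<omega> \<le> ennreal c"
          proof (rule SUP_least)
            fix m assume m: "m \<in> {..Suc n}"
            have s0: "0 < step (Suc n)" by (rule step_pos) simp
            have "norm (drift_rem (Suc n) m \<omega>) \<le> KA * e * t"
            proof (rule \<open>\<forall>n m e. 0 < n \<longrightarrow> _ n m e\<close>[rule_format])
              fix j s assume j: "j < m" "real j * step (Suc n) < s" "s \<le> real (Suc j) * step (Suc n)"
              have jt: "real (Suc j) * step (Suc n) \<le> t" "real j * step (Suc n) \<le> t"
                by (rule grid_le_t; use j m in simp)+
              have j0: "0 \<le> real j * step (Suc n)" using s0 by simp
              have "s \<in> {- hb..t}" using j jt j0 hb_nonneg unfolding atLeastAtMost_iff by linarith
              moreover have "real j * step (Suc n) \<in> {- hb..t}" using jt j0 hb_nonneg unfolding atLeastAtMost_iff by linarith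
              moreover have "\<bar>s - real j * step (Suc n)\<bar> \<le> step (Suc n)" using j by (simp add: algebra_simps)
              ultimately show "norm (x s \<omega> - x (real j * step (Suc n)) \<omega>) \<le> e"
                using elim by blast
            qed (use m e in auto)
            also have "KA * e * t = sqrt c" using KA_pos t_pos by (simp add: e_def)
            finally have "(norm (drift_rem (Suc n) m \<omega>))\<^sup>2 \<le> (sqrt c)\<^sup>2" by (intro power_mono) auto
            then have "(norm (drift_rem (Suc n) m \<omega>))\<^sup>2 \<le> c" using c by simp
            then show "ennreal ((norm (drift_rem (Suc n) m \<omega>))\<^sup>2) * indicator (below (real m * step (Suc n))) \<omega> \<le> ennreal c"
              by (auto simp: indicator_def intro: ennreal_leI)
          qed
          then show ?case using c by simp
        qed
      qed simp
    qed
  qed (rule borel_measurable_const)+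
  then show ?thesis by (simp add: drift_err_def)
qed

lemma \<rho>_tendsto:
  assumes i: "i \<in> {1..N}"
  shows "(\<lambda>n. \<rho> (Suc n) i) \<longlonglongrightarrow> 0"
proof -
  let ?K = "ennreal (2 * ((KA * R)\<^sup>2 * t + 1) + 2 * (KA * R)\<^sup>2 * t)"
  let ?sv = "\<lambda>n. simple_value (Suc n) (\<lambda>j. real j * step (Suc n)) (\<lambda>j \<omega>. A i *v lagged (Suc n) i j \<omega>)"
  let ?q = "\<lambda>n \<omega>. \<integral>\<^sup>+s\<in>{0..t}. ennreal ((norm (A i *v x (s - h i) \<omega> - ?sv n s \<omega>))\<^sup>2) \<partial>lborel"
  have iN: "i \<le> N" using i by simp
  have "(\<lambda>n. \<integral>\<^sup>+\<omega>. min ?K (?q n \<omega>) \<partial>M) \<longlonglongrightarrow> (\<integral>\<^sup>+\<omega>. 0 \<partial>M)"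
  proof (rule nn_integral_dominated_convergence[where w="\<lambda>_. ?K"])
    show "(\<lambda>\<omega>. min ?K (?q n \<omega>)) \<in> borel_measurable M" for n
    proof -
      have s0: "0 < step (Suc n)" by (rule step_pos) simp
      have "progressively_measurable F (?sv n)"
      proof (rule simple_value_progressive)
        show "(\<lambda>\<omega>. A i *v lagged (Suc n) i j \<omega>) \<in> borel_measurable (F (real j * step (Suc n)))" for j
        proof -
          have "lagged (Suc n) i j \<in> borel_measurable (F (real j * step (Suc n)))"
            unfolding lagged_eq_path[OF zero_less_Suc] using lagged_time[OF i zero_less_Suc, of j n] s0 by (intro path_measurable) auto
          then show ?thesis
            by (rule measurable_compose) (intro borel_measurable_continuous_onI matrix_vector_mult_linear_continuous_on)
        qed
      qed (use s0 in \<open>auto intro: mult_right_mono\<close>)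
      moreover have "progressively_measurable F (\<lambda>s \<omega>. A i *v x (s - h i) \<omega>)" using J_ito[OF i] by (simp add: is_ito_integral_def)
      ultimately have "?q n \<in> borel_measurable M" using t_pos by (intro borel_measurable_square_integral) auto
      then show ?thesis by measurable
    qed
    show "AE \<omega> in M. (\<lambda>n. min ?K (?q n \<omega>)) \<longlonglongrightarrow> 0"
      using oscillation_AE x_initial
    proof eventually_elim
      case (elim \<omega>)
      have "(\<lambda>n. ?q n \<omega>) \<longlonglongrightarrow> 0"
      proof (rule order_tendstoI)
        fix a :: ennreal assume "0 < a"
        then obtain c :: real where c: "0 < c" "ennreal c < a"
          by (metis ennreal_less_zero_iff ennreal_cases dense le_less_trans less_top not_gr_zero order_less_le top_greatest zero_le ennreal_0 leD)
        define e where "e = sqrt (c / t) / KA"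
        have e: "0 < e" using c KA_pos t_pos by (simp add: e_def)
        have "eventually (\<lambda>n. \<forall>r\<in>{- hb..t}. \<forall>s\<in>{- hb..t}. \<bar>r - s\<bar> \<le> step (Suc n) \<longrightarrow> norm (x r \<omega> - x s \<omega>) \<le> e) sequentially"
          using elim(1) e by blast
        then show "eventually (\<lambda>n. ?q n \<omega> < a) sequentially"
        proof eventually_elim
          case osc: (elim n)
          let ?\<delta> = "step (Suc n)"
          have s0: "0 < ?\<delta>" by (rule step_pos) simp
          have "?q n \<omega> \<le> ennreal ((KA * e)\<^sup>2 * t)"
          proof (rule set_nn_integral_le_const)
            fix s assume s: "s \<in> {0..t} - {0}"
            have "s \<le> real (Suc n) * ?\<delta>" using s step_last[of "Suc n"] by simp
            then obtain j where j: "j < Suc n" "real j * ?\<delta> < s" "s \<le> real (Suc j) * ?\<delta>"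
              using uniform_cell_exists[OF s0, of s "Suc n"] s by (auto simp del: of_nat_Suc)
            have v: "?sv n s \<omega> = A i *v lagged (Suc n) i j \<omega>"
              by (rule simple_value_eq_single[OF _ j]) (use s0 in \<open>auto intro: mult_right_mono\<close>)
            let ?r = "(real j - real (lag (Suc n) i)) * ?\<delta>"
            have r: "?r \<in> {- hb..real j * ?\<delta>}" using lagged_time[OF i zero_less_Suc, of j n] by blast
            have "path ?r \<omega> = x ?r \<omega>" using elim(2) r by (auto simp: path_def)
            then have l: "lagged (Suc n) i j \<omega> = x ?r \<omega>" by (simp add: lagged_eq_path)
            have "real (lag (Suc n) i) * ?\<delta> \<le> h i" "h i \<le> real (lag (Suc n) i) * ?\<delta> + ?\<delta>"
              using lag_le[OF i zero_less_Suc, of n] lag_ge[OF i zero_less_Suc, of n] by (simp_all add: algebra_simps)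
            \<comment> \<open>\<open>s\<close> exceeds its node and \<open>h i\<close> exceeds its
              rounded value, each by at most one step. The two deviations enter with opposite signs,
              so together they still amount to at most one step.\<close>
            then have "\<bar>(s - h i) - ?r\<bar> \<le> ?\<delta>" using j by (simp add: algebra_simps abs_le_iff)
            moreover have "s - h i \<in> {- hb..t}" using s delay_le_hb[OF i] h_nonneg[OF i] by auto
            moreover have "?r \<in> {- hb..t}" using r j s by auto
            ultimately have "norm (x (s - h i) \<omega> - x ?r \<omega>) \<le> e" using osc by blast
            then have "norm (A i *v x (s - h i) \<omega> - ?sv n s \<omega>) \<le> KA * e"
              unfolding v l matrix_vector_mult_diff_distrib[symmetric]
              using KA[OF iN, of "x (s - h i) \<omega> - x ?r \<omega>"] KA_pos by (auto intro: order_trans mult_left_mono)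
            then show "ennreal ((norm (A i *v x (s - h i) \<omega> - ?sv n s \<omega>))\<^sup>2) \<le> ennreal ((KA * e)\<^sup>2)"
              by (intro ennreal_leI power_mono) auto
          qed (use t_pos in auto)
          also have "(KA * e)\<^sup>2 * t = c" using c KA_pos t_pos by (simp add: e_def)
          finally show ?case using c by simp
        qed
      qed simp
      then have "(\<lambda>n. min ?K (?q n \<omega>)) \<longlonglongrightarrow> min ?K 0" by (intro tendsto_min tendsto_const)
      then show ?case by (simp only: min_absorb2[OF zero_le])
    qed
  qed (auto simp: emeasure_space_1 less_top[symmetric])
  then show ?thesis by (simp add: \<rho>_def)
qed

end

lemma quadruple_sum_le:
  fixes d p q p' q' :: real
  assumes "4 * p \<le> p'" "4 * q \<le> q'"
  shows "2 * d + 2 * (2 * p + 2 * q) \<le> 2 * d + (p' + q')"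
proof -
  have "2 * (2 * p + 2 * q) = 4 * p + 4 * q" by (simp add: distrib_left)
  then show ?thesis using add_mono[OF assms] by (simp only: add_left_mono)
qed

lemma ennreal_combination:
  fixes a k S l T :: real
  assumes "0 \<le> a" "0 \<le> k" "0 \<le> S" "0 \<le> l" "0 \<le> T"
  shows "ennreal (2 * a + (k * S + l * T)) = 2 * ennreal a + (ennreal k * ennreal S + ennreal l * ennreal T)"
  using assms by (simp add: ennreal_plus ennreal_mult)

section \<open>Gronwall argument for the error and passage to the limit\<close>

context sdde_solution_path
begin

lemma eul_unrolled:
  "eul n m \<omega> = \<phi> 0 \<omega> + (\<Sum>j<m. step n *\<^sub>R (A 0 *v eul n j \<omega>))
    + (\<Sum>i=1..N. \<Sum>j<m. dW i (real j * step n) (real (Suc j) * step n) \<omega> *\<^sub>R (A i *v euler_delayed A (step n) (lag n) \<phi> i j \<omega>))"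
proof (induction m)
  case (Suc m)
  then show ?case unfolding euler_Suc sum.lessThan_Suc by (simp add: sum.distrib del: of_nat_Suc)
qed simp

definition noise_err :: "nat \<Rightarrow> nat \<Rightarrow> nat \<Rightarrow> 'a \<Rightarrow> real^'n" where
  "noise_err n m i \<omega> = J i (real m * step n) \<omega> - (\<Sum>j<m. dW i (real j * step n) (real (Suc j) * step n) \<omega>
      *\<^sub>R (A i *v euler_delayed A (step n) (lag n) \<phi> i j \<omega>))"

text \<open>Equation and scheme are subtracted in summed form, because the stochastic integrals run
  from time 0 and are estimated on an event that depends on the final node. The three parts are the
  Riemann error, the error carried through the drift, and the error of the noise.\<close>

lemma err_decomposition:
  "AE \<omega> in M. \<forall>n m. err n m \<omega> = drift_rem n m \<omega> + ((\<Sum>j<m. step n *\<^sub>R (A 0 *v err n j \<omega>)) + (\<Sum>i=1..N. noise_err n m i \<omega>))"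
  using x_initial
proof eventually_elim
  case (elim \<omega>)
  then have x0: "x 0 \<omega> = \<phi> 0 \<omega>" using hb_nonneg by simp
  show ?case
  proof (intro allI)
    fix n m
    have b: "(\<Sum>j<m. step n *\<^sub>R (A 0 *v err n j \<omega>))
        = (\<Sum>j<m. step n *\<^sub>R (A 0 *v x (real j * step n) \<omega>)) - (\<Sum>j<m. step n *\<^sub>R (A 0 *v eul n j \<omega>))"
      by (simp add: err_def matrix_vector_mult_diff_distrib scaleR_diff_right sum_subtractf)
    have c: "(\<Sum>i=1..N. noise_err n m i \<omega>) = (\<Sum>i=1..N. J i (real m * step n) \<omega>)
        - (\<Sum>i=1..N. \<Sum>j<m. dW i (real j * step n) (real (Suc j) * step n) \<omega> *\<^sub>R (A i *v euler_delayed A (step n) (lag n) \<phi> i j \<omega>))"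
      unfolding noise_err_def by (rule sum_subtractf)
    have a: "err n m \<omega> = x (real m * step n) \<omega> - eul n m \<omega>" by (rule err_def)
    show "err n m \<omega> = drift_rem n m \<omega> + ((\<Sum>j<m. step n *\<^sub>R (A 0 *v err n j \<omega>)) + (\<Sum>i=1..N. noise_err n m i \<omega>))"
      unfolding a b c drift_rem_def eul_unrolled[of n m \<omega>] x0 by (simp only: algebra_simps)
  qed
qed

lemma noise_err_borel:
  assumes "0 < n" "i \<in> {1..N}"
  shows "noise_err n m i \<in> borel_measurable M"
proof -
  have nn: "0 \<le> real j * step n" for j using step_pos[OF assms(1)] by simp
  have "dW i (real j * step n) (real (Suc j) * step n) \<in> borel_measurable M" for j
    by (rule dW_borel[OF assms(2) nn]) (use step_pos[OF assms(1)] in \<open>auto intro: mult_right_mono\<close>)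
  then show ?thesis
    unfolding noise_err_def[abs_def] using J_borel[OF assms(2) nn[of m]] L2F_borel[OF L2F_matrix[OF eul_L2(2)[OF assms]]]
    by (intro borel_measurable_diff borel_measurable_sum borel_measurable_scaleR) auto
qed

text \<open>Two splittings of the square put a factor 4 on drift and noise. The drift sum has at
  most \<open>t / step n\<close> terms, which gives \<open>4 * t * KA\<^sup>2\<close>; the noise
  gives \<open>4 * N\<close> for each of \<open>N\<close> processes, times the
  \<open>2 * KA\<^sup>2\<close> of \<open>ito_term_error\<close>.\<close>

definition growth :: real where "growth = 4 * t * KA\<^sup>2 + 8 * (real N)\<^sup>2 * KA\<^sup>2"

text \<open>\<open>16 * N\<close> is \<open>4 * N\<close> times the 4 in front of
  \<open>\<rho>\<close> in \<open>ito_term_error\<close>.\<close>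

definition defect :: "nat \<Rightarrow> ennreal" where
  "defect n = 2 * drift_err n + ennreal (16 * real N) * (\<Sum>i=1..N. \<rho> n i)"

lemma errint_recursion:
  assumes n: "0 < n" and m: "m \<le> n"
  shows "errint n m \<le> defect n + ennreal (growth * step n) * (\<Sum>j<m. errint n j)"
proof -
  have s0: "0 < step n" using step_pos[OF n] .
  let ?I = "\<lambda>j. indicator (below (real j * step n)) :: 'a \<Rightarrow> ennreal"
  let ?Q = "\<lambda>\<omega>. SUP m\<in>{..n}. ennreal ((norm (drift_rem n m \<omega>))\<^sup>2) * ?I m \<omega>"
  let ?e = "\<lambda>j \<omega>. ennreal ((norm (err n j \<omega>))\<^sup>2) * ?I j \<omega>"
  let ?c = "\<lambda>i \<omega>. ennreal ((norm (noise_err n m i \<omega>))\<^sup>2) * ?I m \<omega>"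
  have be[measurable]: "below (real j * step n) \<in> events" for j using s0 by (intro below_events) simp
  have em[measurable]: "err n j \<in> borel_measurable M" for j by (rule err_borel[OF n])
  have dm[measurable]: "drift_rem n j \<in> borel_measurable M" for j by (rule drift_rem_borel[OF n])
  have Qm[measurable]: "?Q \<in> borel_measurable M" by (rule borel_measurable_SUP) (simp, measurable)
  have cm: "?c i \<in> borel_measurable M" if "i \<in> {1..N}" for i
  proof -
    have [measurable]: "noise_err n m i \<in> borel_measurable M" by (rule noise_err_borel[OF n that])
    show ?thesis by measurable
  qed
  have "errint n m \<le> (\<integral>\<^sup>+\<omega>. 2 * ?Q \<omega> + (ennreal (4 * t * KA\<^sup>2 * step n) * (\<Sum>j<m. ?e j \<omega>) + ennreal (4 * real N) * (\<Sum>i=1..N. ?c i \<omega>)) \<partial>M)"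
    unfolding errint_def
  proof (rule nn_integral_mono_AE)
    show "AE \<omega> in M. ?e m \<omega> \<le> 2 * ?Q \<omega> + (ennreal (4 * t * KA\<^sup>2 * step n) * (\<Sum>j<m. ?e j \<omega>) + ennreal (4 * real N) * (\<Sum>i=1..N. ?c i \<omega>))"
      using err_decomposition
    proof eventually_elim
      case (elim \<omega>)
      show ?case
      proof (cases "\<omega> \<in> below (real m * step n)")
        case True
        \<comment> \<open>On the event of node \<open>m\<close> the events of all earlier nodes
          hold, so their indicators can be inserted into the sum at no cost.\<close>
        have I: "?I j \<omega> = 1" if "j \<le> m" for j
          using True below_antimono[of "real j * step n" "real m * step n"] that s0 by (auto simp: mult_right_mono)
        have e_m: "?e m \<omega> = ennreal ((norm (err n m \<omega>))\<^sup>2)" using True by (simp only: indicator_simps mult_1_right)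
        define b where "b = (\<Sum>j<m. step n *\<^sub>R (A 0 *v err n j \<omega>))"
        define c where "c = (\<Sum>i=1..N. noise_err n m i \<omega>)"
        have b_le: "(norm b)\<^sup>2 \<le> t * KA\<^sup>2 * step n * (\<Sum>j<m. (norm (err n j \<omega>))\<^sup>2)"
        proof -
          have "(norm b)\<^sup>2 \<le> real (card {..<m}) * (\<Sum>j<m. (norm (step n *\<^sub>R (A 0 *v err n j \<omega>)))\<^sup>2)"
            unfolding b_def by (rule norm_sum_square_le)
          also have "\<dots> \<le> real m * (\<Sum>j<m. (step n)\<^sup>2 * (KA\<^sup>2 * (norm (err n j \<omega>))\<^sup>2))"
          proof -
            have "(norm (step n *\<^sub>R (A 0 *v err n j \<omega>)))\<^sup>2 \<le> (step n)\<^sup>2 * (KA\<^sup>2 * (norm (err n j \<omega>))\<^sup>2)" for j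
              using KA[of 0 "err n j \<omega>"] s0 by (simp add: power_mult_distrib[symmetric] power_mono mult_left_mono)
            then show ?thesis by (simp add: mult_left_mono sum_mono)
          qed
          also have "\<dots> = (real m * step n) * (KA\<^sup>2 * step n * (\<Sum>j<m. (norm (err n j \<omega>))\<^sup>2))"
            by (simp add: sum_distrib_left power2_eq_square mult_ac)
          also have "\<dots> \<le> t * (KA\<^sup>2 * step n * (\<Sum>j<m. (norm (err n j \<omega>))\<^sup>2))"
            using grid_le_t[OF n m] s0 by (intro mult_right_mono mult_nonneg_nonneg sum_nonneg) auto
          finally show ?thesis by (simp add: mult_ac)
        qed
        have c_le: "(norm c)\<^sup>2 \<le> real N * (\<Sum>i=1..N. (norm (noise_err n m i \<omega>))\<^sup>2)"
          unfolding c_def using norm_sum_square_le[of "\<lambda>i. noise_err n m i \<omega>" "{1..N}"] by simp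
        have "(norm (err n m \<omega>))\<^sup>2 \<le> 2 * (norm (drift_rem n m \<omega>))\<^sup>2 + 2 * (norm (b + c))\<^sup>2"
          using elim[rule_format, of n m] norm_add_square_le_double[of "drift_rem n m \<omega>" "b + c"] unfolding b_def c_def by simp
        also have "\<dots> \<le> 2 * (norm (drift_rem n m \<omega>))\<^sup>2 + 2 * (2 * (norm b)\<^sup>2 + 2 * (norm c)\<^sup>2)"
          using norm_add_square_le_double[of b c] by simp
        also have "\<dots> \<le> 2 * (norm (drift_rem n m \<omega>))\<^sup>2 + ((4 * t * KA\<^sup>2 * step n) * (\<Sum>j<m. (norm (err n j \<omega>))\<^sup>2)
            + (4 * real N) * (\<Sum>i=1..N. (norm (noise_err n m i \<omega>))\<^sup>2))"
        proof -
          have "4 * (norm b)\<^sup>2 \<le> 4 * t * KA\<^sup>2 * step n * (\<Sum>j<m. (norm (err n j \<omega>))\<^sup>2)"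
            using mult_left_mono[OF b_le, of 4] by (simp only: mult.assoc zero_le_numeral)
          moreover have "4 * (norm c)\<^sup>2 \<le> 4 * real N * (\<Sum>i=1..N. (norm (noise_err n m i \<omega>))\<^sup>2)"
            using mult_left_mono[OF c_le, of 4] by (simp only: mult.assoc zero_le_numeral)
          ultimately show ?thesis by (rule quadruple_sum_le)
        qed
        finally have le: "ennreal ((norm (err n m \<omega>))\<^sup>2) \<le> ennreal (2 * (norm (drift_rem n m \<omega>))\<^sup>2
            + ((4 * t * KA\<^sup>2 * step n) * (\<Sum>j<m. (norm (err n j \<omega>))\<^sup>2) + (4 * real N) * (\<Sum>i=1..N. (norm (noise_err n m i \<omega>))\<^sup>2)))"
          by (rule ennreal_leI)
        have nn: "0 \<le> 4 * t * KA\<^sup>2 * step n" using t_pos s0 by simp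
        have "ennreal (2 * (norm (drift_rem n m \<omega>))\<^sup>2
            + ((4 * t * KA\<^sup>2 * step n) * (\<Sum>j<m. (norm (err n j \<omega>))\<^sup>2) + (4 * real N) * (\<Sum>i=1..N. (norm (noise_err n m i \<omega>))\<^sup>2)))
          = 2 * ennreal ((norm (drift_rem n m \<omega>))\<^sup>2) + (ennreal (4 * t * KA\<^sup>2 * step n) * (\<Sum>j<m. ennreal ((norm (err n j \<omega>))\<^sup>2))
            + ennreal (4 * real N) * (\<Sum>i=1..N. ennreal ((norm (noise_err n m i \<omega>))\<^sup>2)))"
        proof -
          have S: "(\<Sum>j<m. ennreal ((norm (err n j \<omega>))\<^sup>2)) = ennreal (\<Sum>j<m. (norm (err n j \<omega>))\<^sup>2)"
            by (rule sum_ennreal) simp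
          have T: "(\<Sum>i=1..N. ennreal ((norm (noise_err n m i \<omega>))\<^sup>2)) = ennreal (\<Sum>i=1..N. (norm (noise_err n m i \<omega>))\<^sup>2)"
            by (rule sum_ennreal) simp
          show ?thesis unfolding S T by (rule ennreal_combination[OF _ nn]) (auto intro: sum_nonneg)
        qed
        also have "\<dots> \<le> 2 * ?Q \<omega> + (ennreal (4 * t * KA\<^sup>2 * step n) * (\<Sum>j<m. ?e j \<omega>) + ennreal (4 * real N) * (\<Sum>i=1..N. ?c i \<omega>))"
        proof (intro add_mono mult_left_mono)
          have "ennreal ((norm (drift_rem n m \<omega>))\<^sup>2) * ?I m \<omega> \<le> ?Q \<omega>" by (rule SUP_upper) (use m in simp)
          then show "ennreal ((norm (drift_rem n m \<omega>))\<^sup>2) \<le> ?Q \<omega>" using I[of m] by simp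
        qed (use I in \<open>auto intro!: sum_mono\<close>)
        finally show ?thesis unfolding e_m by (rule order_trans[OF le])
      next
        case False
        have "?e m \<omega> = 0" unfolding indicator_simps(2)[OF False] by (rule mult_zero_right)
        then show ?thesis by (simp only: zero_le)
      qed
    qed
  qed
  also have "\<dots> = 2 * drift_err n + (ennreal (4 * t * KA\<^sup>2 * step n) * (\<Sum>j<m. errint n j) + ennreal (4 * real N) * (\<Sum>i=1..N. \<integral>\<^sup>+\<omega>. ?c i \<omega> \<partial>M))"
  proof -
    have sc: "(\<lambda>\<omega>. \<Sum>i=1..N. ?c i \<omega>) \<in> borel_measurable M" by (intro borel_measurable_sum cm) auto
    have se: "(\<lambda>\<omega>. \<Sum>j<m. ?e j \<omega>) \<in> borel_measurable M" by measurable
    have ce: "(\<lambda>\<omega>. ennreal (4 * t * KA\<^sup>2 * step n) * (\<Sum>j<m. ?e j \<omega>)) \<in> borel_measurable M" using se by measurable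
    have cc: "(\<lambda>\<omega>. ennreal (4 * real N) * (\<Sum>i=1..N. ?c i \<omega>)) \<in> borel_measurable M"
      by (intro borel_measurable_times_ennreal borel_measurable_const sc)
    have Q2: "(\<lambda>\<omega>. 2 * ?Q \<omega>) \<in> borel_measurable M" using Qm by measurable
    have e1: "(\<integral>\<^sup>+\<omega>. (\<Sum>j<m. ?e j \<omega>) \<partial>M) = (\<Sum>j<m. errint n j)"
      unfolding errint_def by (rule nn_integral_sum) measurable
    have e2: "(\<integral>\<^sup>+\<omega>. (\<Sum>i=1..N. ?c i \<omega>) \<partial>M) = (\<Sum>i=1..N. \<integral>\<^sup>+\<omega>. ?c i \<omega> \<partial>M)"
      by (rule nn_integral_sum) (rule cm)
    show ?thesis
      unfolding nn_integral_add[OF Q2 borel_measurable_add[OF ce cc]] nn_integral_add[OF ce cc]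
        nn_integral_cmult[OF Qm] nn_integral_cmult[OF se] nn_integral_cmult[OF sc] e1 e2 drift_err_def ..
  qed
  also have "\<dots> \<le> 2 * drift_err n + (ennreal (4 * t * KA\<^sup>2 * step n) * (\<Sum>j<m. errint n j)
      + ennreal (4 * real N) * (\<Sum>i=1..N. 4 * \<rho> n i + ennreal (2 * KA\<^sup>2 * step n) * (\<Sum>j<m. errint n j)))"
    by (intro add_left_mono mult_left_mono sum_mono) (use ito_term_error[OF _ n m] in \<open>auto simp: noise_err_def\<close>)
  also have "\<dots> = defect n + ennreal (growth * step n) * (\<Sum>j<m. errint n j)"
  proof -
    let ?E = "\<Sum>j<m. errint n j"
    have "ennreal (4 * real N) * (\<Sum>i=1..N. 4 * \<rho> n i + ennreal (2 * KA\<^sup>2 * step n) * ?E)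
        = ennreal (16 * real N) * (\<Sum>i=1..N. \<rho> n i) + ennreal (8 * (real N)\<^sup>2 * KA\<^sup>2 * step n) * ?E"
    proof -
      have a: "ennreal (4 * real N) * 4 = ennreal (16 * real N)"
        using ennreal_mult[of "4 * real N" 4] by (simp add: mult.commute)
      have b: "ennreal (4 * real N) * (of_nat N * ennreal (2 * KA\<^sup>2 * step n)) = ennreal (8 * (real N)\<^sup>2 * KA\<^sup>2 * step n)"
      proof -
        have "of_nat N = ennreal (real N)" by (simp add: ennreal_of_nat_eq_real_of_nat)
        then have "ennreal (4 * real N) * (of_nat N * ennreal (2 * KA\<^sup>2 * step n)) = ennreal ((4 * real N) * (real N * (2 * KA\<^sup>2 * step n)))"
          using s0 by (simp only: ennreal_mult mult_nonneg_nonneg of_nat_0_le_iff zero_le_numeral zero_le_power2 less_imp_le)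
        also have "(4 * real N) * (real N * (2 * KA\<^sup>2 * step n)) = 8 * (real N)\<^sup>2 * KA\<^sup>2 * step n" by (simp add: power2_eq_square)
        finally show ?thesis .
      qed
      have "(\<Sum>i=1..N. 4 * \<rho> n i + ennreal (2 * KA\<^sup>2 * step n) * ?E) = 4 * (\<Sum>i=1..N. \<rho> n i) + (of_nat N * ennreal (2 * KA\<^sup>2 * step n)) * ?E"
        by (simp add: sum.distrib sum_distrib_left mult.assoc)
      then show ?thesis unfolding a[symmetric] b[symmetric] by (simp only: distrib_left mult.assoc)
    qed
    moreover have "ennreal (growth * step n) = ennreal (4 * t * KA\<^sup>2 * step n) + ennreal (8 * (real N)\<^sup>2 * KA\<^sup>2 * step n)"
      using t_pos s0 by (subst ennreal_plus[symmetric]) (auto simp: growth_def algebra_simps)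
    ultimately show ?thesis unfolding defect_def by (simp only: distrib_right add_ac)
  qed
  finally show ?thesis .
qed

text \<open>The Gronwall factor is at most \<open>exp (growth * t)\<close> for every step size, so
  the limit is decided by the defect.\<close>

lemma errint_last_tendsto: "(\<lambda>n. errint (Suc n) (Suc n)) \<longlonglongrightarrow> 0"
proof -
  have g0: "0 \<le> growth" using t_pos by (simp add: growth_def)
  have bound: "errint (Suc n) (Suc n) \<le> defect (Suc n) * ennreal (exp (growth * t))" for n
  proof -
    let ?n = "Suc n"
    have s0: "0 < step ?n" by (rule step_pos) simp
    have "errint ?n ?n \<le> defect ?n * (1 + ennreal (growth * step ?n)) ^ ?n"
      by (rule discrete_gronwall_sum[where n="?n"]) (auto intro!: errint_recursion)
    also have "(1 + ennreal (growth * step ?n)) ^ ?n = ennreal ((1 + growth * step ?n) ^ ?n)"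
      using g0 s0 by (simp add: ennreal_plus[symmetric] ennreal_power del: ennreal_plus power_Suc flip: ennreal_1)
    also have "\<dots> \<le> ennreal (exp (growth * t))"
      using power_le_exp_mult[OF g0, of ?n "step ?n" t] step_last[of ?n] s0 by (intro ennreal_leI) auto
    finally show ?thesis by (meson mult_left_mono order_trans zero_le)
  qed
  have "(\<lambda>n. 2 * drift_err (Suc n) + ennreal (16 * real N) * (\<Sum>i=1..N. \<rho> (Suc n) i)) \<longlonglongrightarrow> 2 * 0 + ennreal (16 * real N) * (\<Sum>i=1..N. 0)"
    by (intro tendsto_add ennreal_tendsto_cmult tendsto_sum drift_err_tendsto \<rho>_tendsto) auto
  then have "(\<lambda>n. ennreal (exp (growth * t)) * defect (Suc n)) \<longlonglongrightarrow> ennreal (exp (growth * t)) * 0"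
    unfolding defect_def by (intro ennreal_tendsto_cmult) auto
  then have lim: "(\<lambda>n. defect (Suc n) * ennreal (exp (growth * t))) \<longlonglongrightarrow> 0" by (simp add: mult.commute)
  show ?thesis
    by (rule tendsto_sandwich[OF _ _ tendsto_const lim]) (use bound in auto)
qed

text \<open>The factor 2 stems from splitting \<open>x t\<close> into error and scheme. It affects
  only the constant in front of the exponential, not the rate.\<close>

lemma stopped_second_moment:
  assumes bound: "\<And>n. nmin \<le> n \<Longrightarrow> 0 < n \<Longrightarrow> (\<integral>\<^sup>+\<omega>. ennreal ((norm (eul n n \<omega>))\<^sup>2) \<partial>M) \<le> B"
  shows "(\<integral>\<^sup>+\<omega>. ennreal ((norm (x t \<omega>))\<^sup>2) * indicator (below t) \<omega> \<partial>M) \<le> 2 * B"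
proof -
  have lim: "(\<lambda>n. 2 * errint (Suc n) (Suc n) + 2 * B) \<longlonglongrightarrow> 2 * 0 + 2 * B"
    by (intro tendsto_add tendsto_const ennreal_tendsto_cmult errint_last_tendsto) simp
  have "(\<integral>\<^sup>+\<omega>. ennreal ((norm (x t \<omega>))\<^sup>2) * indicator (below t) \<omega> \<partial>M) \<le> 2 * errint n n + 2 * B" if n: "nmin \<le> n" "0 < n" for n
  proof -
    have T: "real n * step n = t" by (rule step_last[OF n(2)])
    have [measurable]: "err n n \<in> borel_measurable M" by (rule err_borel[OF n(2)])
    have [measurable]: "eul n n \<in> borel_measurable M" by (rule L2F_borel[OF eul_L2(1)[OF n(2)]])
    have [measurable]: "below t \<in> events" using t_pos by (intro below_events) simp
    have "(\<integral>\<^sup>+\<omega>. ennreal ((norm (x t \<omega>))\<^sup>2) * indicator (below t) \<omega> \<partial>M)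
        \<le> (\<integral>\<^sup>+\<omega>. 2 * (ennreal ((norm (err n n \<omega>))\<^sup>2) * indicator (below t) \<omega>) + 2 * ennreal ((norm (eul n n \<omega>))\<^sup>2) \<partial>M)"
    proof (rule nn_integral_mono)
      fix \<omega>
      have "x t \<omega> = err n n \<omega> + eul n n \<omega>" unfolding err_def T by simp
      then show "ennreal ((norm (x t \<omega>))\<^sup>2) * indicator (below t) \<omega>
          \<le> 2 * (ennreal ((norm (err n n \<omega>))\<^sup>2) * indicator (below t) \<omega>) + 2 * ennreal ((norm (eul n n \<omega>))\<^sup>2)"
        using ennreal_norm_add_square_le[of "err n n \<omega>" "eul n n \<omega>"] by (auto simp: indicator_def)
    qed
    also have "\<dots> = 2 * errint n n + 2 * (\<integral>\<^sup>+\<omega>. ennreal ((norm (eul n n \<omega>))\<^sup>2) \<partial>M)"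
      unfolding errint_def T by (subst nn_integral_add) (auto simp: nn_integral_cmult)
    also have "\<dots> \<le> 2 * errint n n + 2 * B"
      using bound[OF n] by (intro add_left_mono mult_left_mono) auto
    finally show ?thesis .
  qed
  then have "(\<integral>\<^sup>+\<omega>. ennreal ((norm (x t \<omega>))\<^sup>2) * indicator (below t) \<omega> \<partial>M) \<le> 2 * 0 + 2 * B"
    using le_SucI by (intro LIMSEQ_le_const[OF lim] exI[of _ nmin] allI impI) blast
  then show ?thesis by simp
qed

end

context independent_wiener_processes
begin

lemma solution_second_moment_le:
  fixes A :: "nat \<Rightarrow> real^'n^'n"
  assumes N: "1 \<le> N" and h: "\<And>i. i \<in> {1..N} \<Longrightarrow> 0 \<le> h i"
    and \<phi>: "\<And>s. s \<in> {- max_delay N h..0} \<Longrightarrow> L2F 0 (\<phi> s)"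
    and sol: "sdde_solution M F N W A h \<phi> x" and t: "0 < t"
    and bound: "\<And>n. nmin \<le> n \<Longrightarrow> 0 < n \<Longrightarrow>
      (\<integral>\<^sup>+\<omega>. ennreal ((norm (euler A (t / real n) (\<lambda>i. nat \<lfloor>h i / (t / real n)\<rfloor>) \<phi> n \<omega>))\<^sup>2) \<partial>M) \<le> B"
  shows "(\<integral>\<^sup>+\<omega>. ennreal ((norm (x t \<omega>))\<^sup>2) \<partial>M) \<le> 2 * B"
proof -
  obtain J where sol': "\<And>s. 0 \<le> s \<Longrightarrow> x s \<in> borel_measurable (F s)"
    "AE \<omega> in M. continuous_on {- max_delay N h..} (\<lambda>s. x s \<omega>)"
    "AE \<omega> in M. \<forall>s\<in>{- max_delay N h..0}. x s \<omega> = \<phi> s \<omega>"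
    "\<And>i. i \<in> {1..N} \<Longrightarrow> is_ito_integral M F (W i) (\<lambda>s \<omega>. A i *v x (s - h i) \<omega>) (J i)"
    "AE \<omega> in M. \<forall>s\<ge>0. x s \<omega> = x 0 \<omega> + integral {0..s} (\<lambda>s. A 0 *v x s \<omega>) + (\<Sum>i=1..N. J i s \<omega>)"
    using sol unfolding sdde_solution_def by blast
  obtain KA where KA: "0 < KA" "\<And>i v. i \<le> N \<Longrightarrow> norm (A i *v v) \<le> KA * norm v"
    by (rule matrix_family_bound[of N A]) (rule that; blast)
  have loc: "sdde_solution_path M F N W A h \<phi> x J t KA (real R)" for R :: nat
    by unfold_locales (use N h \<phi> sol' t KA in auto)
  define G where "G R = sdde_solution_path.below M N h \<phi> x t (real R) t" for R :: nat
  have G: "(\<integral>\<^sup>+\<omega>. ennreal ((norm (x t \<omega>))\<^sup>2) * indicator (G R) \<omega> \<partial>M) \<le> 2 * B" for R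
    unfolding G_def
    by (rule sdde_solution_path.stopped_second_moment[OF loc])
      (use bound in \<open>simp add: sdde_solution_path.step_def[OF loc] sdde_solution_path.lag_def[OF loc, abs_def]\<close>)
  have Gm: "G R \<in> events" for R unfolding G_def using t by (intro sdde_solution_path.below_events[OF loc]) simp
  have xm[measurable]: "x t \<in> borel_measurable M" using measurable_FM[OF _ sol'(1)] t by simp
  have "AE \<omega> in M. ennreal ((norm (x t \<omega>))\<^sup>2) \<le> liminf (\<lambda>R. ennreal ((norm (x t \<omega>))\<^sup>2) * indicator (G R) \<omega>)"
    using sol'(2,3) AE_space
  proof eventually_elim
    case (elim \<omega>)
    have hb: "0 \<le> max_delay N h" by (rule sdde_solution_path.hb_nonneg[OF loc])
    have "compact ((\<lambda>s. x s \<omega>) ` {- max_delay N h..t})"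
      by (intro compact_continuous_image continuous_on_subset[OF elim(1)]) auto
    then have "bounded ((\<lambda>s. x s \<omega>) ` {- max_delay N h..t})" by (rule compact_imp_bounded)
    then obtain b where b: "\<And>s. s \<in> {- max_delay N h..t} \<Longrightarrow> norm (x s \<omega>) \<le> b" unfolding bounded_iff by blast
    obtain R0 :: nat where R0: "b \<le> real R0" using real_arch_simple by blast
    \<comment> \<open>A continuous path is bounded on a compact interval, so almost every outcome
      belongs to \<open>G R\<close> for all large \<open>R\<close>.\<close>
    have "\<omega> \<in> G R" if "R0 \<le> R" for R
    proof -
      have "norm (sdde_solution_path.path \<phi> x q \<omega>) \<le> real R" if q: "q \<in> {- max_delay N h..t}" for q
      proof -
        have "sdde_solution_path.path \<phi> x q \<omega> = x q \<omega>"
          using elim(2) q by (auto simp: sdde_solution_path.path_def[OF loc])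
        then show ?thesis using b[OF q] R0 \<open>R0 \<le> R\<close> by simp
      qed
      then show ?thesis using elim(3) by (auto simp: G_def sdde_solution_path.below_def[OF loc])
    qed
    then have "eventually (\<lambda>R. ennreal ((norm (x t \<omega>))\<^sup>2) = ennreal ((norm (x t \<omega>))\<^sup>2) * indicator (G R) \<omega>) sequentially"
      unfolding eventually_sequentially by (intro exI[of _ R0]) auto
    then have "(\<lambda>R. ennreal ((norm (x t \<omega>))\<^sup>2) * indicator (G R) \<omega>) \<longlonglongrightarrow> ennreal ((norm (x t \<omega>))\<^sup>2)"
      by (rule Lim_transform_eventually[OF tendsto_const])
    from lim_imp_Liminf[OF sequentially_bot this] show ?case by simp
  qed
  then have "(\<integral>\<^sup>+\<omega>. ennreal ((norm (x t \<omega>))\<^sup>2) \<partial>M) \<le> (\<integral>\<^sup>+\<omega>. liminf (\<lambda>R. ennreal ((norm (x t \<omega>))\<^sup>2) * indicator (G R) \<omega>) \<partial>M)"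
    by (rule nn_integral_mono_AE)
  also have "\<dots> \<le> liminf (\<lambda>R. \<integral>\<^sup>+\<omega>. ennreal ((norm (x t \<omega>))\<^sup>2) * indicator (G R) \<omega> \<partial>M)"
    by (rule nn_integral_liminf) (use Gm in measurable)
  also have "\<dots> \<le> liminf (\<lambda>R::nat. 2 * B)" by (intro Liminf_mono always_eventually allI G)
  also have "\<dots> = 2 * B" by (rule Liminf_const) simp
  finally show ?thesis .
qed

end

section \<open>A quadratic Lyapunov form\<close>

context independent_wiener_processes
begin

lemma lyapunov_form_of_stability:
  fixes A :: "nat \<Rightarrow> real^'n^'n"
  assumes N: "1 \<le> N" and stable: "mean_square_exponentially_stable M F N W A (\<lambda>_. 0)"
  obtains q :: "real^'n \<Rightarrow> real" and B c C where "0 < c" "0 < C"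
    "\<And>u. c * (norm u)\<^sup>2 \<le> q u" "\<And>u. q u \<le> C * (norm u)\<^sup>2"
    "\<And>u w s. q (u + s *\<^sub>R w) = q u + 2 * s * B u w + s\<^sup>2 * q w"
    "\<And>u. 2 * B u (u v* A 0) + (\<Sum>i=1..N. q (u v* A i)) \<le> - (norm u)\<^sup>2 / 2"
proof -
  obtain \<delta> n where \<delta>: "0 < \<delta>" and contr: "\<And>u. (\<Sum>b\<in>Basis. expectation (\<lambda>\<omega>. (u \<bullet> euler0 A b \<delta> n \<omega>)\<^sup>2)) \<le> (norm u)\<^sup>2 / 2"
    by (rule euler_contraction_of_stability[OF N stable]) (rule that; blast)
  define X where "X b j = euler0 A b \<delta> j" for b j
  have X: "L2F (real j * \<delta>) (X b j)" for b j unfolding X_def using \<delta> by (intro euler0_L2F) simp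
  have XX: "integrable M (\<lambda>\<omega>. (u \<bullet> X b j \<omega>) * (w \<bullet> X b j \<omega>))" for u w b j
    using L2F_inner_integrable[OF L2F_inner[OF X] L2F_inner[OF X], of u b j w b j] by simp
  define cv where "cv j u w = (\<Sum>b\<in>Basis. expectation (\<lambda>\<omega>. (u \<bullet> X b j \<omega>) * (w \<bullet> X b j \<omega>)))" for j u w
  define p where "p j u = cv j u u" for j u
  have p_eq: "p j u = (\<Sum>b\<in>Basis. expectation (\<lambda>\<omega>. (u \<bullet> X b j \<omega>)\<^sup>2))" for j u
    by (simp add: p_def cv_def power2_eq_square)
  have p_add: "p j (u + s *\<^sub>R w) = p j u + 2 * s * cv j u w + s\<^sup>2 * p j w" for j u w s
  proof -
    have "expectation (\<lambda>\<omega>. ((u + s *\<^sub>R w) \<bullet> X b j \<omega>) * ((u + s *\<^sub>R w) \<bullet> X b j \<omega>))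
        = expectation (\<lambda>\<omega>. (u \<bullet> X b j \<omega>) * (u \<bullet> X b j \<omega>)) + 2 * s * expectation (\<lambda>\<omega>. (u \<bullet> X b j \<omega>) * (w \<bullet> X b j \<omega>))
          + s\<^sup>2 * expectation (\<lambda>\<omega>. (w \<bullet> X b j \<omega>) * (w \<bullet> X b j \<omega>))" for b
    proof -
      have "((u + s *\<^sub>R w) \<bullet> X b j \<omega>) * ((u + s *\<^sub>R w) \<bullet> X b j \<omega>) = (u \<bullet> X b j \<omega>) * (u \<bullet> X b j \<omega>)
          + (2 * s) * ((u \<bullet> X b j \<omega>) * (w \<bullet> X b j \<omega>)) + s\<^sup>2 * ((w \<bullet> X b j \<omega>) * (w \<bullet> X b j \<omega>))" for \<omega>
        by (simp add: inner_add_left power2_eq_square algebra_simps)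
      then show ?thesis using XX by simp
    qed
    then show ?thesis by (simp add: p_def cv_def sum.distrib sum_distrib_left)
  qed
  have p0: "p 0 u = (norm u)\<^sup>2" for u
    by (simp add: p_eq X_def prob_space norm_square_eq_sum_inner inner_commute)
  have p_nonneg: "0 \<le> p j u" for j u unfolding p_eq by (intro sum_nonneg integral_nonneg_AE) auto
  have p_Suc: "p (Suc j) u = p j (u + \<delta> *\<^sub>R (u v* A 0)) + \<delta> * (\<Sum>i=1..N. p j (u v* A i))" for j u
  proof -
    have "expectation (\<lambda>\<omega>. (u \<bullet> X b (Suc j) \<omega>)\<^sup>2) = expectation (\<lambda>\<omega>. ((u + \<delta> *\<^sub>R (u v* A 0)) \<bullet> X b j \<omega>)\<^sup>2)
        + \<delta> * (\<Sum>i\<in>{1..N}. expectation (\<lambda>\<omega>. ((u v* A i) \<bullet> X b j \<omega>)\<^sup>2))" for b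
    proof -
      have d: "euler_delayed A \<delta> (\<lambda>_. 0) (\<lambda>_ _. b) i j \<omega> = euler0 A b \<delta> j \<omega>" for i \<omega> by (simp add: euler_delayed_def)
      show ?thesis unfolding X_def
        by (subst euler_second_moment) (use \<delta> in \<open>auto simp: d intro: L2F_const\<close>)
    qed
    then have "p (Suc j) u = (\<Sum>b\<in>Basis. expectation (\<lambda>\<omega>. ((u + \<delta> *\<^sub>R (u v* A 0)) \<bullet> X b j \<omega>)\<^sup>2)
        + \<delta> * (\<Sum>i\<in>{1..N}. expectation (\<lambda>\<omega>. ((u v* A i) \<bullet> X b j \<omega>)\<^sup>2)))" by (simp only: p_eq)
    also have "\<dots> = p j (u + \<delta> *\<^sub>R (u v* A 0)) + \<delta> * (\<Sum>b\<in>Basis. \<Sum>i\<in>{1..N}. expectation (\<lambda>\<omega>. ((u v* A i) \<bullet> X b j \<omega>)\<^sup>2))"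
      by (simp only: sum.distrib sum_distrib_left p_eq)
    also have "(\<Sum>b\<in>Basis. \<Sum>i\<in>{1..N}. expectation (\<lambda>\<omega>. ((u v* A i) \<bullet> X b j \<omega>)\<^sup>2)) = (\<Sum>i=1..N. p j (u v* A i))"
      unfolding p_eq by (rule sum.swap)
    finally show ?thesis .
  qed
  define q where "q u = \<delta> * (\<Sum>j<n. p j u)" for u
  define B where "B u w = \<delta> * (\<Sum>j<n. cv j u w)" for u w
  have q_nonneg: "0 \<le> q u" for u using \<delta> p_nonneg by (simp add: q_def sum_nonneg)
  have q_add: "q (u + s *\<^sub>R w) = q u + 2 * s * B u w + s\<^sup>2 * q w" for u w s
    unfolding q_def B_def p_add by (simp add: sum.distrib sum_distrib_left algebra_simps)
  \<comment> \<open>Zero steps cannot contract. Since \<open>n > 0\<close>, the sum \<open>q\<close>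
    contains \<open>p 0\<close> and is definite.\<close>
  have n0: "0 < n"
  proof (rule ccontr)
    assume "\<not> 0 < n"
    obtain b :: "real^'n" where b: "b \<in> Basis" using nonempty_Basis by blast
    have "p 0 b \<le> (norm b)\<^sup>2 / 2" using contr[of b] \<open>\<not> 0 < n\<close> by (simp add: p_eq X_def)
    then show False using p0[of b] b by simp
  qed
  have tele: "p n u - p 0 u = 2 * B u (u v* A 0) + \<delta> * q (u v* A 0) + (\<Sum>i=1..N. q (u v* A i))" for u
  proof -
    have "p n u - p 0 u = (\<Sum>j<n. p (Suc j) u - p j u)" by (rule sum_lessThan_telescope[of "\<lambda>j. p j u" n, symmetric])
    also have "\<dots> = (\<Sum>j<n. 2 * (\<delta> * cv j u (u v* A 0)) + \<delta> * (\<delta> * p j (u v* A 0)) + (\<Sum>i=1..N. \<delta> * p j (u v* A i)))"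
      by (intro sum.cong refl) (simp add: p_Suc p_add sum_distrib_left power2_eq_square algebra_simps)
    also have "\<dots> = 2 * B u (u v* A 0) + \<delta> * q (u v* A 0) + (\<Sum>j<n. \<Sum>i=1..N. \<delta> * p j (u v* A i))"
      by (simp add: sum.distrib sum_distrib_left B_def q_def)
    also have "(\<Sum>j<n. \<Sum>i=1..N. \<delta> * p j (u v* A i)) = (\<Sum>i=1..N. q (u v* A i))"
      unfolding q_def sum_distrib_left by (rule sum.swap)
    finally show ?thesis .
  qed
  define C where "C = 1 + \<delta> * (\<Sum>j<n. \<Sum>b\<in>(Basis :: (real^'n) set). expectation (\<lambda>\<omega>. (norm (X b j \<omega>))\<^sup>2))"
  have C0: "0 < C" unfolding C_def using \<delta>
    by (intro add_pos_nonneg mult_nonneg_nonneg sum_nonneg integral_nonneg_AE) auto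
  have q_le: "q u \<le> C * (norm u)\<^sup>2" for u
  proof -
    have "expectation (\<lambda>\<omega>. (u \<bullet> X b j \<omega>)\<^sup>2) \<le> (norm u)\<^sup>2 * expectation (\<lambda>\<omega>. (norm (X b j \<omega>))\<^sup>2)" for b j
    proof -
      have "expectation (\<lambda>\<omega>. (u \<bullet> X b j \<omega>)\<^sup>2) \<le> expectation (\<lambda>\<omega>. (norm u)\<^sup>2 * (norm (X b j \<omega>))\<^sup>2)"
      proof (rule integral_mono)
        show "integrable M (\<lambda>\<omega>. (u \<bullet> X b j \<omega>)\<^sup>2)" using XX[of u b j u] by (simp add: power2_eq_square)
        show "integrable M (\<lambda>\<omega>. (norm u)\<^sup>2 * (norm (X b j \<omega>))\<^sup>2)" using L2F_integrable[OF X] by (intro integrable_mult_right)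
        show "(u \<bullet> X b j \<omega>)\<^sup>2 \<le> (norm u)\<^sup>2 * (norm (X b j \<omega>))\<^sup>2" for \<omega>
          using power_mono[OF Cauchy_Schwarz_ineq2[of u "X b j \<omega>"], of 2] by (simp add: power_mult_distrib)
      qed
      then show ?thesis by simp
    qed
    then have "q u \<le> \<delta> * (\<Sum>j<n. \<Sum>b\<in>(Basis :: (real^'n) set). (norm u)\<^sup>2 * expectation (\<lambda>\<omega>. (norm (X b j \<omega>))\<^sup>2))"
      unfolding q_def p_eq using \<delta> by (intro mult_left_mono sum_mono) auto
    also have "\<dots> = (C - 1) * (norm u)\<^sup>2" by (simp add: C_def sum_distrib_left mult_ac)
    also have "\<dots> \<le> C * (norm u)\<^sup>2" by (intro mult_right_mono) auto
    finally show ?thesis .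
  qed
  show thesis
  proof (rule that[of \<delta> C q B])
    show "\<delta> * (norm u)\<^sup>2 \<le> q u" for u
      unfolding q_def p0[symmetric] using \<delta> n0 p_nonneg by (intro mult_left_mono member_le_sum) auto
    show "2 * B u (u v* A 0) + (\<Sum>i=1..N. q (u v* A i)) \<le> - (norm u)\<^sup>2 / 2" for u
    proof -
      have "p n u \<le> (norm u)\<^sup>2 / 2" using contr[of u] by (simp add: p_eq X_def)
      moreover have "0 \<le> \<delta> * q (u v* A 0)" using \<delta> q_nonneg by simp
      ultimately show ?thesis using tele[of u] p0[of u] by linarith
    qed
  qed (use \<delta> C0 q_le q_add in auto)
qed

text \<open>The second moments of the scheme are compared with
  \<open>\<mu> / c * exp (- \<alpha> * time) * q u\<close>, where \<open>\<mu>\<close> is the mean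
  of the squared maximum of the initial data. A delayed moment exceeds the current bound by at most
  the factor \<open>exp (\<alpha> * hb)\<close>, and the slack in the Lyapunov inequality absorbs
  this for small \<open>\<alpha>\<close>.\<close>

lemma stable_of_zero_delay_stable:
  fixes A :: "nat \<Rightarrow> real^'n^'n"
  assumes N: "1 \<le> N" and stable: "mean_square_exponentially_stable M F N W A (\<lambda>_. 0)"
    and h: "\<And>i. i \<in> {1..N} \<Longrightarrow> 0 \<le> h i"
  shows "mean_square_exponentially_stable M F N W A h"
proof -
  obtain q :: "real^'n \<Rightarrow> real" and B c C where c: "0 < c" and C: "0 < C"
    and q_ge: "\<And>u. c * (norm u)\<^sup>2 \<le> q u" and q_le: "\<And>u. q u \<le> C * (norm u)\<^sup>2"
    and q_add: "\<And>u w s. q (u + s *\<^sub>R w) = q u + 2 * s * B u w + s\<^sup>2 * q w"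
    and lyap: "\<And>u. 2 * B u (u v* A 0) + (\<Sum>i=1..N. q (u v* A i)) \<le> - (norm u)\<^sup>2 / 2"
  proof (rule lyapunov_form_of_stability[OF N stable])
    fix q :: "real^'n \<Rightarrow> real" and B c C
    assume "0 < c" "0 < C" "\<And>u. c * (norm u)\<^sup>2 \<le> q u" "\<And>u. q u \<le> C * (norm u)\<^sup>2"
      "\<And>u w s. q (u + s *\<^sub>R w) = q u + 2 * s * B u w + s\<^sup>2 * q w"
      "\<And>u. 2 * B u (u v* A 0) + (\<Sum>i=1..N. q (u v* A i)) \<le> - (norm u)\<^sup>2 / 2"
    then show thesis by (rule that)
  qed
  have q_nonneg: "0 \<le> q u" for u using q_ge[of u] c by (meson order_trans mult_nonneg_nonneg less_imp_le zero_le_power2)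
  let ?hb = "max_delay N h" and ?d = "real DIM(real^'n)"
  have h_le: "h i \<le> ?hb" if "i \<in> {1..N}" for i unfolding max_delay_def using that by (intro Max_ge) auto
  have hb: "0 \<le> ?hb" using h[of 1] h_le[of 1] N by auto
  obtain K where K: "0 < K" "\<And>i v. i \<le> N \<Longrightarrow> norm (transpose (A i) *v v) \<le> K * norm v"
    by (rule matrix_family_bound[of N "\<lambda>i. transpose (A i)"]) (rule that; blast)
  have qA: "q (u v* A i) \<le> C * K\<^sup>2 * (norm u)\<^sup>2" if "i \<le> N" for i u
  proof -
    have "norm (u v* A i) \<le> K * norm u" using K(2)[OF that, of u] by (simp add: transpose_matrix_vector)
    then have "(norm (u v* A i))\<^sup>2 \<le> K\<^sup>2 * (norm u)\<^sup>2" unfolding power_mult_distrib[symmetric] by (intro power_mono) auto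
    then have "C * (norm (u v* A i))\<^sup>2 \<le> C * (K\<^sup>2 * (norm u)\<^sup>2)" using C by (intro mult_left_mono) auto
    then show ?thesis using q_le[of "u v* A i"] by (simp add: mult.assoc)
  qed
  define E where "E = real N * (C * K\<^sup>2)"
  have E: "0 < E" unfolding E_def using N C K by simp
  \<comment> \<open>Choice of \<open>\<alpha>\<close>: the excess of the delayed terms may use one
    eighth of the squared norm of \<open>u\<close>, and \<open>\<alpha> * q u\<close> one quarter.
    The first condition holds near 0 by continuity.\<close>
  have "((\<lambda>a. (exp (a * ?hb) - 1) * E) \<longlongrightarrow> (exp (0 * ?hb) - 1) * E) (at_right 0)"
    by (intro tendsto_intros)
  then have "eventually (\<lambda>a. (exp (a * ?hb) - 1) * E < 1 / 8) (at_right 0)"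
    by (rule order_tendstoD) simp
  moreover have "eventually (\<lambda>a. 0 < a \<and> a < 1 / (4 * C)) (at_right (0::real))"
    using C by (auto simp: eventually_at_right_field intro!: exI[of _ "1 / (4 * C)"])
  ultimately have "eventually (\<lambda>a. (exp (a * ?hb) - 1) * E < 1 / 8 \<and> 0 < a \<and> a < 1 / (4 * C)) (at_right 0)"
    by eventually_elim simp
  then obtain \<alpha> where \<alpha>: "(exp (\<alpha> * ?hb) - 1) * E < 1 / 8" "0 < \<alpha>" "\<alpha> < 1 / (4 * C)"
    using eventually_happens[of _ "at_right (0::real)"] by auto
  \<comment> \<open>Steps so short that the second order term \<open>s * q (u v* A 0)\<close> uses
    at most one eighth of the squared norm of \<open>u\<close>.\<close>
  define smax where "smax = 1 / (8 * (C * K\<^sup>2))"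
  have smax: "0 < smax" using C K by (simp add: smax_def)
  have decay: "q (u + s *\<^sub>R (u v* A 0)) + s * (exp (\<alpha> * ?hb) * (\<Sum>i=1..N. q (u v* A i))) \<le> exp (- \<alpha> * s) * q u"
    if s: "0 < s" "s \<le> smax" for u s
  proof -
    let ?S = "\<Sum>i=1..N. q (u v* A i)" and ?n = "(norm u)\<^sup>2"
    have "?S \<le> (\<Sum>i=1..N. C * K\<^sup>2 * ?n)" using qA by (intro sum_mono) auto
    then have S: "?S \<le> E * ?n" by (simp add: E_def mult_ac)
    have "0 \<le> exp (\<alpha> * ?hb) - 1" using \<alpha> hb by simp
    then have "(exp (\<alpha> * ?hb) - 1) * ?S \<le> (exp (\<alpha> * ?hb) - 1) * (E * ?n)" using S by (rule mult_left_mono[rotated])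
    also have "\<dots> \<le> 1 / 8 * ?n" using mult_right_mono[OF less_imp_le[OF \<alpha>(1)], of ?n] by (simp add: mult.assoc)
    finally have 1: "(exp (\<alpha> * ?hb) - 1) * ?S \<le> ?n / 8" by simp
    have "s * q (u v* A 0) \<le> smax * (C * K\<^sup>2 * ?n)" using s smax qA[of 0 u] q_nonneg by (intro mult_mono) auto
    also have "\<dots> = ?n / 8" using C K by (simp add: smax_def)
    finally have 2: "s * q (u v* A 0) \<le> ?n / 8" .
    \<comment> \<open>One half minus two eighths leaves the quarter that pays for
      \<open>\<alpha> * q u\<close>.\<close>
    have "2 * B u (u v* A 0) + ?S + s * q (u v* A 0) + (exp (\<alpha> * ?hb) - 1) * ?S \<le> - (?n / 4)"
      using lyap[of u] 1 2 by linarith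
    then have "s * (2 * B u (u v* A 0) + ?S + s * q (u v* A 0) + (exp (\<alpha> * ?hb) - 1) * ?S) \<le> s * - (?n / 4)"
      using s by (intro mult_left_mono) auto
    moreover have "q (u + s *\<^sub>R (u v* A 0)) + s * (exp (\<alpha> * ?hb) * ?S)
        = q u + s * (2 * B u (u v* A 0) + ?S + s * q (u v* A 0) + (exp (\<alpha> * ?hb) - 1) * ?S)"
      by (simp add: q_add power2_eq_square algebra_simps)
    moreover have "\<alpha> * q u \<le> ?n / 4"
    proof -
      have "\<alpha> * q u \<le> 1 / (4 * C) * (C * ?n)" using \<alpha> C q_le[of u] q_nonneg[of u] by (intro mult_mono) auto
      then show ?thesis using C by simp
    qed
    then have "s * (\<alpha> * q u) \<le> s * (?n / 4)" using s by (intro mult_left_mono) auto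
    ultimately have "q (u + s *\<^sub>R (u v* A 0)) + s * (exp (\<alpha> * ?hb) * ?S) \<le> (1 + (- \<alpha> * s)) * q u"
      by (simp add: algebra_simps)
    also have "\<dots> \<le> exp (- \<alpha> * s) * q u" using q_nonneg by (intro mult_right_mono exp_ge_add_one_self) auto
    finally show ?thesis .
  qed
  \<comment> \<open>The factor 2 comes from splitting the solution into error and scheme, the
    dimension from summing over unit vectors, \<open>C / c\<close> from passing between
    \<open>q\<close> and the norm. The added 2 ensures \<open>\<beta> > 1\<close>, which also
    settles time 0.\<close>
  define \<beta> where "\<beta> = 2 * (?d * C / c) + 2"
  have \<beta>: "1 < \<beta>" unfolding \<beta>_def using C c by (simp add: add_nonneg_pos)
  show ?thesis
    unfolding mean_square_exponentially_stable_def
  proof (intro exI conjI allI impI)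
    show "0 < \<alpha>" "1 < \<beta>" using \<alpha> \<beta> by auto
    fix \<phi> x and t :: real
    assume init: "initial_condition M F ?hb \<phi>" and sol: "sdde_solution M F N W A h \<phi> x" and t: "0 \<le> t"
    let ?m = "\<integral>\<^sup>+\<omega>. ennreal (SUP s\<in>{- ?hb..0}. (norm (\<phi> s \<omega>))\<^sup>2) \<partial>M"
    have \<phi>_le: "(\<integral>\<^sup>+\<omega>. ennreal ((norm (\<phi> s \<omega>))\<^sup>2) \<partial>M) \<le> ?m" if s: "s \<in> {- ?hb..0}" for s
    proof (rule nn_integral_mono, rule ennreal_leI)
      fix \<omega> assume "\<omega> \<in> space M"
      then have "continuous_on {- ?hb..0} (\<lambda>s. (norm (\<phi> s \<omega>))\<^sup>2)"
        using init by (auto simp: initial_condition_def intro!: continuous_intros)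
      then have "compact ((\<lambda>s. (norm (\<phi> s \<omega>))\<^sup>2) ` {- ?hb..0})" by (intro compact_continuous_image) auto
      then have "bdd_above ((\<lambda>s. (norm (\<phi> s \<omega>))\<^sup>2) ` {- ?hb..0})" by (intro bounded_imp_bdd_above compact_imp_bounded)
      then show "(norm (\<phi> s \<omega>))\<^sup>2 \<le> (SUP s\<in>{- ?hb..0}. (norm (\<phi> s \<omega>))\<^sup>2)" using s by (rule cSUP_upper[rotated])
    qed
    show "(\<integral>\<^sup>+\<omega>. ennreal ((norm (x t \<omega>))\<^sup>2) \<partial>M) \<le> ennreal (\<beta> * exp (- \<alpha> * t)) * ?m"
    \<comment> \<open>For an infinite right side there is nothing to show; otherwise all initial
      values are square integrable and the Euler scheme has second moments.\<close>
    proof (cases "?m = \<infinity>")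
      case True
      have "0 < \<beta> * exp (- \<alpha> * t)" using \<beta> by simp
      then show ?thesis unfolding True using \<beta> by (simp add: ennreal_mult_top)
    next
      case m_fin: False
      define \<mu> where "\<mu> = enn2real ?m"
      have \<mu>: "?m = ennreal \<mu>" "0 \<le> \<mu>" using m_fin by (auto simp: \<mu>_def less_top)
      have \<phi>_L2: "L2F 0 (\<phi> s)" if s: "s \<in> {- ?hb..0}" for s
      proof -
        have m0: "\<phi> s \<in> borel_measurable (F 0)" using init s by (auto simp: initial_condition_def)
        then have [measurable]: "\<phi> s \<in> borel_measurable M" by (rule measurable_FM[rotated]) simp
        have "(\<integral>\<^sup>+\<omega>. ennreal ((norm (\<phi> s \<omega>))\<^sup>2) \<partial>M) < \<infinity>" using \<phi>_le[OF s] m_fin by (simp add: less_top le_less_trans)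
        then have "integrable M (\<lambda>\<omega>. (norm (\<phi> s \<omega>))\<^sup>2)" by (intro integrableI_nonneg) auto
        then show ?thesis using m0 by (simp add: L2F_def)
      qed
      have \<phi>_E: "expectation (\<lambda>\<omega>. (u \<bullet> \<phi> s \<omega>)\<^sup>2) \<le> \<mu> / c * q u" if s: "s \<in> {- ?hb..0}" for s u
      proof -
        have "ennreal (expectation (\<lambda>\<omega>. (norm (\<phi> s \<omega>))\<^sup>2)) = (\<integral>\<^sup>+\<omega>. ennreal ((norm (\<phi> s \<omega>))\<^sup>2) \<partial>M)"
          by (rule nn_integral_eq_integral[OF L2F_integrable[OF \<phi>_L2[OF s]], symmetric]) simp
        also have "\<dots> \<le> ennreal \<mu>" using \<phi>_le[OF s] unfolding \<mu>(1) .
        finally have le: "expectation (\<lambda>\<omega>. (norm (\<phi> s \<omega>))\<^sup>2) \<le> \<mu>" using \<mu>(2) by (simp add: ennreal_le_iff)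
        have "expectation (\<lambda>\<omega>. (u \<bullet> \<phi> s \<omega>)\<^sup>2) \<le> expectation (\<lambda>\<omega>. (norm u)\<^sup>2 * (norm (\<phi> s \<omega>))\<^sup>2)"
        proof (rule integral_mono)
          show "integrable M (\<lambda>\<omega>. (u \<bullet> \<phi> s \<omega>)\<^sup>2)" using L2F_integrable[OF L2F_inner[OF \<phi>_L2[OF s]], of u] by simp
          show "integrable M (\<lambda>\<omega>. (norm u)\<^sup>2 * (norm (\<phi> s \<omega>))\<^sup>2)" using L2F_integrable[OF \<phi>_L2[OF s]] by (rule integrable_mult_right)
          show "(u \<bullet> \<phi> s \<omega>)\<^sup>2 \<le> (norm u)\<^sup>2 * (norm (\<phi> s \<omega>))\<^sup>2" for \<omega>
            using power_mono[OF Cauchy_Schwarz_ineq2[of u "\<phi> s \<omega>"], of 2] by (simp add: power_mult_distrib)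
        qed
        also have "\<dots> = (norm u)\<^sup>2 * expectation (\<lambda>\<omega>. (norm (\<phi> s \<omega>))\<^sup>2)" by simp
        also have "\<dots> \<le> (norm u)\<^sup>2 * \<mu>" using le by (intro mult_left_mono) auto
        also have "\<dots> = \<mu> / c * (c * (norm u)\<^sup>2)" using c by simp
        also have "\<dots> \<le> \<mu> / c * q u" using q_ge \<mu> c by (intro mult_left_mono) auto
        finally show ?thesis .
      qed
      show ?thesis
      \<comment> \<open>Time 0 is separate because the steps \<open>t / n\<close> would be
        zero.\<close>
      proof (cases "t = 0")
        case True
        have "AE \<omega> in M. ennreal ((norm (x 0 \<omega>))\<^sup>2) = ennreal ((norm (\<phi> 0 \<omega>))\<^sup>2)"
        proof -
          have "AE \<omega> in M. \<forall>s\<in>{- ?hb..0}. x s \<omega> = \<phi> s \<omega>" using sol unfolding sdde_solution_def by blast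
          then show ?thesis by eventually_elim (use hb in simp)
        qed
        then have "(\<integral>\<^sup>+\<omega>. ennreal ((norm (x 0 \<omega>))\<^sup>2) \<partial>M) = (\<integral>\<^sup>+\<omega>. ennreal ((norm (\<phi> 0 \<omega>))\<^sup>2) \<partial>M)" by (rule nn_integral_cong_AE)
        also have "\<dots> \<le> 1 * ?m" using \<phi>_le[of 0] hb by simp
        also have "\<dots> \<le> ennreal (\<beta> * exp (- \<alpha> * t)) * ?m"
          using \<beta> True by (intro mult_right_mono) (auto simp: ennreal_1[symmetric] simp del: ennreal_1 intro: ennreal_leI)
        finally show ?thesis unfolding True .
      next
        case False
        then have t: "0 < t" using t by simp
        \<comment> \<open>From \<open>n0\<close> on the step \<open>t / n\<close> is at most
          \<open>smax\<close>.\<close>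
        obtain n0 :: nat where n0: "t / smax \<le> real n0" using real_arch_simple by blast
        let ?B = "ennreal (\<mu> / c * exp (- \<alpha> * t) * (?d * C))"
        have "(\<integral>\<^sup>+\<omega>. ennreal ((norm (x t \<omega>))\<^sup>2) \<partial>M) \<le> 2 * ?B"
        proof (rule solution_second_moment_le[OF N h \<phi>_L2 sol t, where nmin=n0])
          fix n assume n: "n0 \<le> n" "0 < n"
          define s where "s = t / real n"
          define d where "d i = nat \<lfloor>h i / s\<rfloor>" for i
          have s0: "0 < s" using t n by (simp add: s_def)
          have "t / smax \<le> real n" using n0 n by linarith
          then have s_le: "s \<le> smax" using smax n by (simp add: s_def field_simps)
          have ns: "real n * s = t" using n by (simp add: s_def)
          have lag: "real (d i) * s \<le> h i" if "i \<in> {1..N}" for i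
          proof -
            have "0 \<le> h i / s" using h[OF that] s0 by simp
            then have "real (d i) \<le> h i / s" by (simp add: d_def)
            then show ?thesis using s0 by (simp add: pos_le_divide_eq)
          qed
          have hist: "- (real k * s) \<in> {- ?hb..0}" if "i \<in> {1..N}" "k \<le> d i" for i k
          proof -
            have "real k * s \<le> real (d i) * s" using that s0 by (intro mult_right_mono) auto
            then have "real k * s \<le> ?hb" using lag[OF that(1)] h_le[OF that(1)] by linarith
            then show ?thesis using s0 by auto
          qed
          have zero: "0 \<in> {- ?hb..0}" using hb by simp
          let ?X = "euler A s d \<phi>" and ?r = "\<lambda>j. \<mu> / c * exp (- \<alpha> * (real j * s))"
          have r_nonneg: "0 \<le> ?r j" for j using \<mu> c by simp
          have X: "L2F (real j * s) (?X j)" for j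
            by (rule euler_L2F[OF \<phi>_L2[OF zero] \<phi>_L2[OF hist] less_imp_le[OF s0]])
          have main: "expectation (\<lambda>\<omega>. (u \<bullet> ?X j \<omega>)\<^sup>2) \<le> ?r j * q u" for j u
          \<comment> \<open>\<open>u\<close> is arbitrary because one step replaces it by several
            other vectors; the strong form of induction reaches the delayed indices.\<close>
          proof (induction j arbitrary: u rule: less_induct)
            case (less j)
            show ?case
            proof (cases j)
              case 0
              then show ?thesis using \<phi>_E[OF zero, of u] by simp
            next
              case (Suc k)
              have del: "expectation (\<lambda>\<omega>. (v \<bullet> euler_delayed A s d \<phi> i k \<omega>)\<^sup>2) \<le> ?r k * (exp (\<alpha> * ?hb) * q v)"
                if i: "i \<in> {1..N}" for i v
              proof (cases "d i \<le> k")
                case True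
                have "expectation (\<lambda>\<omega>. (v \<bullet> euler_delayed A s d \<phi> i k \<omega>)\<^sup>2) \<le> ?r (k - d i) * q v"
                  using less[of "k - d i" v] True Suc by (simp add: euler_delayed_def)
                also have "exp (- \<alpha> * (real (k - d i) * s)) = exp (- \<alpha> * (real k * s)) * exp (\<alpha> * (real (d i) * s))"
                  using True by (simp add: exp_add[symmetric] of_nat_diff algebra_simps)
                also have "\<mu> / c * (exp (- \<alpha> * (real k * s)) * exp (\<alpha> * (real (d i) * s))) * q v
                    \<le> \<mu> / c * (exp (- \<alpha> * (real k * s)) * exp (\<alpha> * ?hb)) * q v"
                proof (intro mult_right_mono mult_left_mono)
                  show "exp (\<alpha> * (real (d i) * s)) \<le> exp (\<alpha> * ?hb)"
                    using lag[OF i] h_le[OF i] \<alpha> by (simp add: mult_left_mono)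
                qed (use q_nonneg \<mu> c in auto)
                finally show ?thesis by (simp add: mult_ac)
              next
                case False
                \<comment> \<open>As long as the lag has not elapsed, the time is at most
                  \<open>hb\<close>, and the factor \<open>exp (\<alpha> * hb)\<close> makes up for
                  the decay that the initial data do not show.\<close>
                then have "expectation (\<lambda>\<omega>. (v \<bullet> euler_delayed A s d \<phi> i k \<omega>)\<^sup>2) \<le> \<mu> / c * q v"
                  using \<phi>_E[OF hist[OF i, of "d i - k"], of v] by (simp add: euler_delayed_def)
                also have "\<dots> \<le> \<mu> / c * (exp (- \<alpha> * (real k * s)) * exp (\<alpha> * ?hb)) * q v"
                proof -
                  have "real k * s \<le> real (d i) * s" using False s0 by (intro mult_right_mono) auto
                  then have "real k * s \<le> ?hb" using lag[OF i] h_le[OF i] by linarith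
                  then have "1 \<le> exp (- \<alpha> * (real k * s)) * exp (\<alpha> * ?hb)"
                    using \<alpha> by (simp add: exp_add[symmetric] mult_left_mono)
                  then have "\<mu> / c * 1 \<le> \<mu> / c * (exp (- \<alpha> * (real k * s)) * exp (\<alpha> * ?hb))"
                    using \<mu> c by (intro mult_left_mono) auto
                  then show ?thesis using q_nonneg[of v] by (intro mult_right_mono) auto
                qed
                finally show ?thesis by (simp add: mult_ac)
              qed
              have "expectation (\<lambda>\<omega>. (u \<bullet> ?X (Suc k) \<omega>)\<^sup>2) = expectation (\<lambda>\<omega>. ((u + s *\<^sub>R (u v* A 0)) \<bullet> ?X k \<omega>)\<^sup>2)
                  + s * (\<Sum>i\<in>{1..N}. expectation (\<lambda>\<omega>. ((u v* A i) \<bullet> euler_delayed A s d \<phi> i k \<omega>)\<^sup>2))"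
                by (rule euler_second_moment[OF \<phi>_L2[OF zero] \<phi>_L2[OF hist] less_imp_le[OF s0]])
              also have "\<dots> \<le> ?r k * q (u + s *\<^sub>R (u v* A 0)) + s * (\<Sum>i\<in>{1..N}. ?r k * (exp (\<alpha> * ?hb) * q (u v* A i)))"
                using less[of k] Suc del s0 by (intro add_mono mult_left_mono sum_mono) auto
              also have "\<dots> = ?r k * (q (u + s *\<^sub>R (u v* A 0)) + s * (exp (\<alpha> * ?hb) * (\<Sum>i=1..N. q (u v* A i))))"
                by (simp add: sum_distrib_left distrib_left mult_ac)
              also have "\<dots> \<le> ?r k * (exp (- \<alpha> * s) * q u)"
                by (rule mult_left_mono[OF decay[OF s0 s_le] r_nonneg])
              also have "\<dots> = ?r (Suc k) * q u"
                by (simp add: exp_add[symmetric] algebra_simps)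
              finally show ?thesis unfolding Suc .
            qed
          qed
          have "(\<integral>\<^sup>+\<omega>. ennreal ((norm (?X n \<omega>))\<^sup>2) \<partial>M) = ennreal (expectation (\<lambda>\<omega>. (norm (?X n \<omega>))\<^sup>2))"
            by (rule nn_integral_eq_integral[OF L2F_integrable[OF X]]) simp
          also have "expectation (\<lambda>\<omega>. (norm (?X n \<omega>))\<^sup>2) = (\<Sum>b\<in>Basis. expectation (\<lambda>\<omega>. (b \<bullet> ?X n \<omega>)\<^sup>2))"
            unfolding norm_square_eq_sum_inner
          proof (rule Bochner_Integration.integral_sum)
            show "integrable M (\<lambda>\<omega>. (b \<bullet> ?X n \<omega>)\<^sup>2)" for b using L2F_integrable[OF L2F_inner[OF X], of b n] by simp
          qed
          also have "ennreal \<dots> \<le> ?B"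
          proof (rule ennreal_leI)
            have "(\<Sum>b\<in>Basis. expectation (\<lambda>\<omega>. (b \<bullet> ?X n \<omega>)\<^sup>2)) \<le> (\<Sum>b\<in>(Basis :: (real^'n) set). ?r n * C)"
            proof (rule sum_mono)
              fix b :: "real^'n" assume b: "b \<in> Basis"
              have "expectation (\<lambda>\<omega>. (b \<bullet> ?X n \<omega>)\<^sup>2) \<le> ?r n * q b" by (rule main)
              also have "\<dots> \<le> ?r n * C" using q_le[of b] b r_nonneg by (intro mult_left_mono) auto
              finally show "expectation (\<lambda>\<omega>. (b \<bullet> ?X n \<omega>)\<^sup>2) \<le> ?r n * C" .
            qed
            also have "\<dots> = \<mu> / c * exp (- \<alpha> * t) * (?d * C)" unfolding ns by (simp only: sum_constant mult_ac)
            finally show "(\<Sum>b\<in>Basis. expectation (\<lambda>\<omega>. (b \<bullet> ?X n \<omega>)\<^sup>2)) \<le> \<mu> / c * exp (- \<alpha> * t) * (?d * C)" .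
          qed
          finally show "(\<integral>\<^sup>+\<omega>. ennreal ((norm (euler A (t / real n) (\<lambda>i. nat \<lfloor>h i / (t / real n)\<rfloor>) \<phi> n \<omega>))\<^sup>2) \<partial>M) \<le> ?B"
            unfolding s_def d_def .
        qed
        also have "2 * ?B = ennreal (2 * (\<mu> / c * exp (- \<alpha> * t) * (?d * C)))"
          using \<mu> c C by (subst ennreal_mult) auto
        also have "\<dots> \<le> ennreal ((\<beta> * exp (- \<alpha> * t)) * \<mu>)"
        proof (rule ennreal_leI)
          have "2 * (\<mu> / c * exp (- \<alpha> * t) * (?d * C)) = (2 * (?d * C / c)) * (exp (- \<alpha> * t) * \<mu>)" by (simp add: mult_ac)
          also have "\<dots> \<le> \<beta> * (exp (- \<alpha> * t) * \<mu>)" unfolding \<beta>_def using \<mu> by (intro mult_right_mono) auto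
          finally show "2 * (\<mu> / c * exp (- \<alpha> * t) * (?d * C)) \<le> (\<beta> * exp (- \<alpha> * t)) * \<mu>" by (simp only: mult.assoc)
        qed
        also have "\<dots> = ennreal (\<beta> * exp (- \<alpha> * t)) * ?m" unfolding \<mu>(1) using \<mu> \<beta> by (subst ennreal_mult) auto
        finally show ?thesis .
      qed
    qed
  qed
qed

end

theorem theorem3p11:
  fixes M :: "'a measure" and F :: "real \<Rightarrow> 'a measure"
    and N :: nat and W :: "nat \<Rightarrow> real \<Rightarrow> 'a \<Rightarrow> real"
    and A :: "nat \<Rightarrow> real^'n^'n"
  assumes "independent_wiener_processes M F N W"
    and "1 \<le> N"
  shows "(\<forall>h. (\<forall>i\<in>{1..N}. 0 \<le> h i) \<longrightarrow> mean_square_exponentially_stable M F N W A h)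
    \<longleftrightarrow> mean_square_exponentially_stable M F N W A (\<lambda>_. 0)"
proof
  assume "\<forall>h. (\<forall>i\<in>{1..N}. 0 \<le> h i) \<longrightarrow> mean_square_exponentially_stable M F N W A h"
  then show "mean_square_exponentially_stable M F N W A (\<lambda>_. 0)" by simp
next
  assume "mean_square_exponentially_stable M F N W A (\<lambda>_. 0)"
  then show "\<forall>h. (\<forall>i\<in>{1..N}. 0 \<le> h i) \<longrightarrow> mean_square_exponentially_stable M F N W A h"
    using independent_wiener_processes.stable_of_zero_delay_stable[OF assms] by blast
qed

end
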